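(* If there exists a trapdoor function with copy protection (TDF-CP), then there exists a robust, CPA$^+$ anti-piracy secure single-decryptor encryption (SDE) scheme with message space $\{0,1\}$.
   Context: Conventions. $\lambda$ is the security parameter; QPT means quantum polynomial time; adversaries are non-uniform QPT; $\mathrm{negl}$ is an unspecified negligible function; $x\leftarrow S$ is uniform sampling from a finite set; $\mathrm{TD}$ is trace distance. Algorithms with quantum output sample a quantum state, and probabilities over keys are over this sampling. TDF-CP. For polynomials $n,m$, a TDF-CP mapping $n(\lambda)$ bits to $m(\lambda)$ bits is a tuple of efficient algorithms: $\mathsf{Setup}(1^\lambda)\to(\mathsf{ek},\mathsf{td})$ (classical); QPT $\mathsf{KG}(\mathsf{td})\to\widehat{\mathsf{td}}$ (a quantum trapdoor); deterministic $\mathsf{Eval}(\mathsf{ek},x)\to y\in\{0,1\}^{m(\lambda)}$ for $x\in\{0,1\}^{n(\lambda)}$; QPT $\mathsf{Inv}(\widehat{\mathsf{td}},y)\to(x',\widehat{\mathsf{td}}')$. Requirements: - Almost-all-keys correctness: with probability $\ge1-\mathrm{negl}(\lambda)$ over $(\mathsf{ek},\mathsf{td})\leftarrow\mathsf{Setup}(1^\lambda)$, $\widehat{\mathsf{td}}\leftarrow\mathsf{KG}(\mathsf{td})$, for all $x\in\{0,1\}^{n(\lambda)}$, $\mathsf{Inv}(\widehat{\mathsf{td}},\mathsf{Eval}(\mathsf{ek},x))$ outputs $x$ with probability $\ge1-\mathrm{negl}(\lambda)$. - Search anti-piracy: every QPT $(A,B,C)$ wins the following game with probability at most $\mathrm{negl}(\lambda)$: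 the challenger runs $(\mathsf{ek},\mathsf{td})\leftarrow\mathsf{Setup}(1^\lambda)$, $\widehat{\mathsf{td}}\leftarrow\mathsf{KG}(\mathsf{td})$, samples independent $x_B,x_C\leftarrow\{0,1\}^{n(\lambda)}$ and sends $(\mathsf{ek},\widehat{\mathsf{td}})$ to $A$; $A$ generates a bipartite state and sends one register to $B$ and the other to $C$; $B$ receives $\mathsf{Eval}(\mathsf{ek},x_B)$ and $C$ receives $\mathsf{Eval}(\mathsf{ek},x_C)$; $B,C$ (not communicating) output $x_B',x_C'$; they win iff $x_B'=x_B$ and $x_C'=x_C$. SDE. An SDE scheme with message space $\mathcal M$ is a tuple of efficient algorithms $\mathsf{Setup}(1^\lambda)\to(\mathsf{pk},\mathsf{sk})$ (classical); QPT $\mathsf{KG}(\mathsf{sk})\to\widehat{\mathsf{sk}}$ (a quantum decryption key); $\mathsf{Enc}(\mathsf{pk},\mu)\to\mathsf{ct}$ (classical) for $\mu\in\mathcal M$; QPT $\mathsf{Dec}(\widehat{\mathsf{sk}},\mathsf{ct})\to(\mu',\widehat{\mathsf{sk}}')$ with $\mu'\in\mathcal M\cup\{\bot\}$. Correctness: for all $\mu\in\mathcal M$, $\mathsf{Dec}(\widehat{\mathsf{sk}},\mathsf{ct})$ outputs $\mu$ with probability $\ge1-\mathrm{negl}(\lambda)$ over $(\mathsf{pk},\mathsf{sk})\leftarrow\mathsf{Setup}(1^\lambda)$, $\widehat{\mathsf{sk}}\leftarrow\mathsf{KG}(\mathsf{sk})$, $\mathsf{ct}\leftarrow\mathsf{Enc}(\mathsf{pk},\mu)$.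 Robustness of SDE: $\Pr_{(\mathsf{pk},\mathsf{sk})\leftarrow\mathsf{Setup}(1^\lambda),\,\widehat{\mathsf{sk}}\leftarrow\mathsf{KG}(\mathsf{sk})}[\forall\,\mathsf{ct},\ \mathrm{TD}(\widehat{\mathsf{sk}},\widehat{\mathsf{sk}}')\le\mathrm{negl}(\lambda)]\ge1-\mathrm{negl}(\lambda)$, where $(\mu',\widehat{\mathsf{sk}}')\leftarrow\mathsf{Dec}(\widehat{\mathsf{sk}},\mathsf{ct})$, $\mathsf{ct}$ ranges over arbitrary classical strings, and $\widehat{\mathsf{sk}}'$ is the key state after decryption (averaged over $\mu'$). CPA$^+$ anti-piracy security: every QPT $(A,B,C)$ wins the following game with probability at most $\frac12+\mathrm{negl}(\lambda)$: (1) the challenger generates $(\mathsf{pk},\mathsf{sk})\leftarrow\mathsf{Setup}(1^\lambda)$, $\widehat{\mathsf{sk}}\leftarrow\mathsf{KG}(\mathsf{sk})$ and sends $(\mathsf{pk},\widehat{\mathsf{sk}})$ to $A$; (2) $A$ chooses message pairs $(\mu_{B,0},\mu_{B,1}),(\mu_{C,0},\mu_{C,1})\in\mathcal M^2$ (each pair of equal-length messages) and a bipartite state over registers $R_B,R_C$, sends the messages to the challenger, $R_B$ to $B$ and $R_C$ to $C$; (3) the challenger samples independent bits $\mathsf{coin}_B,\mathsf{coin}_C\leftarrow\{0,1\}$ and sends $\mathsf{Enc}(\mathsf{pk},\mu_{B,\mathsf{coin}_B})$ to $B$ and $\mathsf{Enc}(\mathsf{pk},\mu_{C,\mathsf{coin}_C})$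 to $C$; (4) $B,C$ (not communicating) output $\mathsf{coin}_B',\mathsf{coin}_C'$; they win iff $\mathsf{coin}_B'\oplus\mathsf{coin}_C'=\mathsf{coin}_B\oplus\mathsf{coin}_C$. *)

theory Defs
  imports
    "HOL-Probability.Probability"
    "Jordan_Normal_Form.Schur_Decomposition"
begin

section \<open>Negligible functions and bit strings\<close>

definition negligible :: "(nat \<Rightarrow> real) \<Rightarrow> bool" where
  "negligible f \<longleftrightarrow> (\<forall>c::nat. \<forall>\<^sub>F n in sequentially. \<bar>f n\<bar> < 1 / real n ^ c)"

type_synonym bits = "bool list"

definition bitstrings :: "nat \<Rightarrow> bits set" where
  "bitstrings n = {s. length s = n}"

definition uniform_bits :: "nat \<Rightarrow> bits pmf" where
  "uniform_bits n = pmf_of_set (bitstrings n)"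

section \<open>Polynomial time\<close>

text \<open>
  The machine model is the WHILE language of N. D. Jones (Computability and Complexity from
  a Programming Perspective): imperative programs over binary trees.  With unit cost per executed
  command (the expressions of a fixed program have constant size) it defines the same
  polynomial-time functions as Turing machines, as long as output trees have polynomial size.
  This holds for all outputs below: a step increases the depth of trees by at most a constant,
  and the size of our encodings is polynomial in their depth.
\<close>

datatype dat = Nl | Cns dat dat

datatype expr = Var nat | ENil | ECons expr expr | EHd expr | ETl expr

datatype com =
    Assign nat expr
  | Seq com com
  | Cond expr com com
  | While expr com

type_synonym store = "nat \<Rightarrow> dat"

fun dhd :: "dat \<Rightarrow> dat" where
  "dhd Nl = Nl"
| "dhd (Cns a b) = a"

fun dtl :: "dat \<Rightarrow> dat" where
  "dtl Nl = Nl"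
| "dtl (Cns a b) = b"

fun eval_expr :: "expr \<Rightarrow> store \<Rightarrow> dat" where
  "eval_expr (Var i) s = s i"
| "eval_expr ENil s = Nl"
| "eval_expr (ECons a b) s = Cns (eval_expr a s) (eval_expr b s)"
| "eval_expr (EHd a) s = dhd (eval_expr a s)"
| "eval_expr (ETl a) s = dtl (eval_expr a s)"

text \<open>\<open>exec c s t s'\<close>: started in store \<open>s\<close>, program \<open>c\<close> halts after \<open>t\<close> steps in store \<open>s'\<close>.\<close>

inductive exec :: "com \<Rightarrow> store \<Rightarrow> nat \<Rightarrow> store \<Rightarrow> bool" where
  Assign: "exec (Assign i e) s 1 (s(i := eval_expr e s))"
| Seq: "exec c s t s' \<Longrightarrow> exec d s' t' s'' \<Longrightarrow> exec (Seq c d) s (t + t') s''"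
| CondT: "eval_expr e s \<noteq> Nl \<Longrightarrow> exec c s t s' \<Longrightarrow> exec (Cond e c d) s (Suc t) s'"
| CondF: "eval_expr e s = Nl \<Longrightarrow> exec d s t s' \<Longrightarrow> exec (Cond e c d) s (Suc t) s'"
| WhileT: "eval_expr e s \<noteq> Nl \<Longrightarrow> exec c s t s' \<Longrightarrow> exec (While e c) s' t' s''
    \<Longrightarrow> exec (While e c) s (Suc (t + t')) s''"
| WhileF: "eval_expr e s = Nl \<Longrightarrow> exec (While e c) s 1 s"

text \<open>
  Some program maps every encoded argument \<open>inp a\<close> to \<open>out a\<close> (both in variable 0) in time
  polynomial in the size of \<open>inp a\<close>.
\<close>

definition poly_time :: "('a \<Rightarrow> dat) \<Rightarrow> ('a \<Rightarrow> dat) \<Rightarrow> bool" where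
  "poly_time inp out \<longleftrightarrow> (\<exists>c (p :: nat poly). \<forall>a. \<exists>t s.
     exec c ((\<lambda>_. Nl)(0 := inp a)) t s \<and> t \<le> poly p (size (inp a)) \<and> s 0 = out a)"

fun unary :: "nat \<Rightarrow> dat" where
  "unary 0 = Nl"
| "unary (Suc n) = Cns Nl (unary n)"

fun enc_list :: "dat list \<Rightarrow> dat" where
  "enc_list [] = Nl"
| "enc_list (d # ds) = Cns d (enc_list ds)"

text \<open>
  Register lengths such as \<open>n(\<lambda>)\<close> are computable from \<open>1\<^sup>\<lambda>\<close> in polynomial time.  As the
  output is in unary, they are in particular polynomially bounded.
\<close>

definition poly_length :: "(nat \<Rightarrow> nat) \<Rightarrow> bool" where
  "poly_length f \<longleftrightarrow> poly_time unary (\<lambda>l. unary (f l))"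

section \<open>Circuits\<close>

text \<open>The gates \<open>X\<close>, \<open>CNOT\<close>, \<open>Toffoli\<close> are the classical (reversible) ones.\<close>

datatype gate =
    X nat
  | CNOT nat nat
  | Toffoli nat nat nat
  | H nat
  | T nat
  | Tinv nat

datatype circuit = Circuit (wires: nat) (gates: "gate list")

fun gate_wires :: "gate \<Rightarrow> nat list" where
  "gate_wires (X i) = [i]"
| "gate_wires (CNOT i j) = [i, j]"
| "gate_wires (Toffoli i j k) = [i, j, k]"
| "gate_wires (H i) = [i]"
| "gate_wires (T i) = [i]"
| "gate_wires (Tinv i) = [i]"

fun classical_gate :: "gate \<Rightarrow> bool" where
  "classical_gate (X i) = True"
| "classical_gate (CNOT i j) = True"
| "classical_gate (Toffoli i j k) = True"
| "classical_gate (H i) = False"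
| "classical_gate (T i) = False"
| "classical_gate (Tinv i) = False"

text \<open>
  A circuit with \<open>i\<close> input and \<open>j\<close> output wires.  Inputs are on the first \<open>i\<close> wires, the other
  wires are initialised to 0 (unless stated otherwise); outputs are on the first \<open>j\<close> wires.
\<close>

definition wf_circuit :: "nat \<Rightarrow> nat \<Rightarrow> circuit \<Rightarrow> bool" where
  "wf_circuit i j C \<longleftrightarrow> i \<le> wires C \<and> j \<le> wires C \<and>
     (\<forall>g \<in> set (gates C). distinct (gate_wires g) \<and> (\<forall>k \<in> set (gate_wires g). k < wires C))"

definition classical_circuit :: "circuit \<Rightarrow> bool" where
  "classical_circuit C \<longleftrightarrow> (\<forall>g \<in> set (gates C). classical_gate g)"

fun gate_tag :: "gate \<Rightarrow> nat" where
  "gate_tag (X i) = 0"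
| "gate_tag (CNOT i j) = 1"
| "gate_tag (Toffoli i j k) = 2"
| "gate_tag (H i) = 3"
| "gate_tag (T i) = 4"
| "gate_tag (Tinv i) = 5"

definition enc_gate :: "gate \<Rightarrow> dat" where
  "enc_gate g = enc_list (map unary (gate_tag g # gate_wires g))"

definition enc_circuit :: "circuit \<Rightarrow> dat" where
  "enc_circuit C = Cns (unary (wires C)) (enc_list (map enc_gate (gates C)))"

text \<open>
  A uniform algorithm is a circuit family generated in polynomial time from \<open>1\<^sup>\<lambda>\<close>, or from
  \<open>1\<^sup>\<lambda>\<close> and \<open>1\<^sup>L\<close> if it takes an input of variable length \<open>L\<close>.  The circuits then have
  polynomial size, since they are written in unary.  A non-uniform algorithm is an arbitrary
  family of circuits of polynomial size.
\<close>

definition uniform_family :: "(nat \<Rightarrow> circuit) \<Rightarrow> bool" where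
  "uniform_family C \<longleftrightarrow> poly_time unary (\<lambda>l. enc_circuit (C l))"

definition uniform_family2 :: "(nat \<Rightarrow> nat \<Rightarrow> circuit) \<Rightarrow> bool" where
  "uniform_family2 C \<longleftrightarrow>
     poly_time (\<lambda>(l, L). Cns (unary l) (unary L)) (\<lambda>(l, L). enc_circuit (C l L))"

definition poly_size_family :: "(nat \<Rightarrow> circuit) \<Rightarrow> bool" where
  "poly_size_family C \<longleftrightarrow>
     (\<exists>p :: nat poly. \<forall>l. wires (C l) \<le> poly p l \<and> length (gates (C l)) \<le> poly p l)"

subsection \<open>Classical semantics\<close>

definition flip :: "nat \<Rightarrow> bits \<Rightarrow> bits" where
  "flip i s = s[i := \<not> s ! i]"

fun classical_action :: "gate \<Rightarrow> bits \<Rightarrow> bits" where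
  "classical_action (X i) s = flip i s"
| "classical_action (CNOT i j) s = (if s ! i then flip j s else s)"
| "classical_action (Toffoli i j k) s = (if s ! i \<and> s ! j then flip k s else s)"
| "classical_action _ s = s"

definition pad :: "circuit \<Rightarrow> bits \<Rightarrow> bits" where
  "pad C s = s @ replicate (wires C - length s) False"

definition run_classical :: "circuit \<Rightarrow> nat \<Rightarrow> bits \<Rightarrow> bits" where
  "run_classical C j s = take j (fold classical_action (gates C) (pad C s))"

text \<open>Randomised classical computation: \<open>r\<close> uniform bits are appended to the input.\<close>

definition run_random :: "circuit \<Rightarrow> nat \<Rightarrow> nat \<Rightarrow> bits \<Rightarrow> bits pmf" where
  "run_random C r j s = map_pmf (\<lambda>u. run_classical C j (s @ u)) (uniform_bits r)"

subsection \<open>Quantum semantics\<close>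

text \<open>
  A state vector assigns an amplitude to each basis state.  The classical gates act on basis
  states by involutions, so no inverse is needed in the first three cases.
\<close>

fun apply_gate :: "gate \<Rightarrow> (bits \<Rightarrow> complex) \<Rightarrow> bits \<Rightarrow> complex" where
  "apply_gate (X i) \<psi> s = \<psi> (classical_action (X i) s)"
| "apply_gate (CNOT i j) \<psi> s = \<psi> (classical_action (CNOT i j) s)"
| "apply_gate (Toffoli i j k) \<psi> s = \<psi> (classical_action (Toffoli i j k) s)"
| "apply_gate (H i) \<psi> s =
     (\<psi> (s[i := False]) + (if s ! i then - 1 else 1) * \<psi> (s[i := True])) / complex_of_real (sqrt 2)"
| "apply_gate (T i) \<psi> s = (if s ! i then cis (pi / 4) else 1) * \<psi> s"
| "apply_gate (Tinv i) \<psi> s = (if s ! i then cis (- pi / 4) else 1) * \<psi> s"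

text \<open>\<open>amp C s u\<close> is the matrix entry \<open>\<langle>u| U |s,0\<dots>0\<rangle>\<close>, where \<open>U\<close> is the unitary of \<open>C\<close>.\<close>

definition amp :: "circuit \<Rightarrow> bits \<Rightarrow> bits \<Rightarrow> complex" where
  "amp C s = fold apply_gate (gates C) (\<lambda>u. if u = pad C s then 1 else 0)"

text \<open>
  A density operator \<open>\<rho>\<close> on \<open>q\<close> qubits is given by its matrix entries \<open>\<rho> s t = \<langle>s|\<rho>|t\<rangle>\<close> for
  \<open>s, t \<in> bitstrings q\<close>.
\<close>

type_synonym qstate = "bits \<Rightarrow> bits \<Rightarrow> complex"

definition qtrace :: "nat \<Rightarrow> qstate \<Rightarrow> real" where
  "qtrace q \<rho> = Re (\<Sum>s \<in> bitstrings q. \<rho> s s)"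

text \<open>\<open>|x\<rangle>\<langle>x| \<otimes> \<rho>\<close>.\<close>

definition with_classical :: "bits \<Rightarrow> qstate \<Rightarrow> qstate" where
  "with_classical x \<rho> s t =
     (if take (length x) s = x \<and> take (length x) t = x
      then \<rho> (drop (length x) s) (drop (length x) t) else 0)"

text \<open>\<open>U (\<rho> \<otimes> |0\<dots>0\<rangle>\<langle>0\<dots>0|) U\<^sup>\<dagger>\<close>, for \<open>\<rho>\<close> on \<open>i\<close> qubits.\<close>

definition evolve :: "circuit \<Rightarrow> nat \<Rightarrow> qstate \<Rightarrow> qstate" where
  "evolve C i \<rho> u v =
     (\<Sum>s \<in> bitstrings i. \<Sum>t \<in> bitstrings i. amp C s u * \<rho> s t * cnj (amp C t v))"

text \<open>
  Run \<open>C\<close> on the \<open>i\<close>-qubit state \<open>\<rho>\<close>, measure the first \<open>length z\<close> wires, keep the next \<open>q\<close>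
  wires and trace out the others: the state of the kept wires, multiplied by the
  probability of outcome \<open>z\<close>.
\<close>

definition branch :: "circuit \<Rightarrow> nat \<Rightarrow> nat \<Rightarrow> qstate \<Rightarrow> bits \<Rightarrow> qstate" where
  "branch C i q \<rho> z s t =
     (\<Sum>u \<in> bitstrings (wires C - (length z + q)). evolve C i \<rho> (z @ s @ u) (z @ t @ u))"

definition outcome_prob :: "circuit \<Rightarrow> nat \<Rightarrow> nat \<Rightarrow> qstate \<Rightarrow> bits \<Rightarrow> real" where
  "outcome_prob C i q \<rho> z = qtrace q (branch C i q \<rho> z)"

text \<open>
  Sampling a quantum state from the classical input \<open>x\<close>: \<open>c\<close> wires are measured, and the sampled
  state is the normalised state of the next \<open>q\<close> wires given the outcome.  (If \<open>C\<close> is well-formed,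
  it is unitary, so the values \<open>pr z\<close> are non-negative and sum to 1, as \<open>embed_pmf\<close> requires.)
\<close>

definition sample_state :: "circuit \<Rightarrow> nat \<Rightarrow> nat \<Rightarrow> bits \<Rightarrow> qstate pmf" where
  "sample_state C c q x =
     (let \<rho> = (\<lambda>s t. if s = x \<and> t = x then 1 else 0);
          pr = (\<lambda>z. if length z = c then outcome_prob C (length x) q \<rho> z else 0)
      in map_pmf (\<lambda>z s t. branch C (length x) q \<rho> z s t / complex_of_real (pr z)) (embed_pmf pr))"

text \<open>
  \<open>effect C z s t = \<langle>s| E |t\<rangle>\<close> where \<open>E\<close> is the measurement operator (POVM element) of the event
  that running \<open>C\<close> and measuring the first wires yields \<open>z\<close>.
\<close>

definition effect :: "circuit \<Rightarrow> bits \<Rightarrow> bits \<Rightarrow> bits \<Rightarrow> complex" where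
  "effect C z s t =
     (\<Sum>v \<in> bitstrings (wires C - length z). cnj (amp C s (z @ v)) * amp C t (z @ v))"

text \<open>
  \<open>\<sigma>\<close> is a bipartite state with \<open>b\<close> and \<open>c\<close> qubits.  \<open>B\<close> acts on the classical input \<open>x\<close> and the
  first part, \<open>C\<close> acts on the classical input \<open>y\<close> and the second part.  This is the probability
  \<open>Tr ((E\<^sub>B \<otimes> E\<^sub>C) \<sigma>)\<close> that their outputs are \<open>z\<close> and \<open>w\<close>.
\<close>

definition joint_prob ::
  "circuit \<Rightarrow> circuit \<Rightarrow> nat \<Rightarrow> nat \<Rightarrow> qstate \<Rightarrow> bits \<Rightarrow> bits \<Rightarrow> bits \<Rightarrow> bits \<Rightarrow> real" where
  "joint_prob B C b c \<sigma> x y z w =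
     Re (\<Sum>s \<in> bitstrings b. \<Sum>t \<in> bitstrings b. \<Sum>s' \<in> bitstrings c. \<Sum>t' \<in> bitstrings c.
           effect B z (x @ t) (x @ s) * effect C w (y @ t') (y @ s') * \<sigma> (s @ s') (t @ t'))"

subsection \<open>Trace distance\<close>

text \<open>The trace norm \<open>tr (sqrt (A\<^sup>\<dagger> A))\<close> is the sum of the singular values of \<open>A\<close>.\<close>

definition trace_norm :: "complex mat \<Rightarrow> real" where
  "trace_norm A =
     (let p = char_poly (mat_adjoint A * A)
      in \<Sum>e | poly p e = 0. real (Polynomial.order e p) * sqrt (Re e))"

definition basis_string :: "nat \<Rightarrow> nat \<Rightarrow> bits" where
  "basis_string q i = map (\<lambda>k. bit i k) [0..<q]"

definition state_matrix :: "nat \<Rightarrow> qstate \<Rightarrow> complex mat" where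
  "state_matrix q \<rho> = mat (2 ^ q) (2 ^ q) (\<lambda>(i, j). \<rho> (basis_string q i) (basis_string q j))"

definition trace_distance :: "nat \<Rightarrow> qstate \<Rightarrow> qstate \<Rightarrow> real" where
  "trace_distance q \<rho> \<sigma> = trace_norm (state_matrix q \<rho> - state_matrix q \<sigma>) / 2"

section \<open>Trapdoor functions with copy protection\<close>

text \<open>
  All algorithms receive \<open>1\<^sup>\<lambda>\<close> implicitly, as the index of the circuit.  The fields \<open>_rand\<close> and
  \<open>_coins\<close> are the numbers of random bits and of measured wires of \<open>sample_state\<close>.
\<close>

record tdf =
  tdf_n :: "nat \<Rightarrow> nat"
  tdf_m :: "nat \<Rightarrow> nat"
  ek_len :: "nat \<Rightarrow> nat"
  td_len :: "nat \<Rightarrow> nat"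
  qtd_len :: "nat \<Rightarrow> nat"
  tdf_setup :: "nat \<Rightarrow> circuit"
  tdf_setup_rand :: "nat \<Rightarrow> nat"
  tdf_kg :: "nat \<Rightarrow> circuit"
  tdf_kg_coins :: "nat \<Rightarrow> nat"
  tdf_eval :: "nat \<Rightarrow> circuit"
  tdf_inv :: "nat \<Rightarrow> circuit"

text \<open>\<open>Inv\<close> takes the image first and the quantum trapdoor second.\<close>

definition tdf_efficient :: "tdf \<Rightarrow> bool" where
  "tdf_efficient F \<longleftrightarrow>
     (\<forall>f \<in> {tdf_n F, tdf_m F, ek_len F, td_len F, qtd_len F, tdf_setup_rand F, tdf_kg_coins F}.
        poly_length f) \<and>
     (\<forall>C \<in> {tdf_setup F, tdf_kg F, tdf_eval F, tdf_inv F}. uniform_family C) \<and>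
     (\<forall>l. classical_circuit (tdf_setup F l) \<and> classical_circuit (tdf_eval F l) \<and>
        wf_circuit (tdf_setup_rand F l) (ek_len F l + td_len F l) (tdf_setup F l) \<and>
        wf_circuit (td_len F l) (tdf_kg_coins F l + qtd_len F l) (tdf_kg F l) \<and>
        wf_circuit (ek_len F l + tdf_n F l) (tdf_m F l) (tdf_eval F l) \<and>
        wf_circuit (tdf_m F l + qtd_len F l) (tdf_n F l + qtd_len F l) (tdf_inv F l))"

definition tdf_keys :: "tdf \<Rightarrow> nat \<Rightarrow> (bits \<times> bits \<times> qstate) pmf" where
  "tdf_keys F l =
     bind_pmf (run_random (tdf_setup F l) (tdf_setup_rand F l) (ek_len F l + td_len F l) []) (\<lambda>k.
       let ek = take (ek_len F l) k; td = drop (ek_len F l) k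
       in map_pmf (\<lambda>\<kappa>. (ek, td, \<kappa>)) (sample_state (tdf_kg F l) (tdf_kg_coins F l) (qtd_len F l) td))"

definition tdf_image :: "tdf \<Rightarrow> nat \<Rightarrow> bits \<Rightarrow> bits \<Rightarrow> bits" where
  "tdf_image F l ek x = run_classical (tdf_eval F l) (tdf_m F l) (ek @ x)"

definition tdf_inv_prob :: "tdf \<Rightarrow> nat \<Rightarrow> qstate \<Rightarrow> bits \<Rightarrow> bits \<Rightarrow> real" where
  "tdf_inv_prob F l \<kappa> y x =
     outcome_prob (tdf_inv F l) (tdf_m F l + qtd_len F l) (qtd_len F l) (with_classical y \<kappa>) x"

definition tdf_almost_all_keys_correct :: "tdf \<Rightarrow> bool" where
  "tdf_almost_all_keys_correct F \<longleftrightarrow>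
     (\<exists>\<delta> \<epsilon>. negligible \<delta> \<and> negligible \<epsilon> \<and>
       (\<forall>l. measure_pmf.prob (tdf_keys F l)
              {(ek, td, \<kappa>). \<forall>x \<in> bitstrings (tdf_n F l).
                 tdf_inv_prob F l \<kappa> (tdf_image F l ek x) x \<ge> 1 - \<epsilon> l}
            \<ge> 1 - \<delta> l))"

text \<open>A pair of registers of \<open>reg_B\<close> and \<open>reg_C\<close> qubits is passed from \<open>A\<close> to \<open>B\<close> and \<open>C\<close>.\<close>

record adversary =
  adv_A :: "nat \<Rightarrow> circuit"
  adv_B :: "nat \<Rightarrow> circuit"
  adv_C :: "nat \<Rightarrow> circuit"
  reg_B :: "nat \<Rightarrow> nat"
  reg_C :: "nat \<Rightarrow> nat"

text \<open>
  \<open>inA\<close>, \<open>chal\<close>: lengths of the inputs of \<open>A\<close> and of the challenges; \<open>outA\<close>, \<open>ans\<close>: lengths of the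
  classical outputs of \<open>A\<close> and of \<open>B\<close> and \<open>C\<close>.
\<close>

definition qpt_adversary ::
  "(nat \<Rightarrow> nat) \<Rightarrow> (nat \<Rightarrow> nat) \<Rightarrow> (nat \<Rightarrow> nat) \<Rightarrow> (nat \<Rightarrow> nat) \<Rightarrow> adversary \<Rightarrow> bool" where
  "qpt_adversary inA outA chal ans \<A> \<longleftrightarrow>
     poly_size_family (adv_A \<A>) \<and> poly_size_family (adv_B \<A>) \<and> poly_size_family (adv_C \<A>) \<and>
     (\<forall>l. wf_circuit (inA l) (outA l + reg_B \<A> l + reg_C \<A> l) (adv_A \<A> l) \<and>
          wf_circuit (chal l + reg_B \<A> l) (ans l) (adv_B \<A> l) \<and>
          wf_circuit (chal l + reg_C \<A> l) (ans l) (adv_C \<A> l))"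

definition tdf_win_prob :: "tdf \<Rightarrow> adversary \<Rightarrow> nat \<Rightarrow> real" where
  "tdf_win_prob F \<A> l =
     measure_pmf.expectation (tdf_keys F l) (\<lambda>(ek, td, \<kappa>).
       let \<sigma> = branch (adv_A \<A> l) (ek_len F l + qtd_len F l) (reg_B \<A> l + reg_C \<A> l)
                 (with_classical ek \<kappa>) []
       in measure_pmf.expectation (uniform_bits (tdf_n F l)) (\<lambda>xB.
          measure_pmf.expectation (uniform_bits (tdf_n F l)) (\<lambda>xC.
            joint_prob (adv_B \<A> l) (adv_C \<A> l) (reg_B \<A> l) (reg_C \<A> l) \<sigma>
              (tdf_image F l ek xB) (tdf_image F l ek xC) xB xC)))"

definition tdf_search_anti_piracy :: "tdf \<Rightarrow> bool" where
  "tdf_search_anti_piracy F \<longleftrightarrow>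
     (\<forall>\<A>. qpt_adversary (\<lambda>l. ek_len F l + qtd_len F l) (\<lambda>l. 0) (tdf_m F) (tdf_n F) \<A> \<longrightarrow>
        (\<exists>\<epsilon>. negligible \<epsilon> \<and> (\<forall>l. tdf_win_prob F \<A> l \<le> \<epsilon> l)))"

definition TDF_CP :: "tdf \<Rightarrow> bool" where
  "TDF_CP F \<longleftrightarrow> tdf_efficient F \<and> tdf_almost_all_keys_correct F \<and> tdf_search_anti_piracy F"

section \<open>Single-decryptor encryption\<close>

text \<open>
  The message space is \<open>bitstrings k\<close> for a constant \<open>k\<close>, so the two messages of a pair always have
  equal length.  \<open>Dec\<close> takes the ciphertext first and the quantum key second; it is the only
  algorithm with an input of variable length, so that it applies to arbitrary strings, not only
  to those of length \<open>ct_len\<close>.  Its classical output \<open>True # \<mu>\<close> stands for the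
  message \<open>\<mu>\<close>, every output \<open>False # _\<close> for \<open>\<bottom>\<close>.
\<close>

record sde =
  pk_len :: "nat \<Rightarrow> nat"
  sk_len :: "nat \<Rightarrow> nat"
  qsk_len :: "nat \<Rightarrow> nat"
  ct_len :: "nat \<Rightarrow> nat"
  sde_setup :: "nat \<Rightarrow> circuit"
  sde_setup_rand :: "nat \<Rightarrow> nat"
  sde_kg :: "nat \<Rightarrow> circuit"
  sde_kg_coins :: "nat \<Rightarrow> nat"
  sde_enc :: "nat \<Rightarrow> circuit"
  sde_enc_rand :: "nat \<Rightarrow> nat"
  sde_dec :: "nat \<Rightarrow> nat \<Rightarrow> circuit"

definition sde_efficient :: "nat \<Rightarrow> sde \<Rightarrow> bool" where
  "sde_efficient k S \<longleftrightarrow>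
     (\<forall>f \<in> {pk_len S, sk_len S, qsk_len S, ct_len S, sde_setup_rand S, sde_kg_coins S,
             sde_enc_rand S}. poly_length f) \<and>
     (\<forall>C \<in> {sde_setup S, sde_kg S, sde_enc S}. uniform_family C) \<and> uniform_family2 (sde_dec S) \<and>
     (\<forall>l. classical_circuit (sde_setup S l) \<and> classical_circuit (sde_enc S l) \<and>
        wf_circuit (sde_setup_rand S l) (pk_len S l + sk_len S l) (sde_setup S l) \<and>
        wf_circuit (sk_len S l) (sde_kg_coins S l + qsk_len S l) (sde_kg S l) \<and>
        wf_circuit (pk_len S l + k + sde_enc_rand S l) (ct_len S l) (sde_enc S l) \<and>
        (\<forall>L. wf_circuit (L + qsk_len S l) (Suc k + qsk_len S l) (sde_dec S l L)))"

definition sde_keys :: "sde \<Rightarrow> nat \<Rightarrow> (bits \<times> bits \<times> qstate) pmf" where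
  "sde_keys S l =
     bind_pmf (run_random (sde_setup S l) (sde_setup_rand S l) (pk_len S l + sk_len S l) []) (\<lambda>k.
       let pk = take (pk_len S l) k; sk = drop (pk_len S l) k
       in map_pmf (\<lambda>\<kappa>. (pk, sk, \<kappa>)) (sample_state (sde_kg S l) (sde_kg_coins S l) (qsk_len S l) sk))"

definition sde_encrypt :: "sde \<Rightarrow> nat \<Rightarrow> bits \<Rightarrow> bits \<Rightarrow> bits pmf" where
  "sde_encrypt S l pk \<mu> = run_random (sde_enc S l) (sde_enc_rand S l) (ct_len S l) (pk @ \<mu>)"

definition sde_dec_branch :: "sde \<Rightarrow> nat \<Rightarrow> qstate \<Rightarrow> bits \<Rightarrow> bits \<Rightarrow> qstate" where
  "sde_dec_branch S l \<kappa> ct =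
     branch (sde_dec S l (length ct)) (length ct + qsk_len S l) (qsk_len S l) (with_classical ct \<kappa>)"

definition sde_dec_prob :: "sde \<Rightarrow> nat \<Rightarrow> qstate \<Rightarrow> bits \<Rightarrow> bits \<Rightarrow> real" where
  "sde_dec_prob S l \<kappa> ct \<mu> = qtrace (qsk_len S l) (sde_dec_branch S l \<kappa> ct (True # \<mu>))"

text \<open>The key after decryption, averaged over the classical output.\<close>

definition sde_dec_key :: "nat \<Rightarrow> sde \<Rightarrow> nat \<Rightarrow> qstate \<Rightarrow> bits \<Rightarrow> qstate" where
  "sde_dec_key k S l \<kappa> ct s t = (\<Sum>z \<in> bitstrings (Suc k). sde_dec_branch S l \<kappa> ct z s t)"

definition sde_correct :: "nat \<Rightarrow> sde \<Rightarrow> bool" where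
  "sde_correct k S \<longleftrightarrow>
     (\<forall>\<mu> \<in> bitstrings k. \<exists>\<epsilon>. negligible \<epsilon> \<and>
       (\<forall>l. measure_pmf.expectation (sde_keys S l) (\<lambda>(pk, sk, \<kappa>).
              measure_pmf.expectation (sde_encrypt S l pk \<mu>) (\<lambda>ct. sde_dec_prob S l \<kappa> ct \<mu>))
            \<ge> 1 - \<epsilon> l))"

definition SDE :: "nat \<Rightarrow> sde \<Rightarrow> bool" where
  "SDE k S \<longleftrightarrow> sde_efficient k S \<and> sde_correct k S"

definition sde_robust :: "nat \<Rightarrow> sde \<Rightarrow> bool" where
  "sde_robust k S \<longleftrightarrow>
     (\<exists>\<delta> \<epsilon>. negligible \<delta> \<and> negligible \<epsilon> \<and>
       (\<forall>l. measure_pmf.prob (sde_keys S l)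
              {(pk, sk, \<kappa>). \<forall>ct. trace_distance (qsk_len S l) \<kappa> (sde_dec_key k S l \<kappa> ct) \<le> \<epsilon> l}
            \<ge> 1 - \<delta> l))"

text \<open>
  \<open>A\<close> outputs the four messages \<open>\<mu>\<^sub>B\<^sub>0, \<mu>\<^sub>B\<^sub>1, \<mu>\<^sub>C\<^sub>0, \<mu>\<^sub>C\<^sub>1\<close> in this order as one string \<open>z\<close>.
  The states \<open>branch \<dots> z\<close> carry the probability of \<open>z\<close> as their trace, so the sum over \<open>z\<close> is
  the expectation over the measured messages.
\<close>

definition message :: "nat \<Rightarrow> bits \<Rightarrow> nat \<Rightarrow> bits" where
  "message k z i = take k (drop (i * k) z)"

definition sde_cpa_win_prob :: "nat \<Rightarrow> sde \<Rightarrow> adversary \<Rightarrow> nat \<Rightarrow> real" where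
  "sde_cpa_win_prob k S \<A> l =
     measure_pmf.expectation (sde_keys S l) (\<lambda>(pk, sk, \<kappa>).
       \<Sum>z \<in> bitstrings (4 * k).
         let \<sigma> = branch (adv_A \<A> l) (pk_len S l + qsk_len S l) (reg_B \<A> l + reg_C \<A> l)
                   (with_classical pk \<kappa>) z
         in measure_pmf.expectation (pmf_of_set UNIV) (\<lambda>(coinB :: bool, coinC :: bool).
            measure_pmf.expectation (sde_encrypt S l pk (message k z (of_bool coinB))) (\<lambda>ctB.
            measure_pmf.expectation (sde_encrypt S l pk (message k z (2 + of_bool coinC))) (\<lambda>ctC.
              \<Sum>(outB, outC) \<in> {(b, c). (b \<noteq> c) = (coinB \<noteq> coinC)}.
                joint_prob (adv_B \<A> l) (adv_C \<A> l) (reg_B \<A> l) (reg_C \<A> l) \<sigma>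
                  ctB ctC [outB] [outC]))))"

definition sde_cpa_plus_anti_piracy :: "nat \<Rightarrow> sde \<Rightarrow> bool" where
  "sde_cpa_plus_anti_piracy k S \<longleftrightarrow>
     (\<forall>\<A>. qpt_adversary (\<lambda>l. pk_len S l + qsk_len S l) (\<lambda>l. 4 * k) (ct_len S) (\<lambda>l. 1) \<A> \<longrightarrow>
        (\<exists>\<epsilon>. negligible \<epsilon> \<and> (\<forall>l. sde_cpa_win_prob k S \<A> l \<le> 1 / 2 + \<epsilon> l)))"

end

(*
  The key of the scheme is the quantum trapdoor together with ek, and a bit mu is encrypted as
  (r, <r, x> + mu, Eval(ek, x)) for uniform r and x.  Decryption runs Inv coherently, checks the
  preimage by evaluating again, copies the validity bit and the masked message, and uncomputes.
  For an image of x both bits are almost determined, so the measurement hardly disturbs the key;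
  for a string outside the image the check always fails, and for a ciphertext of another length
  nothing is done.  This gives robustness against arbitrary ciphertexts.

  For CPA+ security, let D be the difference of the two measurement operators of B, as a function
  of the challenge.  The bias of the XOR game is the expectation of the tensor product of the
  averages of D over the coins and r, for B and for C.  These averages are, up to a factor of
  modulus at most 1, the amplitudes with which the quantum Goldreich-Levin (Bernstein-Vazirani)
  circuit around B outputs x.  By Cauchy-Schwarz the bias is at most the square root of the
  probability that both circuits extract their preimage, which search anti-piracy makes
  negligible.
*)

theory Submission
  imports Defs
begin

section \<open>Negligible functions\<close>

text \<open>The game asks for matching parities rather than for two right guesses, and this shapes
  the reduction: summed over matching answers, the single-party terms of the measurement operators
  cancel, and what is left is a tensor product of two differences, which can be averaged on each
  side separately. Extraction works on amplitudes, without repetition or candidate lists, because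
  the averaged operator is itself a block of the extracting unitary. Robustness is the reason for
  asking correctness at all \<open>x\<close> under almost every key: one key has to withstand every
  ciphertext. The public key \<open>ek\<close> is part of the quantum key because decryption has no
  other source from which to evaluate again. Mixed states are kept as finite sums of unnormalised
  pure states (\<open>gram\<close>), so that circuits are analysed on vectors and Cauchy-Schwarz
  applies directly. Two definitions need a theory of their own: trace norms are given by roots of a
  characteristic polynomial, which calls for a spectral theorem, and tree programs can double the
  size of a value in one step, so running times are bounded in the height.\<close>

lemma negligible_mono:
  assumes "negligible f" "\<And>l. \<bar>g l\<bar> \<le> \<bar>f l\<bar>"
  shows "negligible g"
  unfolding negligible_def
proof
  fix c :: nat
  have "\<forall>\<^sub>F n in sequentially. \<bar>f n\<bar> < 1 / real n ^ c"
    using assms(1) unfolding negligible_def by blast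
  then show "\<forall>\<^sub>F n in sequentially. \<bar>g n\<bar> < 1 / real n ^ c"
    by eventually_elim (use assms(2) le_less_trans in blast)
qed

text \<open>One exponent more than required pays for the factor 2 as soon as \<open>n\<close> is at
  least 2.\<close>

lemma negligible_add:
  assumes "negligible f" "negligible g"
  shows "negligible (\<lambda>l. f l + g l)"
  unfolding negligible_def
proof
  fix c :: nat
  have "\<forall>\<^sub>F n in sequentially. \<bar>f n\<bar> < 1 / real n ^ Suc c"
    "\<forall>\<^sub>F n in sequentially. \<bar>g n\<bar> < 1 / real n ^ Suc c"
    using assms unfolding negligible_def by blast+
  with eventually_ge_at_top[of 2]
  show "\<forall>\<^sub>F n in sequentially. \<bar>f n + g n\<bar> < 1 / real n ^ c"
  proof eventually_elim
    case (elim n)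
    have "\<bar>f n + g n\<bar> < 2 * (1 / real n ^ Suc c)" using elim by linarith
    also have "\<dots> \<le> real n * (1 / real n ^ Suc c)"
      using elim(1) by (intro mult_right_mono) auto
    also have "\<dots> = 1 / real n ^ c" using elim(1) by simp
    finally show ?case .
  qed
qed

text \<open>Taking the root halves the exponent, so the bound to start from is the one for
  \<open>c * 2\<close>.\<close>

lemma negligible_sqrt:
  assumes "negligible f"
  shows "negligible (\<lambda>l. sqrt \<bar>f l\<bar>)"
  unfolding negligible_def
proof
  fix c :: nat
  have "\<forall>\<^sub>F n in sequentially. \<bar>f n\<bar> < 1 / real n ^ (c * 2)"
    using assms unfolding negligible_def by blast
  with eventually_gt_at_top[of 0]
  show "\<forall>\<^sub>F n in sequentially. \<bar>sqrt \<bar>f n\<bar>\<bar> < 1 / real n ^ c"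
  proof eventually_elim
    case (elim n)
    have "sqrt \<bar>f n\<bar> < sqrt ((1 / real n ^ c)\<^sup>2)"
      using elim by (intro real_sqrt_less_mono) (simp add: power_divide flip: power_mult)
    then show ?case by simp
  qed
qed

section \<open>Polynomial-time WHILE programs\<close>

fun dheight :: "dat \<Rightarrow> nat" where
  "dheight Nl = 0"
| "dheight (Cns a b) = Suc (max (dheight a) (dheight b))"

fun expr_growth :: "expr \<Rightarrow> nat" where
  "expr_growth (Var i) = 0"
| "expr_growth ENil = 0"
| "expr_growth (ECons a b) = Suc (max (expr_growth a) (expr_growth b))"
| "expr_growth (EHd a) = expr_growth a"
| "expr_growth (ETl a) = expr_growth a"

text \<open>Both parts are added, even in a conditional: only a common bound on the growth per step
  is wanted, and a sum dominates both parts.\<close>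

fun com_growth :: "com \<Rightarrow> nat" where
  "com_growth (Assign i e) = expr_growth e"
| "com_growth (Seq c d) = com_growth c + com_growth d"
| "com_growth (Cond e c d) = com_growth c + com_growth d"
| "com_growth (While e c) = com_growth c"

lemma height_dhd [simp]: "dheight (dhd d) \<le> dheight d" by (cases d) auto
lemma height_dtl [simp]: "dheight (dtl d) \<le> dheight d" by (cases d) auto

lemma height_eval_expr:
  assumes "\<And>i. dheight (s i) \<le> h"
  shows "dheight (eval_expr e s) \<le> h + expr_growth e"
  by (induction e) (auto simp: assms intro: le_trans[OF height_dhd] le_trans[OF height_dtl])

text \<open>Only assignments change the store, and each adds at most its \<open>expr_growth\<close>
  to the largest height present. Sizes admit no such bound: \<open>ECons (Var i) (Var i)\<close>
  doubles them.\<close>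

lemma exec_height:
  "exec c s t s' \<Longrightarrow> (\<And>i. dheight (s i) \<le> h) \<Longrightarrow> dheight (s' i) \<le> h + com_growth c * t"
proof (induction arbitrary: h i rule: exec.induct)
  case (Assign i e s)
  then show ?case using height_eval_expr[of s h e] by (auto intro: trans_le_add1)
next
  case (Seq c s t s' d t' s'')
  have "dheight (s'' i) \<le> (h + com_growth c * t) + com_growth d * t'" using Seq by blast
  then show ?case by (simp add: algebra_simps)
next
  case (CondT e s c t s' d)
  then have "dheight (s' i) \<le> h + com_growth c * t" by blast
  then show ?case by (simp add: algebra_simps)
next
  case (CondF e s d t s' c)
  then have "dheight (s' i) \<le> h + com_growth d * t" by blast
  then show ?case by (simp add: algebra_simps)
next
  case (WhileT e s c t s' t' s'')
  have "dheight (s'' i) \<le> (h + com_growth c * t) + com_growth c * t'"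
    using WhileT.IH(2)[of "h + com_growth c * t"] WhileT.IH(1)[OF WhileT.prems] by simp
  then show ?case by (simp add: algebra_simps)
next
  case (WhileF e s c)
  then show ?case by (meson trans_le_add1)
qed

section \<open>Programs as subroutines on a fresh range of variables\<close>

fun expr_vars :: "expr \<Rightarrow> nat" where
  "expr_vars (Var i) = Suc i"
| "expr_vars ENil = 0"
| "expr_vars (ECons a b) = max (expr_vars a) (expr_vars b)"
| "expr_vars (EHd a) = expr_vars a"
| "expr_vars (ETl a) = expr_vars a"

fun com_vars :: "com \<Rightarrow> nat" where
  "com_vars (Assign i e) = max (Suc i) (expr_vars e)"
| "com_vars (Seq c d) = max (com_vars c) (com_vars d)"
| "com_vars (Cond e c d) = max (expr_vars e) (max (com_vars c) (com_vars d))"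
| "com_vars (While e c) = max (expr_vars e) (com_vars c)"

fun shift_expr :: "nat \<Rightarrow> expr \<Rightarrow> expr" where
  "shift_expr k (Var i) = Var (k + i)"
| "shift_expr k ENil = ENil"
| "shift_expr k (ECons a b) = ECons (shift_expr k a) (shift_expr k b)"
| "shift_expr k (EHd a) = EHd (shift_expr k a)"
| "shift_expr k (ETl a) = ETl (shift_expr k a)"

fun shift_com :: "nat \<Rightarrow> com \<Rightarrow> com" where
  "shift_com k (Assign i e) = Assign (k + i) (shift_expr k e)"
| "shift_com k (Seq c d) = Seq (shift_com k c) (shift_com k d)"
| "shift_com k (Cond e c d) = Cond (shift_expr k e) (shift_com k c) (shift_com k d)"
| "shift_com k (While e c) = While (shift_expr k e) (shift_com k c)"

definition sim :: "nat \<Rightarrow> nat \<Rightarrow> store \<Rightarrow> store \<Rightarrow> bool" where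
  "sim k N s r \<longleftrightarrow> (\<forall>i<N. r (k + i) = s i)"

lemma eval_shift_expr:
  "sim k N s r \<Longrightarrow> expr_vars e \<le> N \<Longrightarrow> eval_expr (shift_expr k e) r = eval_expr e s"
  by (induction e) (auto simp: sim_def)

text \<open>Renaming variables changes neither the control flow nor the step count. Since variables
  below \<open>k\<close> survive, a caller can keep its own data there.\<close>

lemma exec_shift_com:
  "exec c s t s' \<Longrightarrow> com_vars c \<le> N \<Longrightarrow> sim k N s r \<Longrightarrow>
     \<exists>r'. exec (shift_com k c) r t r' \<and> sim k N s' r' \<and> (\<forall>i<k. r' i = r i)"
proof (induction arbitrary: r rule: exec.induct)
  case (Assign i e s)
  then have "exec (shift_com k (Assign i e)) r 1 (r(k + i := eval_expr e s))"
    using exec.Assign[of "k + i" "shift_expr k e" r] by (simp add: eval_shift_expr)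
  moreover have "sim k N (s(i := eval_expr e s)) (r(k + i := eval_expr e s))"
    using Assign.prems by (auto simp: sim_def)
  ultimately show ?case by (metis fun_upd_other le_add1 not_le)
next
  case (Seq c s t s' d t' s'')
  then obtain r1 where r1: "exec (shift_com k c) r t r1" "sim k N s' r1" "\<forall>i<k. r1 i = r i"
    by (metis com_vars.simps(2) max.bounded_iff)
  with Seq obtain r2 where "exec (shift_com k d) r1 t' r2" "sim k N s'' r2" "\<forall>i<k. r2 i = r1 i"
    by (metis com_vars.simps(2) max.bounded_iff)
  with r1 show ?case by (auto intro!: exI[of _ r2] exec.Seq)
next
  case (CondT e s c t s' d)
  then obtain r1 where r1: "exec (shift_com k c) r t r1" "sim k N s' r1" "\<forall>i<k. r1 i = r i"
    by (metis com_vars.simps(3) max.bounded_iff)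
  with CondT show ?case by (auto intro!: exI[of _ r1] exec.CondT simp: eval_shift_expr)
next
  case (CondF e s d t s' c)
  then obtain r1 where r1: "exec (shift_com k d) r t r1" "sim k N s' r1" "\<forall>i<k. r1 i = r i"
    by (metis com_vars.simps(3) max.bounded_iff)
  with CondF show ?case by (auto intro!: exI[of _ r1] exec.CondF simp: eval_shift_expr)
next
  case (WhileT e s c t s' t' s'')
  then obtain r1 where r1: "exec (shift_com k c) r t r1" "sim k N s' r1" "\<forall>i<k. r1 i = r i"
    by (metis com_vars.simps(4) max.bounded_iff)
  with WhileT obtain r2 where "exec (shift_com k (While e c)) r1 t' r2" "sim k N s'' r2"
    "\<forall>i<k. r2 i = r1 i" by metis
  with r1 WhileT show ?case by (auto intro!: exI[of _ r2] exec.WhileT simp: eval_shift_expr)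
next
  case (WhileF e s c)
  then show ?case
    by (intro exI[of _ r]) (auto intro!: exec.WhileF simp: eval_shift_expr simp del: One_nat_def)
qed

definition runs :: "com \<Rightarrow> dat \<Rightarrow> nat \<Rightarrow> dat \<Rightarrow> bool" where
  "runs c d n v \<longleftrightarrow> (\<exists>t s. exec c ((\<lambda>_. Nl)(0 := d)) t s \<and> t \<le> n \<and> s 0 = v)"

text \<open>The base case assigns \<open>k\<close> to itself because the language has no skip
  command. Variable \<open>k\<close> holds the argument of a call and is spared.\<close>

fun clear_vars :: "nat \<Rightarrow> nat \<Rightarrow> com" where
  "clear_vars k 0 = Assign k (Var k)"
| "clear_vars k (Suc n) = Seq (clear_vars k n) (Assign (k + Suc n) ENil)"

lemma exec_clear_vars:
  "exec (clear_vars k n) s (Suc n) (\<lambda>i. if k < i \<and> i \<le> k + n then Nl else s i)"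
proof (induction n)
  case 0
  have "exec (Assign k (Var k)) s 1 (s(k := eval_expr (Var k) s))" by (rule exec.Assign)
  moreover have "s(k := eval_expr (Var k) s) = (\<lambda>i. if k < i \<and> i \<le> k + 0 then Nl else s i)"
    by (auto simp: fun_eq_iff)
  ultimately show ?case by simp
next
  case (Suc n)
  have "exec (clear_vars k (Suc n)) s (Suc n + 1)
     ((\<lambda>i. if k < i \<and> i \<le> k + n then Nl else s i)(k + Suc n := Nl))"
    using exec.Seq[OF Suc exec.Assign[of "k + Suc n" ENil]] by simp
  moreover have "((\<lambda>i. if k < i \<and> i \<le> k + n then Nl else s i)(k + Suc n := Nl))
     = (\<lambda>i. if k < i \<and> i \<le> k + Suc n then Nl else s i)" by (auto simp: fun_eq_iff)
  ultimately show ?case by simp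
qed

definition call :: "nat \<Rightarrow> com \<Rightarrow> com" where
  "call k c = Seq (clear_vars k (com_vars c)) (shift_com k c)"

text \<open>Clearing comes first because \<open>runs\<close> speaks only of stores that are empty
  apart from the input. Variables above \<open>k\<close> end with unspecified content, so callers
  keep their data below \<open>k\<close> and use increasing positions.\<close>

lemma exec_call:
  assumes "runs c d n v" "s k = d"
  shows "\<exists>t s'. exec (call k c) s t s' \<and> t \<le> n + com_vars c + 1 \<and> s' k = v \<and> (\<forall>i<k. s' i = s i)"
proof -
  from assms obtain t s1 where c: "exec c ((\<lambda>_. Nl)(0 := d)) t s1" "t \<le> n" "s1 0 = v"
    unfolding runs_def by blast
  let ?r = "\<lambda>i. if k < i \<and> i \<le> k + com_vars c then Nl else s i"
  have "sim k (Suc (com_vars c)) ((\<lambda>_. Nl)(0 := d)) ?r" using assms by (auto simp: sim_def)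
  from exec_shift_com[OF c(1) _ this] obtain r' where
    r': "exec (shift_com k c) ?r t r'" "sim k (Suc (com_vars c)) s1 r'" "\<forall>i<k. r' i = ?r i" by auto
  have "exec (call k c) s (Suc (com_vars c) + t) r'"
    unfolding call_def by (rule exec.Seq[OF exec_clear_vars r'(1)])
  moreover have "r' k = v" using r'(2) c(3) unfolding sim_def by force
  ultimately show ?thesis using r'(3) c(2) by (intro exI[of _ "Suc (com_vars c) + t"] exI[of _ r']) auto
qed

lemma poly_nat_mono: "a \<le> b \<Longrightarrow> poly p a \<le> poly (p :: nat poly) b"
  by (induction p) (auto intro!: add_mono mult_mono)

text \<open>
  Time is measured against the height of the input tree, which for the encodings used here is
  polynomially related to the size.  As a step raises heights by a constant only, outputs have
  polynomial height, so this notion is closed under composition.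
\<close>

definition ptime :: "('a \<Rightarrow> dat) \<Rightarrow> ('a \<Rightarrow> dat) \<Rightarrow> bool" where
  "ptime inp out \<longleftrightarrow> (\<exists>c (p :: nat poly). \<forall>a. runs c (inp a) (poly p (dheight (inp a))) (out a))"

abbreviation pfun :: "(dat \<Rightarrow> dat) \<Rightarrow> bool" where
  "pfun f \<equiv> ptime (\<lambda>d. d) f"

lemma runs_height:
  assumes "runs c d n v"
  shows "dheight v \<le> dheight d + com_growth c * n"
proof -
  from assms obtain t s where c: "exec c ((\<lambda>_. Nl)(0 := d)) t s" "t \<le> n" "s 0 = v"
    unfolding runs_def by blast
  have "dheight v \<le> dheight d + com_growth c * t" using exec_height[OF c(1), of "dheight d" 0] c(3) by simp
  also have "\<dots> \<le> dheight d + com_growth c * n" using c(2) by simp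
  finally show ?thesis .
qed

lemma ptime_height:
  assumes "ptime inp out"
  shows "\<exists>p :: nat poly. \<forall>a. dheight (out a) \<le> poly p (dheight (inp a))"
proof -
  from assms obtain c and p :: "nat poly" where c: "\<And>a. runs c (inp a) (poly p (dheight (inp a))) (out a)"
    unfolding ptime_def by blast
  have "dheight (out a) \<le> poly ([:0, 1:] + Polynomial.smult (com_growth c) p) (dheight (inp a))" for a
    using runs_height[OF c[of a]] by simp
  then show ?thesis by blast
qed

lemma runs_Seq_Assign: "exec c (s(i := eval_expr e s)) t s' \<Longrightarrow> exec (Seq (Assign i e) c) s (Suc t) s'"
  using exec.Seq[OF exec.Assign] by fastforce

lemma ptime_expr:
  assumes "\<And>a. out a = eval_expr e ((\<lambda>_. Nl)(0 := inp a))"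
  shows "ptime inp out"
proof -
  have "runs (Assign 0 e) (inp a) (poly [:1:] (dheight (inp a))) (out a)" for a
    unfolding runs_def assms using exec.Assign[of 0 e] by fastforce
  then show ?thesis unfolding ptime_def by blast
qed

section \<open>Closure properties of \<open>ptime\<close>\<close>

lemma ptime_id: "ptime inp inp" by (rule ptime_expr[of _ "Var 0"]) simp
lemma ptime_Nl: "ptime inp (\<lambda>_. Nl)" by (rule ptime_expr[of _ ENil]) simp

lemma ptime_reindex: "ptime inp out \<Longrightarrow> ptime (\<lambda>b. inp (h b)) (\<lambda>b. out (h b))"
  unfolding ptime_def by blast

text \<open>A polynomial height bound on the intermediate value keeps the second running time
  polynomial in the original input; it enters through \<open>pcompose\<close>.\<close>

lemma ptime_trans:
  assumes "ptime inp mid" "ptime mid out"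
  shows "ptime inp out"
proof -
  from assms(1) obtain c and p :: "nat poly"
    where c: "\<And>a. runs c (inp a) (poly p (dheight (inp a))) (mid a)" unfolding ptime_def by blast
  from assms(2) obtain d and q :: "nat poly"
    where d: "\<And>a. runs d (mid a) (poly q (dheight (mid a))) (out a)" unfolding ptime_def by blast
  from ptime_height[OF assms(1)] obtain r :: "nat poly"
    where r: "\<And>a. dheight (mid a) \<le> poly r (dheight (inp a))" by blast
  let ?prog = "Seq (call 0 c) (call 0 d)"
  let ?p = "p + pcompose q r + [:com_vars c + com_vars d + 2:]"
  have "runs ?prog (inp a) (poly ?p (dheight (inp a))) (out a)" for a
  proof -
    obtain t1 s1 where 1: "exec (call 0 c) ((\<lambda>_. Nl)(0 := inp a)) t1 s1"
      "t1 \<le> poly p (dheight (inp a)) + com_vars c + 1" "s1 0 = mid a"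
      using exec_call[OF c[of a], of "(\<lambda>_. Nl)(0 := inp a)" 0] by auto
    obtain t2 s2 where 2: "exec (call 0 d) s1 t2 s2"
      "t2 \<le> poly q (dheight (mid a)) + com_vars d + 1" "s2 0 = out a"
      using exec_call[OF d[of a], of s1 0] 1(3) by auto
    have "poly q (dheight (mid a)) \<le> poly (pcompose q r) (dheight (inp a))"
      unfolding poly_pcompose using poly_nat_mono[OF r] .
    then show ?thesis unfolding runs_def
      using exec.Seq[OF 1(1) 2(1)] 1 2 by (intro exI[of _ "t1 + t2"] exI[of _ s2]) auto
  qed
  then show ?thesis unfolding ptime_def by blast
qed

lemma ptime_app:
  assumes "pfun f" "ptime inp mid"
  shows "ptime inp (\<lambda>a. f (mid a))"
  using ptime_trans[OF assms(2) ptime_reindex[OF assms(1)]] .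

lemma ptime_hd: "ptime inp f \<Longrightarrow> ptime inp (\<lambda>a. dhd (f a))"
  by (rule ptime_app[OF ptime_expr[of _ "EHd (Var 0)"]]) auto

lemma ptime_tl: "ptime inp f \<Longrightarrow> ptime inp (\<lambda>a. dtl (f a))"
  by (rule ptime_app[OF ptime_expr[of _ "ETl (Var 0)"]]) auto

lemma ptime_Cns:
  assumes "ptime inp f" "ptime inp g"
  shows "ptime inp (\<lambda>a. Cns (f a) (g a))"
proof -
  from assms(1) obtain c and p :: "nat poly"
    where c: "\<And>a. runs c (inp a) (poly p (dheight (inp a))) (f a)" unfolding ptime_def by blast
  from assms(2) obtain d and q :: "nat poly"
    where d: "\<And>a. runs d (inp a) (poly q (dheight (inp a))) (g a)" unfolding ptime_def by blast
  \<comment> \<open>Variable 0 keeps the input while the two parts run from positions 1 and 2, so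
    both see it unchanged and the first result survives the second call.\<close>
  let ?prog = "Seq (Assign 1 (Var 0)) (Seq (call 1 c) (Seq (Assign 2 (Var 0)) (Seq (call 2 d)
     (Assign 0 (ECons (Var 1) (Var 2))))))"
  let ?p = "p + q + [:com_vars c + com_vars d + 5:]"
  have "runs ?prog (inp a) (poly ?p (dheight (inp a))) (Cns (f a) (g a))" for a
  proof -
    let ?s = "(\<lambda>_. Nl)(0 := inp a, 1 := inp a)"
    obtain t1 s1 where 1: "exec (call 1 c) ?s t1 s1"
      "t1 \<le> poly p (dheight (inp a)) + com_vars c + 1" "s1 1 = f a" "s1 0 = inp a"
      using exec_call[OF c[of a], of ?s 1] by auto
    let ?s1 = "s1(2 := inp a)"
    obtain t2 s2 where 2: "exec (call 2 d) ?s1 t2 s2"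
      "t2 \<le> poly q (dheight (inp a)) + com_vars d + 1" "s2 2 = g a" "s2 1 = f a"
      using exec_call[OF d[of a], of ?s1 2] 1(3) by auto
    have "exec (Seq (call 2 d) (Assign 0 (ECons (Var 1) (Var 2)))) ?s1 (t2 + 1)
       (s2(0 := Cns (f a) (g a)))"
      using exec.Seq[OF 2(1) exec.Assign[of 0 "ECons (Var 1) (Var 2)"]] 2 by simp
    then have "exec (Seq (Assign 2 (Var 0)) (Seq (call 2 d) (Assign 0 (ECons (Var 1) (Var 2)))))
       s1 (Suc (t2 + 1)) (s2(0 := Cns (f a) (g a)))"
      using 1 by (intro runs_Seq_Assign) simp
    from exec.Seq[OF 1(1) this]
    have "exec ?prog ((\<lambda>_. Nl)(0 := inp a)) (Suc (t1 + Suc (t2 + 1))) (s2(0 := Cns (f a) (g a)))"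
      by (intro runs_Seq_Assign) simp
    then show ?thesis unfolding runs_def using 1 2
      by (intro exI[of _ "Suc (t1 + Suc (t2 + 1))"] exI[of _ "s2(0 := Cns (f a) (g a))"]) auto
  qed
  then show ?thesis unfolding ptime_def by blast
qed

lemma ptime_if:
  assumes "ptime inp b" "ptime inp f" "ptime inp g"
  shows "ptime inp (\<lambda>a. if b a \<noteq> Nl then f a else g a)"
proof -
  \<comment> \<open>The condition is computed beforehand and paired with the input, so that the
    program itself only unpacks the pair and branches.\<close>
  have bi: "ptime inp (\<lambda>a. Cns (b a) (inp a))" by (rule ptime_Cns[OF assms(1) ptime_id])
  from assms(2) obtain c and p :: "nat poly"
    where c: "\<And>a. runs c (inp a) (poly p (dheight (inp a))) (f a)" unfolding ptime_def by blast
  from assms(3) obtain d and q :: "nat poly"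
    where d: "\<And>a. runs d (inp a) (poly q (dheight (inp a))) (g a)" unfolding ptime_def by blast
  let ?prog = "Seq (Assign 1 (EHd (Var 0))) (Seq (Assign 0 (ETl (Var 0)))
     (Cond (Var 1) (call 0 c) (call 0 d)))"
  let ?p = "p + q + [:com_vars c + com_vars d + 5:]"
  have "runs ?prog (Cns (b a) (inp a)) (poly ?p (dheight (Cns (b a) (inp a))))
      (if b a \<noteq> Nl then f a else g a)" for a
  proof -
    let ?s = "(\<lambda>_. Nl)(0 := inp a, 1 := b a)"
    have m: "poly p (dheight (inp a)) \<le> poly p (dheight (Cns (b a) (inp a)))"
      "poly q (dheight (inp a)) \<le> poly q (dheight (Cns (b a) (inp a)))"
      by (auto intro!: poly_nat_mono)
    \<comment> \<open>The \<open>- 2\<close> reserves time for the two assignments that unpack the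
      pair.\<close>
    have "\<exists>t s. exec (Cond (Var 1) (call 0 c) (call 0 d)) ?s t s \<and>
       t \<le> poly ?p (dheight (Cns (b a) (inp a))) - 2 \<and> s 0 = (if b a \<noteq> Nl then f a else g a)"
    proof (cases "b a = Nl")
      case True
      obtain t2 s2 where 2: "exec (call 0 d) ?s t2 s2"
        "t2 \<le> poly q (dheight (inp a)) + com_vars d + 1" "s2 0 = g a"
        using exec_call[OF d[of a], of ?s 0] by auto
      have "exec (Cond (Var 1) (call 0 c) (call 0 d)) ?s (Suc t2) s2"
        using True by (intro exec.CondF 2) simp
      with 2 m True show ?thesis by (intro exI[of _ "Suc t2"] exI[of _ s2]) auto
    next
      case False
      obtain t2 s2 where 2: "exec (call 0 c) ?s t2 s2"
        "t2 \<le> poly p (dheight (inp a)) + com_vars c + 1" "s2 0 = f a"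
        using exec_call[OF c[of a], of ?s 0] by auto
      have "exec (Cond (Var 1) (call 0 c) (call 0 d)) ?s (Suc t2) s2"
        using False by (intro exec.CondT 2) simp
      with 2 m False show ?thesis by (intro exI[of _ "Suc t2"] exI[of _ s2]) auto
    qed
    then obtain t s where ts: "exec (Cond (Var 1) (call 0 c) (call 0 d)) ?s t s"
      "t \<le> poly ?p (dheight (Cns (b a) (inp a))) - 2" "s 0 = (if b a \<noteq> Nl then f a else g a)" by blast
    have "exec ?prog ((\<lambda>_. Nl)(0 := Cns (b a) (inp a))) (Suc (Suc t)) s"
      by (intro runs_Seq_Assign) (use ts(1) in \<open>simp add: fun_upd_twist\<close>)
    moreover have "Suc (Suc t) \<le> poly ?p (dheight (Cns (b a) (inp a)))" using ts(2) by simp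
    ultimately show ?thesis unfolding runs_def using ts(3) by blast
  qed
  then have "ptime (\<lambda>a. Cns (b a) (inp a)) (\<lambda>a. if b a \<noteq> Nl then f a else g a)"
    unfolding ptime_def by blast
  with bi show ?thesis by (rule ptime_trans)
qed

subsection \<open>Folds over trees read as lists\<close>

text \<open>The parameter \<open>e\<close> is handed to every step because \<open>f\<close> is a
  function computed by a program and cannot capture values of the surrounding computation.\<close>

fun dfold :: "(dat \<Rightarrow> dat) \<Rightarrow> dat \<Rightarrow> dat \<Rightarrow> dat \<Rightarrow> dat" where
  "dfold f e acc Nl = acc"
| "dfold f e acc (Cns x l) = dfold f e (f (Cns x (Cns acc e))) l"

text \<open>A polynomial-time step is not enough, since iterating a step that doubles the height of
  the accumulator leads to exponential height. The hypothesis \<open>growth\<close> lets the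
  accumulator grow only additively, by an amount controlled by the item and the environment; there
  are at most as many rounds as the list tree is high.\<close>

lemma pfun_dfold:
  assumes "pfun f"
    and growth: "\<And>x acc e. dheight (f (Cns x (Cns acc e))) \<le> dheight acc + poly q (max (dheight x) (dheight e))"
  shows "pfun (\<lambda>d. dfold f (dtl (dtl d)) (dhd (dtl d)) (dhd d))"
proof -
  from assms(1) obtain c and p :: "nat poly"
    where c: "\<And>a. runs c a (poly p (dheight a)) (f a)" unfolding ptime_def by blast
  let ?body = "Seq (Assign 3 (ECons (EHd (Var 0)) (ECons (Var 1) (Var 2)))) (Seq (call 3 c)
      (Seq (Assign 1 (Var 3)) (Assign 0 (ETl (Var 0)))))"
  let ?loop = "While (Var 0) ?body"
  let ?prog = "Seq (Assign 1 (EHd (ETl (Var 0)))) (Seq (Assign 2 (ETl (ETl (Var 0))))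
      (Seq (Assign 0 (EHd (Var 0))) (Seq ?loop (Assign 0 (Var 1)))))"
  \<comment> \<open>\<open>h\<close> bounds the items and the environment. \<open>B\<close> bounds
    the accumulator together with all growth still to come, which is invariant under a round. The
    argument \<open>B + 2\<close> accounts for the two constructors that package item, accumulator
    and environment.\<close>
  have loop: "\<exists>t s'. exec ?loop s t s' \<and> s' 1 = dfold f (s 2) (s 1) (s 0) \<and>
      t \<le> dheight (s 0) * (poly p (B + 2) + com_vars c + 5) + 1"
    if "dheight (s 0) \<le> h" "dheight (s 2) \<le> h" "h \<le> B" "dheight (s 1) + dheight (s 0) * poly q h \<le> B"
    for s :: store and h B
    using that
  proof (induction "s 0" arbitrary: s)
    case Nl
    then have "exec ?loop s 1 s" by (intro exec.WhileF) simp
    with Nl show ?case by fastforce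
  next
    case (Cns x l)
    let ?d = "Cns x (Cns (s 1) (s 2))"
    let ?s = "s(3 := ?d)"
    obtain t1 s1 where 1: "exec (call 3 c) ?s t1 s1"
      "t1 \<le> poly p (dheight ?d) + com_vars c + 1" "s1 3 = f ?d" "s1 0 = s 0" "s1 2 = s 2"
      using exec_call[OF c[of ?d], of ?s 3] by auto
    let ?s2 = "s1(1 := f ?d, 0 := l)"
    have "exec (Seq (Assign 1 (Var 3)) (Assign 0 (ETl (Var 0)))) s1 (Suc 1) ?s2"
      by (intro runs_Seq_Assign)
        (use exec.Assign[of 0 "ETl (Var 0)" "s1(1 := f ?d)"] 1 Cns(3)[symmetric] in simp)
    from exec.Seq[OF 1(1) this] have body: "exec ?body s (Suc (t1 + Suc 1)) ?s2"
      by (intro runs_Seq_Assign) (use Cns(3)[symmetric] in simp)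
    have hl: "dheight (s 0) = Suc (max (dheight x) (dheight l))" using Cns(3)[symmetric] by simp
    have hx: "dheight x \<le> h" "dheight l \<le> h" using Cns.prems(1) hl by auto
    have "dheight (f ?d) \<le> dheight (s 1) + poly q h"
      using growth[of x "s 1" "s 2"] poly_nat_mono[of "max (dheight x) (dheight (s 2))" h q]
        hx Cns.prems(2) by auto
    moreover have "Suc (dheight l) * poly q h \<le> dheight (s 0) * poly q h"
      using hl by (intro mult_right_mono) auto
    ultimately have "dheight (f ?d) + dheight l * poly q h \<le> B" using Cns.prems(4) by simp
    with Cns.hyps(2)[of ?s2] hx Cns.prems 1
    obtain t3 s3 where 3: "exec ?loop ?s2 t3 s3" "s3 1 = dfold f (s 2) (f ?d) l"
      "t3 \<le> dheight l * (poly p (B + 2) + com_vars c + 5) + 1" by auto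
    have "exec ?loop s (Suc (Suc (t1 + Suc 1) + t3)) s3"
      using body 3(1) Cns(3)[symmetric] by (intro exec.WhileT) auto
    moreover have "Suc (Suc (t1 + Suc 1) + t3) \<le> dheight (s 0) * (poly p (B + 2) + com_vars c + 5) + 1"
    proof -
      have "dheight ?d \<le> B + 2" using hx Cns.prems by (auto simp: trans_le_add1)
      then have "t1 \<le> poly p (B + 2) + com_vars c + 1" using 1(2) poly_nat_mono[of "dheight ?d" "B + 2" p] by simp
      moreover have "Suc (dheight l) * (poly p (B + 2) + com_vars c + 5)
          \<le> dheight (s 0) * (poly p (B + 2) + com_vars c + 5)"
        using hl by (intro mult_right_mono) auto
      ultimately show ?thesis using 3(3) by simp
    qed
    moreover have "s3 1 = dfold f (s 2) (s 1) (s 0)" using 3(2) Cns(3)[symmetric] by simp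
    ultimately show ?case by blast
  qed
  let ?B = "[:0, 1:] + [:0, 1:] * q"
  let ?p = "[:0, 1:] * (pcompose p (?B + [:2:]) + [:com_vars c + 5:]) + [:6:]"
  have "runs ?prog d (poly ?p (dheight d)) (dfold f (dtl (dtl d)) (dhd (dtl d)) (dhd d))" for d
  proof -
    let ?s = "(\<lambda>_. Nl)(0 := dhd d, 1 := dhd (dtl d), 2 := dtl (dtl d))"
    let ?h = "dheight d"
    have hts: "dheight (dhd d) \<le> ?h" "dheight (dtl (dtl d)) \<le> ?h" "dheight (dhd (dtl d)) \<le> ?h"
      by (meson height_dhd height_dtl le_trans)+
    have "dheight (dhd (dtl d)) + dheight (dhd d) * poly q ?h \<le> poly ?B ?h"
      using hts by (auto intro!: add_mono mult_mono)
    with loop[of ?s ?h "poly ?B ?h"] hts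
    obtain t s where ts: "exec ?loop ?s t s" "s 1 = dfold f (dtl (dtl d)) (dhd (dtl d)) (dhd d)"
      "t \<le> dheight (dhd d) * (poly p (poly ?B ?h + 2) + com_vars c + 5) + 1" by auto
    have t: "t \<le> ?h * (poly p (poly ?B ?h + 2) + com_vars c + 5) + 1"
      using ts(3) hts(1) by (meson add_mono le_refl le_trans mult_right_mono zero_le)
    have "exec (Seq ?loop (Assign 0 (Var 1))) ?s (t + 1) (s(0 := s 1))"
      using exec.Seq[OF ts(1) exec.Assign[of 0 "Var 1"]] by simp
    then have "exec ?prog ((\<lambda>_. Nl)(0 := d)) (Suc (Suc (Suc (t + 1)))) (s(0 := s 1))"
      by (intro runs_Seq_Assign) (simp add: fun_upd_twist)
    then show ?thesis unfolding runs_def using ts(2) t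
      by (intro exI[of _ "Suc (Suc (Suc (t + 1)))"] exI[of _ "s(0 := s 1)"])
        (auto simp: poly_pcompose algebra_simps)
  qed
  then show ?thesis unfolding ptime_def by blast
qed

lemma ptime_dfold:
  assumes "pfun f"
    and "\<And>x acc e. dheight (f (Cns x (Cns acc e))) \<le> dheight acc + poly q (max (dheight x) (dheight e))"
    and "ptime inp l" "ptime inp acc" "ptime inp e"
  shows "ptime inp (\<lambda>a. dfold f (e a) (acc a) (l a))"
  using ptime_app[OF pfun_dfold[OF assms(1,2)] ptime_Cns[OF assms(3) ptime_Cns[OF assms(4,5)]]]
  by simp

lemma dfold_enc_list:
  "dfold f e acc (enc_list xs) = foldl (\<lambda>acc x. f (Cns x (Cns acc e))) acc xs"
  by (induction xs arbitrary: acc) auto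

text \<open>A left fold produces its result in reverse, so reversal onto an accumulator is the
  primitive, and appending and mapping are corrected by a second reversal.\<close>

definition drev_onto :: "dat \<Rightarrow> dat \<Rightarrow> dat" where
  "drev_onto l acc = dfold (\<lambda>d. Cns (dhd d) (dhd (dtl d))) Nl acc l"

definition dappend :: "dat \<Rightarrow> dat \<Rightarrow> dat" where
  "dappend a b = drev_onto (drev_onto a Nl) b"

definition dmap :: "(dat \<Rightarrow> dat) \<Rightarrow> dat \<Rightarrow> dat \<Rightarrow> dat" where
  "dmap f e l = drev_onto (dfold (\<lambda>d. Cns (f (Cns (dhd d) (dtl (dtl d)))) (dhd (dtl d))) e Nl l) Nl"

lemma drev_onto_enc_list: "drev_onto (enc_list xs) (enc_list ys) = enc_list (rev xs @ ys)"
proof -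
  have "foldl (\<lambda>acc x. Cns x acc) (enc_list ys) xs = enc_list (rev xs @ ys)"
  proof (induction xs arbitrary: ys)
    case (Cons x xs)
    then show ?case using Cons.IH[of "x # ys"] by simp
  qed simp
  then show ?thesis unfolding drev_onto_def dfold_enc_list by simp
qed

lemma drev_onto_Nl: "drev_onto (enc_list xs) Nl = enc_list (rev xs)"
  using drev_onto_enc_list[of xs "[]"] by simp

lemma dappend_enc_list: "dappend (enc_list xs) (enc_list ys) = enc_list (xs @ ys)"
  unfolding dappend_def by (simp add: drev_onto_Nl drev_onto_enc_list)

lemma dmap_enc_list: "dmap f e (enc_list xs) = enc_list (map (\<lambda>x. f (Cns x e)) xs)"
proof -
  have "foldl (\<lambda>acc x. Cns (f (Cns x e)) acc) (enc_list ys) xs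
      = enc_list (rev (map (\<lambda>x. f (Cns x e)) xs) @ ys)" for ys
  proof (induction xs arbitrary: ys)
    case (Cons x xs)
    then show ?case using Cons.IH[of "f (Cns x e) # ys"] by simp
  qed simp
  from this[of "[]"] show ?thesis unfolding dmap_def dfold_enc_list by (simp add: drev_onto_Nl)
qed

lemma ptime_drev_onto:
  assumes "ptime inp l" "ptime inp acc"
  shows "ptime inp (\<lambda>a. drev_onto (l a) (acc a))"
  unfolding drev_onto_def
proof (rule ptime_dfold[where q = "[:1, 1:]"])
  show "pfun (\<lambda>d. Cns (dhd d) (dhd (dtl d)))"
    by (intro ptime_Cns ptime_hd ptime_tl ptime_id)
qed (use assms in \<open>auto intro: ptime_Nl\<close>)

lemma ptime_dappend: "ptime inp f \<Longrightarrow> ptime inp g \<Longrightarrow> ptime inp (\<lambda>a. dappend (f a) (g a))"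
  unfolding dappend_def by (intro ptime_drev_onto ptime_Nl)

lemma ptime_dmap:
  assumes "pfun f" "ptime inp e" "ptime inp l"
  shows "ptime inp (\<lambda>a. dmap f (e a) (l a))"
proof -
  from ptime_height[OF assms(1)] obtain p :: "nat poly"
    where p: "\<And>d. dheight (f d) \<le> poly p (dheight d)" by blast
  have "dheight (f (Cns x e)) \<le> poly (pcompose p [:1, 1:]) (max (dheight x) (dheight e))" for x e
    using p[of "Cns x e"] by (simp add: poly_pcompose)
  then have *: "dheight (Cns (f (Cns x e)) acc)
      \<le> dheight acc + poly (pcompose p [:1, 1:] + [:1:]) (max (dheight x) (dheight e))" for x e acc
    by (simp add: max_def trans_le_add2)
  show ?thesis unfolding dmap_def
  proof (intro ptime_drev_onto ptime_Nl ptime_dfold[where q = "pcompose p [:1, 1:] + [:1:]"])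
    show "pfun (\<lambda>d. Cns (f (Cns (dhd d) (dtl (dtl d)))) (dhd (dtl d)))"
      by (intro ptime_Cns ptime_app[OF assms(1)] ptime_hd ptime_tl ptime_id)
  qed (use * assms in auto)
qed

lemma unary_eq_enc_list: "unary n = enc_list (replicate n Nl)"
  by (induction n) auto

lemma dappend_unary: "dappend (unary m) (unary n) = unary (m + n)"
  by (simp add: unary_eq_enc_list dappend_enc_list replicate_add)

subsection \<open>Operations on circuits\<close>

fun shift_gate :: "nat \<Rightarrow> gate \<Rightarrow> gate" where
  "shift_gate k (X i) = X (k + i)"
| "shift_gate k (CNOT i j) = CNOT (k + i) (k + j)"
| "shift_gate k (Toffoli i j l) = Toffoli (k + i) (k + j) (k + l)"
| "shift_gate k (H i) = H (k + i)"
| "shift_gate k (T i) = T (k + i)"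
| "shift_gate k (Tinv i) = Tinv (k + i)"

definition shift :: "nat \<Rightarrow> gate list \<Rightarrow> gate list" where
  "shift k gs = map (shift_gate k) gs"

text \<open>Also used for gates whose shifted copies overlap, such as \<open>CNOT i (Suc i)\<close>.
  Then the order matters: each gate reads what its predecessor has written, and the family computes
  running sums or conjunctions.\<close>

definition gate_family :: "nat \<Rightarrow> gate \<Rightarrow> gate list" where
  "gate_family n g = map (\<lambda>i. shift_gate i g) [0..<n]"

text \<open>Every gate has an order dividing 8.\<close>

definition inverse_gates :: "gate list \<Rightarrow> gate list" where
  "inverse_gates gs = concat (map (replicate 7) (rev gs))"

definition copy_block :: "nat \<Rightarrow> nat \<Rightarrow> nat \<Rightarrow> gate list" where
  "copy_block i j n = gate_family n (CNOT i j)"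

definition swap_block :: "nat \<Rightarrow> nat \<Rightarrow> nat \<Rightarrow> gate list" where
  "swap_block i j n = copy_block i j n @ copy_block j i n @ copy_block i j n"

abbreviation pnat :: "('a \<Rightarrow> dat) \<Rightarrow> ('a \<Rightarrow> nat) \<Rightarrow> bool" where
  "pnat inp f \<equiv> ptime inp (\<lambda>a. unary (f a))"

abbreviation pgates :: "('a \<Rightarrow> dat) \<Rightarrow> ('a \<Rightarrow> gate list) \<Rightarrow> bool" where
  "pgates inp G \<equiv> ptime inp (\<lambda>a. enc_list (map enc_gate (G a)))"

abbreviation pcirc :: "('a \<Rightarrow> dat) \<Rightarrow> ('a \<Rightarrow> circuit) \<Rightarrow> bool" where
  "pcirc inp C \<equiv> ptime inp (\<lambda>a. enc_circuit (C a))"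

lemma pnat_add: "pnat inp f \<Longrightarrow> pnat inp g \<Longrightarrow> pnat inp (\<lambda>a. f a + g a)"
  using ptime_dappend[of inp "\<lambda>a. unary (f a)" "\<lambda>a. unary (g a)"] by (simp add: dappend_unary)

lemma pnat_Suc: "pnat inp f \<Longrightarrow> pnat inp (\<lambda>a. Suc (f a))"
  by (simp add: ptime_Cns ptime_Nl)

lemma pnat_const: "pnat inp (\<lambda>_. k)"
  by (induction k) (auto intro: ptime_Nl ptime_Cns)

lemma dfold_monus: "dfold (\<lambda>d. dtl (dhd (dtl d))) e (unary m) (unary n) = unary (m - n)"
proof (induction n arbitrary: m)
  case (Suc n)
  have "dtl (unary m) = unary (m - 1)" by (cases m) auto
  with Suc show ?case by simp
qed simp

lemma pnat_diff: "pnat inp f \<Longrightarrow> pnat inp g \<Longrightarrow> pnat inp (\<lambda>a. f a - g a)"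
proof -
  assume fg: "pnat inp f" "pnat inp g"
  have "ptime inp (\<lambda>a. dfold (\<lambda>d. dtl (dhd (dtl d))) Nl (unary (f a)) (unary (g a)))"
  proof (rule ptime_dfold[where q = "0"])
    show "pfun (\<lambda>d. dtl (dhd (dtl d)))" by (intro ptime_hd ptime_tl ptime_id)
  qed (use fg in \<open>auto intro: ptime_Nl\<close>)
  then show ?thesis by (simp add: dfold_monus)
qed

lemma unary_eq_Nl: "unary n = Nl \<longleftrightarrow> n = 0" by (cases n) auto

lemma ptime_if_eq:
  assumes "pnat inp m" "pnat inp n" "ptime inp f" "ptime inp g"
  shows "ptime inp (\<lambda>a. if m a = n a then f a else g a)"
proof -
  \<comment> \<open>Truncated differences in both directions vanish together exactly at
    equality.\<close>
  have "pnat inp (\<lambda>a. (m a - n a) + (n a - m a))" by (intro pnat_add pnat_diff assms)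
  from ptime_if[OF this assms(4,3)]
  have "ptime inp (\<lambda>a. if (m a - n a) + (n a - m a) \<noteq> 0 then g a else f a)"
    by (simp add: unary_eq_Nl)
  moreover have "(\<lambda>a. if (m a - n a) + (n a - m a) \<noteq> 0 then g a else f a)
      = (\<lambda>a. if m a = n a then f a else g a)" by (auto simp: fun_eq_iff)
  ultimately show ?thesis by simp
qed

text \<open>Each round prefixes the successor of the current head, starting from the list
  \<open>[0]\<close>, so the numbers come out in descending order.\<close>

lemma foldl_upt:
  "foldl (\<lambda>acc x. Cns (Cns Nl (dhd acc)) acc) (Cns Nl Nl) (replicate n Nl)
     = enc_list (rev (map unary [0..<Suc n]))"
proof (induction n)
  case (Suc n)
  have "foldl (\<lambda>acc x. Cns (Cns Nl (dhd acc)) acc) (Cns Nl Nl) (replicate (Suc n) Nl)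
    = foldl (\<lambda>acc x. Cns (Cns Nl (dhd acc)) acc) (Cns Nl Nl) (replicate n Nl @ [Nl])"
    by (simp only: replicate_append_same[symmetric] replicate_Suc)
  also have "\<dots> = enc_list (rev (map unary [0..<Suc (Suc n)]))"
    using Suc by simp
  finally show ?case .
qed simp

lemma ptime_upt: "pnat inp n \<Longrightarrow> ptime inp (\<lambda>a. enc_list (map unary [0..<n a]))"
proof -
  assume n: "pnat inp n"
  have "ptime inp (\<lambda>a. dfold (\<lambda>d. Cns (Cns Nl (dhd (dhd (dtl d)))) (dhd (dtl d))) Nl (Cns Nl Nl) (unary (n a)))"
  proof (rule ptime_dfold[where q = "[:2:]"])
    show "pfun (\<lambda>d. Cns (Cns Nl (dhd (dhd (dtl d)))) (dhd (dtl d)))"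
      by (intro ptime_hd ptime_tl ptime_id ptime_Nl ptime_Cns)
    fix x acc e
    show "dheight (Cns (Cns Nl (dhd (dhd (dtl (Cns x (Cns acc e)))))) (dhd (dtl (Cns x (Cns acc e)))))
         \<le> dheight acc + poly [:2:] (max (dheight x) (dheight e))"
      using height_dhd[of acc] by simp
  qed (auto intro: ptime_Nl ptime_Cns n)
  then have "ptime inp (\<lambda>a. enc_list (rev (map unary [0..<Suc (n a)])))"
    by (simp only: dfold_enc_list unary_eq_enc_list[of "n _"] dhd.simps dtl.simps foldl_upt)
  \<comment> \<open>The fold delivers one number too many, \<open>n a\<close> itself, at the head;
    it is dropped before the order is reversed.\<close>
  then have "ptime inp (\<lambda>a. drev_onto (dtl (enc_list (rev (map unary [0..<Suc (n a)])))) Nl)"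
    by (intro ptime_drev_onto ptime_Nl ptime_tl)
  then show ?thesis by (simp add: drev_onto_Nl)
qed

lemma pgates_append: "pgates inp F \<Longrightarrow> pgates inp G \<Longrightarrow> pgates inp (\<lambda>a. F a @ G a)"
  using ptime_dappend[of inp "\<lambda>a. enc_list (map enc_gate (F a))" "\<lambda>a. enc_list (map enc_gate (G a))"]
  by (simp add: dappend_enc_list)

lemma pgates_Nil: "pgates inp (\<lambda>_. [])" by (simp add: ptime_Nl)

lemma pgates_Cons: "ptime inp (\<lambda>a. enc_gate (g a)) \<Longrightarrow> pgates inp G \<Longrightarrow> pgates inp (\<lambda>a. g a # G a)"
  by (simp add: ptime_Cns)

lemma ptime_gates:
  "pnat inp i \<Longrightarrow> ptime inp (\<lambda>a. enc_gate (X (i a)))"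
  "pnat inp i \<Longrightarrow> pnat inp j \<Longrightarrow> ptime inp (\<lambda>a. enc_gate (CNOT (i a) (j a)))"
  "pnat inp i \<Longrightarrow> pnat inp j \<Longrightarrow> pnat inp k \<Longrightarrow> ptime inp (\<lambda>a. enc_gate (Toffoli (i a) (j a) (k a)))"
  unfolding enc_gate_def by (auto intro!: ptime_Cns ptime_Nl pnat_const simp del: unary.simps)

definition dshift_gate :: "dat \<Rightarrow> dat" where
  "dshift_gate d = Cns (dhd (dhd d)) (dmap (\<lambda>d. dappend (dtl d) (dhd d)) (dtl d) (dtl (dhd d)))"

lemma dshift_gate: "dshift_gate (Cns (enc_gate g) (unary k)) = enc_gate (shift_gate k g)"
proof -
  have "dmap (\<lambda>d. dappend (dtl d) (dhd d)) (unary k) (enc_list (map unary is))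
      = enc_list (map (\<lambda>i. unary (k + i)) is)" for "is"
    by (simp add: dmap_enc_list dappend_unary o_def)
  from this[of "gate_wires g"] show ?thesis
    by (cases g) (simp_all add: dshift_gate_def enc_gate_def)
qed

lemma pfun_dshift_gate: "pfun dshift_gate"
proof -
  have "pfun (\<lambda>d. dappend (dtl d) (dhd d))" by (intro ptime_dappend ptime_hd ptime_tl ptime_id)
  then show ?thesis unfolding dshift_gate_def
    by (intro ptime_Cns ptime_dmap) (auto intro!: ptime_hd ptime_tl ptime_id)
qed

lemma pgates_shift:
  assumes "pnat inp k" "pgates inp G"
  shows "pgates inp (\<lambda>a. shift (k a) (G a))"
  using ptime_dmap[OF pfun_dshift_gate assms]
  by (simp add: dmap_enc_list shift_def dshift_gate o_def)

lemma pgates_family: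
  assumes "pnat inp n" "ptime inp (\<lambda>a. enc_gate (g a))"
  shows "pgates inp (\<lambda>a. gate_family (n a) (g a))"
proof -
  have "pfun (\<lambda>d. dshift_gate (Cns (dtl d) (dhd d)))"
    by (intro ptime_app[OF pfun_dshift_gate] ptime_Cns ptime_hd ptime_tl ptime_id)
  from ptime_dmap[OF this assms(2) ptime_upt[OF assms(1)]]
  show ?thesis by (simp add: dmap_enc_list gate_family_def dshift_gate o_def)
qed

lemma pgates_inverse:
  assumes "pgates inp G"
  shows "pgates inp (\<lambda>a. inverse_gates (G a))"
proof -
  \<comment> \<open>Prefixing seven copies onto the accumulator also reverses the order of the
    gates, so a single fold yields \<open>inverse_gates\<close>.\<close>
  let ?f = "\<lambda>x acc. Cns x (Cns x (Cns x (Cns x (Cns x (Cns x (Cns x acc))))))"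
  have "ptime inp (\<lambda>a. dfold (\<lambda>d. ?f (dhd d) (dhd (dtl d))) Nl Nl (enc_list (map enc_gate (G a))))"
  proof (rule ptime_dfold[where q = "[:7, 1:]"])
    show "pfun (\<lambda>d. ?f (dhd d) (dhd (dtl d)))" by (intro ptime_hd ptime_tl ptime_id ptime_Cns)
  qed (auto intro: ptime_Nl assms)
  moreover have "foldl (\<lambda>acc x. ?f x acc) (enc_list ys) (map enc_gate gs)
      = enc_list (map enc_gate (inverse_gates gs) @ ys)" for ys gs
  proof (induction gs arbitrary: ys)
    case (Cons g gs)
    then show ?case using Cons.IH[of "replicate 7 (enc_gate g) @ ys"]
      by (simp add: inverse_gates_def numeral_eq_Suc)
  qed (simp add: inverse_gates_def)
  from this[of "[]"] have "dfold (\<lambda>d. ?f (dhd d) (dhd (dtl d))) Nl Nl (enc_list (map enc_gate gs))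
      = enc_list (map enc_gate (inverse_gates gs))" for gs by (simp add: dfold_enc_list)
  ultimately show ?thesis by simp
qed

lemma pgates_copy_block:
  "pnat inp i \<Longrightarrow> pnat inp j \<Longrightarrow> pnat inp n \<Longrightarrow> pgates inp (\<lambda>a. copy_block (i a) (j a) (n a))"
  unfolding copy_block_def by (intro pgates_family ptime_gates)

lemma pgates_swap_block:
  "pnat inp i \<Longrightarrow> pnat inp j \<Longrightarrow> pnat inp n \<Longrightarrow> pgates inp (\<lambda>a. swap_block (i a) (j a) (n a))"
  unfolding swap_block_def by (intro pgates_append pgates_copy_block)

lemma pcirc_Circuit: "pnat inp w \<Longrightarrow> pgates inp G \<Longrightarrow> pcirc inp (\<lambda>a. Circuit (w a) (G a))"
  by (simp add: enc_circuit_def ptime_Cns)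

lemma pnat_wires: "pcirc inp C \<Longrightarrow> pnat inp (\<lambda>a. wires (C a))"
  using ptime_hd[of inp "\<lambda>a. enc_circuit (C a)"] by (simp add: enc_circuit_def)

lemma pgates_gates: "pcirc inp C \<Longrightarrow> pgates inp (\<lambda>a. gates (C a))"
  using ptime_tl[of inp "\<lambda>a. enc_circuit (C a)"] by (simp add: enc_circuit_def)

section \<open>From heights back to sizes\<close>

lemma dheight_unary [simp]: "dheight (unary n) = n" by (induction n) auto
lemma size_unary: "size (unary n) = n" by (induction n) auto
lemma dheight_le_size: "dheight d \<le> size d" by (induction d) auto

text \<open>Height is at most size, so a time bound in the height is the stronger one. On unary
  inputs the two measures agree, and there the notions coincide; this makes the given algorithms
  available to the closure properties above.\<close>

lemma ptime_imp_poly_time: "ptime inp out \<Longrightarrow> poly_time inp out"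
  unfolding ptime_def poly_time_def runs_def
  by (meson dheight_le_size le_trans poly_nat_mono)

lemma poly_time_unary_iff: "poly_time unary out \<longleftrightarrow> ptime unary out"
  unfolding ptime_def poly_time_def runs_def by (simp add: size_unary)

lemma poly_length_iff: "poly_length f \<longleftrightarrow> pnat unary f"
  unfolding poly_length_def poly_time_unary_iff ..

lemma uniform_family_iff: "uniform_family C \<longleftrightarrow> pcirc unary C"
  unfolding uniform_family_def poly_time_unary_iff ..

section \<open>Polynomially bounded sizes of circuit families\<close>

definition poly_bounded :: "(nat \<Rightarrow> nat) \<Rightarrow> bool" where
  "poly_bounded f \<longleftrightarrow> (\<exists>p :: nat poly. \<forall>l. f l \<le> poly p l)"

lemma poly_bounded_const: "poly_bounded (\<lambda>_. k)"
  unfolding poly_bounded_def by (rule exI[of _ "[:k:]"]) simp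

lemma poly_bounded_add: "poly_bounded f \<Longrightarrow> poly_bounded g \<Longrightarrow> poly_bounded (\<lambda>l. f l + g l)"
  unfolding poly_bounded_def by (metis add_mono poly_add)

lemma poly_bounded_mult: "poly_bounded f \<Longrightarrow> poly_bounded g \<Longrightarrow> poly_bounded (\<lambda>l. f l * g l)"
  unfolding poly_bounded_def by (metis mult_le_mono poly_mult)

lemma poly_bounded_mono: "poly_bounded f \<Longrightarrow> (\<And>l. g l \<le> f l) \<Longrightarrow> poly_bounded g"
  unfolding poly_bounded_def by (meson le_trans)

lemma poly_size_family_iff:
  "poly_size_family C \<longleftrightarrow> poly_bounded (\<lambda>l. wires (C l)) \<and> poly_bounded (\<lambda>l. length (gates (C l)))"
  (is "?l \<longleftrightarrow> ?r")
proof
  assume ?r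
  then obtain p q :: "nat poly" where "\<And>l. wires (C l) \<le> poly p l" "\<And>l. length (gates (C l)) \<le> poly q l"
    unfolding poly_bounded_def by blast
  then have "\<forall>l. wires (C l) \<le> poly (p + q) l \<and> length (gates (C l)) \<le> poly (p + q) l"
    by (auto intro: trans_le_add1 trans_le_add2)
  then show ?l unfolding poly_size_family_def by blast
qed (auto simp: poly_size_family_def poly_bounded_def)

lemma length_shift [simp]: "length (shift k gs) = length gs" by (simp add: shift_def)
lemma length_gate_family [simp]: "length (gate_family n g) = n" by (simp add: gate_family_def)
lemma length_inverse_gates [simp]: "length (inverse_gates gs) = 7 * length gs"
  by (induction gs) (auto simp: inverse_gates_def)
lemma length_copy_block [simp]: "length (copy_block i j n) = n" by (simp add: copy_block_def)
lemma length_swap_block [simp]: "length (swap_block i j n) = 3 * n" by (simp add: swap_block_def)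

section \<open>Circuit semantics\<close>

subsection \<open>Bit strings\<close>

lemma bitstrings_Suc: "bitstrings (Suc n) = (\<lambda>(b, s). b # s) ` (UNIV \<times> bitstrings n)"
  by (auto simp: bitstrings_def image_iff length_Suc_conv)

lemma bitstrings_0: "bitstrings 0 = {[]}" by (auto simp: bitstrings_def)

lemma in_bitstrings [simp]: "s \<in> bitstrings n \<longleftrightarrow> length s = n" by (simp add: bitstrings_def)

lemma finite_bitstrings [simp]: "finite (bitstrings n)"
  by (induction n) (auto simp: bitstrings_Suc bitstrings_0)

lemma card_bitstrings: "card (bitstrings n) = 2 ^ n"
proof (induction n)
  case (Suc n)
  have "inj_on (\<lambda>(b, s). b # s) (UNIV \<times> bitstrings n)" by (auto simp: inj_on_def)
  then show ?case unfolding bitstrings_Suc by (simp add: card_image card_cartesian_product Suc)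
qed (simp add: bitstrings_0)

lemma bitstrings_nonempty [simp]: "bitstrings n \<noteq> {}"
  using card_bitstrings[of n] by force

lemma sum_bitstrings_append:
  "(\<Sum>s\<in>bitstrings (m + n). f s) = (\<Sum>a\<in>bitstrings m. \<Sum>b\<in>bitstrings n. f (a @ b))"
proof -
  have "(\<Sum>a\<in>bitstrings m. \<Sum>b\<in>bitstrings n. f (a @ b)) = (\<Sum>(a, b)\<in>bitstrings m \<times> bitstrings n. f (a @ b))"
    by (simp add: sum.cartesian_product)
  also have "\<dots> = (\<Sum>s\<in>bitstrings (m + n). f s)"
    by (rule sum.reindex_bij_witness[where i = "\<lambda>s. (take m s, drop m s)" and j = "\<lambda>(a, b). a @ b"]) auto
  finally show ?thesis by simp
qed

lemma sum_bitstrings_1: "(\<Sum>s\<in>bitstrings (Suc 0). f s) = f [False] + f [True]"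
proof -
  have "bitstrings (Suc 0) = {[False], [True]}" by (auto simp: bitstrings_Suc bitstrings_0 UNIV_bool)
  then show ?thesis by simp
qed

lemma sum_bitstrings_single:
  assumes "s \<in> bitstrings n" "\<And>t. t \<in> bitstrings n \<Longrightarrow> t \<noteq> s \<Longrightarrow> f t = 0"
  shows "(\<Sum>t\<in>bitstrings n. f t) = f s"
  using assms by (subst sum.remove[of _ s]) (auto intro: sum.neutral)

abbreviation zeros :: "nat \<Rightarrow> bits" where "zeros n \<equiv> replicate n False"

definition bxor :: "bits \<Rightarrow> bits \<Rightarrow> bits" where "bxor x y = map2 (\<noteq>) x y"
text \<open>\<open>parity (band x y)\<close> is the inner product of \<open>x\<close> and
  \<open>y\<close> over the field with two elements.\<close>

definition band :: "bits \<Rightarrow> bits \<Rightarrow> bits" where "band x y = map2 (\<and>) x y"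
definition parity :: "bits \<Rightarrow> bool" where "parity x = foldr (\<noteq>) x False"

lemma length_bxor [simp]: "length (bxor x y) = min (length x) (length y)" by (simp add: bxor_def)
lemma length_band [simp]: "length (band x y) = min (length x) (length y)" by (simp add: band_def)

lemma bxor_zeros [simp]: "length x = n \<Longrightarrow> bxor x (zeros n) = x" "length x = n \<Longrightarrow> bxor (zeros n) x = x"
  by (auto simp: bxor_def intro!: nth_equalityI)

lemma bxor_self [simp]: "bxor x x = zeros (length x)"
  by (auto simp: bxor_def intro!: nth_equalityI)

lemma bxor_cancel:
  "length x = length y \<Longrightarrow> bxor (bxor x y) x = y" "length x = length y \<Longrightarrow> bxor y (bxor x y) = x"
  by (auto simp: bxor_def intro!: nth_equalityI)

lemma parity_simps [simp]: "parity [] = False" "parity (b # x) = (b \<noteq> parity x)"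
  by (auto simp: parity_def)

lemma parity_append [simp]: "parity (x @ y) = (parity x \<noteq> parity y)"
  by (induction x) auto

lemma bxor_append [simp]:
  "length x = length x' \<Longrightarrow> bxor (x @ y) (x' @ y') = bxor x x' @ bxor y y'" by (simp add: bxor_def)
lemma band_append [simp]:
  "length x = length x' \<Longrightarrow> band (x @ y) (x' @ y') = band x x' @ band y y'" by (simp add: band_def)
lemma bxor_Cons [simp]: "bxor (a # x) (b # y) = (a \<noteq> b) # bxor x y" by (simp add: bxor_def)
lemma band_Cons [simp]: "band (a # x) (b # y) = (a \<and> b) # band x y" by (simp add: band_def)
lemma band_Nil [simp]: "band [] x = []" by (simp add: band_def)
lemma band_commute: "band x y = band y x"
  by (auto simp: band_def intro!: nth_equalityI)

subsection \<open>Gate lists\<close>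

definition wf_gates :: "nat \<Rightarrow> gate list \<Rightarrow> bool" where
  "wf_gates W gs \<longleftrightarrow> (\<forall>g\<in>set gs. distinct (gate_wires g) \<and> (\<forall>k\<in>set (gate_wires g). k < W))"

lemma wf_circuit_iff:
  "wf_circuit i j C \<longleftrightarrow> i \<le> wires C \<and> j \<le> wires C \<and> wf_gates (wires C) (gates C)"
  unfolding wf_circuit_def wf_gates_def ..

lemma wf_gates_Nil [simp]: "wf_gates W []" by (simp add: wf_gates_def)
lemma wf_gates_Cons [simp]:
  "wf_gates W (g # gs) \<longleftrightarrow> distinct (gate_wires g) \<and> (\<forall>k\<in>set (gate_wires g). k < W) \<and> wf_gates W gs"
  by (auto simp: wf_gates_def)
lemma wf_gates_append [simp]: "wf_gates W (fs @ gs) \<longleftrightarrow> wf_gates W fs \<and> wf_gates W gs"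
  by (auto simp: wf_gates_def)

lemma wf_gates_mono: "wf_gates V gs \<Longrightarrow> V \<le> W \<Longrightarrow> wf_gates W gs"
  unfolding wf_gates_def by (meson order_less_le_trans)

lemma gate_wires_shift: "gate_wires (shift_gate k g) = map ((+) k) (gate_wires g)"
  by (cases g) auto

lemma wf_gates_shift:
  assumes "wf_gates V gs" "k + V \<le> W" shows "wf_gates W (shift k gs)"
  using assms(1) unfolding wf_gates_def shift_def
  by (auto simp: gate_wires_shift distinct_map) (use assms(2) in force)

lemma wf_gate_family:
  assumes "0 < n \<Longrightarrow> distinct (gate_wires g)" "\<And>k. 0 < n \<Longrightarrow> k \<in> set (gate_wires g) \<Longrightarrow> k + n \<le> W"
  shows "wf_gates W (gate_family n g)"
  using assms unfolding wf_gates_def gate_family_def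
  by (cases "n = 0") (auto simp: gate_wires_shift distinct_map, force)

lemma wf_inverse_gates: "wf_gates W (inverse_gates gs) \<longleftrightarrow> wf_gates W gs"
  by (auto simp: wf_gates_def inverse_gates_def)

lemma wf_copy_block:
  "(0 < n \<Longrightarrow> i \<noteq> j) \<Longrightarrow> i + n \<le> W \<Longrightarrow> j + n \<le> W \<Longrightarrow> wf_gates W (copy_block i j n)"
  unfolding copy_block_def by (rule wf_gate_family) auto

lemma wf_swap_block:
  "(0 < n \<Longrightarrow> i \<noteq> j) \<Longrightarrow> i + n \<le> W \<Longrightarrow> j + n \<le> W \<Longrightarrow> wf_gates W (swap_block i j n)"
  unfolding swap_block_def wf_gates_append by (intro conjI wf_copy_block) auto

abbreviation classical_gates :: "gate list \<Rightarrow> bool" where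
  "classical_gates gs \<equiv> \<forall>g\<in>set gs. classical_gate g"

lemma classical_shift: "classical_gates (shift k gs) \<longleftrightarrow> classical_gates gs"
proof -
  have "classical_gate (shift_gate k g) = classical_gate g" for g by (cases g) auto
  then show ?thesis by (auto simp: shift_def)
qed

lemma classical_family: "classical_gate g \<Longrightarrow> classical_gates (gate_family n g)"
  by (cases g) (auto simp: gate_family_def)

lemma classical_copy_block [simp]: "classical_gates (copy_block i j n)"
  unfolding copy_block_def by (rule classical_family) simp

lemma classical_swap_block [simp]: "classical_gates (swap_block i j n)"
  unfolding swap_block_def by (metis Un_iff classical_copy_block set_append)

lemma gate_family_Suc: "gate_family (Suc n) g = gate_family n g @ [shift_gate n g]"
  by (simp add: gate_family_def)

lemma gate_family_0 [simp]: "gate_family 0 g = []" by (simp add: gate_family_def)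

subsection \<open>Classical action\<close>

definition act :: "gate list \<Rightarrow> bits \<Rightarrow> bits" where "act gs s = fold classical_action gs s"

lemma act_Nil [simp]: "act [] s = s" by (simp add: act_def)
lemma act_Cons [simp]: "act (g # gs) s = act gs (classical_action g s)" by (simp add: act_def)
lemma act_append [simp]: "act (fs @ gs) s = act gs (act fs s)" by (simp add: act_def)

lemma length_classical_action [simp]: "length (classical_action g s) = length s"
  by (cases g) (auto simp: flip_def)

lemma length_act [simp]: "length (act gs s) = length s"
  by (induction gs arbitrary: s) auto

lemma flip_flip [simp]: "flip i (flip i s) = s"
  by (cases "i < length s") (simp_all add: flip_def not_less list_update_beyond)

lemma nth_flip [simp]: "i \<noteq> j \<Longrightarrow> flip i s ! j = s ! j" by (simp add: flip_def)

lemma classical_action_invol: "distinct (gate_wires g) \<Longrightarrow> classical_action g (classical_action g s) = s"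
  by (cases g) auto

text \<open>Classical gates are involutions, so the reversed list undoes the list.\<close>

lemma act_rev: "wf_gates W gs \<Longrightarrow> act (rev gs) (act gs s) = s"
  by (induction gs arbitrary: s) (auto simp: classical_action_invol)

lemma act_rev': "wf_gates W gs \<Longrightarrow> act gs (act (rev gs) s) = s"
  by (induction gs arbitrary: s) (auto simp: classical_action_invol)

lemma flip_append:
  "i < length b \<Longrightarrow> flip (length a + i) (a @ b @ c) = a @ flip i b @ c"
  by (simp add: flip_def nth_append list_update_append)

lemma classical_action_shift_gate:
  assumes "\<forall>k\<in>set (gate_wires g). k < length b"
  shows "classical_action (shift_gate (length a) g) (a @ b @ c) = a @ classical_action g b @ c"
  using assms by (cases g) (auto simp: flip_append nth_append)

lemma act_shift:
  "wf_gates (length b) gs \<Longrightarrow> k = length a \<Longrightarrow> act (shift k gs) (a @ b @ c) = a @ act gs b @ c"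
  by (induction gs arbitrary: b) (auto simp: shift_def classical_action_shift_gate)

lemma act_prefix: "wf_gates (length b) gs \<Longrightarrow> act gs (b @ c) = act gs b @ c"
proof -
  have "shift_gate 0 g = g" for g by (cases g) auto
  then have "shift 0 gs = gs" by (simp add: shift_def map_idI)
  then show "wf_gates (length b) gs \<Longrightarrow> act gs (b @ c) = act gs b @ c"
    using act_shift[of b gs 0 "[]" c] by simp
qed

lemma snoc_lengthE: assumes "length x = Suc n" obtains y b where "x = y @ [b]" "length y = n"
  using assms by (metis length_Suc_conv_rev)

lemma nth_at: "s = p @ b # r \<Longrightarrow> i = length p \<Longrightarrow> s ! i = b" by simp
lemma flip_at: "s = p @ b # r \<Longrightarrow> i = length p \<Longrightarrow> t = p @ (\<not> b) # r \<Longrightarrow> flip i s = t"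
  by (simp add: flip_def list_update_append)

text \<open>The string is cut so that block positions appear as lengths of prefixes. A family acts
  on the last bits last, so the induction splits off the final bit of each block and lends it to the
  neighbouring segments \<open>q\<close> and \<open>r\<close>. The later families are treated in the
  same way.\<close>

lemma act_copy_block:
  assumes "length p = i" "length (p @ x @ q) = j" "length x = n" "length y = n"
  shows "act (copy_block i j n) (p @ x @ q @ y @ r) = p @ x @ q @ bxor x y @ r"
  using assms
proof (induction n arbitrary: x y q r)
  case (Suc n)
  obtain x' a where x: "x = x' @ [a]" "length x' = n" using Suc.prems(3) by (rule snoc_lengthE)
  obtain y' b where y: "y = y' @ [b]" "length y' = n" using Suc.prems(4) by (rule snoc_lengthE)
  have "act (copy_block i j n) (p @ x' @ (a # q) @ y' @ (b # r)) = p @ x' @ (a # q) @ bxor x' y' @ (b # r)"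
    by (rule Suc.IH) (use Suc.prems x y in auto)
  moreover have "(p @ x' @ (a # q) @ bxor x' y' @ (b # r)) ! (n + i) = a"
    by (rule nth_at[where p = "p @ x'"]) (use x Suc.prems in auto)
  moreover have "flip (n + j) (p @ x' @ (a # q) @ bxor x' y' @ (b # r))
      = p @ x' @ (a # q) @ bxor x' y' @ ((\<not> b) # r)"
    by (rule flip_at[where p = "p @ x' @ (a # q) @ bxor x' y'"]) (use x y Suc.prems in auto)
  ultimately show ?case using x y by (auto simp: copy_block_def gate_family_Suc)
qed (simp add: copy_block_def)

lemma act_copy_block_back:
  assumes "length p = i" "length (p @ x @ q) = j" "length x = n" "length y = n"
  shows "act (copy_block j i n) (p @ x @ q @ y @ r) = p @ bxor y x @ q @ y @ r"
  using assms
proof (induction n arbitrary: x y q r)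
  case (Suc n)
  obtain x' a where x: "x = x' @ [a]" "length x' = n" using Suc.prems(3) by (rule snoc_lengthE)
  obtain y' b where y: "y = y' @ [b]" "length y' = n" using Suc.prems(4) by (rule snoc_lengthE)
  have "act (copy_block j i n) (p @ x' @ (a # q) @ y' @ (b # r)) = p @ bxor y' x' @ (a # q) @ y' @ (b # r)"
    by (rule Suc.IH) (use Suc.prems x y in auto)
  moreover have "(p @ bxor y' x' @ (a # q) @ y' @ (b # r)) ! (n + j) = b"
    by (rule nth_at[where p = "p @ bxor y' x' @ (a # q) @ y'"]) (use x y Suc.prems in auto)
  moreover have "flip (n + i) (p @ bxor y' x' @ (a # q) @ y' @ (b # r))
      = p @ bxor y' x' @ ((\<not> a) # q) @ y' @ (b # r)"
    by (rule flip_at[where p = "p @ bxor y' x'"]) (use x y Suc.prems in auto)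
  ultimately show ?case using x y by (auto simp: copy_block_def gate_family_Suc)
qed (simp add: copy_block_def)

lemma act_swap_block:
  assumes "length p = i" "length (p @ x @ q) = j" "length x = n" "length y = n"
  shows "act (swap_block i j n) (p @ x @ q @ y @ r) = p @ y @ q @ x @ r"
  using assms unfolding swap_block_def
  by (simp add: act_copy_block act_copy_block_back bxor_cancel)

lemma act_X_family:
  assumes "length p = i" "length x = n"
  shows "act (gate_family n (X i)) (p @ x @ r) = p @ map Not x @ r"
  using assms
proof (induction n arbitrary: x r)
  case (Suc n)
  obtain x' a where x: "x = x' @ [a]" "length x' = n" using Suc.prems(2) by (rule snoc_lengthE)
  have "act (gate_family n (X i)) (p @ x' @ (a # r)) = p @ map Not x' @ (a # r)"
    by (rule Suc.IH) (use Suc.prems x in auto)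
  moreover have "flip (n + i) (p @ map Not x' @ (a # r)) = p @ map Not x' @ ((\<not> a) # r)"
    by (rule flip_at[where p = "p @ map Not x'"]) (use x Suc.prems in auto)
  ultimately show ?case using x by (simp add: gate_family_Suc)
qed simp

lemma act_Toffoli_family:
  assumes "length p = i" "length (p @ x @ q) = j" "length (p @ x @ q @ y @ r) = k"
    "length x = n" "length y = n" "length z = n"
  shows "act (gate_family n (Toffoli i j k)) (p @ x @ q @ y @ r @ z @ w)
       = p @ x @ q @ y @ r @ bxor (band x y) z @ w"
  using assms
proof (induction n arbitrary: x y z q r w)
  case (Suc n)
  obtain x' a where x: "x = x' @ [a]" "length x' = n" using Suc.prems(4) by (rule snoc_lengthE)
  obtain y' b where y: "y = y' @ [b]" "length y' = n" using Suc.prems(5) by (rule snoc_lengthE)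
  obtain z' c where z: "z = z' @ [c]" "length z' = n" using Suc.prems(6) by (rule snoc_lengthE)
  have "act (gate_family n (Toffoli i j k)) (p @ x' @ (a # q) @ y' @ (b # r) @ z' @ (c # w))
      = p @ x' @ (a # q) @ y' @ (b # r) @ bxor (band x' y') z' @ (c # w)" (is "_ = ?s")
    by (rule Suc.IH) (use Suc.prems x y z in auto)
  moreover have "?s ! (n + i) = a" by (rule nth_at[where p = "p @ x'"]) (use x Suc.prems in auto)
  moreover have "?s ! (n + j) = b"
    by (rule nth_at[where p = "p @ x' @ (a # q) @ y'"]) (use x y Suc.prems in auto)
  moreover have "flip (n + k) ?s = p @ x' @ (a # q) @ y' @ (b # r) @ bxor (band x' y') z' @ ((\<not> c) # w)"
    by (rule flip_at[where p = "p @ x' @ (a # q) @ y' @ (b # r) @ bxor (band x' y') z'"]) (use x y z Suc.prems in auto)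
  ultimately show ?case using x y z by (auto simp: gate_family_Suc)
qed simp

text \<open>The empty prefix is included, so the result is one longer than \<open>x\<close> and
  begins with \<open>True\<close>.\<close>

definition and_prefixes :: "bits \<Rightarrow> bits" where
  "and_prefixes x = map (\<lambda>i. \<forall>b\<in>set (take i x). b) [0..<Suc (length x)]"

lemma length_and_prefixes [simp]: "length (and_prefixes x) = Suc (length x)"
  by (simp add: and_prefixes_def)

lemma and_prefixes_snoc: "and_prefixes (x @ [b]) = and_prefixes x @ [(\<forall>b\<in>set x. b) \<and> b]"
  by (auto simp: and_prefixes_def)

lemma and_prefixes_eq: "and_prefixes x = butlast (and_prefixes x) @ [\<forall>b\<in>set x. b]"
  by (simp add: and_prefixes_def)

text \<open>Consecutive gates share a wire: each combines the conjunction reached so far with the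
  next bit of \<open>x\<close>. The leading \<open>True\<close> is the empty conjunction, and the
  last wire tells whether all bits are set.\<close>

lemma act_and_chain:
  assumes "length p = i" "length (p @ x @ q) = j" "length x = n"
  shows "act (gate_family n (Toffoli i j (Suc j))) (p @ x @ q @ (True # zeros n) @ r)
       = p @ x @ q @ and_prefixes x @ r"
  using assms
proof (induction n arbitrary: x q r)
  case 0
  then show ?case by (simp add: and_prefixes_def)
next
  case (Suc n)
  obtain x' a where x: "x = x' @ [a]" "length x' = n" using Suc.prems(3) by (rule snoc_lengthE)
  let ?c = "butlast (and_prefixes x')" and ?d = "\<forall>b\<in>set x'. b"
  have "act (gate_family n (Toffoli i j (Suc j))) (p @ x' @ (a # q) @ (True # zeros n) @ (False # r))
      = p @ x' @ (a # q) @ and_prefixes x' @ (False # r)"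
    by (rule Suc.IH) (use Suc.prems x in auto)
  also have "\<dots> = p @ x' @ (a # q) @ ?c @ ?d # False # r" (is "_ = ?s")
    by (subst and_prefixes_eq) simp
  finally have *: "act (gate_family n (Toffoli i j (Suc j))) (p @ x' @ (a # q) @ (True # zeros n) @ (False # r)) = ?s" .
  have "?s ! (n + i) = a" by (rule nth_at[where p = "p @ x'"]) (use x Suc.prems in auto)
  moreover have "?s ! (n + j) = ?d"
    by (rule nth_at[where p = "p @ x' @ (a # q) @ ?c"]) (use x Suc.prems in auto)
  moreover have "flip (n + Suc j) ?s = p @ x' @ (a # q) @ ?c @ ?d # True # r"
    by (rule flip_at[where p = "p @ x' @ (a # q) @ ?c @ [?d]"]) (use x Suc.prems in auto)
  ultimately have "classical_action (Toffoli (n + i) (n + j) (n + Suc j)) ?s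
     = p @ x' @ (a # q) @ ?c @ ?d # (?d \<and> a) # r" by auto
  also have "\<dots> = p @ x @ q @ and_prefixes x @ r"
    using and_prefixes_eq[of x'] x by (simp add: and_prefixes_snoc)
  finally show ?case using * x by (simp add: gate_family_Suc replicate_append_same[symmetric] del: replicate_append_same)
qed

definition parity_prefixes :: "bits \<Rightarrow> bits" where
  "parity_prefixes x = map (\<lambda>i. parity (take (Suc i) x)) [0..<length x]"

lemma length_parity_prefixes [simp]: "length (parity_prefixes x) = length x"
  by (simp add: parity_prefixes_def)

lemma parity_prefixes_snoc: "parity_prefixes (x @ [b]) = parity_prefixes x @ [parity x \<noteq> b]"
  by (auto simp: parity_prefixes_def)

text \<open>Each gate adds the sum just formed to the next bit, so prefix sums replace the bits in
  place and the last wire receives the total parity.\<close>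

lemma act_cascade:
  assumes "length p = i" "length x = Suc n"
  shows "act (gate_family n (CNOT i (Suc i))) (p @ x @ r) = p @ parity_prefixes x @ r"
  using assms
proof (induction n arbitrary: x r)
  case 0
  then show ?case by (auto simp: length_Suc_conv parity_prefixes_def)
next
  case (Suc n)
  obtain x1 b where x1: "x = x1 @ [b]" "length x1 = Suc n" using Suc.prems(2) by (rule snoc_lengthE)
  obtain x' a where x: "x1 = x' @ [a]" "length x' = n" using x1(2) by (rule snoc_lengthE)
  let ?d = "parity x1"
  have "act (gate_family n (CNOT i (Suc i))) (p @ x1 @ (b # r)) = p @ parity_prefixes x1 @ (b # r)"
    by (rule Suc.IH) (use Suc.prems x1 in auto)
  also have "\<dots> = p @ parity_prefixes x' @ ?d # b # r" (is "_ = ?s")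
    using x by (simp add: parity_prefixes_snoc)
  finally have *: "act (gate_family n (CNOT i (Suc i))) (p @ x1 @ (b # r)) = ?s" .
  have "?s ! (n + i) = ?d" by (rule nth_at[where p = "p @ parity_prefixes x'"]) (use x Suc.prems in auto)
  moreover have "flip (n + Suc i) ?s = p @ parity_prefixes x' @ ?d # (\<not> b) # r"
    by (rule flip_at[where p = "p @ parity_prefixes x' @ [?d]"]) (use x Suc.prems in auto)
  ultimately have "classical_action (CNOT (n + i) (n + Suc i)) ?s = p @ parity_prefixes x' @ ?d # (?d \<noteq> b) # r"
    by auto
  also have "\<dots> = p @ parity_prefixes x @ r"
    unfolding x1(1) parity_prefixes_snoc by (simp add: x(1) parity_prefixes_snoc)
  finally show ?case using * x1 by (simp add: gate_family_Suc)
qed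

section \<open>An upper bound on the trace norm\<close>

lemma adjoint_carrier: "A \<in> carrier_mat m n \<Longrightarrow> mat_adjoint A \<in> carrier_mat n m"
  by (auto simp: mat_adjoint_def mat_of_rows_def)

lemma dim_adjoint [simp]: "dim_row (mat_adjoint A) = dim_col A" "dim_col (mat_adjoint A) = dim_row A"
  by (auto simp: mat_adjoint_def mat_of_rows_def)

lemma adjoint_index:
  fixes A :: "complex mat"
  assumes "i < dim_col A" "j < dim_row A"
  shows "mat_adjoint A $$ (i, j) = cnj (A $$ (j, i))"
  using assms by (simp add: mat_adjoint_def mat_of_rows_def)

lemma mult_index_sum:
  assumes "A \<in> carrier_mat m n" "B \<in> carrier_mat n k" "i < m" "j < k"
  shows "(A * B) $$ (i, j) = (\<Sum>l<n. A $$ (i, l) * B $$ (l, j))"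
  using assms by (auto simp: scalar_prod_def atLeast0LessThan intro!: sum.cong)

lemma adjoint_mult_index:
  fixes A :: "complex mat"
  assumes "A \<in> carrier_mat m n" "B \<in> carrier_mat m k" "i < n" "j < k"
  shows "(mat_adjoint A * B) $$ (i, j) = (\<Sum>l<m. cnj (A $$ (l, i)) * B $$ (l, j))"
  using assms by (subst mult_index_sum[of _ n m]) (auto simp: adjoint_index intro!: sum.cong)

lemma adjoint_mult:
  fixes A :: "complex mat"
  assumes "A \<in> carrier_mat m n" "B \<in> carrier_mat n k"
  shows "mat_adjoint (A * B) = mat_adjoint B * mat_adjoint A"
proof (rule eq_matI)
  fix i j assume "i < dim_row (mat_adjoint B * mat_adjoint A)" "j < dim_col (mat_adjoint B * mat_adjoint A)"
  then have ij: "i < k" "j < m" using assms adjoint_carrier[OF assms(1)] adjoint_carrier[OF assms(2)] by auto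
  then have "mat_adjoint (A * B) $$ (i, j) = cnj (\<Sum>l<n. A $$ (j, l) * B $$ (l, i))"
    using assms mult_index_sum[OF assms, of j i] by (simp add: adjoint_index)
  also have "\<dots> = (\<Sum>l<n. cnj (B $$ (l, i)) * mat_adjoint A $$ (l, j))"
    using ij assms by (auto simp: adjoint_index intro!: sum.cong)
  also have "\<dots> = (mat_adjoint B * mat_adjoint A) $$ (i, j)"
    using ij assms by (subst adjoint_mult_index[of _ n k _ m]) auto
  finally show "mat_adjoint (A * B) $$ (i, j) = (mat_adjoint B * mat_adjoint A) $$ (i, j)" .
qed (use assms in auto)

lemma adjoint_adjoint:
  fixes A :: "complex mat"
  shows "mat_adjoint (mat_adjoint A) = A"
  by (rule eq_matI) (auto simp: adjoint_index)

section \<open>Spectral decomposition of Hermitian matrices\<close>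

definition diagonal_of :: "complex list \<Rightarrow> complex mat" where
  "diagonal_of es = mat (length es) (length es) (\<lambda>(i, j). if i = j then es ! i else 0)"

text \<open>Complete an eigenvector to a basis, orthogonalise and normalise the columns.
  Gram-Schmidt leaves the first vector as it is, so column 0 remains an eigenvector.\<close>

lemma unitary_eigenvector_first:
  fixes M :: "complex mat"
  assumes M: "M \<in> carrier_mat n n" and e: "eigenvalue M e"
  shows "\<exists>U. U \<in> carrier_mat n n \<and> mat_adjoint U * U = 1\<^sub>m n \<and>
     (\<forall>i<n. (M * U) $$ (i, 0) = e * U $$ (i, 0))"
proof -
  define v where "v = find_eigenvector M e"
  have ev: "eigenvector M v e" unfolding v_def by (rule find_eigenvector[OF M e])
  then have v: "v \<in> carrier_vec n" and v0: "v \<noteq> 0\<^sub>v n" and Mv: "M *\<^sub>v v = e \<cdot>\<^sub>v v"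
    using M unfolding eigenvector_def by auto
  have n0: "n \<noteq> 0" using v v0 by (metis carrier_vecD eq_vecI index_zero_vec(2) less_nat_zero_code)
  interpret cof_vec_space n "TYPE(complex)" .
  define b where "b = basis_completion v"
  from basis_completion[OF v v0, folded b_def]
  have dist_b: "distinct b" and indep: "\<not> lin_dep (set b)" and b: "set b \<subseteq> carrier_vec n"
    and hdb: "hd b = v" and len_b: "length b = n" by auto
  from hdb len_b n0 obtain vs where bv: "b = v # vs" by (cases b) auto
  define ws where "ws = gram_schmidt n b"
  from gram_schmidt_result[OF b dist_b indep refl, folded ws_def]
  have ws: "set ws \<subseteq> carrier_vec n" "corthogonal ws" "length ws = n" by (auto simp: len_b)
  from gram_schmidt_hd[OF v, of vs, folded bv] have hdws: "hd ws = v" unfolding ws_def .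
  have ws0: "ws ! 0 = v" using hdws ws(3) n0 by (metis hd_conv_nth list.size(3))
  have wsc: "ws ! i \<in> carrier_vec n" if "i < n" for i using ws that by auto
  have ip: "ws ! i \<bullet>c ws ! j = (\<Sum>k<n. ws ! i $ k * cnj (ws ! j $ k))" if "i < n" "j < n" for i j
    using wsc[OF that(1)] wsc[OF that(2)] by (simp add: scalar_prod_def atLeast0LessThan)
  define nr where "nr i = sqrt (\<Sum>k<n. (cmod (ws ! i $ k))\<^sup>2)" for i
  have nr: "ws ! i \<bullet>c ws ! i = complex_of_real ((nr i)\<^sup>2)" if "i < n" for i
    unfolding ip[OF that that] nr_def
    by (simp add: sum_nonneg complex_norm_square[symmetric] del: of_real_power)
  have nr0: "nr i \<noteq> 0" if "i < n" for i
    using corthogonalD[OF ws(2), of i i] nr[OF that] that ws(3) by auto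
  define U where "U = mat n n (\<lambda>(i, j). ws ! j $ i / complex_of_real (nr j))"
  have U: "U \<in> carrier_mat n n" by (simp add: U_def)
  have "mat_adjoint U * U = 1\<^sub>m n"
  proof (rule eq_matI)
    fix i j assume "i < dim_row (1\<^sub>m n :: complex mat)" "j < dim_col (1\<^sub>m n :: complex mat)"
    then have ij: "i < n" "j < n" by auto
    have "(mat_adjoint U * U) $$ (i, j) = (\<Sum>l<n. cnj (U $$ (l, i)) * U $$ (l, j))"
      by (rule adjoint_mult_index[OF U U ij])
    also have "\<dots> = (\<Sum>l<n. ws ! j $ l * cnj (ws ! i $ l) / (complex_of_real (nr i) * complex_of_real (nr j)))"
      using ij by (intro sum.cong) (auto simp: U_def)
    also have "\<dots> = (ws ! j \<bullet>c ws ! i) / (complex_of_real (nr i) * complex_of_real (nr j))"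
      using ij by (simp add: ip sum_divide_distrib)
    also have "\<dots> = 1\<^sub>m n $$ (i, j)"
    proof (cases "i = j")
      case True
      then show ?thesis using nr[OF ij(1)] nr0[OF ij(1)] ij by (simp add: power2_eq_square)
    next
      case False
      then have "ws ! j \<bullet>c ws ! i = 0" using corthogonalD[OF ws(2), of j i] ij ws(3) by auto
      then show ?thesis using False ij by simp
    qed
    finally show "(mat_adjoint U * U) $$ (i, j) = 1\<^sub>m n $$ (i, j)" .
  qed (use U adjoint_carrier[OF U] in auto)
  moreover have "(M * U) $$ (i, 0) = e * U $$ (i, 0)" if "i < n" for i
  proof -
    have "(M * U) $$ (i, 0) = (\<Sum>l<n. M $$ (i, l) * v $ l) / complex_of_real (nr 0)"
      using n0 that by (subst mult_index_sum[OF M U]) (auto simp: U_def ws0 sum_divide_distrib)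
    also have "(\<Sum>l<n. M $$ (i, l) * v $ l) = (M *\<^sub>v v) $ i"
      using M v that by (simp add: scalar_prod_def atLeast0LessThan)
    also have "\<dots> = e * v $ i" using Mv v that by simp
    finally show ?thesis using that n0 by (simp add: U_def ws0)
  qed
  ultimately show ?thesis using U by blast
qed

text \<open>Deflation: in an orthonormal basis that starts with an eigenvector, the Hermitian matrix
  splits into the eigenvalue and a smaller Hermitian block, to which the induction applies.\<close>

lemma spectral_decomposition:
  fixes M :: "complex mat"
  assumes "M \<in> carrier_mat n n" "mat_adjoint M = M" "char_poly M = (\<Prod>e\<leftarrow>es. [:- e, 1:])"
    and "length es = n"
  shows "\<exists>U. U \<in> carrier_mat n n \<and> mat_adjoint U * U = 1\<^sub>m n \<and> mat_adjoint U * M * U = diagonal_of es"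
  using assms
proof (induction es arbitrary: n M)
  case Nil
  then show ?case by (intro exI[of _ "1\<^sub>m 0"]) (auto simp: diagonal_of_def intro!: eq_matI)
next
  case (Cons e es)
  note M = Cons.prems(1)
  obtain m where n: "n = Suc m" and m: "length es = m" using Cons.prems(4) by auto
  have "eigenvalue M e" unfolding eigenvalue_root_char_poly[OF M] Cons.prems(3) by simp
  from unitary_eigenvector_first[OF M this] obtain U1 where U1: "U1 \<in> carrier_mat n n"
    and uni: "mat_adjoint U1 * U1 = 1\<^sub>m n" and ev: "\<And>i. i < n \<Longrightarrow> (M * U1) $$ (i, 0) = e * U1 $$ (i, 0)"
    by blast
  note aU1 = adjoint_carrier[OF U1]
  have uni': "U1 * mat_adjoint U1 = 1\<^sub>m n" by (rule mat_mult_left_right_inverse[OF aU1 U1 uni])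
  define M' where "M' = mat_adjoint U1 * M * U1"
  have M': "M' \<in> carrier_mat n n" using M U1 aU1 by (simp add: M'_def)
  have "mat_adjoint M' = mat_adjoint U1 * (M * U1)"
    unfolding M'_def using adjoint_mult[OF mult_carrier_mat[OF aU1 M] U1] adjoint_mult[OF aU1 M]
      Cons.prems(2) by (simp add: adjoint_adjoint)
  then have herm: "mat_adjoint M' = M'" unfolding M'_def using M U1 aU1 by simp
  have col0: "M' $$ (i, 0) = (if i = 0 then e else 0)" if "i < n" for i
  proof -
    have "M' $$ (i, 0) = (mat_adjoint U1 * (M * U1)) $$ (i, 0)" unfolding M'_def using M U1 aU1 by simp
    also have "\<dots> = e * (mat_adjoint U1 * U1) $$ (i, 0)"
      using that n M U1 by (simp add: adjoint_mult_index[of _ n n _ n] ev sum_distrib_left mult_ac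
        distrib_left del: index_mult_mat(1))
    also have "\<dots> = (if i = 0 then e else 0)" using uni that n by simp
    finally show ?thesis .
  qed
  \<comment> \<open>Being Hermitian, \<open>M'\<close> inherits a vanishing first row from its
    vanishing first column; this is what makes it block diagonal.\<close>
  have row0: "M' $$ (0, i) = 0" if "i < n" "i \<noteq> 0" for i
    using herm col0[OF that(1)] that n M' adjoint_index[of 0 M' i] by simp
  define M3 where "M3 = mat m m (\<lambda>(i, j). M' $$ (Suc i, Suc j))"
  have M3: "M3 \<in> carrier_mat m m" by (simp add: M3_def)
  let ?E = "mat 1 1 (\<lambda>_. e)"
  have blk: "M' = four_block_mat ?E (0\<^sub>m 1 m) (0\<^sub>m m 1) M3"
  proof (rule eq_matI)
    fix i j assume "i < dim_row (four_block_mat ?E (0\<^sub>m 1 m) (0\<^sub>m m 1) M3)"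
      "j < dim_col (four_block_mat ?E (0\<^sub>m 1 m) (0\<^sub>m m 1) M3)"
    then have "i < n" "j < n" using n M3 by auto
    then show "M' $$ (i, j) = four_block_mat ?E (0\<^sub>m 1 m) (0\<^sub>m m 1) M3 $$ (i, j)"
      using col0[of i] row0[of j] n M3 by (cases i; cases j) (auto simp: M3_def)
  qed (use M' M3 n in auto)
  have herm3: "mat_adjoint M3 = M3"
  proof (rule eq_matI)
    fix i j assume "i < dim_row M3" "j < dim_col M3"
    then have ij: "i < m" "j < m" using M3 by auto
    then have "mat_adjoint M' $$ (Suc i, Suc j) = cnj (M' $$ (Suc j, Suc i))"
      using M' n by (intro adjoint_index) auto
    then show "mat_adjoint M3 $$ (i, j) = M3 $$ (i, j)"
      using ij M3 herm by (simp add: adjoint_index M3_def)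
  qed (use M3 adjoint_carrier[OF M3] in auto)
  have "similar_mat_wit M' M (mat_adjoint U1) U1"
    by (rule similar_mat_witI[OF uni uni']) (use M M' U1 aU1 in \<open>auto simp: M'_def\<close>)
  then have "char_poly M' = char_poly M" by (intro char_poly_similar) (auto simp: similar_mat_def)
  moreover have "char_poly M' = char_poly ?E * char_poly M3"
    unfolding blk by (rule char_poly_four_block_zeros_col) (use M3 in auto)
  moreover have "char_poly ?E = [:- e, 1:]"
    by (simp add: char_poly_defs det_def sign_def)
  \<comment> \<open>Cancelling the linear factor of \<open>e\<close> leaves the product over the
    remaining list that the induction hypothesis asks for.\<close>
  ultimately have cp3: "char_poly M3 = (\<Prod>e\<leftarrow>es. [:- e, 1:])"
    using Cons.prems(3) by (metis (no_types, lifting) list.simps(9) mult_cancel_left pCons_eq_0_iff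
      prod_list.Cons zero_neq_one)
  from Cons.IH[OF M3 herm3 cp3 m] obtain U3 where U3: "U3 \<in> carrier_mat m m"
    and uni3: "mat_adjoint U3 * U3 = 1\<^sub>m m" and d3: "mat_adjoint U3 * M3 * U3 = diagonal_of es" by blast
  note aU3 = adjoint_carrier[OF U3]
  let ?V = "four_block_mat (1\<^sub>m 1) (0\<^sub>m 1 m) (0\<^sub>m m 1) U3"
  let ?V' = "four_block_mat (1\<^sub>m 1) (0\<^sub>m 1 m) (0\<^sub>m m 1) (mat_adjoint U3)"
  have V: "?V \<in> carrier_mat n n" using U3 n by auto
  have V': "?V' \<in> carrier_mat n n" using four_block_carrier_mat[OF one_carrier_mat aU3, of 1] n by simp
  have adjV: "mat_adjoint ?V = ?V'"
  proof (rule eq_matI)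
    fix i j assume "i < dim_row ?V'" "j < dim_col ?V'"
    then have ij: "i < n" "j < n" using V' by auto
    then have "mat_adjoint ?V $$ (i, j) = cnj (?V $$ (j, i))" using V by (intro adjoint_index) auto
    then show "mat_adjoint ?V $$ (i, j) = ?V' $$ (i, j)"
      using ij U3 aU3 n by (cases i; cases j) (auto simp: adjoint_index)
  qed (use V' adjoint_carrier[OF V] in auto)
  define U where "U = U1 * ?V"
  have U: "U \<in> carrier_mat n n" using U1 V by (simp add: U_def)
  have aU: "mat_adjoint U = ?V' * mat_adjoint U1" unfolding U_def adjV[symmetric] by (rule adjoint_mult[OF U1 V])
  have "mat_adjoint U * U = ?V' * (mat_adjoint U1 * U1) * ?V"
    unfolding aU unfolding U_def using U1 aU1 V V' by (simp add: assoc_mult_mat[of _ n n _ n _ n])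
  also have "\<dots> = ?V' * ?V" unfolding uni right_mult_one_mat[OF V'] ..
  also have "\<dots> = four_block_mat (1\<^sub>m 1) (0\<^sub>m 1 m) (0\<^sub>m m 1) (1\<^sub>m m)"
    using U3 aU3 uni3 by (subst mult_four_block_mat[of _ 1 1 _ m _ m _ _ 1 _ m]) auto
  also have "\<dots> = 1\<^sub>m n" using n by (intro eq_matI) auto
  finally have 1: "mat_adjoint U * U = 1\<^sub>m n" .
  have "mat_adjoint U * M * U = ?V' * M' * ?V"
    unfolding aU unfolding U_def M'_def using U1 aU1 V V' M by (simp add: assoc_mult_mat[of _ n n _ n _ n])
  also have "?V' * M' = four_block_mat ?E (0\<^sub>m 1 m) (0\<^sub>m m 1) (mat_adjoint U3 * M3)"
    unfolding blk using U3 aU3 M3 by (subst mult_four_block_mat[of _ 1 1 _ m _ m _ _ 1 _ m]) auto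
  also have "\<dots> * ?V = four_block_mat ?E (0\<^sub>m 1 m) (0\<^sub>m m 1) (mat_adjoint U3 * M3 * U3)"
    using U3 aU3 M3 by (subst mult_four_block_mat[of _ 1 1 _ m _ m _ _ 1 _ m]) auto
  also have "\<dots> = diagonal_of (e # es)"
    unfolding d3 using m by (intro eq_matI) (auto simp: diagonal_of_def nth_Cons')
  finally show ?case using 1 U by blast
qed

text \<open>The order of a root is its number of occurrences in the list, so the weighted sum over
  distinct roots becomes a plain sum over the list of eigenvalues.\<close>

lemma trace_norm_eq_sum_list:
  assumes "char_poly (mat_adjoint A * A) = (\<Prod>e\<leftarrow>es. [:- e, 1:])"
  shows "trace_norm A = (\<Sum>e\<leftarrow>es. sqrt (Re e))"
proof -
  let ?p = "\<lambda>es. \<Prod>e\<leftarrow>es. [:- e, 1:] :: complex poly"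
  have nz: "?p es \<noteq> 0" for es by (auto simp: prod_list_zero_iff)
  have ord: "Polynomial.order e (?p es) = count_list es e" for e and es :: "complex list"
  proof (induction es)
    case (Cons a es)
    have "Polynomial.order e [:- a, 1:] = (if a = e then 1 else 0)"
      using order_power_n_n[of a 1] by (auto intro: order_0I)
    moreover have "Polynomial.order e (?p (a # es)) = Polynomial.order e [:- a, 1:] + Polynomial.order e (?p es)"
      unfolding list.map prod_list.Cons by (rule order_mult) (use nz[of "a # es"] in simp)
    ultimately show ?case using Cons by simp
  qed (simp add: order_0I)
  have roots: "{e. poly (?p es) e = 0} = set es"
    by (induction es) (auto simp: poly_prod_list)
  show ?thesis unfolding trace_norm_def Let_def assms ord roots
  proof (induction es)
    case (Cons a es)
    have "(\<Sum>e\<in>set (a # es). real (count_list (a # es) e) * sqrt (Re e))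
        = (\<Sum>e\<in>set (a # es). (if e = a then sqrt (Re e) else 0)) + (\<Sum>e\<in>set (a # es). real (count_list es e) * sqrt (Re e))"
      unfolding sum.distrib[symmetric] by (intro sum.cong) (auto simp: algebra_simps)
    also have "(\<Sum>e\<in>set (a # es). (if e = a then sqrt (Re e) else 0)) = sqrt (Re a)" by simp
    also have "(\<Sum>e\<in>set (a # es). real (count_list es e) * sqrt (Re e)) = (\<Sum>e\<in>set es. real (count_list es e) * sqrt (Re e))"
      by (rule sum.mono_neutral_right) (auto simp: count_list_0_iff)
    finally show ?case using Cons by simp
  qed simp
qed

text \<open>Expand the nonnegative squared norm of \<open>\<phi>\<close> minus its component
  \<open>s\<close>. Squared lengths \<open>r i\<close> at most 1 are allowed, rather than exactly 1,
  to admit zero vectors, which occur below wherever a singular value vanishes.\<close>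

lemma bessel_inequality:
  fixes w :: "'i \<Rightarrow> 'a \<Rightarrow> complex"
  assumes I: "finite I" and V: "finite V"
    and orth: "\<And>i j. i \<in> I \<Longrightarrow> j \<in> I \<Longrightarrow> (\<Sum>a\<in>V. cnj (w i a) * w j a) = (if i = j then complex_of_real (r i) else 0)"
    and r: "\<And>i. i \<in> I \<Longrightarrow> r i \<le> 1"
  shows "(\<Sum>i\<in>I. (cmod (\<Sum>a\<in>V. cnj (w i a) * \<phi> a))\<^sup>2) \<le> (\<Sum>a\<in>V. (cmod (\<phi> a))\<^sup>2)"
proof -
  define c where "c i = (\<Sum>a\<in>V. cnj (w i a) * \<phi> a)" for i
  define s where "s a = (\<Sum>i\<in>I. c i * w i a)" for a
  have 1: "(\<Sum>a\<in>V. \<phi> a * cnj (s a)) = (\<Sum>i\<in>I. complex_of_real ((cmod (c i))\<^sup>2))"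
  proof -
    have "(\<Sum>a\<in>V. \<phi> a * cnj (s a)) = (\<Sum>a\<in>V. \<Sum>i\<in>I. cnj (c i) * (cnj (w i a) * \<phi> a))"
      by (simp add: s_def sum_distrib_left mult_ac)
    also have "\<dots> = (\<Sum>i\<in>I. cnj (c i) * c i)"
      by (subst sum.swap) (simp add: c_def sum_distrib_left)
    finally show ?thesis by (simp add: complex_norm_square mult.commute del: of_real_power)
  qed
  have 2: "(\<Sum>a\<in>V. s a * cnj (\<phi> a)) = (\<Sum>i\<in>I. complex_of_real ((cmod (c i))\<^sup>2))"
    using arg_cong[OF 1, of cnj] by (simp add: mult.commute del: of_real_power)
  have 3: "(\<Sum>a\<in>V. s a * cnj (s a)) = (\<Sum>i\<in>I. complex_of_real (r i * (cmod (c i))\<^sup>2))"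
  proof -
    have "(\<Sum>a\<in>V. s a * cnj (s a)) = (\<Sum>a\<in>V. \<Sum>i\<in>I. \<Sum>j\<in>I. c i * cnj (c j) * (cnj (w j a) * w i a))"
      by (simp add: s_def sum_product mult_ac)
    also have "\<dots> = (\<Sum>i\<in>I. \<Sum>j\<in>I. c i * cnj (c j) * (\<Sum>a\<in>V. cnj (w j a) * w i a))"
      by (subst sum.swap, rule sum.cong[OF refl], subst sum.swap) (simp add: sum_distrib_left)
    also have "\<dots> = (\<Sum>i\<in>I. \<Sum>j\<in>I. if j = i then complex_of_real (r i) * (c i * cnj (c i)) else 0)"
      by (intro sum.cong refl) (auto simp: orth)
    also have "\<dots> = (\<Sum>i\<in>I. complex_of_real (r i) * (c i * cnj (c i)))" using I by simp
    finally show ?thesis by (simp add: complex_norm_square del: of_real_power)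
  qed
  have "complex_of_real (\<Sum>a\<in>V. (cmod (\<phi> a - s a))\<^sup>2)
     = (\<Sum>a\<in>V. \<phi> a * cnj (\<phi> a)) - (\<Sum>a\<in>V. \<phi> a * cnj (s a)) - (\<Sum>a\<in>V. s a * cnj (\<phi> a)) + (\<Sum>a\<in>V. s a * cnj (s a))"
    by (simp add: complex_norm_square algebra_simps sum.distrib sum_subtractf del: of_real_power)
  also have "\<dots> = complex_of_real ((\<Sum>a\<in>V. (cmod (\<phi> a))\<^sup>2) - (\<Sum>i\<in>I. (cmod (c i))\<^sup>2) - (\<Sum>i\<in>I. (cmod (c i))\<^sup>2)
      + (\<Sum>i\<in>I. r i * (cmod (c i))\<^sup>2))"
    unfolding 1 2 3 by (simp add: complex_norm_square del: of_real_power)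
  finally have "(\<Sum>a\<in>V. (cmod (\<phi> a - s a))\<^sup>2) = (\<Sum>a\<in>V. (cmod (\<phi> a))\<^sup>2) - (\<Sum>i\<in>I. (cmod (c i))\<^sup>2)
      - (\<Sum>i\<in>I. (cmod (c i))\<^sup>2) + (\<Sum>i\<in>I. r i * (cmod (c i))\<^sup>2)" unfolding of_real_eq_iff .
  moreover have "0 \<le> (\<Sum>a\<in>V. (cmod (\<phi> a - s a))\<^sup>2)" by (intro sum_nonneg) auto
  moreover have "(\<Sum>i\<in>I. r i * (cmod (c i))\<^sup>2) \<le> (\<Sum>i\<in>I. (cmod (c i))\<^sup>2)"
    by (intro sum_mono) (use r mult_right_mono[of _ 1] in force)
  ultimately show ?thesis unfolding c_def by linarith
qed

text \<open>The triangle inequality for the trace norm, for a sum of rank-one operators with vectors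
  \<open>\<phi> k\<close> and \<open>\<theta> k\<close>. Every singular value is a matrix entry of
  \<open>A\<close> between two orthogonal systems; inserting the decomposition, Cauchy-Schwarz over
  the singular values and Bessel on both sides bound the contribution of each
  \<open>k\<close>.\<close>

lemma trace_norm_le:
  fixes \<phi> \<theta> :: "'k \<Rightarrow> nat \<Rightarrow> complex"
  assumes A: "A \<in> carrier_mat n n" and K: "finite K"
    and dec: "\<And>i j. i < n \<Longrightarrow> j < n \<Longrightarrow> A $$ (i, j) = (\<Sum>k\<in>K. \<phi> k i * cnj (\<theta> k j))"
  shows "trace_norm A \<le> (\<Sum>k\<in>K. sqrt (\<Sum>i<n. (cmod (\<phi> k i))\<^sup>2) * sqrt (\<Sum>i<n. (cmod (\<theta> k i))\<^sup>2))"
proof -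
  let ?M = "mat_adjoint A * A"
  note aA = adjoint_carrier[OF A]
  have M: "?M \<in> carrier_mat n n" using mult_carrier_mat[OF aA A] .
  have "mat_adjoint ?M = ?M" using adjoint_mult[OF aA A] by (simp add: adjoint_adjoint)
  moreover obtain es where es: "char_poly ?M = (\<Prod>e\<leftarrow>es. [:- e, 1:])" "length es = n"
    using char_poly_factorized[OF M] by blast
  ultimately obtain U where U: "U \<in> carrier_mat n n" and uni: "mat_adjoint U * U = 1\<^sub>m n"
    and diag: "mat_adjoint U * ?M * U = diagonal_of es"
    using spectral_decomposition[OF M] by blast
  note aU = adjoint_carrier[OF U]
  \<comment> \<open>The columns of \<open>Y\<close> are orthogonal with the eigenvalues
    \<open>es\<close> as squared lengths, so normalising them gives the left singular
    vectors.\<close>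
  define Y where "Y = A * U"
  have Y: "Y \<in> carrier_mat n n" using A U by (simp add: Y_def)
  have YY: "mat_adjoint Y * Y = diagonal_of es"
    unfolding diag[symmetric] Y_def adjoint_mult[OF A U] using A aA U aU
    by (simp add: assoc_mult_mat[of _ n n _ n _ n])
  have Yorth: "(\<Sum>l<n. cnj (Y $$ (l, i)) * Y $$ (l, j)) = (if i = j then es ! i else 0)" if "i < n" "j < n" for i j
    using adjoint_mult_index[OF Y Y that] that es(2) unfolding YY by (simp add: diagonal_of_def)
  have Uorth: "(\<Sum>l<n. cnj (U $$ (l, i)) * U $$ (l, j)) = (if i = j then complex_of_real 1 else 0)" if "i < n" "j < n" for i j
    using adjoint_mult_index[OF U U that] that unfolding uni by auto
  define d where "d i = sqrt (Re (es ! i))" for i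
  have es_norm: "es ! i = complex_of_real (\<Sum>l<n. (cmod (Y $$ (l, i)))\<^sup>2)" if "i < n" for i
    using Yorth[OF that that] by (simp add: complex_norm_square mult.commute del: of_real_power)
  then have es_d: "es ! i = complex_of_real ((d i)\<^sup>2)" and d0: "d i \<ge> 0" if "i < n" for i
    using that by (auto simp: d_def sum_nonneg simp del: of_real_sum)
  \<comment> \<open>Division by zero gives zero, so \<open>w i\<close> is the zero vector when the
    singular value \<open>d i\<close> is 0.\<close>
  define w where "w i l = Y $$ (l, i) / complex_of_real (d i)" for i l
  have worth: "(\<Sum>l<n. cnj (w i l) * w j l) = (if i = j then complex_of_real (if d i = 0 then 0 else 1) else 0)"
    if "i < n" "j < n" for i j
  proof -
    have "(\<Sum>l<n. cnj (w i l) * w j l) = (\<Sum>l<n. cnj (Y $$ (l, i)) * Y $$ (l, j)) / complex_of_real (d i * d j)"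
      by (simp add: w_def sum_divide_distrib)
    then show ?thesis using Yorth[OF that] es_d[OF that(1)] by (auto simp: power2_eq_square)
  qed
  define p where "p k i = (\<Sum>l<n. cnj (w i l) * \<phi> k l)" for k i
  define q where "q k i = (\<Sum>l<n. cnj (U $$ (l, i)) * \<theta> k l)" for k i
  \<comment> \<open>The singular value is the entry of \<open>A\<close> between the left vector
    \<open>w i\<close> and column \<open>i\<close> of \<open>U\<close>, written out through the
    decomposition of \<open>A\<close>.\<close>
  have dterm: "complex_of_real (d i) = (\<Sum>k\<in>K. p k i * cnj (q k i))" if i: "i < n" for i
  proof -
    have Yi: "Y $$ (l, i) = (\<Sum>k\<in>K. \<phi> k l * cnj (q k i))" if "l < n" for l
    proof -
      have "Y $$ (l, i) = (\<Sum>m<n. \<Sum>k\<in>K. \<phi> k l * cnj (\<theta> k m) * U $$ (m, i))"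
        using that i by (simp add: Y_def mult_index_sum[OF A U] dec sum_distrib_right del: index_mult_mat)
      then show ?thesis by (subst (asm) sum.swap) (simp add: q_def sum_distrib_left mult_ac)
    qed
    have "(\<Sum>k\<in>K. p k i * cnj (q k i)) = (\<Sum>k\<in>K. \<Sum>l<n. cnj (w i l) * (\<phi> k l * cnj (q k i)))"
      by (simp add: p_def sum_distrib_left mult_ac)
    also have "\<dots> = (\<Sum>l<n. cnj (w i l) * Y $$ (l, i))"
      by (subst sum.swap) (simp add: Yi sum_distrib_left)
    also have "\<dots> = (\<Sum>l<n. cnj (Y $$ (l, i)) * Y $$ (l, i)) / complex_of_real (d i)"
      by (simp add: w_def sum_divide_distrib)
    also have "\<dots> = complex_of_real (d i)" using Yorth[OF i i] es_d[OF i] by (simp add: power2_eq_square)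
    finally show ?thesis by simp
  qed
  have "trace_norm A = (\<Sum>i<n. d i)"
    unfolding trace_norm_eq_sum_list[OF es(1)] sum_list_sum_nth using es(2) by (simp add: d_def atLeast0LessThan)
  also have "\<dots> = Re (\<Sum>i<n. \<Sum>k\<in>K. p k i * cnj (q k i))"
  proof -
    have "(\<Sum>i<n. \<Sum>k\<in>K. p k i * cnj (q k i)) = complex_of_real (\<Sum>i<n. d i)"
      unfolding of_real_sum by (intro sum.cong refl dterm[symmetric]) simp
    then show ?thesis by (simp only: Re_complex_of_real)
  qed
  also have "\<dots> \<le> (\<Sum>i<n. \<Sum>k\<in>K. cmod (p k i) * cmod (q k i))"
    by (rule order_trans[OF complex_Re_le_cmod], intro order_trans[OF norm_sum] sum_mono)
      (simp add: norm_mult)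
  also have "\<dots> = (\<Sum>k\<in>K. \<Sum>i<n. \<bar>cmod (p k i)\<bar> * \<bar>cmod (q k i)\<bar>)" by (subst sum.swap) simp
  also have "\<dots> \<le> (\<Sum>k\<in>K. L2_set (\<lambda>i. cmod (p k i)) {..<n} * L2_set (\<lambda>i. cmod (q k i)) {..<n})"
    by (intro sum_mono L2_set_mult_ineq)
  also have "\<dots> \<le> (\<Sum>k\<in>K. sqrt (\<Sum>i<n. (cmod (\<phi> k i))\<^sup>2) * sqrt (\<Sum>i<n. (cmod (\<theta> k i))\<^sup>2))"
    unfolding L2_set_def p_def q_def
  proof (intro sum_mono mult_mono)
    fix k
    show "sqrt (\<Sum>i<n. (cmod (\<Sum>l<n. cnj (w i l) * \<phi> k l))\<^sup>2) \<le> sqrt (\<Sum>i<n. (cmod (\<phi> k i))\<^sup>2)"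
      by (intro real_sqrt_le_mono bessel_inequality[where r = "\<lambda>i. if d i = 0 then 0 else 1"])
        (use worth in auto)
    show "sqrt (\<Sum>i<n. (cmod (\<Sum>l<n. cnj (U $$ (l, i)) * \<theta> k l))\<^sup>2) \<le> sqrt (\<Sum>i<n. (cmod (\<theta> k i))\<^sup>2)"
      by (intro real_sqrt_le_mono bessel_inequality[where r = "\<lambda>i. 1"]) (use Uorth in auto)
  qed (auto intro!: sum_nonneg)
  finally show ?thesis .
qed

subsection \<open>State vectors\<close>

definition run_gates :: "gate list \<Rightarrow> (bits \<Rightarrow> complex) \<Rightarrow> bits \<Rightarrow> complex" where
  "run_gates gs \<psi> = fold apply_gate gs \<psi>"

lemma run_gates_Nil [simp]: "run_gates [] \<psi> = \<psi>" by (simp add: run_gates_def)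
lemma run_gates_Cons: "run_gates (g # gs) \<psi> = run_gates gs (apply_gate g \<psi>)" by (simp add: run_gates_def)
lemma run_gates_append: "run_gates (fs @ gs) \<psi> = run_gates gs (run_gates fs \<psi>)" by (simp add: run_gates_def)

lemma apply_gate_cong:
  "(\<And>u. length u = length s \<Longrightarrow> \<psi> u = \<phi> u) \<Longrightarrow> apply_gate g \<psi> s = apply_gate g \<phi> s"
  by (cases g) (auto simp: flip_def)

text \<open>Gates relate only strings of equal length. State vectors are functions on all lists, and
  this lemma allows values at other lengths to be ignored.\<close>

lemma run_gates_cong:
  "(\<And>u. length u = length s \<Longrightarrow> \<psi> u = \<phi> u) \<Longrightarrow> run_gates gs \<psi> s = run_gates gs \<phi> s"
proof (induction gs arbitrary: \<psi> \<phi>)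
  case (Cons g gs)
  show ?case unfolding run_gates_Cons
    by (rule Cons.IH, rule apply_gate_cong) (use Cons.prems in auto)
qed simp

lemma apply_gate_sum:
  "apply_gate g (\<lambda>u. \<Sum>i\<in>I. c i * \<psi> i u) = (\<lambda>u. \<Sum>i\<in>I. c i * apply_gate g (\<psi> i) u)"
  by (cases g) (auto simp: fun_eq_iff sum_distrib_left sum.distrib sum_subtractf sum_divide_distrib
      algebra_simps add_divide_distrib diff_divide_distrib sum_negf)

lemma run_gates_sum:
  "run_gates gs (\<lambda>u. \<Sum>i\<in>I. c i * \<psi> i u) = (\<lambda>u. \<Sum>i\<in>I. c i * run_gates gs (\<psi> i) u)"
  by (induction gs arbitrary: \<psi>) (simp_all add: run_gates_Cons apply_gate_sum)

lemma run_gates_0: "run_gates gs (\<lambda>_. 0) = (\<lambda>_. 0)"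
  using run_gates_sum[of gs "\<lambda>_. 0" undefined "{}"] by simp

lemma apply_classical_gate: "classical_gate g \<Longrightarrow> apply_gate g \<psi> s = \<psi> (classical_action g s)"
  by (cases g) auto

lemma run_classical_gates: "classical_gates gs \<Longrightarrow> run_gates gs \<psi> s = \<psi> (act (rev gs) s)"
  by (induction gs arbitrary: \<psi>) (auto simp: run_gates_Cons apply_classical_gate)

lemma apply_shift_gate:
  assumes "\<forall>k\<in>set (gate_wires g). k < length b"
  shows "apply_gate (shift_gate (length a) g) \<psi> (a @ b @ c) = apply_gate g (\<lambda>b'. \<psi> (a @ b' @ c)) b"
  using assms classical_action_shift_gate[OF assms, of a c]
  by (cases g) (auto simp: nth_append list_update_append)

lemma run_gates_shift:
  "wf_gates (length b) gs \<Longrightarrow> k = length a \<Longrightarrow>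
     run_gates (shift k gs) \<psi> (a @ b @ c) = run_gates gs (\<lambda>b'. \<psi> (a @ b' @ c)) b"
proof (induction gs arbitrary: \<psi>)
  case (Cons g gs)
  have "run_gates (shift k (g # gs)) \<psi> (a @ b @ c)
      = run_gates gs (\<lambda>b'. apply_gate (shift_gate k g) \<psi> (a @ b' @ c)) b"
    using Cons by (simp add: shift_def run_gates_Cons)
  also have "\<dots> = run_gates gs (apply_gate g (\<lambda>b'. \<psi> (a @ b' @ c))) b"
    by (rule run_gates_cong) (use Cons.prems in \<open>auto simp: apply_shift_gate\<close>)
  finally show ?case by (simp add: run_gates_Cons)
qed (simp add: shift_def)

lemma shift_0: "shift 0 gs = gs"
proof -
  have "shift_gate 0 g = g" for g by (cases g) auto
  then show ?thesis by (simp add: shift_def map_idI)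
qed

lemma run_gates_prefix:
  "wf_gates (length b) gs \<Longrightarrow> run_gates gs \<psi> (b @ c) = run_gates gs (\<lambda>b'. \<psi> (b' @ c)) b"
  using run_gates_shift[of b gs 0 "[]" \<psi> c] by (simp add: shift_0)

subsection \<open>Unitarity\<close>

definition inner_prod :: "nat \<Rightarrow> (bits \<Rightarrow> complex) \<Rightarrow> (bits \<Rightarrow> complex) \<Rightarrow> complex" where
  "inner_prod W \<phi> \<psi> = (\<Sum>s\<in>bitstrings W. cnj (\<phi> s) * \<psi> s)"

definition sqnorm :: "nat \<Rightarrow> (bits \<Rightarrow> complex) \<Rightarrow> real" where
  "sqnorm W \<psi> = (\<Sum>s\<in>bitstrings W. (cmod (\<psi> s))\<^sup>2)"

lemma sqnorm_inner_prod: "complex_of_real (sqnorm W \<psi>) = inner_prod W \<psi> \<psi>"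
  unfolding sqnorm_def inner_prod_def of_real_sum complex_norm_square by (simp add: mult.commute)

lemma sqnorm_nonneg [simp]: "0 \<le> sqnorm W \<psi>" unfolding sqnorm_def by (intro sum_nonneg) auto

lemma sum_bitstrings_involution:
  assumes "\<And>s. length s = W \<Longrightarrow> h (h s) = s" "\<And>s. length (h s) = length s"
  shows "(\<Sum>s\<in>bitstrings W. f (h s)) = (\<Sum>s\<in>bitstrings W. f s)"
  by (rule sum.reindex_bij_witness[of _ h h]) (use assms in auto)

lemma length_flip: "length (flip i s) = length s" by (simp add: flip_def)

text \<open>Setting bit \<open>i\<close> both ways gives \<open>s\<close> and its flip in some
  order, and flipping permutes the strings. Made for the gate \<open>H\<close>, which mixes just
  such pairs.\<close>

lemma sum_bitstrings_pair:
  fixes f :: "bits \<Rightarrow> complex"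
  assumes "i < W"
  shows "(\<Sum>s\<in>bitstrings W. f (s[i := False]) + f (s[i := True])) = 2 * (\<Sum>s\<in>bitstrings W. f s)"
proof -
  have "f (s[i := False]) + f (s[i := True]) = f s + f (flip i s)" for s
  proof (cases "s ! i")
    case True
    then have "s[i := True] = s" by (metis list_update_id)
    with True show ?thesis by (simp add: flip_def)
  next
    case False
    then have "s[i := False] = s" by (metis (full_types) list_update_id)
    with False show ?thesis by (simp add: flip_def)
  qed
  then have "(\<Sum>s\<in>bitstrings W. f (s[i := False]) + f (s[i := True]))
      = (\<Sum>s\<in>bitstrings W. f s) + (\<Sum>s\<in>bitstrings W. f (flip i s))" by (simp add: sum.distrib)
  also have "(\<Sum>s\<in>bitstrings W. f (flip i s)) = (\<Sum>s\<in>bitstrings W. f s)"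
    by (rule sum_bitstrings_involution) (simp_all add: length_flip)
  finally show ?thesis by simp
qed

text \<open>Classical gates permute the basis and phase gates multiply by numbers of modulus 1. For
  \<open>H\<close> the identity holds for each pair of strings that differ in bit \<open>i\<close>,
  where the mixed terms cancel.\<close>

lemma inner_prod_apply_gate:
  assumes g: "distinct (gate_wires g)" "\<forall>k\<in>set (gate_wires g). k < W"
  shows "inner_prod W (apply_gate g \<phi>) (apply_gate g \<psi>) = inner_prod W \<phi> \<psi>"
proof -
  have T: "cnj (cis a) * cis a = 1" for a by (simp add: cis_cnj cis_mult)
  have cl: ?thesis if "classical_gate g"
    unfolding inner_prod_def apply_classical_gate[OF that]
    by (rule sum_bitstrings_involution[where f = "\<lambda>s. cnj (\<phi> s) * \<psi> s"])
      (use classical_action_invol[OF g(1)] in auto)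
  have ph: "(if b then cnj c else 1) * (if b then c else 1) = 1" if "cnj c * c = 1" for b and c :: complex
    using that by simp
  show ?thesis
  proof (cases g)
    case (H i)
    then have i: "i < W" using g by simp
    let ?s = "complex_of_real (sqrt 2)"
    have ss: "?s * ?s = 2" by (simp flip: of_real_mult)
    let ?h = "\<lambda>s. cnj (apply_gate g \<phi> s) * apply_gate g \<psi> s" and ?f = "\<lambda>s. cnj (\<phi> s) * \<psi> s"
    have "?h (s[i := False]) + ?h (s[i := True]) = ?f (s[i := False]) + ?f (s[i := True])" if "length s = W" for s
    proof -
      have "\<And>a b c d :: complex. cnj ((a + b) / ?s) * ((c + d) / ?s) + cnj ((a - b) / ?s) * ((c - d) / ?s)
          = (cnj a * c + cnj b * d) * 2 / (?s * ?s)" by (simp add: field_simps)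
      note key = this
      have e: "apply_gate g \<eta> (s[i := False]) = (\<eta> (s[i := False]) + \<eta> (s[i := True])) / ?s"
        "apply_gate g \<eta> (s[i := True]) = (\<eta> (s[i := False]) - \<eta> (s[i := True])) / ?s" for \<eta>
        using that i unfolding H by simp_all
      show ?thesis unfolding e key ss by simp
    qed
    then have "(\<Sum>s\<in>bitstrings W. ?h (s[i := False]) + ?h (s[i := True]))
       = (\<Sum>s\<in>bitstrings W. ?f (s[i := False]) + ?f (s[i := True]))" by (intro sum.cong) auto
    then show ?thesis
      unfolding sum_bitstrings_pair[OF i, of ?h] sum_bitstrings_pair[OF i, of ?f] inner_prod_def by simp
  next
    case (T i)
    have "cnj (apply_gate g \<phi> s) * apply_gate g \<psi> s = cnj (\<phi> s) * \<psi> s" for s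
      unfolding T using \<open>\<And>a. cnj (cis a) * cis a = 1\<close>[of "pi / 4"] by (auto simp: mult_ac)
    then show ?thesis by (simp add: inner_prod_def)
  next
    case (Tinv i)
    have "cnj (apply_gate g \<phi> s) * apply_gate g \<psi> s = cnj (\<phi> s) * \<psi> s" for s
      unfolding Tinv using T[of "- pi / 4"] by (auto simp: mult_ac)
    then show ?thesis by (simp add: inner_prod_def)
  qed (use cl in auto)
qed

lemma inner_prod_run_gates:
  "wf_gates W gs \<Longrightarrow> inner_prod W (run_gates gs \<phi>) (run_gates gs \<psi>) = inner_prod W \<phi> \<psi>"
  by (induction gs arbitrary: \<phi> \<psi>) (auto simp: run_gates_Cons inner_prod_apply_gate)

lemma sqnorm_run_gates: "wf_gates W gs \<Longrightarrow> sqnorm W (run_gates gs \<psi>) = sqnorm W \<psi>"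
  using inner_prod_run_gates[of W gs \<psi> \<psi>] unfolding sqnorm_inner_prod[symmetric] of_real_eq_iff .

text \<open>\<open>T\<close> and \<open>Tinv\<close> are eighth roots of the identity because eight
  times \<open>pi / 4\<close> is a full turn; all other gates are involutions.\<close>

lemma apply_gate_order_8:
  assumes "distinct (gate_wires g)" "\<forall>k\<in>set (gate_wires g). k < length s"
  shows "(apply_gate g ^^ 8) \<psi> s = \<psi> s"
proof -
  have c8: "cis (pi / 4) ^ 8 = 1" "cis (- pi / 4) ^ 8 = 1"
    using Complex.DeMoivre[of "pi / 4" 8] Complex.DeMoivre[of "- pi / 4" 8] by (simp_all add: complex_eq_iff)
  have diag: "((\<lambda>\<psi> s. f s * \<psi> s) ^^ n) \<psi> s = f s ^ n * \<psi> s"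
    for f :: "bits \<Rightarrow> complex" and n \<psi> s by (induction n) auto
  have invol: "(h ^^ 8) \<psi> s = \<psi> s" if "\<And>\<phi> u. length u = length s \<Longrightarrow> h (h \<phi>) u = \<phi> u" 
    for h :: "(bits \<Rightarrow> complex) \<Rightarrow> bits \<Rightarrow> complex"
    using that[of s] by (simp add: numeral_eq_Suc)
  show ?thesis
  proof (cases g)
    case (H i)
    let ?s = "complex_of_real (sqrt 2)"
    have ss: "?s * ?s = 2" by (simp flip: of_real_mult)
    show ?thesis
    proof (rule invol)
      fix \<phi> :: "bits \<Rightarrow> complex" and u :: bits assume u: "length u = length s"
      have i: "i < length u" using assms H u by simp
      have "apply_gate g (apply_gate g \<phi>) u
        = (if u ! i then (\<phi> (u[i := True])) else \<phi> (u[i := False])) * 2 / (?s * ?s)"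
        unfolding H using i by (simp add: field_simps)
      also have "\<dots> = \<phi> u" unfolding ss by (cases "u ! i") (simp_all, (metis list_update_id)+)
      finally show "apply_gate g (apply_gate g \<phi>) u = \<phi> u" .
    qed
  next
    case (T i)
    have "apply_gate g = (\<lambda>\<psi> s. (if s ! i then cis (pi / 4) else 1) * \<psi> s)" by (simp add: T fun_eq_iff)
    then show ?thesis using c8(1) by (simp add: diag)
  next
    case (Tinv i)
    have "apply_gate g = (\<lambda>\<psi> s. (if s ! i then cis (- pi / 4) else 1) * \<psi> s)" by (simp add: Tinv fun_eq_iff)
    then show ?thesis using c8(2) by (simp add: diag)
  qed (rule invol, use assms in \<open>auto simp: apply_classical_gate classical_action_invol\<close>)+
qed

lemma run_gates_replicate: "run_gates (replicate n g) \<psi> = (apply_gate g ^^ n) \<psi>"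
  by (induction n arbitrary: \<psi>) (auto simp: run_gates_Cons funpow_swap1)

lemma inverse_gates_Cons: "inverse_gates (g # gs) = inverse_gates gs @ replicate 7 g"
  by (simp add: inverse_gates_def)

lemma run_inverse_gates:
  "wf_gates (length s) gs \<Longrightarrow> run_gates (inverse_gates gs) (run_gates gs \<psi>) s = \<psi> s"
proof (induction gs arbitrary: \<psi> s)
  case (Cons g gs)
  have "run_gates (inverse_gates (g # gs)) (run_gates (g # gs) \<psi>) s
     = run_gates (replicate 7 g) (apply_gate g \<psi>) s"
    unfolding inverse_gates_Cons run_gates_append run_gates_Cons
    by (rule run_gates_cong) (use Cons in auto)
  also have "\<dots> = (apply_gate g ^^ 8) \<psi> s"
    unfolding run_gates_replicate by (simp add: numeral_eq_Suc)
  also have "\<dots> = \<psi> s" by (rule apply_gate_order_8) (use Cons.prems in auto)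
  finally show ?case .
qed (simp add: inverse_gates_def)

lemma run_gates_inverse:
  "wf_gates (length s) gs \<Longrightarrow> run_gates gs (run_gates (inverse_gates gs) \<psi>) s = \<psi> s"
proof (induction gs arbitrary: \<psi> s)
  case (Cons g gs)
  have "run_gates (g # gs) (run_gates (inverse_gates (g # gs)) \<psi>) s
     = run_gates gs ((apply_gate g ^^ 8) (run_gates (inverse_gates gs) \<psi>)) s"
    unfolding inverse_gates_Cons run_gates_append run_gates_Cons run_gates_replicate
    by (simp add: numeral_eq_Suc)
  also have "\<dots> = run_gates gs (run_gates (inverse_gates gs) \<psi>) s"
    by (rule run_gates_cong, rule apply_gate_order_8) (use Cons.prems in auto)
  also have "\<dots> = \<psi> s" using Cons by simp
  finally show ?case .
qed (simp add: inverse_gates_def)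

subsection \<open>Superpositions of basis states\<close>

definition ket :: "bits \<Rightarrow> bits \<Rightarrow> complex" where "ket a u = (if u = a then 1 else 0)"

text \<open>With \<open>F\<close> inserting fixed strings around its argument, this embeds a state
  of a few wires into a state of all wires of a circuit.\<close>

definition superpos :: "'i set \<Rightarrow> ('i \<Rightarrow> complex) \<Rightarrow> ('i \<Rightarrow> bits) \<Rightarrow> bits \<Rightarrow> complex" where
  "superpos I \<alpha> F = (\<lambda>u. \<Sum>i\<in>I. \<alpha> i * ket (F i) u)"

lemma run_superpos: "run_gates gs (superpos I \<alpha> F) = (\<lambda>u. \<Sum>i\<in>I. \<alpha> i * run_gates gs (ket (F i)) u)"
  unfolding superpos_def by (rule run_gates_sum)

lemma superpos_cong:
  "(\<And>i. i \<in> I \<Longrightarrow> \<alpha> i = \<beta> i) \<Longrightarrow> (\<And>i. i \<in> I \<Longrightarrow> F i = G i) \<Longrightarrow> superpos I \<alpha> F = superpos I \<beta> G"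
  unfolding superpos_def by (auto simp: fun_eq_iff intro!: sum.cong)

lemma run_ket_classical:
  assumes "wf_gates W gs" "classical_gates gs"
  shows "run_gates gs (ket a) = ket (act gs a)"
  using act_rev[OF assms(1)] act_rev'[OF assms(1)]
  by (auto simp: run_classical_gates[OF assms(2)] ket_def fun_eq_iff)

lemma run_superpos_classical:
  assumes "wf_gates W gs" "classical_gates gs"
  shows "run_gates gs (superpos I \<alpha> F) = superpos I \<alpha> (\<lambda>i. act gs (F i))"
  unfolding run_superpos run_ket_classical[OF assms] unfolding superpos_def ..

lemma superpos_block:
  "superpos (bitstrings w) \<alpha> (\<lambda>g. a @ g @ c) u =
     (if length u = length a + w + length c \<and> take (length a) u = a \<and> drop (length a + w) u = c
      then \<alpha> (take w (drop (length a) u)) else 0)"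
proof -
  have *: "u = a @ g @ c \<longleftrightarrow> length u = length a + w + length c \<and> take (length a) u = a
     \<and> drop (length a + w) u = c \<and> g = take w (drop (length a) u)" if "length g = w" for g
  proof
    assume r: "length u = length a + w + length c \<and> take (length a) u = a
     \<and> drop (length a + w) u = c \<and> g = take w (drop (length a) u)"
    have "u = take (length a) u @ take w (drop (length a) u) @ drop w (drop (length a) u)"
      by (metis append_take_drop_id)
    with r show "u = a @ g @ c" by (simp add: add.commute)
  qed (use that in auto)
  show ?thesis
  proof (cases "length u = length a + w + length c \<and> take (length a) u = a \<and> drop (length a + w) u = c")
    case True
    then have "superpos (bitstrings w) \<alpha> (\<lambda>g. a @ g @ c) u
       = \<alpha> (take w (drop (length a) u)) * ket (a @ take w (drop (length a) u) @ c) u"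
      unfolding superpos_def by (intro sum_bitstrings_single) (auto simp: ket_def *)
    with True show ?thesis by (simp add: ket_def *)
  next
    case False
    then show ?thesis unfolding superpos_def by (auto simp: ket_def * intro!: sum.neutral)
  qed
qed

lemma superpos_block_at:
  "length g = w \<Longrightarrow> length a' = length a \<Longrightarrow>
   superpos (bitstrings w) \<alpha> (\<lambda>g. a @ g @ c) (a' @ g @ c') = (if a' = a \<and> c' = c then \<alpha> g else 0)"
  by (auto simp: superpos_block)

text \<open>The workhorse for subcircuits: gates on a block act on the amplitudes alone, while the
  surrounding strings \<open>a\<close> and \<open>c\<close> stay as they are.\<close>

lemma run_superpos_block:
  assumes "wf_gates w gs" "k = length a"
  shows "run_gates (shift k gs) (superpos (bitstrings w) \<alpha> (\<lambda>g. a @ g @ c))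
       = superpos (bitstrings w) (run_gates gs \<alpha>) (\<lambda>g. a @ g @ c)"
proof
  fix u
  show "run_gates (shift k gs) (superpos (bitstrings w) \<alpha> (\<lambda>g. a @ g @ c)) u
       = superpos (bitstrings w) (run_gates gs \<alpha>) (\<lambda>g. a @ g @ c) u"
  proof (cases "length u = length a + w + length c")
    case False
    have "run_gates (shift k gs) (superpos (bitstrings w) \<alpha> (\<lambda>g. a @ g @ c)) u = run_gates (shift k gs) (\<lambda>_. 0) u"
      by (rule run_gates_cong) (use False in \<open>auto simp: superpos_block\<close>)
    with False show ?thesis by (simp add: superpos_block run_gates_0)
  next
    case True
    define a' b' c' where "a' = take (length a) u" "b' = take w (drop (length a) u)" "c' = drop (length a + w) u"
    have u: "u = a' @ b' @ c'" unfolding a'_b'_c'_def by (metis add.commute append_take_drop_id drop_drop)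
    have len: "length a' = length a" "length b' = w" "length c' = length c"
      using True by (auto simp: a'_b'_c'_def)
    have "run_gates (shift k gs) (superpos (bitstrings w) \<alpha> (\<lambda>g. a @ g @ c)) u
       = run_gates gs (\<lambda>g. superpos (bitstrings w) \<alpha> (\<lambda>g. a @ g @ c) (a' @ g @ c')) b'"
      unfolding u by (rule run_gates_shift) (use len assms in auto)
    also have "\<dots> = run_gates gs (if a' = a \<and> c' = c then \<alpha> else (\<lambda>_. 0)) b'"
      by (rule run_gates_cong) (use len in \<open>auto simp: superpos_block_at\<close>)
    also have "\<dots> = superpos (bitstrings w) (run_gates gs \<alpha>) (\<lambda>g. a @ g @ c) u"
      unfolding u using len by (simp add: superpos_block_at run_gates_0)
    finally show ?thesis .
  qed
qed

lemma sqnorm_superpos_block: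
  "W = length a + w + length c \<Longrightarrow> sqnorm W (superpos (bitstrings w) \<alpha> (\<lambda>g. a @ g @ c)) = sqnorm w \<alpha>"
proof -
  assume W: "W = length a + w + length c"
  have "sqnorm W (superpos (bitstrings w) \<alpha> (\<lambda>g. a @ g @ c))
      = (\<Sum>a'\<in>bitstrings (length a). \<Sum>g\<in>bitstrings w. \<Sum>c'\<in>bitstrings (length c).
          if a' = a \<and> c' = c then (cmod (\<alpha> g))\<^sup>2 else 0)"
    unfolding sqnorm_def W add.assoc sum_bitstrings_append
    by (intro sum.cong refl) (auto simp: superpos_block_at)
  also have "\<dots> = (\<Sum>g\<in>bitstrings w. \<Sum>c'\<in>bitstrings (length c). if c' = c then (cmod (\<alpha> g))\<^sup>2 else 0)"
    by (subst sum_bitstrings_single[of a]) (auto intro!: sum.neutral)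
  also have "\<dots> = sqnorm w \<alpha>" unfolding sqnorm_def
    by (intro sum.cong refl) (subst sum_bitstrings_single[of c], auto)
  finally show ?thesis .
qed

subsection \<open>Hadamard layers\<close>

definition sign :: "bool \<Rightarrow> complex" where "sign b = (if b then - 1 else 1)"

lemma cmod_sign [simp]: "cmod (sign b) = 1" by (auto simp: sign_def)

text \<open>The Walsh-Hadamard transform of the first \<open>n\<close> wires. The family appends its
  gates, so the induction treats the last of these wires as the new one.\<close>

lemma run_hadamard_layer:
  "length a = n \<Longrightarrow> run_gates (gate_family n (H 0)) \<psi> (a @ c)
     = (\<Sum>a'\<in>bitstrings n. sign (parity (band a a')) * \<psi> (a' @ c)) / complex_of_real (sqrt 2) ^ n"
proof (induction n arbitrary: a c)
  case 0
  then show ?case by (simp add: bitstrings_0 sign_def)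
next
  case (Suc n)
  obtain x b where a: "a = x @ [b]" "length x = n" using Suc.prems by (rule snoc_lengthE)
  let ?s = "complex_of_real (sqrt 2)" and ?f = "run_gates (gate_family n (H 0)) \<psi>"
  have "run_gates (gate_family (Suc n) (H 0)) \<psi> (a @ c) = (?f (x @ [False] @ c) + sign b * ?f (x @ [True] @ c)) / ?s"
    using a by (simp add: gate_family_Suc run_gates_append run_gates_Cons list_update_append sign_def nth_append)
  also have "\<dots> = (\<Sum>a'\<in>bitstrings n. sign (parity (band x a')) * \<psi> (a' @ [False] @ c)
       + sign b * (sign (parity (band x a')) * \<psi> (a' @ [True] @ c))) / ?s ^ Suc n"
    unfolding Suc.IH[OF a(2)] by (simp add: sum.distrib sum_distrib_left add_divide_distrib mult_ac)
  also have "\<dots> = (\<Sum>a'\<in>bitstrings (Suc n). sign (parity (band a a')) * \<psi> (a' @ c)) / ?s ^ Suc n"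
    unfolding Suc_eq_plus1 sum_bitstrings_append sum_bitstrings_1[unfolded One_nat_def[symmetric]]
    by (intro arg_cong2[where f = "(/)"] sum.cong refl) (use a in \<open>auto simp: sign_def\<close>)
  finally show ?case .
qed

subsection \<open>Mixed states as sums of vectors\<close>

lemma amp_eq: "amp C s = run_gates (gates C) (ket (pad C s))"
  unfolding amp_def run_gates_def ket_def ..

lemma pad_eq: "pad C s = s @ zeros (wires C - length s)" by (simp add: pad_def)

definition evolve_vec :: "circuit \<Rightarrow> nat \<Rightarrow> (bits \<Rightarrow> complex) \<Rightarrow> bits \<Rightarrow> complex" where
  "evolve_vec C i \<psi> = run_gates (gates C) (superpos (bitstrings i) \<psi> (pad C))"

lemma evolve_vec_amp: "evolve_vec C i \<psi> u = (\<Sum>s\<in>bitstrings i. amp C s u * \<psi> s)"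
  unfolding evolve_vec_def run_superpos amp_eq by (simp add: mult.commute)

lemma sqnorm_evolve_vec:
  assumes "wf_gates (wires C) (gates C)" "i \<le> wires C"
  shows "sqnorm (wires C) (evolve_vec C i \<psi>) = sqnorm i \<psi>"
proof -
  have "superpos (bitstrings i) \<psi> (pad C) = superpos (bitstrings i) \<psi> (\<lambda>g. [] @ g @ zeros (wires C - i))"
    by (rule superpos_cong) (auto simp: pad_eq)
  then show ?thesis unfolding evolve_vec_def
    using assms by (simp add: sqnorm_run_gates sqnorm_superpos_block del: append_Nil)
qed

text \<open>A decomposition of \<open>\<rho>\<close> into unnormalised pure states. Entries at
  strings of other lengths are left free, since a \<open>qstate\<close> is a function on all
  lists.\<close>

definition gram :: "nat \<Rightarrow> 'j set \<Rightarrow> ('j \<Rightarrow> bits \<Rightarrow> complex) \<Rightarrow> qstate \<Rightarrow> bool" where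
  "gram q J \<psi> \<rho> \<longleftrightarrow> (\<forall>s\<in>bitstrings q. \<forall>t\<in>bitstrings q. \<rho> s t = (\<Sum>j\<in>J. \<psi> j s * cnj (\<psi> j t)))"

lemma evolve_gram:
  assumes "gram i J \<psi> \<rho>"
  shows "evolve C i \<rho> u v = (\<Sum>j\<in>J. evolve_vec C i (\<psi> j) u * cnj (evolve_vec C i (\<psi> j) v))"
proof -
  have "evolve C i \<rho> u v = (\<Sum>s\<in>bitstrings i. \<Sum>t\<in>bitstrings i. \<Sum>j\<in>J.
      (amp C s u * \<psi> j s) * cnj (amp C t v * \<psi> j t))"
    unfolding evolve_def using assms[unfolded gram_def]
    by (intro sum.cong refl) (auto simp: sum_distrib_left sum_distrib_right mult_ac)
  also have "\<dots> = (\<Sum>j\<in>J. \<Sum>s\<in>bitstrings i. \<Sum>t\<in>bitstrings i. (amp C s u * \<psi> j s) * cnj (amp C t v * \<psi> j t))"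
    by (rule trans[OF sum.cong[OF refl sum.swap] sum.swap])
  also have "\<dots> = (\<Sum>j\<in>J. evolve_vec C i (\<psi> j) u * cnj (evolve_vec C i (\<psi> j) v))"
    by (simp add: evolve_vec_amp sum_product cnj_sum)
  finally show ?thesis .
qed

lemma branch_gram:
  assumes "gram i J \<psi> \<rho>"
  shows "branch C i q \<rho> z s t = (\<Sum>j\<in>J. \<Sum>u\<in>bitstrings (wires C - (length z + q)).
     evolve_vec C i (\<psi> j) (z @ s @ u) * cnj (evolve_vec C i (\<psi> j) (z @ t @ u)))"
  unfolding branch_def evolve_gram[OF assms] by (rule sum.swap)

lemma outcome_prob_gram:
  assumes "gram i J \<psi> \<rho>"
  shows "outcome_prob C i q \<rho> z = (\<Sum>j\<in>J. \<Sum>s\<in>bitstrings q. \<Sum>u\<in>bitstrings (wires C - (length z + q)).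
     (cmod (evolve_vec C i (\<psi> j) (z @ s @ u)))\<^sup>2)"
proof -
  have *: "complex_of_real (\<Sum>j\<in>J. \<Sum>s\<in>bitstrings q. \<Sum>u\<in>bitstrings (wires C - (length z + q)).
     (cmod (evolve_vec C i (\<psi> j) (z @ s @ u)))\<^sup>2) = (\<Sum>s\<in>bitstrings q. branch C i q \<rho> z s s)"
    unfolding branch_gram[OF assms] of_real_sum complex_norm_square by (rule sum.swap)
  then show ?thesis unfolding outcome_prob_def qtrace_def by (simp only: Re_complex_of_real flip: *)
qed

text \<open>Summing over all outcomes, kept wires and traced-out wires gives the full squared norm,
  which the unitary circuit preserves.\<close>

lemma sum_outcome_prob:
  assumes "gram i J \<psi> \<rho>" "wf_circuit i (c + q) C"
  shows "(\<Sum>z\<in>bitstrings c. outcome_prob C i q \<rho> z) = (\<Sum>j\<in>J. sqnorm i (\<psi> j))"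
proof -
  have W: "wires C = c + (q + (wires C - (c + q)))" using assms(2) by (simp add: wf_circuit_iff)
  have "(\<Sum>z\<in>bitstrings c. outcome_prob C i q \<rho> z) = (\<Sum>j\<in>J. \<Sum>z\<in>bitstrings c. \<Sum>s\<in>bitstrings q.
     \<Sum>u\<in>bitstrings (wires C - (c + q)). (cmod (evolve_vec C i (\<psi> j) (z @ s @ u)))\<^sup>2)"
    by (rule trans[OF sum.cong[OF refl] sum.swap]) (simp add: outcome_prob_gram[OF assms(1)])
  also have "\<dots> = (\<Sum>j\<in>J. sqnorm (wires C) (evolve_vec C i (\<psi> j)))"
    unfolding sqnorm_def by (subst W) (simp add: sum_bitstrings_append)
  also have "\<dots> = (\<Sum>j\<in>J. sqnorm i (\<psi> j))"
    using assms(2) by (simp add: sqnorm_evolve_vec wf_circuit_iff)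
  finally show ?thesis .
qed

text \<open>The vector counterpart of \<open>with_classical\<close>: a basis state \<open>x\<close>
  tensored with \<open>\<psi>\<close>.\<close>

definition classical_vec :: "bits \<Rightarrow> (bits \<Rightarrow> complex) \<Rightarrow> bits \<Rightarrow> complex" where
  "classical_vec x \<psi> s = (if take (length x) s = x then \<psi> (drop (length x) s) else 0)"

lemma gram_with_classical:
  assumes "gram q J \<psi> \<rho>" "n = length x + q"
  shows "gram n J (\<lambda>j. classical_vec x (\<psi> j)) (with_classical x \<rho>)"
  unfolding gram_def
proof (intro ballI)
  fix s t assume "s \<in> bitstrings n" "t \<in> bitstrings n"
  then have "drop (length x) s \<in> bitstrings q" "drop (length x) t \<in> bitstrings q" using assms(2) by auto
  with assms(1) have eq: "\<rho> (drop (length x) s) (drop (length x) t)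
      = (\<Sum>j\<in>J. \<psi> j (drop (length x) s) * cnj (\<psi> j (drop (length x) t)))" unfolding gram_def by blast
  show "with_classical x \<rho> s t = (\<Sum>j\<in>J. classical_vec x (\<psi> j) s * cnj (classical_vec x (\<psi> j) t))"
  proof (cases "take (length x) s = x \<and> take (length x) t = x")
    case True
    then show ?thesis unfolding with_classical_def classical_vec_def
      by (simp only: if_P simp_thms eq)
  next
    case False
    then have "classical_vec x (\<psi> j) s * cnj (classical_vec x (\<psi> j) t) = 0" for j
      unfolding classical_vec_def by (simp only: de_Morgan_conj) (elim disjE; simp only: if_False mult_zero_left mult_zero_right complex_cnj_zero)
    with False show ?thesis unfolding with_classical_def by (simp only: if_False sum.neutral_const)
  qed
qed

lemma classical_vec_append: "length a = length x \<Longrightarrow> classical_vec x \<psi> (a @ s) = (if a = x then \<psi> s else 0)"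
  by (auto simp: classical_vec_def)

lemma sqnorm_classical_vec: "n = length x + q \<Longrightarrow> sqnorm n (classical_vec x \<psi>) = sqnorm q \<psi>"
  unfolding sqnorm_def
  by (simp add: sum_bitstrings_append classical_vec_append) (subst sum_bitstrings_single[of x], auto simp: classical_vec_append)

lemma superpos_classical_vec:
  assumes "n = length x + q"
  shows "superpos (bitstrings n) (classical_vec x \<psi>) F = superpos (bitstrings q) \<psi> (\<lambda>s. F (x @ s))"
proof
  fix u
  show "superpos (bitstrings n) (classical_vec x \<psi>) F u = superpos (bitstrings q) \<psi> (\<lambda>s. F (x @ s)) u"
    unfolding superpos_def assms sum_bitstrings_append
    by (subst sum_bitstrings_single[of x]) (auto simp: classical_vec_append)
qed

lemma evolve_vec_classical:
  assumes "n = length x + q"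
  shows "evolve_vec C n (classical_vec x \<psi>) = run_gates (gates C) (superpos (bitstrings q) \<psi> (\<lambda>s. pad C (x @ s)))"
  unfolding evolve_vec_def superpos_classical_vec[OF assms] ..

section \<open>The encryption scheme\<close>

text \<open>The secret key has to carry \<open>ek\<close> too, because key generation attaches it to
  the quantum key; the output is thus \<open>ek\<close>, \<open>td\<close>, \<open>ek\<close>. It is
  assembled from \<open>Y\<close> on and swapped to the front. The \<open>e\<close> padding wires
  make the front long enough for the swapped blocks to be disjoint.\<close>

definition setup_circuit :: "nat \<Rightarrow> nat \<Rightarrow> circuit \<Rightarrow> circuit" where
  "setup_circuit e d C = (let Y = wires C + e in
     Circuit (Y + (e + d + e))
      (gates C @ copy_block 0 Y (e + d) @ copy_block 0 (Y + (e + d)) e @ swap_block 0 Y (e + d + e)))"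

text \<open>The output of the inner circuit is quantum and is moved by swaps, whereas
  \<open>ek\<close> is classical and is copied. The \<open>k + e\<close> wires after the input make
  the front as long as the block that is finally swapped there.\<close>

definition kg_circuit :: "nat \<Rightarrow> nat \<Rightarrow> nat \<Rightarrow> circuit \<Rightarrow> circuit" where
  "kg_circuit e d k C = (let Z = d + e + (k + e); Y = Z + wires C in
     Circuit (Y + (k + e))
      (copy_block 0 Z d @ shift Z (gates C) @ swap_block Z Y k @ copy_block d (Y + k) e
        @ swap_block 0 Y (k + e)))"

text \<open>The message bit is at \<open>e\<close>, \<open>x\<close> at \<open>e + 1\<close> and
  \<open>r\<close> at \<open>R\<close>. The offset \<open>E = Y + n + 1\<close> puts the evaluation
  right behind \<open>r\<close> and the masked bit, so the ciphertext is contiguous from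
  \<open>Y\<close>. At \<open>P\<close> the message bit and the products of the bits of
  \<open>x\<close> and \<open>r\<close> are summed up.\<close>

definition enc_gates_circuit :: "nat \<Rightarrow> nat \<Rightarrow> nat \<Rightarrow> circuit \<Rightarrow> circuit" where
  "enc_gates_circuit e n m C =
    (let R = e + 1 + n; Y = R + n + (n + 1 + m); E = Y + n + 1; P = E + wires C in
     Circuit (P + 1 + n)
      (copy_block R Y n @ copy_block 0 E e @ copy_block (e + 1) (E + e) n @ shift E (gates C)
        @ copy_block e P 1 @ gate_family n (Toffoli (e + 1) R (P + 1)) @ gate_family n (CNOT P (Suc P))
        @ copy_block (P + n) (Y + n) 1 @ swap_block 0 Y (n + 1 + m)))"

text \<open>
  Decryption computes \<open>P\<close>, copies the validity bit \<open>v\<close> and the conjunction of \<open>v\<close> with the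
  message bit \<open>p\<close> to fresh wires, uncomputes \<open>P\<close>, and moves the outputs to the front.
\<close>

definition measure_circuit :: "nat \<Rightarrow> nat \<Rightarrow> nat \<Rightarrow> gate list \<Rightarrow> nat \<Rightarrow> nat \<Rightarrow> circuit" where
  "measure_circuit L q W P v p = Circuit (W + (2 + q))
     (P @ [CNOT v W, Toffoli v p (W + 1)] @ inverse_gates P
       @ swap_block L (W + 2) q @ swap_block 0 W (2 + q))"

text \<open>The input of \<open>Inv\<close> is put together at \<open>I\<close>: the image is
  classical and copied, the trapdoor is quantum and swapped in.\<close>

definition load_gates :: "nat \<Rightarrow> nat \<Rightarrow> nat \<Rightarrow> nat \<Rightarrow> gate list" where
  "load_gates n m q I = copy_block (n + 1) I m @ swap_block (n + 1 + m) (I + m) q"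

text \<open>\<open>I\<close> is where the candidate preimage starts and \<open>k\<close> where
  \<open>ek\<close> does. The evaluation at \<open>E\<close> is added to the given image and
  negated, so equality becomes a string of ones, whose conjunction is built from \<open>A\<close>
  and ends on wire \<open>A + m\<close>. At \<open>P\<close> the masked bit is unmasked by the inner
  product of \<open>r\<close> and the candidate, ending on wire \<open>P + n\<close>.\<close>

definition check_gates :: "nat \<Rightarrow> nat \<Rightarrow> nat \<Rightarrow> nat \<Rightarrow> nat \<Rightarrow> nat \<Rightarrow> circuit \<Rightarrow> gate list" where
  "check_gates n m k e I E C =
    (let A = E + wires C; P = A + (1 + m) in
      copy_block k E e @ copy_block I (E + e) n @ shift E (gates C) @ copy_block (n + 1) E m
        @ gate_family m (X E) @ [X A] @ gate_family m (Toffoli E A (Suc A))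
        @ copy_block n P 1 @ gate_family n (Toffoli 0 I (P + 1)) @ gate_family n (CNOT P (Suc P)))"

definition dec_gates :: "nat \<Rightarrow> nat \<Rightarrow> nat \<Rightarrow> nat \<Rightarrow> circuit \<Rightarrow> circuit \<Rightarrow> gate list" where
  "dec_gates n m q e CI CE =
    (let I = n + 1 + m + (q + e) in
      load_gates n m q I @ shift I (gates CI) @ check_gates n m (n + 1 + m + q) e I (I + wires CI) CE)"

text \<open>For other lengths the output bits are read from two extra wires that stay 0, so the
  outcome is a certain rejection.\<close>

definition dec_circuit :: "nat \<Rightarrow> nat \<Rightarrow> nat \<Rightarrow> nat \<Rightarrow> circuit \<Rightarrow> circuit \<Rightarrow> nat \<Rightarrow> circuit" where
  "dec_circuit n m q e CI CE L =
    (if L = n + 1 + m then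
       let A = n + 1 + m + (q + e) + wires CI + wires CE in
       measure_circuit L (q + e) (A + (1 + m) + (1 + n)) (dec_gates n m q e CI CE) (A + m) (A + (1 + m) + n)
     else measure_circuit L (q + e) (L + (q + e) + 2) [] (L + (q + e)) (L + (q + e) + 1))"

text \<open>The \<open>n + n\<close> random bits of encryption are \<open>x\<close> followed by
  \<open>r\<close>.\<close>

definition sde_of :: "tdf \<Rightarrow> sde" where
  "sde_of F = \<lparr>
     pk_len = ek_len F,
     sk_len = (\<lambda>l. td_len F l + ek_len F l),
     qsk_len = (\<lambda>l. qtd_len F l + ek_len F l),
     ct_len = (\<lambda>l. tdf_n F l + 1 + tdf_m F l),
     sde_setup = (\<lambda>l. setup_circuit (ek_len F l) (td_len F l) (tdf_setup F l)),
     sde_setup_rand = tdf_setup_rand F,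
     sde_kg = (\<lambda>l. kg_circuit (ek_len F l) (td_len F l) (tdf_kg_coins F l + qtd_len F l) (tdf_kg F l)),
     sde_kg_coins = tdf_kg_coins F,
     sde_enc = (\<lambda>l. enc_gates_circuit (ek_len F l) (tdf_n F l) (tdf_m F l) (tdf_eval F l)),
     sde_enc_rand = (\<lambda>l. tdf_n F l + tdf_n F l),
     sde_dec = (\<lambda>l. dec_circuit (tdf_n F l) (tdf_m F l) (qtd_len F l) (ek_len F l) (tdf_inv F l) (tdf_eval F l))\<rparr>"

lemma sde_of_simps [simp]:
  "pk_len (sde_of F) = ek_len F"
  "sk_len (sde_of F) l = td_len F l + ek_len F l"
  "qsk_len (sde_of F) l = qtd_len F l + ek_len F l"
  "ct_len (sde_of F) l = tdf_n F l + 1 + tdf_m F l"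
  "sde_setup (sde_of F) l = setup_circuit (ek_len F l) (td_len F l) (tdf_setup F l)"
  "sde_setup_rand (sde_of F) = tdf_setup_rand F"
  "sde_kg (sde_of F) l = kg_circuit (ek_len F l) (td_len F l) (tdf_kg_coins F l + qtd_len F l) (tdf_kg F l)"
  "sde_kg_coins (sde_of F) = tdf_kg_coins F"
  "sde_enc (sde_of F) l = enc_gates_circuit (ek_len F l) (tdf_n F l) (tdf_m F l) (tdf_eval F l)"
  "sde_enc_rand (sde_of F) l = tdf_n F l + tdf_n F l"
  "sde_dec (sde_of F) l = dec_circuit (tdf_n F l) (tdf_m F l) (qtd_len F l) (ek_len F l) (tdf_inv F l) (tdf_eval F l)"
  by (simp_all add: sde_of_def)

subsection \<open>Efficiency\<close>

lemma wf_setup_circuit: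
  assumes "wf_circuit r (e + d) C"
  shows "wf_circuit r (e + (d + e)) (setup_circuit e d C)"
  using assms unfolding wf_circuit_iff setup_circuit_def Let_def
  by (auto intro!: wf_copy_block wf_swap_block intro: wf_gates_mono)

lemma wf_kg_circuit:
  assumes "wf_circuit d k C"
  shows "wf_circuit (d + e) (k + e) (kg_circuit e d k C)"
proof -
  have "k \<le> wires C" "d \<le> wires C" "wf_gates (wires C) (gates C)" using assms by (auto simp: wf_circuit_iff)
  then show ?thesis unfolding wf_circuit_iff kg_circuit_def Let_def
  by (cases "wires C = 0"; cases "d = 0")
    (auto intro!: wf_copy_block wf_swap_block wf_gates_shift[of "wires C"])
qed

lemma wf_enc_gates_circuit:
  assumes "wf_circuit (e + n) m C"
  shows "wf_circuit (e + 1 + (n + n)) (n + 1 + m) (enc_gates_circuit e n m C)"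
  using assms unfolding wf_circuit_iff enc_gates_circuit_def Let_def
  by (auto intro!: wf_copy_block wf_swap_block wf_gate_family wf_gates_shift[of "wires C"])

lemma wf_measure_circuit:
  assumes "wf_gates W P" "v < W" "p < W" "v \<noteq> p" "L + q \<le> W" "2 + q \<le> W"
  shows "wf_circuit (L + q) (2 + q) (measure_circuit L q W P v p)"
  using assms unfolding wf_circuit_iff measure_circuit_def
  by (auto simp: wf_inverse_gates intro!: wf_swap_block intro: wf_gates_mono[of W])

lemma wf_load_gates: "I + m + q \<le> W \<Longrightarrow> n + 1 + m + q \<le> I \<Longrightarrow> wf_gates W (load_gates n m q I)"
  unfolding load_gates_def by (auto intro!: wf_copy_block wf_swap_block)

lemma wf_check_gates:
  assumes "wf_circuit (e + n) m C" "E + wires C + (1 + m) + (1 + n) \<le> W" "n + 1 + m \<le> I" "k + e \<le> I" "I + n \<le> E"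
  shows "wf_gates W (check_gates n m k e I E C)"
  using assms unfolding wf_circuit_iff check_gates_def Let_def
  by (auto intro!: wf_copy_block wf_swap_block wf_gate_family wf_gates_shift[of "wires C"])

lemma wf_dec_gates:
  assumes "wf_circuit (m + q) (n + q) CI" "wf_circuit (e + n) m CE"
  shows "wf_gates (n + 1 + m + (q + e) + wires CI + wires CE + (1 + m) + (1 + n)) (dec_gates n m q e CI CE)"
  using assms unfolding dec_gates_def Let_def
  by (auto intro!: wf_load_gates wf_check_gates wf_gates_shift[of "wires CI"] simp: wf_circuit_iff)

lemma wf_dec_circuit:
  assumes "wf_circuit (m + q) (n + q) CI" "wf_circuit (e + n) m CE"
  shows "wf_circuit (L + (q + e)) (2 + (q + e)) (dec_circuit n m q e CI CE L)"
proof (cases "L = n + 1 + m")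
  case True
  then show ?thesis unfolding dec_circuit_def Let_def if_P[OF True]
    by (intro wf_measure_circuit wf_dec_gates assms) auto
next
  case False
  then show ?thesis unfolding dec_circuit_def if_not_P[OF False]
    by (intro wf_measure_circuit) auto
qed

lemma classical_append:
  "classical_gates (fs @ gs) \<longleftrightarrow> classical_gates fs \<and> classical_gates gs" by auto

lemma classical_setup_circuit: "classical_circuit C \<Longrightarrow> classical_circuit (setup_circuit e d C)"
  unfolding classical_circuit_def setup_circuit_def Let_def by (simp only: circuit.sel classical_append) simp

lemma classical_enc_gates_circuit: "classical_circuit C \<Longrightarrow> classical_circuit (enc_gates_circuit e n m C)"
  unfolding classical_circuit_def enc_gates_circuit_def Let_def
  by (simp only: circuit.sel classical_append classical_shift)
    (intro conjI classical_copy_block classical_swap_block classical_family classical_gate.simps(2)[THEN iffD2]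
      classical_gate.simps(3)[THEN iffD2]; simp)

lemmas ptime_circuit_intros =
  pcirc_Circuit pgates_append pgates_Cons pgates_Nil ptime_gates pgates_shift pgates_family
  pgates_inverse pgates_copy_block pgates_swap_block pnat_add pnat_Suc pnat_const pnat_wires pgates_gates

lemma sde_efficient_sde_of:
  assumes "tdf_efficient F"
  shows "sde_efficient 1 (sde_of F)"
proof -
  have len: "pnat unary (tdf_n F)" "pnat unary (tdf_m F)" "pnat unary (ek_len F)" "pnat unary (td_len F)"
    "pnat unary (qtd_len F)" "pnat unary (tdf_setup_rand F)" "pnat unary (tdf_kg_coins F)"
    using assms unfolding tdf_efficient_def poly_length_iff by auto
  have circ: "pcirc unary (tdf_setup F)" "pcirc unary (tdf_kg F)" "pcirc unary (tdf_eval F)" "pcirc unary (tdf_inv F)"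
    using assms unfolding tdf_efficient_def uniform_family_iff by auto
  have wf: "classical_circuit (tdf_setup F l)" "classical_circuit (tdf_eval F l)"
     "wf_circuit (tdf_setup_rand F l) (ek_len F l + td_len F l) (tdf_setup F l)"
     "wf_circuit (td_len F l) (tdf_kg_coins F l + qtd_len F l) (tdf_kg F l)"
     "wf_circuit (ek_len F l + tdf_n F l) (tdf_m F l) (tdf_eval F l)"
     "wf_circuit (tdf_m F l + qtd_len F l) (tdf_n F l + qtd_len F l) (tdf_inv F l)" for l
    using assms unfolding tdf_efficient_def by auto
  have "\<forall>f \<in> {pk_len (sde_of F), sk_len (sde_of F), qsk_len (sde_of F), ct_len (sde_of F),
      sde_setup_rand (sde_of F), sde_kg_coins (sde_of F), sde_enc_rand (sde_of F)}. poly_length f"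
    unfolding poly_length_iff
    unfolding sde_of_def sde.simps by (intro ballI, elim insertE emptyE; hypsubst) (intro len pnat_add pnat_const)+
  moreover have "\<forall>C \<in> {sde_setup (sde_of F), sde_kg (sde_of F), sde_enc (sde_of F)}. uniform_family C"
    unfolding uniform_family_iff
    by (auto simp only: sde_of_simps setup_circuit_def kg_circuit_def enc_gates_circuit_def Let_def insert_iff empty_iff
        intro!: ptime_circuit_intros len circ)
  moreover have "uniform_family2 (sde_dec (sde_of F))"
  proof -
    let ?inp = "\<lambda>p. Cns (unary (fst p)) (unary (snd p))"
    have fst: "ptime ?inp (\<lambda>p. unary (fst p))" and snd: "ptime ?inp (\<lambda>p. unary (snd p))"
      using ptime_hd[OF ptime_id, of ?inp] ptime_tl[OF ptime_id, of ?inp] by simp_all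
    \<comment> \<open>Everything computable from the security parameter alone is pulled back along
      the first component, as the decryption family has the ciphertext length as a second
      argument.\<close>
    have lift: "ptime ?inp (\<lambda>p. g (fst p))" if "ptime unary g" for g
      by (rule ptime_trans[OF fst ptime_reindex[OF that, of fst]])
    have "pcirc ?inp (\<lambda>p. sde_dec (sde_of F) (fst p) (snd p))"
      unfolding sde_of_simps dec_circuit_def if_distrib[of enc_circuit] Let_def measure_circuit_def
        dec_gates_def load_gates_def check_gates_def
      by (intro ptime_if_eq ptime_circuit_intros snd len[THEN lift] circ[THEN lift])
    then have "poly_time ?inp (\<lambda>p. enc_circuit (sde_dec (sde_of F) (fst p) (snd p)))"
      by (rule ptime_imp_poly_time)
    then show ?thesis unfolding uniform_family2_def by (simp only: case_prod_unfold)
  qed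
  moreover have "\<forall>l. classical_circuit (sde_setup (sde_of F) l) \<and> classical_circuit (sde_enc (sde_of F) l) \<and>
        wf_circuit (sde_setup_rand (sde_of F) l) (pk_len (sde_of F) l + sk_len (sde_of F) l) (sde_setup (sde_of F) l) \<and>
        wf_circuit (sk_len (sde_of F) l) (sde_kg_coins (sde_of F) l + qsk_len (sde_of F) l) (sde_kg (sde_of F) l) \<and>
        wf_circuit (pk_len (sde_of F) l + 1 + sde_enc_rand (sde_of F) l) (ct_len (sde_of F) l) (sde_enc (sde_of F) l) \<and>
        (\<forall>L. wf_circuit (L + qsk_len (sde_of F) l) (Suc 1 + qsk_len (sde_of F) l) (sde_dec (sde_of F) l L))"
  proof (intro allI conjI)
    fix l
    show "wf_circuit (sk_len (sde_of F) l) (sde_kg_coins (sde_of F) l + qsk_len (sde_of F) l) (sde_kg (sde_of F) l)"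
      using wf_kg_circuit[OF wf(4)] by (simp add: add.assoc)
    show "wf_circuit (pk_len (sde_of F) l + 1 + sde_enc_rand (sde_of F) l) (ct_len (sde_of F) l) (sde_enc (sde_of F) l)"
      using wf_enc_gates_circuit[OF wf(5)] by simp
    fix L
    show "wf_circuit (L + qsk_len (sde_of F) l) (Suc 1 + qsk_len (sde_of F) l) (sde_dec (sde_of F) l L)"
      using wf_dec_circuit[OF wf(6,5)] by simp
  qed (use wf wf_setup_circuit in \<open>simp_all add: classical_setup_circuit classical_enc_gates_circuit\<close>)
  ultimately show ?thesis unfolding sde_efficient_def by blast
qed

subsection \<open>Keys\<close>

lemma run_classical_act: "run_classical C j s = take j (act (gates C) (pad C s))"
  by (simp add: run_classical_def act_def)

lemma append_take_drop: "take n s @ drop n s @ r = s @ r"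
  by (simp flip: append_assoc)

lemma run_setup_circuit:
  assumes wf: "wf_circuit r (e + d) C" and u: "length u = r"
  shows "run_classical (setup_circuit e d C) (e + (d + e)) u
    = (let k = run_classical C (e + d) u in take e k @ drop e k @ take e k)"
proof -
  define s where "s = act (gates C) (pad C u)"
  have len: "r \<le> wires C" "e + d \<le> wires C" "wf_gates (wires C) (gates C)" using wf by (auto simp: wf_circuit_iff)
  have ls: "length s = wires C" using u len by (simp add: s_def pad_eq)
  define ek td R where "ek = take e s" and "td = take d (drop e s)" and "R = drop (e + d) s"
  have s: "s = ek @ td @ R" unfolding ek_def td_def R_def
    by (metis add.commute append_take_drop_id drop_drop)
  have lek: "length ek = e" "length td = d" "length R + (e + d) = wires C"
    using ls len by (auto simp: ek_def td_def R_def)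
  have k: "run_classical C (e + d) u = ek @ td" unfolding run_classical_act s_def[symmetric] using s lek by simp
  let ?Y = "wires C + e"
  have "wires C + e + (e + d + e) - r = (wires C - r) + (e + (e + d) + e)" using len by simp
  then have "pad (setup_circuit e d C) u = pad C u @ zeros e @ zeros (e + d) @ zeros e"
    using u unfolding pad_eq setup_circuit_def Let_def by (simp only: circuit.sel replicate_add append_assoc)
  then have 1: "act (gates C) (pad (setup_circuit e d C) u) = s @ zeros e @ zeros (e + d) @ zeros e"
    using act_prefix[of "pad C u" "gates C" "zeros e @ zeros (e + d) @ zeros e"] len u by (simp add: s_def pad_eq)
  have 2: "act (copy_block 0 ?Y (e + d)) (s @ zeros e @ zeros (e + d) @ zeros e)
      = s @ zeros e @ ek @ td @ zeros e"
    using act_copy_block[of "[]" 0 "ek @ td" "R @ zeros e" ?Y "e + d" "zeros (e + d)" "zeros e"] lek s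
    by simp
  have 3: "act (copy_block 0 (?Y + (e + d)) e) (s @ zeros e @ ek @ td @ zeros e) = s @ zeros e @ ek @ td @ ek"
    using act_copy_block[of "[]" 0 ek "td @ R @ zeros e @ ek @ td" "?Y + (e + d)" e "zeros e" "[]"] lek s
    by simp
  have 4: "act (swap_block 0 ?Y (e + d + e)) (s @ zeros e @ ek @ td @ ek)
     = ek @ td @ ek @ drop (e + d + e) (s @ zeros e) @ take (e + d + e) (s @ zeros e)"
    using act_swap_block[of "[]" 0 "take (e + d + e) (s @ zeros e)" "drop (e + d + e) (s @ zeros e)" ?Y "e + d + e"
      "ek @ td @ ek" "[]"] lek ls len
    by (simp add: append_take_drop del: take_append drop_append take_replicate drop_replicate)
  have "act (gates (setup_circuit e d C)) (pad (setup_circuit e d C) u)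
      = ek @ td @ ek @ drop (e + d + e) (s @ zeros e) @ take (e + d + e) (s @ zeros e)"
    unfolding setup_circuit_def Let_def circuit.sel act_append
    unfolding setup_circuit_def[unfolded Let_def, symmetric] 1 2 3 4 ..
  then show ?thesis unfolding run_classical_act[of "setup_circuit e d C"] k using lek by simp
qed

lemma ket_block: "length s = w \<Longrightarrow> ket (a @ s @ c) = superpos (bitstrings w) (ket s) (\<lambda>g. a @ g @ c)"
  unfolding superpos_def by (rule ext, subst sum_bitstrings_single[of s]) (auto simp: ket_def)

lemma superpos_split:
  assumes "length v = k" "length w' = w" "length b' = length b" "length c' = length c"
  shows "superpos (bitstrings (k + w)) \<alpha> (\<lambda>g. take k g @ b @ drop k g @ c) (v @ b' @ w' @ c')
     = (if b' = b \<and> c' = c then \<alpha> (v @ w') else 0)"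
proof -
  have "superpos (bitstrings (k + w)) \<alpha> (\<lambda>g. take k g @ b @ drop k g @ c) (v @ b' @ w' @ c')
     = \<alpha> (v @ w') * ket (v @ b @ w' @ c) (v @ b' @ w' @ c')"
    unfolding superpos_def
  proof (subst sum_bitstrings_single[of "v @ w'"])
    fix t assume t: "t \<in> bitstrings (k + w)" "t \<noteq> v @ w'"
    have "v @ b' @ w' @ c' \<noteq> take k t @ b @ drop k t @ c"
    proof
      assume "v @ b' @ w' @ c' = take k t @ b @ drop k t @ c"
      then have "v = take k t" "w' = drop k t" using assms t(1) by auto
      with t(2) show False by simp
    qed
    then show "\<alpha> t * ket (take k t @ b @ drop k t @ c) (v @ b' @ w' @ c') = 0" by (simp add: ket_def)
  qed (use assms in auto)
  then show ?thesis using assms by (auto simp: ket_def)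
qed

text \<open>Meant for partial traces over wires whose content is fixed on the whole support of the
  state.\<close>

lemma sum_bitstrings_fixed:
  assumes "n = length b + w + length c"
    and "\<And>b' w' c'. length b' = length b \<Longrightarrow> length w' = w \<Longrightarrow> length c' = length c \<Longrightarrow>
      b' \<noteq> b \<or> c' \<noteq> c \<Longrightarrow> f (b' @ w' @ c') = 0"
  shows "(\<Sum>u\<in>bitstrings n. f u) = (\<Sum>w'\<in>bitstrings w. f (b @ w' @ c))"
proof -
  have "(\<Sum>u\<in>bitstrings n. f u) = (\<Sum>b'\<in>bitstrings (length b). \<Sum>w'\<in>bitstrings w. \<Sum>c'\<in>bitstrings (length c). f (b' @ w' @ c'))"
    unfolding assms(1) add.assoc sum_bitstrings_append ..
  also have "\<dots> = (\<Sum>w'\<in>bitstrings w. \<Sum>c'\<in>bitstrings (length c). f (b @ w' @ c'))"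
    by (rule sum_bitstrings_single) (use assms(2) in \<open>auto intro!: sum.neutral\<close>)
  also have "\<dots> = (\<Sum>w'\<in>bitstrings w. f (b @ w' @ c))"
    by (intro sum.cong refl sum_bitstrings_single) (use assms(2) in auto)
  finally show ?thesis .
qed

text \<open>The leftovers \<open>R1\<close> and \<open>R2\<close> are the same in every branch of
  the superposition. Tracing them out therefore causes no decoherence of the key.\<close>

lemma amp_kg_circuit:
  assumes wf: "wf_circuit d k C" and td: "length td = d" and ek: "length ek = e"
  obtains R1 R2 where "length R1 = d + e" "length R2 = k + e"
    "amp (kg_circuit e d k C) (td @ ek) = superpos (bitstrings (wires C)) (amp C td)
       (\<lambda>g. take k g @ (ek @ R1 @ zeros k) @ drop k g @ R2)"
proof -
  have len: "d \<le> wires C" "k \<le> wires C" "wf_gates (wires C) (gates C)" using wf by (auto simp: wf_circuit_iff)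
  let ?W = "wires C" and ?Z = "d + e + (k + e)"
  let ?Y = "?Z + ?W"
  define A where "A = td @ ek @ zeros (k + e)"
  have lA: "length A = ?Z" using td ek by (simp add: A_def)
  define R1 where "R1 = drop (k + e) A"
  define R2 where "R2 = take (k + e) A"
  have A: "A = R2 @ R1" by (simp add: R1_def R2_def)
  have R: "length R1 = d + e" "length R2 = k + e" using lA by (auto simp: R1_def R2_def)
  have "?Y + (k + e) - (d + e) = (k + e) + (?W + (k + e))" by simp
  then have "pad (kg_circuit e d k C) (td @ ek) = td @ (ek @ zeros (k + e)) @ zeros ?W @ zeros (k + e)"
    using td ek unfolding pad_eq kg_circuit_def Let_def
    by (simp only: circuit.sel replicate_add append_assoc length_append)
  also have "zeros ?W = zeros d @ zeros (?W - d)" using len by (simp flip: replicate_add)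
  finally have pad: "pad (kg_circuit e d k C) (td @ ek) = td @ (ek @ zeros (k + e)) @ zeros d @ zeros (?W - d) @ zeros (k + e)"
    by simp
  have 1: "act (copy_block 0 ?Z d) (pad (kg_circuit e d k C) (td @ ek)) = A @ pad C td @ zeros (k + e)"
    unfolding pad
    using act_copy_block[of "[]" 0 td "ek @ zeros (k + e)" ?Z d "zeros d" "zeros (?W - d) @ zeros (k + e)"] td ek
    by (simp add: A_def pad_eq)
  have lpad: "length (pad C td) = ?W" using td len by (simp add: pad_eq)
  have fin: "act (swap_block ?Z ?Y k @ copy_block d (?Y + k) e @ swap_block 0 ?Y (k + e)) (A @ g @ zeros (k + e))
      = take k g @ (ek @ R1 @ zeros k) @ drop k g @ R2" if g: "length g = ?W" for g
  proof -
    have "act (swap_block ?Z ?Y k) (A @ g @ zeros (k + e)) = A @ zeros k @ drop k g @ take k g @ zeros e"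
      using act_swap_block[of A ?Z "take k g" "drop k g" ?Y k "zeros k" "zeros e"] lA g len
      by (simp add: replicate_add append_take_drop)
    moreover have "act (copy_block d (?Y + k) e) (A @ zeros k @ drop k g @ take k g @ zeros e)
       = A @ zeros k @ drop k g @ take k g @ ek"
      using act_copy_block[of td d ek "zeros (k + e) @ zeros k @ drop k g @ take k g" "?Y + k" e "zeros e" "[]"] td ek g len
      by (simp add: A_def)
    moreover have "act (swap_block 0 ?Y (k + e)) (A @ zeros k @ drop k g @ take k g @ ek)
       = take k g @ (ek @ R1 @ zeros k) @ drop k g @ R2"
      using act_swap_block[of "[]" 0 R2 "R1 @ zeros k @ drop k g" ?Y "k + e" "take k g @ ek" "[]"] R ek g len
      by (simp add: A)
    ultimately show ?thesis by simp
  qed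
  have wfs: "wf_gates (?Y + (k + e)) (copy_block 0 ?Z d)"
    "wf_gates (?Y + (k + e)) (swap_block ?Z ?Y k @ copy_block d (?Y + k) e @ swap_block 0 ?Y (k + e))"
    using wf_kg_circuit[OF wf, of e] unfolding wf_circuit_iff kg_circuit_def Let_def by simp_all
  have cl: "classical_gates (swap_block ?Z ?Y k @ copy_block d (?Y + k) e @ swap_block 0 ?Y (k + e))"
    unfolding classical_append by (intro conjI classical_swap_block classical_copy_block)
  have "amp (kg_circuit e d k C) (td @ ek)
     = run_gates (swap_block ?Z ?Y k @ copy_block d (?Y + k) e @ swap_block 0 ?Y (k + e))
        (run_gates (shift ?Z (gates C)) (run_gates (copy_block 0 ?Z d) (ket (pad (kg_circuit e d k C) (td @ ek)))))"
    unfolding amp_eq by (subst kg_circuit_def) (simp only: Let_def circuit.sel run_gates_append)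
  also have "run_gates (copy_block 0 ?Z d) (ket (pad (kg_circuit e d k C) (td @ ek))) = ket (A @ pad C td @ zeros (k + e))"
    unfolding run_ket_classical[OF wfs(1) classical_copy_block] 1 ..
  also have "\<dots> = superpos (bitstrings ?W) (ket (pad C td)) (\<lambda>g. A @ g @ zeros (k + e))"
    by (rule ket_block[OF lpad])
  also have "run_gates (shift ?Z (gates C)) \<dots> = superpos (bitstrings ?W) (amp C td) (\<lambda>g. A @ g @ zeros (k + e))"
    unfolding amp_eq by (rule run_superpos_block) (use len lA in auto)
  also have "run_gates (swap_block ?Z ?Y k @ copy_block d (?Y + k) e @ swap_block 0 ?Y (k + e)) \<dots>
     = superpos (bitstrings ?W) (amp C td) (\<lambda>g. take k g @ (ek @ R1 @ zeros k) @ drop k g @ R2)"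
    unfolding run_superpos_classical[OF wfs(2) cl] by (rule superpos_cong) (use fin in auto)
  finally show ?thesis using that R by blast
qed

lemma gram_ket: "gram (length x) {()} (\<lambda>_. ket x) (\<lambda>s t. if s = x \<and> t = x then 1 else 0)"
  by (auto simp: gram_def ket_def)

lemma evolve_vec_ket: "evolve_vec C (length x) (ket x) = amp C x"
  by (rule ext) (auto simp: evolve_vec_amp ket_def intro!: trans[OF sum_bitstrings_single[of x]])

abbreviation basis_state :: "bits \<Rightarrow> qstate" where
  "basis_state x \<equiv> (\<lambda>s t. if s = x \<and> t = x then 1 else 0)"

lemma branch_basis_state:
  "branch C (length x) q (basis_state x) z s t =
    (\<Sum>u\<in>bitstrings (wires C - (length z + q)). amp C x (z @ s @ u) * cnj (amp C x (z @ t @ u)))"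
  using branch_gram[OF gram_ket, of C x q z s t] by (simp add: evolve_vec_ket)

text \<open>With the leftovers fixed, the partial trace reduces to that of the inner circuit, and
  the copy of \<open>ek\<close> factors off as a basis state.\<close>

lemma branch_kg_circuit:
  assumes wf: "wf_circuit d (length z + q) C" and td: "length td = d" and ek: "length ek = e"
    and lens: "length s = q" "length t = q" "length e' = e" "length f = e"
  shows "branch (kg_circuit e d (length z + q) C) (length (td @ ek)) (q + e) (basis_state (td @ ek)) z (s @ e') (t @ f)
    = (if e' = ek \<and> f = ek then branch C (length td) q (basis_state td) z s t else 0)"
proof -
  let ?k = "length z + q" and ?W = "wires C"
  have len: "?k \<le> ?W" using wf by (auto simp: wf_circuit_iff)
  obtain R1 R2 where R: "length R1 = d + e" "length R2 = ?k + e"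
    "amp (kg_circuit e d ?k C) (td @ ek) = superpos (bitstrings ?W) (amp C td)
       (\<lambda>g. take ?k g @ (ek @ R1 @ zeros ?k) @ drop ?k g @ R2)"
    by (rule amp_kg_circuit[OF wf td ek])
  have W: "?W = ?k + (?W - ?k)" using len by simp
  define B where "B = R1 @ zeros ?k"
  have lB: "length B = d + e + ?k" using R by (simp add: B_def)
  let ?a = "amp (kg_circuit e d ?k C) (td @ ek)"
  have amp: "?a (z @ s @ e' @ b' @ w' @ c')
     = (if e' = ek \<and> b' = B \<and> c' = R2 then amp C td (z @ s @ w') else 0)"
    if "length s = q" "length e' = e" "length b' = length B" "length w' = ?W - ?k" "length c' = length R2"
    for s e' b' w' c'
    using superpos_split[of "z @ s" ?k w' "?W - ?k" "e' @ b'" "ek @ B" c' R2 "amp C td"] that ek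
    unfolding R(3) B_def[symmetric] W[symmetric] by (simp add: conj_assoc)
  have n: "wires (kg_circuit e d ?k C) - (length z + (q + e)) = length B + (?W - ?k) + length R2"
    using R lB len by (simp add: kg_circuit_def Let_def)
  have "(\<Sum>u\<in>bitstrings (wires (kg_circuit e d ?k C) - (length z + (q + e))).
        ?a (z @ (s @ e') @ u) * cnj (?a (z @ (t @ f) @ u)))
     = (\<Sum>w'\<in>bitstrings (?W - ?k). ?a (z @ (s @ e') @ (B @ w' @ R2)) * cnj (?a (z @ (t @ f) @ (B @ w' @ R2))))"
    by (rule sum_bitstrings_fixed[OF n]) (use lens amp in auto)
  also have "\<dots> = (\<Sum>w'\<in>bitstrings (?W - ?k). if e' = ek \<and> f = ek
       then amp C td (z @ s @ w') * cnj (amp C td (z @ t @ w')) else 0)"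
    by (rule sum.cong) (use lens amp in auto)
  finally show ?thesis unfolding branch_basis_state by auto
qed

lemma outcome_prob_kg_circuit:
  assumes wf: "wf_circuit d (length z + q) C" and td: "length td = d" and ek: "length ek = e"
  shows "outcome_prob (kg_circuit e d (length z + q) C) (length (td @ ek)) (q + e) (basis_state (td @ ek)) z
    = outcome_prob C (length td) q (basis_state td) z"
proof -
  have "(\<Sum>e'\<in>bitstrings e. branch (kg_circuit e d (length z + q) C) (length (td @ ek)) (q + e) (basis_state (td @ ek)) z (s @ e') (s @ e'))
     = branch C (length td) q (basis_state td) z s s" if "length s = q" for s
    by (subst sum_bitstrings_single[of ek])
      (use that in \<open>auto simp: branch_kg_circuit[OF wf td ek] ek simp del: length_append\<close>)
  then show ?thesis unfolding outcome_prob_def qtrace_def sum_bitstrings_append by simp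
qed

text \<open>The index type is fixed to bit strings because an existential cannot range over types;
  the traced-out wires of the sampling circuit provide such indices.\<close>

definition density :: "nat \<Rightarrow> qstate \<Rightarrow> bool" where
  "density q \<kappa> \<longleftrightarrow> (\<exists>(J :: bits set) \<psi>. finite J \<and> gram q J \<psi> \<kappa> \<and> (\<Sum>j\<in>J. sqnorm q (\<psi> j)) = 1)"

definition sample_prob :: "circuit \<Rightarrow> nat \<Rightarrow> nat \<Rightarrow> bits \<Rightarrow> bits \<Rightarrow> real" where
  "sample_prob C c q x z = (if length z = c then outcome_prob C (length x) q (basis_state x) z else 0)"

definition sampled_state :: "circuit \<Rightarrow> nat \<Rightarrow> nat \<Rightarrow> bits \<Rightarrow> bits \<Rightarrow> qstate" where
  "sampled_state C c q x z = (\<lambda>s t. branch C (length x) q (basis_state x) z s t / complex_of_real (sample_prob C c q x z))"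

lemma sample_state_eq:
  "sample_state C c q x = map_pmf (sampled_state C c q x) (embed_pmf (sample_prob C c q x))"
  unfolding sample_state_def Let_def sampled_state_def sample_prob_def ..

lemma outcome_prob_basis_state:
  "outcome_prob C (length x) q (basis_state x) z
     = (\<Sum>s\<in>bitstrings q. \<Sum>u\<in>bitstrings (wires C - (length z + q)). (cmod (amp C x (z @ s @ u)))\<^sup>2)"
  using outcome_prob_gram[OF gram_ket, of C x q z] by (simp add: evolve_vec_ket)

text \<open>\<open>embed_pmf\<close> has its intended meaning only for nonnegative weights with sum
  1; here unitarity supplies this.\<close>

lemma pmf_embed_sample_prob:
  assumes "wf_circuit (length x) (c + q) C"
  shows "pmf (embed_pmf (sample_prob C c q x)) z = sample_prob C c q x z"
proof (rule pmf_embed_pmf)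
  show nn: "0 \<le> sample_prob C c q x z" for z
    unfolding sample_prob_def outcome_prob_basis_state by (auto intro!: sum_nonneg)
  have "sqnorm (length x) (ket x) = 1"
    unfolding sqnorm_def by (subst sum_bitstrings_single[of x]) (auto simp: ket_def)
  then have "(\<Sum>z\<in>bitstrings c. outcome_prob C (length x) q (basis_state x) z) = 1"
    using sum_outcome_prob[OF gram_ket assms] by simp
  then have 1: "(\<Sum>z\<in>bitstrings c. sample_prob C c q x z) = 1" by (simp add: sample_prob_def)
  have "(\<integral>\<^sup>+ z. ennreal (sample_prob C c q x z) \<partial>count_space UNIV) = (\<Sum>z\<in>bitstrings c. ennreal (sample_prob C c q x z))"
    by (rule nn_integral_count_space') (auto simp: sample_prob_def)
  also have "\<dots> = ennreal (\<Sum>z\<in>bitstrings c. sample_prob C c q x z)" using nn by (rule sum_ennreal)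
  finally show "(\<integral>\<^sup>+ z. ennreal (sample_prob C c q x z) \<partial>count_space UNIV) = 1" using 1 by simp
qed

lemma set_embed_sample_prob:
  assumes "wf_circuit (length x) (c + q) C" "z \<in> set_pmf (embed_pmf (sample_prob C c q x))"
  shows "length z = c" "sample_prob C c q x z > 0"
proof -
  have "pmf (embed_pmf (sample_prob C c q x)) z > 0" using assms(2) by (simp add: pmf_positive)
  then show "sample_prob C c q x z > 0" unfolding pmf_embed_sample_prob[OF assms(1)] .
  then show "length z = c" by (auto simp: sample_prob_def split: if_splits)
qed

lemma density_sampled_state:
  assumes wf: "wf_circuit (length x) (c + q) C" and z: "z \<in> set_pmf (embed_pmf (sample_prob C c q x))"
  shows "density q (sampled_state C c q x z)"
proof -
  let ?p = "sample_prob C c q x z" and ?J = "bitstrings (wires C - (length z + q))"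
  note lz = set_embed_sample_prob[OF wf z]
  define \<psi> where "\<psi> u s = amp C x (z @ s @ u) / complex_of_real (sqrt ?p)" for u s
  have pp: "complex_of_real (sqrt ?p) * complex_of_real (sqrt ?p) = complex_of_real ?p"
    using lz(2) by (simp flip: of_real_mult)
  have "gram q ?J \<psi> (sampled_state C c q x z)"
    unfolding gram_def sampled_state_def branch_basis_state \<psi>_def by (simp add: sum_divide_distrib pp)
  moreover have "(\<Sum>u\<in>?J. sqnorm q (\<psi> u)) = 1"
  proof -
    have "(\<Sum>u\<in>?J. sqnorm q (\<psi> u)) = (\<Sum>u\<in>?J. \<Sum>s\<in>bitstrings q. (cmod (amp C x (z @ s @ u)))\<^sup>2) / ?p"
      using lz(2) by (simp add: sqnorm_def \<psi>_def norm_divide power_divide sum_divide_distrib)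
    also have "(\<Sum>u\<in>?J. \<Sum>s\<in>bitstrings q. (cmod (amp C x (z @ s @ u)))\<^sup>2) = ?p"
      unfolding sample_prob_def using lz(1) by (simp add: outcome_prob_basis_state) (rule sum.swap)
    finally show ?thesis using lz(2) by simp
  qed
  ultimately show ?thesis unfolding density_def by (intro exI[of _ ?J] exI[of _ \<psi>]) simp
qed

text \<open>\<open>\<kappa>'\<close> is \<open>\<kappa> \<otimes> |ek\<rangle>\<langle>ek|\<close>.\<close>

definition extends_key :: "nat \<Rightarrow> bits \<Rightarrow> qstate \<Rightarrow> qstate \<Rightarrow> bool" where
  "extends_key q ek \<kappa> \<kappa>' \<longleftrightarrow> (\<forall>s t e' f. length s = q \<longrightarrow> length t = q \<longrightarrow> length e' = length ek \<longrightarrow> length f = length ek \<longrightarrow>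
     \<kappa>' (s @ e') (t @ f) = (if e' = ek \<and> f = ek then \<kappa> s t else 0))"

lemma run_random_map:
  "(\<And>u. length u = r \<Longrightarrow> run_classical C j u = h (run_classical C' j' u)) \<Longrightarrow>
     run_random C r j [] = map_pmf h (run_random C' r j' [])"
  unfolding run_random_def uniform_bits_def by (auto simp: map_pmf_comp intro!: map_pmf_cong)

text \<open>A coupling: both keys arise from the same setup string and the same measurement outcome,
  so facts about trapdoor keys carry over to keys of the scheme pair by pair.\<close>

definition key_pairs :: "tdf \<Rightarrow> nat \<Rightarrow> ((bits \<times> bits \<times> qstate) \<times> (bits \<times> bits \<times> qstate)) pmf" where
  "key_pairs F l =
    (let e = ek_len F l; d = td_len F l; q = qtd_len F l; c = tdf_kg_coins F l in
     bind_pmf (run_random (tdf_setup F l) (tdf_setup_rand F l) (e + d) []) (\<lambda>k.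
       map_pmf (\<lambda>z. ((take e k, drop e k, sampled_state (tdf_kg F l) c q (drop e k) z),
                     (take e k, drop e k @ take e k,
                      sampled_state (kg_circuit e d (c + q) (tdf_kg F l)) c (q + e) (drop e k @ take e k) z)))
        (embed_pmf (sample_prob (tdf_kg F l) c q (drop e k)))))"

lemma key_pairs:
  assumes "tdf_efficient F"
  shows fst_key_pairs: "map_pmf fst (key_pairs F l) = tdf_keys F l"
    and snd_key_pairs: "map_pmf snd (key_pairs F l) = sde_keys (sde_of F) l"
    and set_key_pairs: "((ek, td, \<kappa>), (pk, sk, \<kappa>')) \<in> set_pmf (key_pairs F l) \<Longrightarrow>
      pk = ek \<and> length ek = ek_len F l \<and> density (qtd_len F l) \<kappa> \<and> extends_key (qtd_len F l) ek \<kappa> \<kappa>'"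
    and finite_key_pairs: "finite (set_pmf (key_pairs F l))"
proof -
  let ?e = "ek_len F l" and ?d = "td_len F l" and ?q = "qtd_len F l" and ?c = "tdf_kg_coins F l"
  let ?S = "run_random (tdf_setup F l) (tdf_setup_rand F l) (?e + ?d) []"
  have wf: "wf_circuit (tdf_setup_rand F l) (?e + ?d) (tdf_setup F l)" "wf_circuit ?d (?c + ?q) (tdf_kg F l)"
    using assms unfolding tdf_efficient_def by auto
  have lk: "length k = ?e + ?d" if "k \<in> set_pmf ?S" for k
    using that wf(1) unfolding run_random_def uniform_bits_def
    by (auto simp: run_classical_act pad_eq wf_circuit_iff)
  have S': "run_random (setup_circuit ?e ?d (tdf_setup F l)) (tdf_setup_rand F l) (?e + (?d + ?e)) []
      = map_pmf (\<lambda>k. take ?e k @ drop ?e k @ take ?e k) ?S"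
    by (rule run_random_map) (simp add: run_setup_circuit[OF wf(1)] Let_def)
  show "map_pmf fst (key_pairs F l) = tdf_keys F l"
    unfolding key_pairs_def tdf_keys_def Let_def sample_state_eq
    by (simp add: map_bind_pmf map_pmf_comp)
  \<comment> \<open>Attaching \<open>ek\<close> leaves the outcome probabilities unchanged, so one
    sample of the coins serves both key generators.\<close>
  have pr: "sample_prob (kg_circuit ?e ?d (?c + ?q) (tdf_kg F l)) ?c (?q + ?e) (drop ?e k @ take ?e k)
      = sample_prob (tdf_kg F l) ?c ?q (drop ?e k)" if "length k = ?e + ?d" for k
  proof
    fix z
    have "outcome_prob (kg_circuit ?e ?d (length z + ?q) (tdf_kg F l)) (length (drop ?e k @ take ?e k)) (?q + ?e)
        (basis_state (drop ?e k @ take ?e k)) z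
        = outcome_prob (tdf_kg F l) (length (drop ?e k)) ?q (basis_state (drop ?e k)) z" if "length z = ?c"
      by (rule outcome_prob_kg_circuit) (use wf that \<open>length k = ?e + ?d\<close> in auto)
    then show "sample_prob (kg_circuit ?e ?d (?c + ?q) (tdf_kg F l)) ?c (?q + ?e) (drop ?e k @ take ?e k) z
      = sample_prob (tdf_kg F l) ?c ?q (drop ?e k) z"
      unfolding sample_prob_def by auto
  qed
  show "map_pmf snd (key_pairs F l) = sde_keys (sde_of F) l"
    unfolding key_pairs_def sde_keys_def Let_def sample_state_eq sde_of_simps S' map_bind_pmf bind_map_pmf map_pmf_comp
  proof (rule bind_pmf_cong[OF refl])
    fix k assume "k \<in> set_pmf ?S"
    from lk[OF this] show "map_pmf (\<lambda>z. snd ((take ?e k, drop ?e k, sampled_state (tdf_kg F l) ?c ?q (drop ?e k) z),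
          (take ?e k, drop ?e k @ take ?e k, sampled_state (kg_circuit ?e ?d (?c + ?q) (tdf_kg F l)) ?c (?q + ?e) (drop ?e k @ take ?e k) z)))
        (embed_pmf (sample_prob (tdf_kg F l) ?c ?q (drop ?e k))) =
       map_pmf (\<lambda>z. (take ?e (take ?e k @ drop ?e k @ take ?e k), drop ?e (take ?e k @ drop ?e k @ take ?e k),
          sampled_state (kg_circuit ?e ?d (?c + ?q) (tdf_kg F l)) ?c (?q + ?e) (drop ?e (take ?e k @ drop ?e k @ take ?e k)) z))
        (embed_pmf (sample_prob (kg_circuit ?e ?d (?c + ?q) (tdf_kg F l)) ?c (?q + ?e) (drop ?e (take ?e k @ drop ?e k @ take ?e k))))"
      by (simp add: pr)
  qed
  \<comment> \<open>Finite support makes every real function of the keys integrable.\<close>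
  show "finite (set_pmf (key_pairs F l))"
    unfolding key_pairs_def Let_def set_bind_pmf set_map_pmf
  proof (intro finite_UN_I finite_imageI)
    show "finite (set_pmf ?S)" unfolding run_random_def uniform_bits_def by simp
    fix k assume "k \<in> set_pmf ?S"
    from lk[OF this] have wfk: "wf_circuit (length (drop ?e k)) (?c + ?q) (tdf_kg F l)" using wf by simp
    have "set_pmf (embed_pmf (sample_prob (tdf_kg F l) ?c ?q (drop ?e k))) \<subseteq> bitstrings ?c"
    proof
      fix z assume "z \<in> set_pmf (embed_pmf (sample_prob (tdf_kg F l) ?c ?q (drop ?e k)))"
      from set_embed_sample_prob(1)[OF wfk this] show "z \<in> bitstrings ?c" by (simp only: in_bitstrings)
    qed
    then show "finite (set_pmf (embed_pmf (sample_prob (tdf_kg F l) ?c ?q (drop ?e k))))"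
      by (rule finite_subset) simp
  qed
  assume "((ek, td, \<kappa>), (pk, sk, \<kappa>')) \<in> set_pmf (key_pairs F l)"
  then obtain k z where k: "k \<in> set_pmf ?S" and z: "z \<in> set_pmf (embed_pmf (sample_prob (tdf_kg F l) ?c ?q (drop ?e k)))"
    and ek: "ek = take ?e k" "pk = take ?e k" and \<kappa>: "\<kappa> = sampled_state (tdf_kg F l) ?c ?q (drop ?e k) z"
    and \<kappa>': "\<kappa>' = sampled_state (kg_circuit ?e ?d (?c + ?q) (tdf_kg F l)) ?c (?q + ?e) (drop ?e k @ take ?e k) z"
    unfolding key_pairs_def Let_def by auto
  have wf': "wf_circuit (length (drop ?e k)) (?c + ?q) (tdf_kg F l)" using wf lk[OF k] by simp
  note lz = set_embed_sample_prob[OF wf' z]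
  have "extends_key ?q ek \<kappa> \<kappa>'"
    unfolding extends_key_def
  proof (intro allI impI)
    fix s t e' f :: bits assume l: "length s = ?q" "length t = ?q" "length e' = length ek" "length f = length ek"
    have "branch (kg_circuit ?e ?d (length z + ?q) (tdf_kg F l)) (length (drop ?e k @ ek)) (?q + ?e)
         (basis_state (drop ?e k @ ek)) z (s @ e') (t @ f)
       = (if e' = ek \<and> f = ek then branch (tdf_kg F l) (length (drop ?e k)) ?q (basis_state (drop ?e k)) z s t else 0)"
      by (rule branch_kg_circuit) (use wf lz lk[OF k] l ek in auto)
    then show "\<kappa>' (s @ e') (t @ f) = (if e' = ek \<and> f = ek then \<kappa> s t else 0)"
      unfolding \<kappa> \<kappa>' sampled_state_def pr[OF lk[OF k]] using lz ek by simp
  qed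
  then show "pk = ek \<and> length ek = ?e \<and> density ?q \<kappa> \<and> extends_key ?q ek \<kappa> \<kappa>'"
    using ek lk[OF k] density_sampled_state[OF wf' z] \<kappa> by simp
qed

subsection \<open>Encryption\<close>

lemma last_parity_prefixes: "x \<noteq> [] \<Longrightarrow> last (parity_prefixes x) = parity x"
  by (cases x rule: rev_cases) (auto simp: parity_prefixes_snoc)

lemma run_enc_gates_circuit:
  assumes wf: "wf_circuit (e + n) m C" and lens: "length ek = e" "length x = n" "length r = n"
  shows "run_classical (enc_gates_circuit e n m C) (n + 1 + m) (ek @ [b] @ x @ r)
    = r @ [b \<noteq> parity (band x r)] @ run_classical C m (ek @ x)"
proof -
  have len: "e + n \<le> wires C" "m \<le> wires C" "wf_gates (wires C) (gates C)" using wf by (auto simp: wf_circuit_iff)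
  let ?W = "wires C"
  define R Y E P where "R = e + 1 + n" and "Y = R + n + (n + 1 + m)" and "E = Y + n + 1" and "P = E + ?W"
  define A where "A = ek @ [b] @ x @ r @ zeros (n + 1 + m)"
  have lA: "length A = Y" using lens by (simp add: A_def Y_def R_def)
  define s where "s = act (gates C) (pad C (ek @ x))"
  have ls: "length s = ?W" using lens len by (simp add: s_def pad_eq)
  \<comment> \<open>Running sums of the message bit and the bitwise products of \<open>x\<close> and
    \<open>r\<close>; the last one is the masked bit.\<close>
  define c where "c = parity_prefixes (b # band x r)"
  have lc: "length c = Suc n" using lens by (simp add: c_def)
  have c: "c = butlast c @ [b \<noteq> parity (band x r)]"
  proof -
    have ne: "c \<noteq> []" using lc by auto
    have l: "last c = (b \<noteq> parity (band x r))" unfolding c_def by (simp add: last_parity_prefixes)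
    show ?thesis unfolding l[symmetric] append_butlast_last_id[OF ne] ..
  qed
  have "P + 1 + n - length (ek @ [b] @ x @ r) = (n + 1 + m) + (n + (1 + (e + (n + ((?W - (e + n)) + (1 + n))))))"
    using lens len by (simp add: P_def E_def Y_def R_def)
  then have pad: "pad (enc_gates_circuit e n m C) (ek @ [b] @ x @ r)
     = A @ zeros n @ zeros 1 @ zeros e @ zeros n @ zeros (?W - (e + n)) @ zeros (1 + n)"
    unfolding pad_eq enc_gates_circuit_def Let_def
    by (simp only: circuit.sel R_def[symmetric] Y_def[symmetric] E_def[symmetric] P_def[symmetric]
      replicate_add A_def append_assoc)
  have 1: "act (copy_block R Y n) (A @ zeros n @ zeros 1 @ zeros e @ zeros n @ zeros (?W - (e + n)) @ zeros (1 + n))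
     = A @ r @ zeros 1 @ zeros e @ zeros n @ zeros (?W - (e + n)) @ zeros (1 + n)"
    using act_copy_block[of "ek @ [b] @ x" R r "zeros (n + 1 + m)" Y n "zeros n"
      "zeros 1 @ zeros e @ zeros n @ zeros (?W - (e + n)) @ zeros (1 + n)"] lens
    by (simp add: A_def Y_def R_def)
  have 2: "act (copy_block 0 E e) (A @ r @ zeros 1 @ zeros e @ zeros n @ zeros (?W - (e + n)) @ zeros (1 + n))
     = A @ r @ zeros 1 @ ek @ zeros n @ zeros (?W - (e + n)) @ zeros (1 + n)"
    using act_copy_block[of "[]" 0 ek "[b] @ x @ r @ zeros (n + 1 + m) @ r @ zeros 1" E e "zeros e"
       "zeros n @ zeros (?W - (e + n)) @ zeros (1 + n)"] lens
    by (simp add: A_def E_def Y_def R_def)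
  have 3: "act (copy_block (e + 1) (E + e) n) (A @ r @ zeros 1 @ ek @ zeros n @ zeros (?W - (e + n)) @ zeros (1 + n))
     = A @ r @ zeros 1 @ pad C (ek @ x) @ zeros (1 + n)"
    using act_copy_block[of "ek @ [b]" "e + 1" x "r @ zeros (n + 1 + m) @ r @ zeros 1 @ ek" "E + e" n "zeros n"
       "zeros (?W - (e + n)) @ zeros (1 + n)"] lens
    by (simp add: A_def E_def Y_def R_def pad_eq)
  have 4: "act (shift E (gates C)) (A @ r @ zeros 1 @ pad C (ek @ x) @ zeros (1 + n))
     = A @ r @ zeros 1 @ s @ zeros 1 @ zeros n"
    using act_shift[of "pad C (ek @ x)" "gates C" E "A @ r @ zeros 1" "zeros (1 + n)"] lens len lA
    by (simp add: s_def E_def pad_eq)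
  have 5: "act (copy_block e P 1) (A @ r @ zeros 1 @ s @ zeros 1 @ zeros n)
     = A @ r @ zeros 1 @ s @ [b] @ zeros n"
    using act_copy_block[of ek e "[b]" "x @ r @ zeros (n + 1 + m) @ r @ zeros 1 @ s" P 1 "zeros 1" "zeros n"] lens ls
    by (simp add: A_def P_def E_def Y_def R_def)
  have 6: "act (gate_family n (Toffoli (e + 1) R (P + 1))) (A @ r @ zeros 1 @ s @ [b] @ zeros n)
     = A @ r @ zeros 1 @ s @ (b # band x r)"
    using act_Toffoli_family[of "ek @ [b]" "e + 1" x "[]" R r "zeros (n + 1 + m) @ r @ zeros 1 @ s @ [b]" "P + 1" n "zeros n" "[]"]
      lens ls by (simp add: A_def P_def E_def Y_def R_def)
  have 7: "act (gate_family n (CNOT P (Suc P))) (A @ r @ zeros 1 @ s @ (b # band x r)) = A @ r @ zeros 1 @ s @ c"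
    using act_cascade[of "A @ r @ zeros 1 @ s" P "b # band x r" n "[]"] lens lA ls
    by (simp add: c_def P_def E_def)
  let ?b = "b \<noteq> parity (band x r)"
  have lbc: "length (butlast c) = n" using lc by simp
  have 8: "act (copy_block (P + n) (Y + n) 1) (A @ r @ zeros 1 @ s @ c) = A @ r @ [?b] @ s @ c"
    using act_copy_block_back[of "A @ r" "Y + n" "zeros 1" "s @ butlast c" "P + n" 1 "[?b]" "[]"] lens lA ls lbc c
    by (simp add: P_def E_def)
  have 9: "act (swap_block 0 Y (n + 1 + m)) (A @ r @ [?b] @ s @ c)
     = (r @ [?b] @ take m s) @ drop (n + 1 + m) A @ take (n + 1 + m) A @ drop m s @ c"
    using act_swap_block[of "[]" 0 "take (n + 1 + m) A" "drop (n + 1 + m) A" Y "n + 1 + m" "r @ [?b] @ take m s" "drop m s @ c"]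
      lens lA ls len by (simp add: append_take_drop Y_def R_def)
  have "act (gates (enc_gates_circuit e n m C)) (pad (enc_gates_circuit e n m C) (ek @ [b] @ x @ r))
     = (r @ [?b] @ take m s) @ drop (n + 1 + m) A @ take (n + 1 + m) A @ drop m s @ c"
    unfolding pad
    unfolding enc_gates_circuit_def Let_def circuit.sel R_def[symmetric] Y_def[symmetric] E_def[symmetric] P_def[symmetric] act_append
    unfolding 1 2 3 4 5 6 7 8 9 ..
  then show ?thesis unfolding run_classical_act s_def[symmetric] using lens ls len by simp
qed

lemma expectation_uniform_bits:
  "measure_pmf.expectation (uniform_bits n) f = (\<Sum>s\<in>bitstrings n. f s) / (2 ^ n :: real)"
  unfolding uniform_bits_def by (subst integral_pmf_of_set) (auto simp: card_bitstrings)

subsection \<open>Trace distance after a partial trace\<close>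

lemma basis_string_bij: "bij_betw (basis_string q) {..<2 ^ q} (bitstrings q)"
proof -
  have inj: "inj_on (basis_string q) {..<2 ^ q}"
  proof (rule inj_onI)
    fix i j :: nat assume ij: "i \<in> {..<2 ^ q}" "j \<in> {..<2 ^ q}" and eq: "basis_string q i = basis_string q j"
    show "i = j"
    proof (rule bit_eqI)
      fix k
      show "bit i k = bit j k"
      proof (cases "k < q")
        case True
        then show ?thesis using arg_cong[OF eq, of "\<lambda>s. s ! k"] by (simp add: basis_string_def)
      next
        case False
        then have "(2::nat) ^ q \<le> 2 ^ k" by simp
        then have "i < 2 ^ k" "j < 2 ^ k" using ij by (meson lessThan_iff order_less_le_trans)+
        then show ?thesis by (simp add: bit_iff_odd)
      qed
    qed
  qed
  have "basis_string q ` {..<2 ^ q} \<subseteq> bitstrings q" by (auto simp: basis_string_def)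
  then have "basis_string q ` {..<2 ^ q} = bitstrings q"
    by (rule card_subset_eq[rotated]) (simp_all add: card_image[OF inj] card_bitstrings)
  with inj show ?thesis unfolding bij_betw_def by blast
qed

lemma sum_Times_fst_snd: "(\<Sum>p\<in>A \<times> B. f (fst p) (snd p)) = (\<Sum>x\<in>A. \<Sum>y\<in>B. f x y)"
  by (simp add: sum.cartesian_product case_prod_unfold)

lemma sum_Times_pair: "(\<Sum>x\<in>A. \<Sum>y\<in>B. f (x, y)) = (\<Sum>p\<in>A \<times> B. f p)"
  by (simp add: sum.cartesian_product)

text \<open>Partial traces do not increase the bound: each pair of traced-out strings
  \<open>(c, r)\<close> serves as a further index of rank-one terms in \<open>trace_norm_le\<close>,
  and Cauchy-Schwarz over these pairs recombines the pieces into norms on all \<open>W\<close>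
  wires.\<close>

lemma trace_distance_partial_trace:
  fixes a b :: "'k \<Rightarrow> bits \<Rightarrow> complex"
  assumes K: "finite K" and W: "W = L + (q + M)"
    and dec: "\<And>t t'. length t = q \<Longrightarrow> length t' = q \<Longrightarrow> \<rho> t t' - \<sigma> t t'
      = (\<Sum>k\<in>K. \<Sum>c\<in>bitstrings L. \<Sum>r\<in>bitstrings M. a k (c @ t @ r) * cnj (b k (c @ t' @ r)))"
  shows "trace_distance q \<rho> \<sigma> \<le> (\<Sum>k\<in>K. sqrt (sqnorm W (a k)) * sqrt (sqnorm W (b k))) / 2"
proof -
  let ?I = "K \<times> bitstrings L \<times> bitstrings M" and ?bs = "basis_string q"
  define av where "av = (\<lambda>(k, c, r) i. a k (c @ ?bs i @ r))"
  define bv where "bv = (\<lambda>(k, c, r) i. b k (c @ ?bs i @ r))"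
  define na where "na k p = sqrt (\<Sum>i<2 ^ q. (cmod (av (k, p) i))\<^sup>2)" for k p
  define nb where "nb k p = sqrt (\<Sum>i<2 ^ q. (cmod (bv (k, p) i))\<^sup>2)" for k p
  have lbs: "length (?bs i) = q" for i by (simp add: basis_string_def)
  have sq: "(\<Sum>p\<in>bitstrings L \<times> bitstrings M. \<Sum>i<2 ^ q. (cmod (f (fst p @ ?bs i @ snd p)))\<^sup>2) = sqnorm W f"
    for f :: "bits \<Rightarrow> complex"
  proof -
    have "(\<Sum>p\<in>bitstrings L \<times> bitstrings M. \<Sum>i<2 ^ q. (cmod (f (fst p @ ?bs i @ snd p)))\<^sup>2)
        = (\<Sum>p\<in>bitstrings L \<times> bitstrings M. \<Sum>t\<in>bitstrings q. (cmod (f (fst p @ t @ snd p)))\<^sup>2)"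
      by (intro sum.cong refl sum.reindex_bij_betw[OF basis_string_bij])
    also have "\<dots> = (\<Sum>c\<in>bitstrings L. \<Sum>r\<in>bitstrings M. \<Sum>t\<in>bitstrings q. (cmod (f (c @ t @ r)))\<^sup>2)"
      by (rule sum_Times_fst_snd)
    also have "\<dots> = sqnorm W f" unfolding sqnorm_def W sum_bitstrings_append
      by (intro sum.cong refl sum.swap)
    finally show ?thesis .
  qed
  have "trace_norm (state_matrix q \<rho> - state_matrix q \<sigma>) \<le>
     (\<Sum>k\<in>?I. sqrt (\<Sum>i<2 ^ q. (cmod (av k i))\<^sup>2) * sqrt (\<Sum>i<2 ^ q. (cmod (bv k i))\<^sup>2))"
  proof (rule trace_norm_le)
    fix i j :: nat assume "i < 2 ^ q" "j < 2 ^ q"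
    then show "(state_matrix q \<rho> - state_matrix q \<sigma>) $$ (i, j) = (\<Sum>k\<in>?I. av k i * cnj (bv k j))"
      using dec[OF lbs lbs] by (simp add: state_matrix_def av_def bv_def sum.cartesian_product case_prod_unfold)
  qed (use K in \<open>auto simp: state_matrix_def\<close>)
  also have "\<dots> = (\<Sum>k\<in>K. \<Sum>p\<in>bitstrings L \<times> bitstrings M. \<bar>na k p\<bar> * \<bar>nb k p\<bar>)"
    by (simp add: sum.cartesian_product na_def nb_def case_prod_unfold sum_nonneg)
  also have "\<dots> \<le> (\<Sum>k\<in>K. L2_set (na k) (bitstrings L \<times> bitstrings M) * L2_set (nb k) (bitstrings L \<times> bitstrings M))"
    by (intro sum_mono L2_set_mult_ineq)
  also have "\<dots> = (\<Sum>k\<in>K. sqrt (sqnorm W (a k)) * sqrt (sqnorm W (b k)))"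
    unfolding L2_set_def na_def nb_def av_def bv_def
    by (simp add: sum_nonneg sq case_prod_unfold)
  finally show ?thesis unfolding trace_distance_def by simp
qed

lemma sqnorm_uminus: "sqnorm W (\<lambda>s. - f s) = sqnorm W f"
  by (simp add: sqnorm_def)

subsection \<open>Measuring without disturbance\<close>

text \<open>\<open>L\<close> ciphertext wires are followed by \<open>q\<close> key wires;
  \<open>P\<close> works on \<open>W\<close> wires, with the validity bit on \<open>v\<close> and
  the message bit on \<open>p\<close>.\<close>

locale measurement =
  fixes L q W :: nat and P :: "gate list" and v p :: nat
  assumes wf: "wf_gates W P" and vp: "v < W" "p < W" "v \<noteq> p" and LW: "L + q \<le> W" and qW: "2 + q \<le> W"
begin

text \<open>Masking the message bit by the validity bit gives all rejections the single outcome
  \<open>[False, False]\<close>. An unmasked bit would measure whatever a failed inversion left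
  behind and could disturb the key.\<close>

definition outbits :: "bits \<Rightarrow> bits" where "outbits s = [s ! v, s ! v \<and> s ! p]"

definition start :: "bits \<Rightarrow> (bits \<Rightarrow> complex) \<Rightarrow> bits \<Rightarrow> complex" where
  "start ct \<psi> = superpos (bitstrings q) \<psi> (\<lambda>t. ct @ t @ zeros (W - (L + q)))"

definition computed :: "bits \<Rightarrow> (bits \<Rightarrow> complex) \<Rightarrow> bits \<Rightarrow> complex" where
  "computed ct \<psi> = run_gates P (start ct \<psi>)"

text \<open>The projection that measuring the copied bits induces, conjugated by \<open>P\<close>;
  its squared norm is the probability of \<open>Q\<close>.\<close>

definition post :: "(bits \<Rightarrow> bool) \<Rightarrow> bits \<Rightarrow> (bits \<Rightarrow> complex) \<Rightarrow> bits \<Rightarrow> complex" where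
  "post Q ct \<psi> = run_gates (inverse_gates P) (\<lambda>s. if Q (outbits s) then computed ct \<psi> s else 0)"

abbreviation "circ \<equiv> measure_circuit L q W P v p"

lemma sqnorm_start: "length ct = L \<Longrightarrow> sqnorm W (start ct \<psi>) = sqnorm q \<psi>"
  unfolding start_def by (rule sqnorm_superpos_block) (use LW in simp)

lemma sqnorm_computed: "length ct = L \<Longrightarrow> sqnorm W (computed ct \<psi>) = sqnorm q \<psi>"
  unfolding computed_def by (simp add: sqnorm_run_gates[OF wf] sqnorm_start)

lemma sqnorm_post:
  "sqnorm W (post Q ct \<psi>) = (\<Sum>s | length s = W \<and> Q (outbits s). (cmod (computed ct \<psi> s))\<^sup>2)"
proof -
  have "sqnorm W (post Q ct \<psi>) = (\<Sum>s\<in>bitstrings W. if Q (outbits s) then (cmod (computed ct \<psi> s))\<^sup>2 else 0)"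
    unfolding post_def using wf by (simp add: sqnorm_run_gates wf_inverse_gates) (auto simp: sqnorm_def intro!: sum.cong)
  also have "\<dots> = (\<Sum>s | length s = W \<and> Q (outbits s). (cmod (computed ct \<psi> s))\<^sup>2)"
    by (subst sum.inter_filter[symmetric]) (auto intro!: sum.cong)
  finally show ?thesis .
qed

lemma post_add:
  assumes "\<And>u. (Q u \<longrightarrow> \<not> R u) \<and> (Q u \<or> R u)"
  shows "length s = W \<Longrightarrow> start ct \<psi> s = post Q ct \<psi> s + post R ct \<psi> s"
proof -
  assume s: "length s = W"
  let ?f = "\<lambda>b s. if (if b then Q else R) (outbits s) then computed ct \<psi> s else 0"
  have "post Q ct \<psi> s + post R ct \<psi> s = (\<Sum>b\<in>UNIV. 1 * run_gates (inverse_gates P) (?f b) s)"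
    unfolding post_def UNIV_bool by simp
  also have "\<dots> = run_gates (inverse_gates P) (\<lambda>s. \<Sum>b\<in>UNIV. 1 * ?f b s) s"
    unfolding run_gates_sum ..
  also have "(\<lambda>s. \<Sum>b\<in>UNIV. 1 * ?f b s) = computed ct \<psi>"
    using assms unfolding UNIV_bool by (auto simp: fun_eq_iff)
  also have "run_gates (inverse_gates P) (computed ct \<psi>) s = start ct \<psi> s"
    unfolding computed_def using wf s by (intro run_inverse_gates) simp
  finally show ?thesis by simp
qed

text \<open>\<open>c' @ f @ r\<close> is the working register once the key block at \<open>L\<close>
  has been exchanged for \<open>q\<close> zero wires. The last swap cuts this register after
  \<open>2 + q\<close> wires, regardless of its block structure, hence the second splitting into
  \<open>h\<close> and \<open>h2\<close>.\<close>

lemma evolve_vec_circ: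
  assumes ct: "length ct = L" and lens: "length c' = L" "length f = q" "length r = W - (L + q)"
    "length z = 2" "length t = q" and h: "h @ h2 = c' @ f @ r" "length h = 2 + q"
  shows "evolve_vec circ (L + q) (classical_vec ct \<psi>) (z @ t @ h2 @ h)
    = (if f = zeros q then post (\<lambda>u. u = z) ct \<psi> (c' @ t @ r) else 0)"
proof -
  let ?O = "[CNOT v W, Toffoli v p (W + 1)]" and ?S1 = "swap_block L (W + 2) q" and ?S2 = "swap_block 0 W (2 + q)"
  define V0 where "V0 = superpos (bitstrings q) \<psi> (\<lambda>t. pad circ (ct @ t))"
  define V1 where "V1 = run_gates P V0"
  define V2 where "V2 = run_gates ?O V1"
  define V3 where "V3 = run_gates (inverse_gates P) V2"
  have evolve: "evolve_vec circ (L + q) (classical_vec ct \<psi>) = run_gates (?S1 @ ?S2) V3"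
    unfolding V3_def V2_def V1_def V0_def
      evolve_vec_classical[of "L + q" ct q, unfolded ct, OF refl]
    by (simp only: measure_circuit_def circuit.sel run_gates_append)
  have V0: "V0 (s @ f2) = (if f2 = zeros (2 + q) then start ct \<psi> s else 0)" if "length s = W" "length f2 = 2 + q" for s f2
  proof -
    have "V0 = superpos (bitstrings q) \<psi> (\<lambda>t. (ct @ t @ zeros (W - (L + q))) @ zeros (2 + q))"
      unfolding V0_def
    proof (rule superpos_cong)
      fix t assume "t \<in> bitstrings q"
      then have "wires circ - length (ct @ t) = (W - (L + q)) + (2 + q)" using ct LW by (simp add: measure_circuit_def)
      then show "pad circ (ct @ t) = (ct @ t @ zeros (W - (L + q))) @ zeros (2 + q)"
        unfolding pad_eq by (simp only: replicate_add append_assoc)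
    qed simp
    moreover have "ket ((ct @ t @ zeros (W - (L + q))) @ zeros (2 + q)) (s @ f2)
      = (if f2 = zeros (2 + q) then ket (ct @ t @ zeros (W - (L + q))) s else 0)" if "length t = q" for t
      using that \<open>length s = W\<close> ct LW unfolding ket_def by (subst append_eq_append_conv) auto
    ultimately show ?thesis unfolding superpos_def start_def by (auto intro!: sum.neutral sum.cong)
  qed
  have V1: "V1 (s @ f2) = (if f2 = zeros (2 + q) then computed ct \<psi> s else 0)" if "length s = W" "length f2 = 2 + q" for s f2
  proof -
    have "V1 (s @ f2) = run_gates P (\<lambda>b. V0 (b @ f2)) s"
      unfolding V1_def by (rule run_gates_prefix) (use wf that in simp)
    also have "\<dots> = run_gates P (if f2 = zeros (2 + q) then start ct \<psi> else (\<lambda>_. 0)) s"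
      by (rule run_gates_cong) (use that V0 in simp)
    finally show ?thesis by (simp add: computed_def run_gates_0)
  qed
  have V2: "V2 (s @ z @ f) = (if z = outbits s \<and> f = zeros q then computed ct \<psi> s else 0)"
    if "length s = W" "length z = 2" "length f = q" for s z f
  proof -
    obtain a b where z: "z = [a, b]" using \<open>length z = 2\<close> by (auto simp: length_Suc_conv numeral_2_eq_2)
    have "act (rev ?O) (s @ [a, b] @ f) = s @ [a \<noteq> s ! v, b \<noteq> (s ! v \<and> s ! p)] @ f"
      using vp that(1) by (auto simp: nth_append flip_def list_update_append)
    then have "V2 (s @ z @ f) = V1 (s @ [a \<noteq> s ! v, b \<noteq> (s ! v \<and> s ! p)] @ f)"
      unfolding V2_def z by (subst run_classical_gates) auto
    also have "\<dots> = (if [a \<noteq> s ! v, b \<noteq> (s ! v \<and> s ! p)] @ f = zeros (2 + q) then computed ct \<psi> s else 0)"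
      by (rule V1) (use that in auto)
    finally show ?thesis by (auto simp: z outbits_def)
  qed
  have V3: "V3 (s @ z @ f) = (if f = zeros q then post (\<lambda>u. u = z) ct \<psi> s else 0)"
    if "length s = W" "length z = 2" "length f = q" for s z f
  proof -
    have "V3 (s @ z @ f) = run_gates (inverse_gates P) (\<lambda>b. V2 (b @ z @ f)) s"
      unfolding V3_def by (rule run_gates_prefix) (use wf that in \<open>simp add: wf_inverse_gates\<close>)
    also have "\<dots> = run_gates (inverse_gates P) (\<lambda>s. if f = zeros q then (if outbits s = z then computed ct \<psi> s else 0) else 0) s"
      by (rule run_gates_cong) (use that V2 in auto)
    finally show ?thesis by (simp add: post_def run_gates_0)
  qed
  have lh2: "length h2 = W - (2 + q)"
    using arg_cong[OF h(1), of length] lens h(2) LW qW by simp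
  have "act ?S1 (c' @ t @ r @ z @ f) = c' @ f @ r @ z @ t"
    using act_swap_block[of c' L t "r @ z" "W + 2" q f "[]"] lens LW by simp
  moreover have hh: "c' @ f @ r @ z @ t = h @ h2 @ z @ t" using h(1) by (metis append_assoc)
  have "act ?S2 (c' @ f @ r @ z @ t) = z @ t @ h2 @ h"
    unfolding hh using act_swap_block[of "[]" 0 h h2 W "2 + q" "z @ t" "[]"] lens LW qW h lh2 by simp
  ultimately have act: "act (?S1 @ ?S2) (c' @ t @ r @ z @ f) = z @ t @ h2 @ h" by simp
  have cl: "classical_gates (?S1 @ ?S2)" unfolding classical_append by (intro conjI classical_swap_block)
  have wfS: "wf_gates (W + (2 + q)) (?S1 @ ?S2)"
    unfolding wf_gates_append using LW qW by (intro conjI wf_swap_block) auto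
  have "run_gates (?S1 @ ?S2) V3 (z @ t @ h2 @ h) = V3 (c' @ t @ r @ z @ f)"
    unfolding run_classical_gates[OF cl] act[symmetric] act_rev[OF wfS] ..
  also have "\<dots> = (if f = zeros q then post (\<lambda>u. u = z) ct \<psi> (c' @ t @ r) else 0)"
    using V3[of "c' @ t @ r" z f] lens LW by simp
  finally show ?thesis unfolding evolve .
qed

lemma branch_circ:
  assumes "gram q J \<psi> \<kappa>" "length ct = L" "length z = 2" "length t = q" "length t' = q"
  shows "branch circ (L + q) q (with_classical ct \<kappa>) z t t' = (\<Sum>j\<in>J. \<Sum>c\<in>bitstrings L. \<Sum>r\<in>bitstrings (W - (L + q)).
     post (\<lambda>u. u = z) ct (\<psi> j) (c @ t @ r) * cnj (post (\<lambda>u. u = z) ct (\<psi> j) (c @ t' @ r)))"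
proof -
  have gr: "gram (L + q) J (\<lambda>j. classical_vec ct (\<psi> j)) (with_classical ct \<kappa>)"
    by (rule gram_with_classical) (use assms in auto)
  have "(\<Sum>u\<in>bitstrings W. evolve_vec circ (L + q) (classical_vec ct \<psi>) (z @ t @ u) * cnj (evolve_vec circ (L + q) (classical_vec ct \<psi>) (z @ t' @ u)))
      = (\<Sum>c\<in>bitstrings L. \<Sum>r\<in>bitstrings (W - (L + q)). post (\<lambda>u. u = z) ct \<psi> (c @ t @ r) * cnj (post (\<lambda>u. u = z) ct \<psi> (c @ t' @ r)))"
    (is "(\<Sum>u\<in>_. ?G u) = _") for \<psi>
  proof -
    have e: "W - (2 + q) + (2 + q) = W" "2 + q + (W - (2 + q)) = W" using qW by auto
    \<comment> \<open>The traced-out wires appear in the order \<open>h2\<close>, \<open>h\<close>.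
      Exchanging the two parts restores the working register, which can then be cut into ciphertext,
      key block and rest.\<close>
    have "(\<Sum>u\<in>bitstrings W. ?G u) = (\<Sum>h2\<in>bitstrings (W - (2 + q)). \<Sum>h\<in>bitstrings (2 + q). ?G (h2 @ h))"
      using sum_bitstrings_append[of ?G "W - (2 + q)" "2 + q"] unfolding e(1) by (simp only:)
    also have "\<dots> = (\<Sum>h\<in>bitstrings (2 + q). \<Sum>h2\<in>bitstrings (W - (2 + q)). ?G (h2 @ h))" by (rule sum.swap)
    also have "\<dots> = (\<Sum>h\<in>bitstrings (2 + q). \<Sum>h2\<in>bitstrings (W - (2 + q)).
        ?G (drop (2 + q) (h @ h2) @ take (2 + q) (h @ h2)))" by (intro sum.cong refl) auto
    also have "\<dots> = (\<Sum>w\<in>bitstrings W. ?G (drop (2 + q) w @ take (2 + q) w))"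
      using sum_bitstrings_append[of "\<lambda>w. ?G (drop (2 + q) w @ take (2 + q) w)" "2 + q" "W - (2 + q)"]
      unfolding e(2) by (simp only:)
    also have "\<dots> = (\<Sum>c\<in>bitstrings L. \<Sum>f\<in>bitstrings q. \<Sum>r\<in>bitstrings (W - (L + q)).
        ?G (drop (2 + q) (c @ f @ r) @ take (2 + q) (c @ f @ r)))"
    proof -
      have W: "W = L + (q + (W - (L + q)))" using LW by simp
      show ?thesis by (subst W) (simp only: sum_bitstrings_append)
    qed
    also have "\<dots> = (\<Sum>c\<in>bitstrings L. \<Sum>f\<in>bitstrings q. \<Sum>r\<in>bitstrings (W - (L + q)).
       if f = zeros q then post (\<lambda>u. u = z) ct \<psi> (c @ t @ r) * cnj (post (\<lambda>u. u = z) ct \<psi> (c @ t' @ r)) else 0)"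
    proof (intro sum.cong refl)
      fix c f r assume l: "c \<in> bitstrings L" "f \<in> bitstrings q" "r \<in> bitstrings (W - (L + q))"
      have "evolve_vec circ (L + q) (classical_vec ct \<psi>) (z @ t @ drop (2 + q) (c @ f @ r) @ take (2 + q) (c @ f @ r))
        = (if f = zeros q then post (\<lambda>u. u = z) ct \<psi> (c @ t @ r) else 0)" if "length t = q" for t
        by (rule evolve_vec_circ) (use l that assms LW qW in \<open>simp_all del: take_append drop_append\<close>)
      then show "?G (drop (2 + q) (c @ f @ r) @ take (2 + q) (c @ f @ r))
        = (if f = zeros q then post (\<lambda>u. u = z) ct \<psi> (c @ t @ r) * cnj (post (\<lambda>u. u = z) ct \<psi> (c @ t' @ r)) else 0)"
        using assms(4,5) by simp
    qed
    also have "\<dots> = (\<Sum>c\<in>bitstrings L. \<Sum>r\<in>bitstrings (W - (L + q)). post (\<lambda>u. u = z) ct \<psi> (c @ t @ r) * cnj (post (\<lambda>u. u = z) ct \<psi> (c @ t' @ r)))"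
      by (rule sum.cong[OF refl], subst sum_bitstrings_single[of "zeros q"]) auto
    finally show ?thesis .
  qed
  moreover have "wires circ - (length z + q) = W" using assms(3) by (simp add: measure_circuit_def)
  ultimately show ?thesis unfolding branch_gram[OF gr] by simp
qed

lemma qtrace_branch_circ:
  assumes "gram q J \<psi> \<kappa>" "length ct = L" "length z = 2"
  shows "qtrace q (branch circ (L + q) q (with_classical ct \<kappa>) z) = (\<Sum>j\<in>J. sqnorm W (post (\<lambda>u. u = z) ct (\<psi> j)))"
proof -
  have W: "W = L + (q + (W - (L + q)))" using LW by simp
  have "(\<Sum>t\<in>bitstrings q. branch circ (L + q) q (with_classical ct \<kappa>) z t t)
     = (\<Sum>t\<in>bitstrings q. \<Sum>j\<in>J. \<Sum>c\<in>bitstrings L. \<Sum>r\<in>bitstrings (W - (L + q)).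
       complex_of_real ((cmod (post (\<lambda>u. u = z) ct (\<psi> j) (c @ t @ r)))\<^sup>2))"
    unfolding complex_norm_square by (intro sum.cong refl branch_circ assms) auto
  also have "\<dots> = (\<Sum>j\<in>J. \<Sum>c\<in>bitstrings L. \<Sum>t\<in>bitstrings q. \<Sum>r\<in>bitstrings (W - (L + q)).
       complex_of_real ((cmod (post (\<lambda>u. u = z) ct (\<psi> j) (c @ t @ r)))\<^sup>2))"
    by (rule trans[OF sum.swap sum.cong[OF refl sum.swap]])
  also have "\<dots> = complex_of_real (\<Sum>j\<in>J. sqnorm W (post (\<lambda>u. u = z) ct (\<psi> j)))"
    unfolding sqnorm_def by (subst (3) W) (simp only: sum_bitstrings_append of_real_sum)
  finally show ?thesis unfolding qtrace_def by simp
qed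

text \<open>Write the state before measuring as \<open>\<Psi> = \<Psi>z z0 + \<Delta>\<close>, where
  \<open>\<Delta>\<close> collects all other outcomes and has total weight at most
  \<open>\<epsilon>\<close>. The difference to the averaged state after measuring then consists of
  rank-one terms each containing a factor of small norm, and the bound for partial traces
  applies.\<close>

lemma gentle_measurement:
  fixes J :: "'j set"
  assumes J: "finite J" and gr: "gram q J \<psi> \<kappa>" and tr: "(\<Sum>j\<in>J. sqnorm q (\<psi> j)) = 1"
    and ct: "length ct = L" and z0: "length z0 = 2"
    and wt: "(\<Sum>j\<in>J. sqnorm W (post (\<lambda>u. u \<noteq> z0) ct (\<psi> j))) \<le> \<epsilon>"
  shows "trace_distance q \<kappa> (\<lambda>s t. \<Sum>z\<in>bitstrings 2. branch circ (L + q) q (with_classical ct \<kappa>) z s t) \<le> sqrt \<epsilon> + \<epsilon>"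
proof -
  let ?M = "W - (L + q)" and ?B = "bitstrings 2 - {z0}"
  have W: "W = L + (q + ?M)" using LW by simp
  define \<Psi> where "\<Psi> j = start ct (\<psi> j)" for j
  define \<Psi>z where "\<Psi>z j z = post (\<lambda>u. u = z) ct (\<psi> j)" for j z
  define \<Delta> where "\<Delta> j = post (\<lambda>u. u \<noteq> z0) ct (\<psi> j)" for j
  have split: "\<Psi> j s = \<Psi>z j z0 s + \<Delta> j s" if "length s = W" for j s
    unfolding \<Psi>_def \<Psi>z_def \<Delta>_def by (rule post_add) (use that in auto)
  \<comment> \<open>The index set of the rank-one terms: \<open>Inl 0\<close> and
    \<open>Inl 1\<close> for the two cross terms with \<open>\<Delta>\<close>, and
    \<open>Inr z\<close> for the unlikely outcomes, which enter with a minus sign.\<close>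
  define T where "T = {0 :: nat, 1} <+> ?B"
  define a where "a = (\<lambda>(j, k). case k of Inl (0::nat) \<Rightarrow> \<Psi>z j z0 | Inl _ \<Rightarrow> \<Delta> j | Inr z \<Rightarrow> (\<lambda>s. - \<Psi>z j z s))"
  define b where "b = (\<lambda>(j, k). case k of Inl (0::nat) \<Rightarrow> \<Delta> j | Inl _ \<Rightarrow> \<Psi> j | Inr z \<Rightarrow> \<Psi>z j z)"
  have T: "finite T" by (simp add: T_def)
  have sumT: "(\<Sum>k\<in>T. g k) = g (Inl 0) + g (Inl 1) + (\<Sum>z\<in>?B. g (Inr z))" for g :: "nat + bits \<Rightarrow> 'c::comm_monoid_add"
    unfolding T_def by (simp add: sum.Plus)
  have key: "\<kappa> t t' = (\<Sum>j\<in>J. \<Sum>c\<in>bitstrings L. \<Sum>r\<in>bitstrings ?M. \<Psi> j (c @ t @ r) * cnj (\<Psi> j (c @ t' @ r)))"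
    if "length t = q" "length t' = q" for t t'
  proof -
    have "(\<Sum>c\<in>bitstrings L. \<Sum>r\<in>bitstrings ?M. \<Psi> j (c @ t @ r) * cnj (\<Psi> j (c @ t' @ r)))
        = (\<Sum>c\<in>bitstrings L. if c = ct then \<psi> j t * cnj (\<psi> j t') else 0)" for j
    proof (rule sum.cong[OF refl])
      fix c assume c: "c \<in> bitstrings L"
      show "(\<Sum>r\<in>bitstrings ?M. \<Psi> j (c @ t @ r) * cnj (\<Psi> j (c @ t' @ r))) = (if c = ct then \<psi> j t * cnj (\<psi> j t') else 0)"
        unfolding \<Psi>_def start_def
        by (subst sum_bitstrings_single[of "zeros ?M"]) (use that ct c in \<open>auto simp: superpos_block_at\<close>)
    qed
    then show ?thesis using gr that ct unfolding gram_def by (simp add: sum.delta)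
  qed
  have "trace_distance q \<kappa> (\<lambda>s t. \<Sum>z\<in>bitstrings 2. branch circ (L + q) q (with_classical ct \<kappa>) z s t)
     \<le> (\<Sum>k\<in>J \<times> T. sqrt (sqnorm W (a k)) * sqrt (sqnorm W (b k))) / 2"
  proof (rule trace_distance_partial_trace[OF _ W])
    show "finite (J \<times> T)" using J T by simp
    fix t t' :: bits assume t: "length t = q" "length t' = q"
    let ?p = "\<lambda>f g. \<Sum>c\<in>bitstrings L. \<Sum>r\<in>bitstrings ?M. f (c @ t @ r) * cnj (g (c @ t' @ r))"
    have "(\<Sum>z\<in>bitstrings 2. branch circ (L + q) q (with_classical ct \<kappa>) z t t') = (\<Sum>z\<in>bitstrings 2. \<Sum>j\<in>J. ?p (\<Psi>z j z) (\<Psi>z j z))"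
      unfolding \<Psi>z_def by (intro sum.cong refl branch_circ gr ct t) auto
    also have "\<dots> = (\<Sum>j\<in>J. \<Sum>z\<in>bitstrings 2. ?p (\<Psi>z j z) (\<Psi>z j z))" by (rule sum.swap)
    also have "\<dots> = (\<Sum>j\<in>J. ?p (\<Psi>z j z0) (\<Psi>z j z0) + (\<Sum>z\<in>?B. ?p (\<Psi>z j z) (\<Psi>z j z)))"
      using z0 by (intro sum.cong refl sum.remove) auto
    finally have br: "(\<Sum>z\<in>bitstrings 2. branch circ (L + q) q (with_classical ct \<kappa>) z t t')
      = (\<Sum>j\<in>J. ?p (\<Psi>z j z0) (\<Psi>z j z0) + (\<Sum>z\<in>?B. ?p (\<Psi>z j z) (\<Psi>z j z)))" .
    \<comment> \<open>Splitting \<open>\<Psi>\<close> asymmetrically, with \<open>\<Psi>\<close>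
      kept whole in the last term, leaves only two cross terms.\<close>
    have eqp: "?p (\<Psi> j) (\<Psi> j) = ?p (\<Psi>z j z0) (\<Psi>z j z0) + ?p (\<Psi>z j z0) (\<Delta> j) + ?p (\<Delta> j) (\<Psi> j)" for j
    proof -
      have "\<Psi> j (c @ t @ r) * cnj (\<Psi> j (c @ t' @ r)) = \<Psi>z j z0 (c @ t @ r) * cnj (\<Psi>z j z0 (c @ t' @ r))
         + \<Psi>z j z0 (c @ t @ r) * cnj (\<Delta> j (c @ t' @ r)) + \<Delta> j (c @ t @ r) * cnj (\<Psi> j (c @ t' @ r))"
        if "length c = L" "length r = ?M" for c r
        using split[of "c @ t @ r" j] split[of "c @ t' @ r" j] that t LW by (simp add: algebra_simps)
      then show ?thesis by (simp add: sum.distrib)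
    qed
    have "\<kappa> t t' - (\<Sum>z\<in>bitstrings 2. branch circ (L + q) q (with_classical ct \<kappa>) z t t')
       = (\<Sum>j\<in>J. ?p (\<Psi>z j z0) (\<Delta> j) + ?p (\<Delta> j) (\<Psi> j) - (\<Sum>z\<in>?B. ?p (\<Psi>z j z) (\<Psi>z j z)))"
      unfolding key[OF t] br sum_subtractf[symmetric] eqp by (intro sum.cong refl) simp
    also have "\<dots> = (\<Sum>j\<in>J. \<Sum>k\<in>T. ?p (a (j, k)) (b (j, k)))"
      unfolding sumT by (simp add: a_def b_def sum_negf)
    also have "\<dots> = (\<Sum>k\<in>J \<times> T. ?p (a k) (b k))" by (rule sum_Times_pair)
    finally show "\<kappa> t t' - (\<Sum>z\<in>bitstrings 2. branch circ (L + q) q (with_classical ct \<kappa>) z t t')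
       = (\<Sum>k\<in>J \<times> T. ?p (a k) (b k))" .
  qed
  also have "(\<Sum>k\<in>J \<times> T. sqrt (sqnorm W (a k)) * sqrt (sqnorm W (b k)))
      = (\<Sum>j\<in>J. \<Sum>k\<in>T. sqrt (sqnorm W (a (j, k))) * sqrt (sqnorm W (b (j, k))))"
    by (simp add: sum.cartesian_product case_prod_unfold)
  also have "\<dots> \<le> (\<Sum>j\<in>J. 2 * (sqrt (sqnorm q (\<psi> j)) * sqrt (sqnorm W (\<Delta> j))) + sqnorm W (\<Delta> j))"
  proof (rule sum_mono)
    fix j assume "j \<in> J"
    have n\<Psi>: "sqnorm W (\<Psi> j) = sqnorm q (\<psi> j)" unfolding \<Psi>_def by (rule sqnorm_start[OF ct])
    have "sqnorm W (\<Psi>z j z0) \<le> (\<Sum>s\<in>bitstrings W. (cmod (computed ct (\<psi> j) s))\<^sup>2)"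
      unfolding \<Psi>z_def sqnorm_post by (rule sum_mono2) auto
    then have n0: "sqnorm W (\<Psi>z j z0) \<le> sqnorm q (\<psi> j)"
      using sqnorm_computed[OF ct, of "\<psi> j"] unfolding sqnorm_def[of W] by simp
    \<comment> \<open>Different outcomes are projections onto disjoint sets of basis states, so
      their weights add up to that of \<open>\<Delta>\<close>.\<close>
    have "(\<Sum>z\<in>?B. sqnorm W (\<Psi>z j z)) = (\<Sum>z\<in>?B. \<Sum>s | s \<in> {s. length s = W \<and> outbits s \<noteq> z0} \<and> outbits s = z. (cmod (computed ct (\<psi> j) s))\<^sup>2)"
      unfolding \<Psi>z_def sqnorm_post by (intro sum.cong refl) auto
    also have "\<dots> = sqnorm W (\<Delta> j)" unfolding \<Delta>_def sqnorm_post
      by (rule sum.group) (auto intro: finite_subset[OF _ finite_bitstrings[of W]] simp: outbits_def)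
    finally have nB: "(\<Sum>z\<in>?B. sqnorm W (\<Psi>z j z)) = sqnorm W (\<Delta> j)" .
    have "(\<Sum>k\<in>T. sqrt (sqnorm W (a (j, k))) * sqrt (sqnorm W (b (j, k))))
       = sqrt (sqnorm W (\<Psi>z j z0)) * sqrt (sqnorm W (\<Delta> j)) + sqrt (sqnorm W (\<Delta> j)) * sqrt (sqnorm W (\<Psi> j))
         + (\<Sum>z\<in>?B. sqnorm W (\<Psi>z j z))"
      unfolding sumT by (simp add: a_def b_def sqnorm_uminus)
    also have "\<dots> \<le> sqrt (sqnorm q (\<psi> j)) * sqrt (sqnorm W (\<Delta> j)) + sqrt (sqnorm W (\<Delta> j)) * sqrt (sqnorm q (\<psi> j)) + sqnorm W (\<Delta> j)"
      unfolding nB n\<Psi> by (intro add_mono mult_right_mono real_sqrt_le_mono n0 order_refl) auto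
    finally show "(\<Sum>k\<in>T. sqrt (sqnorm W (a (j, k))) * sqrt (sqnorm W (b (j, k))))
      \<le> 2 * (sqrt (sqnorm q (\<psi> j)) * sqrt (sqnorm W (\<Delta> j))) + sqnorm W (\<Delta> j)" by (simp add: mult.commute)
  qed
  also have "\<dots> = 2 * (\<Sum>j\<in>J. \<bar>sqrt (sqnorm q (\<psi> j))\<bar> * \<bar>sqrt (sqnorm W (\<Delta> j))\<bar>) + (\<Sum>j\<in>J. sqnorm W (\<Delta> j))"
    by (simp add: sum.distrib sum_distrib_left)
  also have "(\<Sum>j\<in>J. \<bar>sqrt (sqnorm q (\<psi> j))\<bar> * \<bar>sqrt (sqnorm W (\<Delta> j))\<bar>)
     \<le> L2_set (\<lambda>j. sqrt (sqnorm q (\<psi> j))) J * L2_set (\<lambda>j. sqrt (sqnorm W (\<Delta> j))) J" by (rule L2_set_mult_ineq)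
  also have "\<dots> = sqrt (\<Sum>j\<in>J. sqnorm W (\<Delta> j))" unfolding L2_set_def by (simp add: tr)
  also have "2 * sqrt (\<Sum>j\<in>J. sqnorm W (\<Delta> j)) + (\<Sum>j\<in>J. sqnorm W (\<Delta> j)) \<le> 2 * sqrt \<epsilon> + 2 * \<epsilon>"
  proof -
    have "0 \<le> (\<Sum>j\<in>J. sqnorm W (\<Delta> j))" by (intro sum_nonneg) simp
    then show ?thesis using wt real_sqrt_le_mono[OF wt] unfolding \<Delta>_def by linarith
  qed
  finally show ?thesis by simp
qed

end

subsection \<open>Decryption\<close>

definition key_vec :: "nat \<Rightarrow> bits \<Rightarrow> (bits \<Rightarrow> complex) \<Rightarrow> bits \<Rightarrow> complex" where
  "key_vec q ek \<psi> s = (if drop q s = ek then \<psi> (take q s) else 0)"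

lemma gram_key_vec:
  assumes "extends_key q ek \<kappa> \<kappa>'" "gram q J \<psi> \<kappa>"
  shows "gram (q + length ek) J (\<lambda>j. key_vec q ek (\<psi> j)) \<kappa>'"
  unfolding gram_def
proof (intro ballI)
  fix s t assume st: "s \<in> bitstrings (q + length ek)" "t \<in> bitstrings (q + length ek)"
  have "\<kappa>' (take q s @ drop q s) (take q t @ drop q t)
      = (if drop q s = ek \<and> drop q t = ek then \<kappa> (take q s) (take q t) else 0)"
    using assms(1) st unfolding extends_key_def by (intro assms(1)[unfolded extends_key_def, rule_format]) auto
  moreover have "\<kappa> (take q s) (take q t) = (\<Sum>j\<in>J. \<psi> j (take q s) * cnj (\<psi> j (take q t)))"
    using assms(2) st unfolding gram_def by simp
  ultimately show "\<kappa>' s t = (\<Sum>j\<in>J. key_vec q ek (\<psi> j) s * cnj (key_vec q ek (\<psi> j) t))"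
    by (auto simp: key_vec_def)
qed

lemma sqnorm_key_vec: "length ek = e \<Longrightarrow> sqnorm (q + e) (key_vec q ek \<psi>) = sqnorm q \<psi>"
  unfolding sqnorm_def sum_bitstrings_append
  by (intro sum.cong refl) (subst sum_bitstrings_single[of ek], auto simp: key_vec_def)

lemma superpos_key_vec:
  "length ek = e \<Longrightarrow> superpos (bitstrings (q + e)) (key_vec q ek \<psi>) F = superpos (bitstrings q) \<psi> (\<lambda>s. F (s @ ek))"
  unfolding superpos_def sum_bitstrings_append
  by (intro ext sum.cong refl) (subst sum_bitstrings_single[of ek], auto simp: key_vec_def)

lemma superpos_image:
  assumes "\<And>i. i \<in> I \<Longrightarrow> length (F i) = w"
  shows "superpos I \<alpha> (\<lambda>i. K (F i)) = superpos (bitstrings w) (superpos I \<alpha> F) K"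
proof
  fix u
  have "superpos (bitstrings w) (superpos I \<alpha> F) K u = (\<Sum>i\<in>I. \<Sum>g\<in>bitstrings w. \<alpha> i * ket (F i) g * ket (K g) u)"
    unfolding superpos_def sum_distrib_right by (rule sum.swap)
  also have "\<dots> = (\<Sum>i\<in>I. \<alpha> i * ket (K (F i)) u)"
  proof (rule sum.cong[OF refl])
    fix i assume "i \<in> I"
    then show "(\<Sum>g\<in>bitstrings w. \<alpha> i * ket (F i) g * ket (K g) u) = \<alpha> i * ket (K (F i)) u"
      by (subst sum_bitstrings_single[of "F i"]) (auto simp: ket_def assms)
  qed
  finally show "superpos I \<alpha> (\<lambda>i. K (F i)) u = superpos (bitstrings w) (superpos I \<alpha> F) K u"
    unfolding superpos_def ..
qed

text \<open>Injectivity excludes interference: every basis state receives at most one of the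
  amplitudes.\<close>

lemma sum_superpos_inj:
  assumes I: "finite I" and inj: "inj_on F I" and F: "\<And>i. i \<in> I \<Longrightarrow> length (F i) = W"
  shows "(\<Sum>s | length s = W \<and> Q s. (cmod (superpos I \<alpha> F s))\<^sup>2) = (\<Sum>i | i \<in> I \<and> Q (F i). (cmod (\<alpha> i))\<^sup>2)"
proof -
  have val: "superpos I \<alpha> F (F i) = \<alpha> i" if "i \<in> I" for i
  proof -
    have "superpos I \<alpha> F (F i) = (\<Sum>k\<in>I. if k = i then \<alpha> i else 0)"
      unfolding superpos_def by (rule sum.cong) (use inj that in \<open>auto simp: ket_def inj_on_def\<close>)
    then show ?thesis using I that by simp
  qed
  have zero: "superpos I \<alpha> F s = 0" if "s \<notin> F ` I" for s
    unfolding superpos_def using that by (intro sum.neutral) (auto simp: ket_def)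
  have "(\<Sum>s | length s = W \<and> Q s. (cmod (superpos I \<alpha> F s))\<^sup>2) = (\<Sum>s\<in>F ` {i. i \<in> I \<and> Q (F i)}. (cmod (superpos I \<alpha> F s))\<^sup>2)"
    by (rule sum.mono_neutral_right) (use F in \<open>auto intro: finite_subset[OF _ finite_bitstrings[of W]] intro!: zero\<close>)
  also have "\<dots> = (\<Sum>i | i \<in> I \<and> Q (F i). (cmod (\<alpha> i))\<^sup>2)"
    by (subst sum.reindex) (use inj val in \<open>auto simp: inj_on_def\<close>)
  finally show ?thesis .
qed

lemma act_load_gates:
  assumes lens: "length r = n" "length y = m" "length t = q" "length ek = e" and W: "m + q \<le> wires CI"
  shows "act (load_gates n m q (n + 1 + m + (q + e))) ((r @ [c] @ y) @ (t @ ek) @ zeros (wires CI + k))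
     = (r @ [c] @ y @ zeros q @ ek) @ pad CI (y @ t) @ zeros k"
proof -
  let ?I = "n + 1 + m + (q + e)" and ?Z = "zeros (wires CI - (m + q))"
  have "wires CI + k = m + (q + ((wires CI - (m + q)) + k))" using W by simp
  then have z: "zeros (wires CI + k) = zeros m @ zeros q @ ?Z @ zeros k" by (simp only: replicate_add)
  have 1: "act (copy_block (n + 1) ?I m) (r @ [c] @ y @ t @ ek @ zeros m @ zeros q @ ?Z @ zeros k)
     = r @ [c] @ y @ t @ ek @ y @ zeros q @ ?Z @ zeros k"
    using act_copy_block[of "r @ [c]" "n + 1" y "t @ ek" ?I m "zeros m" "zeros q @ ?Z @ zeros k"] lens by simp
  have 2: "act (swap_block (n + 1 + m) (?I + m) q) (r @ [c] @ y @ t @ ek @ y @ zeros q @ ?Z @ zeros k)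
     = r @ [c] @ y @ zeros q @ ek @ y @ t @ ?Z @ zeros k"
    using act_swap_block[of "r @ [c] @ y" "n + 1 + m" t "ek @ y" "?I + m" q "zeros q" "?Z @ zeros k"] lens by simp
  show ?thesis unfolding load_gates_def z act_append append_assoc 1 2 using lens by (simp add: pad_eq)
qed

lemma act_check_gates:
  assumes wf: "wf_circuit (e + n) m C"
    and lens: "length r = n" "length y = m" "length ek = e" "length g = w" "n \<le> w"
  defines "y' \<equiv> run_classical C m (ek @ take n g)"
  obtains s where "length s = wires C"
    "act (check_gates n m (n + 1 + m + q) e (n + 1 + m + (q + e)) (n + 1 + m + (q + e) + w) C)
       ((r @ [c] @ y @ zeros q @ ek) @ g @ zeros (wires C + (1 + m) + (1 + n)))
     = (r @ [c] @ y @ zeros q @ ek) @ g @ s @ and_prefixes (map Not (bxor y y')) @ parity_prefixes (c # band r (take n g))"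
proof -
  let ?I = "n + 1 + m + (q + e)" and ?V = "wires C"
  have len: "e + n \<le> ?V" "m \<le> ?V" "wf_gates ?V (gates C)" using wf by (auto simp: wf_circuit_iff)
  define E A P where "E = ?I + w" and "A = E + ?V" and "P = A + (1 + m)"
  define x g' where "x = take n g" and "g' = drop n g"
  have g: "g = x @ g'" and lx: "length x = n" and lg': "length g' = w - n" using lens by (auto simp: x_def g'_def)
  let ?z = "zeros (?V - (e + n))"
  define s where "s = act (gates C) (pad C (ek @ x))"
  have ls: "length s = ?V" using lens lx len by (simp add: s_def pad_eq)
  have y': "y' = take m s" by (simp add: y'_def run_classical_act s_def x_def)
  have ly': "length y' = m" using ls len by (simp add: y')
  define s' where "s' = drop m s"
  have s: "s = y' @ s'" by (simp add: y' s'_def)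
  have ls': "length s' = ?V - m" using ls by (simp add: s'_def)
  define d where "d = map Not (bxor y y')"
  have ld: "length d = m" using lens ly' by (simp add: d_def)
  have "?V + (1 + m) + (1 + n) = e + (n + ((?V - (e + n)) + (1 + m + (1 + n))))" using len by simp
  then have z: "zeros (?V + (1 + m) + (1 + n)) = zeros e @ zeros n @ ?z @ (zeros 1 @ zeros m) @ zeros 1 @ zeros n"
    by (simp only: replicate_add append_assoc)
  have 1: "act (copy_block (n + 1 + m + q) E e) (r @ [c] @ y @ zeros q @ ek @ x @ g' @ zeros e @ zeros n @ ?z @ zeros 1 @ zeros m @ zeros 1 @ zeros n)
    = r @ [c] @ y @ zeros q @ ek @ x @ g' @ ek @ zeros n @ ?z @ zeros 1 @ zeros m @ zeros 1 @ zeros n"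
    using act_copy_block[of "r @ [c] @ y @ zeros q" "n + 1 + m + q" ek "x @ g'" E e "zeros e"
      "zeros n @ ?z @ zeros 1 @ zeros m @ zeros 1 @ zeros n"] lens lx lg' by (simp add: E_def)
  have 2: "act (copy_block ?I (E + e) n) (r @ [c] @ y @ zeros q @ ek @ x @ g' @ ek @ zeros n @ ?z @ zeros 1 @ zeros m @ zeros 1 @ zeros n)
    = r @ [c] @ y @ zeros q @ ek @ x @ g' @ pad C (ek @ x) @ zeros 1 @ zeros m @ zeros 1 @ zeros n"
    using act_copy_block[of "r @ [c] @ y @ zeros q @ ek" ?I x "g' @ ek" "E + e" n "zeros n"
      "?z @ zeros 1 @ zeros m @ zeros 1 @ zeros n"] lens lx lg' by (simp add: E_def pad_eq)
  have 3: "act (shift E (gates C)) (r @ [c] @ y @ zeros q @ ek @ x @ g' @ pad C (ek @ x) @ zeros 1 @ zeros m @ zeros 1 @ zeros n)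
    = r @ [c] @ y @ zeros q @ ek @ x @ g' @ y' @ s' @ zeros 1 @ zeros m @ zeros 1 @ zeros n"
    using act_shift[of "pad C (ek @ x)" "gates C" E "r @ [c] @ y @ zeros q @ ek @ x @ g'" "zeros 1 @ zeros m @ zeros 1 @ zeros n"]
      lens lx lg' len s by (simp add: E_def pad_eq s_def)
  have 4: "act (copy_block (n + 1) E m) (r @ [c] @ y @ zeros q @ ek @ x @ g' @ y' @ s' @ zeros 1 @ zeros m @ zeros 1 @ zeros n)
    = r @ [c] @ y @ zeros q @ ek @ x @ g' @ bxor y y' @ s' @ zeros 1 @ zeros m @ zeros 1 @ zeros n"
    using act_copy_block[of "r @ [c]" "n + 1" y "zeros q @ ek @ x @ g'" E m y' "s' @ zeros 1 @ zeros m @ zeros 1 @ zeros n"]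
      lens lx lg' ly' by (simp add: E_def)
  have 5: "act (gate_family m (X E)) (r @ [c] @ y @ zeros q @ ek @ x @ g' @ bxor y y' @ s' @ zeros 1 @ zeros m @ zeros 1 @ zeros n)
    = r @ [c] @ y @ zeros q @ ek @ x @ g' @ d @ s' @ zeros 1 @ zeros m @ zeros 1 @ zeros n"
    using act_X_family[of "r @ [c] @ y @ zeros q @ ek @ x @ g'" E "bxor y y'" m "s' @ zeros 1 @ zeros m @ zeros 1 @ zeros n"]
      lens lx lg' ly' by (simp add: E_def d_def)
  have 6: "act [X A] (r @ [c] @ y @ zeros q @ ek @ x @ g' @ d @ s' @ zeros 1 @ zeros m @ zeros 1 @ zeros n)
    = r @ [c] @ y @ zeros q @ ek @ x @ g' @ d @ s' @ (True # zeros m) @ zeros 1 @ zeros n"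
    using act_X_family[of "r @ [c] @ y @ zeros q @ ek @ x @ g' @ d @ s'" A "zeros 1" 1 "zeros m @ zeros 1 @ zeros n"]
      lens lx lg' ld ls' ly' len by (simp add: E_def A_def gate_family_def)
  have 7: "act (gate_family m (Toffoli E A (Suc A))) (r @ [c] @ y @ zeros q @ ek @ x @ g' @ d @ s' @ (True # zeros m) @ zeros 1 @ zeros n)
    = r @ [c] @ y @ zeros q @ ek @ x @ g' @ d @ s' @ and_prefixes d @ zeros 1 @ zeros n"
    using act_and_chain[of "r @ [c] @ y @ zeros q @ ek @ x @ g'" E d s' A m "zeros 1 @ zeros n"]
      lens lx lg' ld ls' ly' len by (simp add: E_def A_def)
  have 8: "act (copy_block n P 1) (r @ [c] @ y @ zeros q @ ek @ x @ g' @ d @ s' @ and_prefixes d @ zeros 1 @ zeros n)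
    = r @ [c] @ y @ zeros q @ ek @ x @ g' @ d @ s' @ and_prefixes d @ [c] @ zeros n"
    using act_copy_block[of r n "[c]" "y @ zeros q @ ek @ x @ g' @ d @ s' @ and_prefixes d" P 1 "zeros 1" "zeros n"]
      lens lx lg' ld ls' ly' len by (simp add: E_def A_def P_def)
  have 9: "act (gate_family n (Toffoli 0 ?I (P + 1))) (r @ [c] @ y @ zeros q @ ek @ x @ g' @ d @ s' @ and_prefixes d @ [c] @ zeros n)
    = r @ [c] @ y @ zeros q @ ek @ x @ g' @ d @ s' @ and_prefixes d @ (c # band r x)"
    using act_Toffoli_family[of "[]" 0 r "[c] @ y @ zeros q @ ek" ?I x "g' @ d @ s' @ and_prefixes d @ [c]" "P + 1" n "zeros n" "[]"]
      lens lx lg' ld ls' ly' len by (simp add: E_def A_def P_def)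
  have 10: "act (gate_family n (CNOT P (Suc P))) (r @ [c] @ y @ zeros q @ ek @ x @ g' @ d @ s' @ and_prefixes d @ (c # band r x))
    = r @ [c] @ y @ zeros q @ ek @ x @ g' @ d @ s' @ and_prefixes d @ parity_prefixes (c # band r x)"
    using act_cascade[of "r @ [c] @ y @ zeros q @ ek @ x @ g' @ d @ s' @ and_prefixes d" P "c # band r x" n "[]"]
      lens lx lg' ld ls' ly' len by (simp add: E_def A_def P_def)
  have "act (check_gates n m (n + 1 + m + q) e ?I (?I + w) C)
       ((r @ [c] @ y @ zeros q @ ek) @ g @ zeros (?V + (1 + m) + (1 + n)))
     = (r @ [c] @ y @ zeros q @ ek) @ g @ (d @ s') @ and_prefixes d @ parity_prefixes (c # band r x)"
    unfolding check_gates_def Let_def E_def[symmetric] unfolding A_def[symmetric] unfolding P_def[symmetric]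
    unfolding act_append z g append_assoc 1 2 3 4 5 6 7 8 9 10 ..
  moreover have "length (d @ s') = ?V" using ld ls' len by simp
  ultimately show ?thesis using that unfolding d_def x_def by blast
qed

lemma all_Not_bxor:
  "length y = length y' \<Longrightarrow> (\<forall>b\<in>set (map Not (bxor y y')). b) \<longleftrightarrow> y = y'"
  by (induction y y' rule: list_induct2) auto

lemma parity_prefixes_eq: "x \<noteq> [] \<Longrightarrow> parity_prefixes x = butlast (parity_prefixes x) @ [parity x]"
  by (cases x rule: rev_cases) (auto simp: parity_prefixes_snoc)

lemma measurement_dec:
  assumes "wf_circuit (m + q) (n + q) CI" "wf_circuit (e + n) m CE"
  defines "A \<equiv> n + 1 + m + (q + e) + wires CI + wires CE"
  shows "measurement (n + 1 + m) (q + e) (A + (1 + m) + (1 + n)) (dec_gates n m q e CI CE) (A + m) (A + (1 + m) + n)"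
  by unfold_locales (use wf_dec_gates[OF assms(1,2)] in \<open>auto simp: A_def\<close>)

text \<open>After \<open>Inv\<close> the computation is classical and reversible. It moves the
  amplitudes of \<open>Inv\<close> to distinct basis states, and the outcome is a function of the
  candidate \<open>take n g\<close> alone, so probabilities can be read off from
  \<open>Inv\<close>.\<close>

lemma sqnorm_post_dec:
  fixes q e :: nat
  assumes wfs: "wf_circuit (m + q) (n + q) CI" "wf_circuit (e + n) m CE" and clE: "classical_circuit CE"
    and lens: "length r = n" "length y = m" "length ek = e"
  defines "A \<equiv> n + 1 + m + (q + e) + wires CI + wires CE"
    and "y' \<equiv> \<lambda>g. run_classical CE m (ek @ take n g)"
  shows "sqnorm (A + (1 + m) + (1 + n))
      (measurement.post (n + 1 + m) (q + e) (A + (1 + m) + (1 + n)) (dec_gates n m q e CI CE) (A + m) (A + (1 + m) + n)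
         Q (r @ [c] @ y) (key_vec q ek \<psi>))
    = (\<Sum>g | length g = wires CI \<and> Q [y = y' g, y = y' g \<and> c \<noteq> parity (band r (take n g))].
         (cmod (evolve_vec CI (m + q) (classical_vec y \<psi>) g))\<^sup>2)"
proof -
  let ?W = "A + (1 + m) + (1 + n)" and ?G = "dec_gates n m q e CI CE" and ?v = "A + m" and ?p = "A + (1 + m) + n"
  interpret measurement "n + 1 + m" "q + e" ?W ?G ?v ?p
    unfolding A_def by (rule measurement_dec[OF wfs])
  let ?I = "n + 1 + m + (q + e)" and ?k = "wires CE + (1 + m) + (1 + n)" and ?w = "wires CI"
  let ?ct = "r @ [c] @ y"
  define B where "B = r @ [c] @ y @ zeros q @ ek"
  have lB: "length B = ?I" using lens by (simp add: B_def)
  have len: "m + q \<le> ?w" "n + q \<le> ?w" "wf_gates ?w (gates CI)" using wfs by (auto simp: wf_circuit_iff)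
  define \<beta> where "\<beta> = evolve_vec CI (m + q) (classical_vec y \<psi>)"
  define check where "check = check_gates n m (n + 1 + m + q) e ?I (?I + ?w) CE"
  define F where "F g = act check (B @ g @ zeros ?k)" for g
  have W: "?W = ?I + ?w + ?k" by (simp add: A_def)
  have wfc: "wf_gates ?W check" "wf_gates ?W (load_gates n m q ?I)"
    using wfs unfolding check_def by (auto intro!: wf_check_gates wf_load_gates simp: A_def wf_circuit_iff)
  have cl: "classical_gates (load_gates n m q ?I)"
    unfolding load_gates_def classical_append by (intro conjI classical_copy_block classical_swap_block)
  have "start ?ct (key_vec q ek \<psi>) = superpos (bitstrings q) \<psi> (\<lambda>t. ?ct @ (t @ ek) @ zeros (?w + ?k))"
  proof -
    have "?W - (n + 1 + m + (q + e)) = ?w + ?k" using W by linarith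
    then show ?thesis unfolding start_def superpos_key_vec[OF lens(3)] by (simp only:)
  qed
  then have "run_gates (load_gates n m q ?I) (start ?ct (key_vec q ek \<psi>))
      = superpos (bitstrings q) \<psi> (\<lambda>t. act (load_gates n m q ?I) (?ct @ (t @ ek) @ zeros (?w + ?k)))"
    by (simp only: run_superpos_classical[OF wfc(2) cl])
  also have "\<dots> = superpos (bitstrings q) \<psi> (\<lambda>t. B @ pad CI (y @ t) @ zeros ?k)"
  proof (rule superpos_cong[OF refl])
    fix t assume "t \<in> bitstrings q"
    then show "act (load_gates n m q ?I) (?ct @ (t @ ek) @ zeros (?w + ?k)) = B @ pad CI (y @ t) @ zeros ?k"
      unfolding B_def by (intro act_load_gates) (use lens len in auto)
  qed
  also have "\<dots> = superpos (bitstrings ?w) (superpos (bitstrings q) \<psi> (\<lambda>t. pad CI (y @ t))) (\<lambda>g. B @ g @ zeros ?k)"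
    by (rule superpos_image[where F = "\<lambda>t. pad CI (y @ t)"]) (use lens len in \<open>auto simp: pad_eq\<close>)
  finally have 1: "run_gates (shift ?I (gates CI)) (run_gates (load_gates n m q ?I) (start ?ct (key_vec q ek \<psi>)))
     = superpos (bitstrings ?w) \<beta> (\<lambda>g. B @ g @ zeros ?k)"
    unfolding \<beta>_def evolve_vec_classical[of "m + q" y q, unfolded lens(2), OF refl]
    using run_superpos_block[OF len(3), of ?I B] lB by simp
  have "classical_gates check" unfolding check_def check_gates_def Let_def classical_append classical_shift
    by (intro conjI classical_copy_block classical_family) (use clE in \<open>auto simp: classical_circuit_def\<close>)
  from run_superpos_classical[OF wfc(1) this]
  have "run_gates check (superpos (bitstrings ?w) \<beta> (\<lambda>g. B @ g @ zeros ?k)) = superpos (bitstrings ?w) \<beta> F"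
    unfolding F_def .
  with 1 have computed: "computed ?ct (key_vec q ek \<psi>) = superpos (bitstrings ?w) \<beta> F"
    unfolding computed_def by (subst dec_gates_def) (simp only: Let_def run_gates_append check_def)
  have inj: "inj_on F (bitstrings ?w)"
  proof (rule inj_onI)
    fix g g' assume gg: "g \<in> bitstrings ?w" "g' \<in> bitstrings ?w" "F g = F g'"
    have "act (rev check) (F g) = B @ g @ zeros ?k" for g unfolding F_def by (rule act_rev[OF wfc(1)])
    from this[of g] this[of g'] have "B @ g @ zeros ?k = B @ g' @ zeros ?k" unfolding gg(3) by (rule trans[OF sym])
    then show "g = g'" by (simp only: same_append_eq append_same_eq)
  qed
  have out: "outbits (F g) = [y = y' g, y = y' g \<and> c \<noteq> parity (band r (take n g))]" if g: "length g = ?w" for g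
  proof -
    have ly': "length (y' g) = m" using wfs(2) lens g len by (simp add: y'_def run_classical_act pad_eq wf_circuit_iff)
    obtain s where s: "length s = wires CE"
      "F g = B @ g @ s @ and_prefixes (map Not (bxor y (y' g))) @ parity_prefixes (c # band r (take n g))"
      unfolding F_def check_def B_def y'_def
      by (rule act_check_gates[OF wfs(2) lens g]) (use len in auto)
    let ?d = "map Not (bxor y (y' g))" and ?b = "c # band r (take n g)"
    have ld: "length ?d = m" using lens ly' by simp
    have lb: "length ?b = Suc n" using lens g len by simp
    have "F g ! ?v = (\<forall>b\<in>set ?d. b)"
      by (rule nth_at[where p = "B @ g @ s @ butlast (and_prefixes ?d)" and r = "parity_prefixes ?b"])
        (subst s(2), subst and_prefixes_eq, use lB g s ld in \<open>simp_all add: A_def\<close>)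
    moreover have "parity_prefixes ?b = butlast (parity_prefixes ?b) @ [parity ?b]"
      by (rule parity_prefixes_eq) simp
    then have "F g ! ?p = parity ?b"
      using s(2) lB g s ld lb
      by (intro nth_at[where p = "B @ g @ s @ and_prefixes ?d @ butlast (parity_prefixes ?b)" and r = "[]"])
        (simp_all add: A_def)
    ultimately show ?thesis unfolding outbits_def using all_Not_bxor[of y "y' g"] lens ly' by simp
  qed
  have "sqnorm ?W (post Q ?ct (key_vec q ek \<psi>))
     = (\<Sum>g | g \<in> bitstrings ?w \<and> Q (outbits (F g)). (cmod (\<beta> g))\<^sup>2)"
    unfolding sqnorm_post computed
    by (rule sum_superpos_inj[OF _ inj]) (use lB W in \<open>auto simp: F_def\<close>)
  also have "\<dots> = (\<Sum>g | length g = ?w \<and> Q [y = y' g, y = y' g \<and> c \<noteq> parity (band r (take n g))]. (cmod (\<beta> g))\<^sup>2)"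
  proof -
    have "{g. g \<in> bitstrings ?w \<and> Q (outbits (F g))}
      = {g. length g = ?w \<and> Q [y = y' g, y = y' g \<and> c \<noteq> parity (band r (take n g))]}"
      by (intro Collect_cong) (simp only: in_bitstrings out cong: conj_cong)
    then show ?thesis by (simp only:)
  qed
  finally show ?thesis unfolding \<beta>_def .
qed

lemma tdf_inv_prob_gram:
  assumes eff: "tdf_efficient F" and gr: "gram (qtd_len F l) J \<psi> \<kappa>"
    and lens: "length y = tdf_m F l" "length x = tdf_n F l"
  shows "tdf_inv_prob F l \<kappa> y x = (\<Sum>j\<in>J. \<Sum>g | length g = wires (tdf_inv F l) \<and> take (tdf_n F l) g = x.
     (cmod (evolve_vec (tdf_inv F l) (tdf_m F l + qtd_len F l) (classical_vec y (\<psi> j)) g))\<^sup>2)"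
proof -
  let ?n = "tdf_n F l" and ?q = "qtd_len F l" and ?C = "tdf_inv F l" and ?w = "wires (tdf_inv F l)"
  have "?n + ?q \<le> ?w" using eff by (auto simp: tdf_efficient_def wf_circuit_iff)
  then have w: "?w = ?n + (?q + (?w - (?n + ?q)))" by arith
  have *: "(\<Sum>s\<in>bitstrings ?q. \<Sum>u\<in>bitstrings (?w - (?n + ?q)). f (x @ s @ u)) = (\<Sum>g | length g = ?w \<and> take ?n g = x. f g)"
    for f :: "bits \<Rightarrow> real"
  proof -
    have "(\<Sum>g | length g = ?w \<and> take ?n g = x. f g) = (\<Sum>g\<in>bitstrings ?w. if take ?n g = x then f g else 0)"
      by (subst sum.inter_filter[symmetric]) (auto intro!: sum.cong)
    also have "\<dots> = (\<Sum>a\<in>bitstrings ?n. \<Sum>s\<in>bitstrings ?q. \<Sum>u\<in>bitstrings (?w - (?n + ?q)). if a = x then f (a @ s @ u) else 0)"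
      by (subst w) (simp add: sum_bitstrings_append)
    also have "\<dots> = (\<Sum>s\<in>bitstrings ?q. \<Sum>u\<in>bitstrings (?w - (?n + ?q)). f (x @ s @ u))"
      by (subst sum_bitstrings_single[of x]) (use lens in auto)
    finally show ?thesis by simp
  qed
  have gr': "gram (tdf_m F l + ?q) J (\<lambda>j. classical_vec y (\<psi> j)) (with_classical y \<kappa>)"
    by (rule gram_with_classical[OF gr]) (simp add: lens)
  show ?thesis unfolding tdf_inv_prob_def outcome_prob_gram[OF gr'] lens
    by (intro sum.cong refl *)
qed

lemma length_tdf_image:
  assumes "tdf_efficient F" "length ek = ek_len F l" "length x = tdf_n F l"
  shows "length (tdf_image F l ek x) = tdf_m F l"
proof -
  have "wf_circuit (ek_len F l + tdf_n F l) (tdf_m F l) (tdf_eval F l)" using assms(1) by (simp add: tdf_efficient_def)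
  then have "ek_len F l + tdf_n F l \<le> wires (tdf_eval F l)" "tdf_m F l \<le> wires (tdf_eval F l)" by (auto simp: wf_circuit_iff)
  then show ?thesis using assms(2,3) unfolding tdf_image_def run_classical_act pad_eq by auto
qed

definition good_key :: "tdf \<Rightarrow> nat \<Rightarrow> real \<Rightarrow> bits \<Rightarrow> qstate \<Rightarrow> bool" where
  "good_key F l \<epsilon> ek \<kappa> \<longleftrightarrow> (\<forall>x\<in>bitstrings (tdf_n F l). tdf_inv_prob F l \<kappa> (tdf_image F l ek x) x \<ge> 1 - \<epsilon>)"

context
  fixes F :: tdf and l :: nat and ek :: bits and \<kappa> \<kappa>' :: qstate and J :: "bits set" and \<psi> :: "bits \<Rightarrow> bits \<Rightarrow> complex"
  assumes eff: "tdf_efficient F" and lek: "length ek = ek_len F l"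
    and ext: "extends_key (qtd_len F l) ek \<kappa> \<kappa>'"
    and J: "finite J" and gr: "gram (qtd_len F l) J \<psi> \<kappa>" and tr: "(\<Sum>j\<in>J. sqnorm (qtd_len F l) (\<psi> j)) = 1"
begin

private abbreviation "n \<equiv> tdf_n F l"
private abbreviation "m \<equiv> tdf_m F l"
private abbreviation "q \<equiv> qtd_len F l"
private abbreviation "e \<equiv> ek_len F l"
private abbreviation "CI \<equiv> tdf_inv F l"
private abbreviation "CE \<equiv> tdf_eval F l"
private abbreviation "A \<equiv> n + 1 + m + (q + e) + wires CI + wires CE"
private abbreviation "\<psi>' j \<equiv> key_vec q ek (\<psi> j)"
private abbreviation "\<beta> y j \<equiv> evolve_vec CI (m + q) (classical_vec y (\<psi> j))"
private abbreviation "dec_post \<equiv> measurement.post (n + 1 + m) (q + e) (A + (1 + m) + (1 + n)) (dec_gates n m q e CI CE) (A + m) (A + (1 + m) + n)"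

private lemma wfs: "wf_circuit (m + q) (n + q) CI" "wf_circuit (e + n) m CE" "classical_circuit CE"
  using eff unfolding tdf_efficient_def by auto

private lemma gr': "gram (q + e) J \<psi>' \<kappa>'" using gram_key_vec[OF ext gr] lek by simp

private lemma tr': "(\<Sum>j\<in>J. sqnorm (q + e) (\<psi>' j)) = 1" using tr lek by (simp add: sqnorm_key_vec)

private lemma sum_\<beta>: "length y = m \<Longrightarrow> (\<Sum>j\<in>J. \<Sum>g | length g = wires CI. (cmod (\<beta> y j g))\<^sup>2) = 1"
proof -
  assume y: "length y = m"
  have "(\<Sum>g | length g = wires CI. (cmod (\<beta> y j g))\<^sup>2) = sqnorm q (\<psi> j)" for j
    using sqnorm_evolve_vec[of CI "m + q" "classical_vec y (\<psi> j)"] sqnorm_classical_vec[of "m + q" y q "\<psi> j"] y wfs(1)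
    by (simp add: wf_circuit_iff sqnorm_def[of "wires CI"] bitstrings_def)
  then show ?thesis using tr by simp
qed

private lemma sum_post:
  assumes "length r = n" "length y = m"
  shows "(\<Sum>j\<in>J. sqnorm (A + (1 + m) + (1 + n)) (dec_post Q (r @ [c] @ y) (\<psi>' j)))
    = (\<Sum>j\<in>J. \<Sum>g | length g = wires CI \<and> Q [y = tdf_image F l ek (take n g),
        y = tdf_image F l ek (take n g) \<and> c \<noteq> parity (band r (take n g))]. (cmod (\<beta> y j g))\<^sup>2)"
  unfolding tdf_image_def by (intro sum.cong refl sqnorm_post_dec wfs assms lek)

text \<open>When \<open>Inv\<close> returns \<open>x\<close>, the check succeeds and the mask
  cancels. Other preimages of the same image may also decrypt to \<open>b\<close>, hence an
  inequality.\<close>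

lemma sde_dec_prob_ge:
  assumes x: "length x = n" and r: "length r = n"
  shows "sde_dec_prob (sde_of F) l \<kappa>' (r @ [b \<noteq> parity (band x r)] @ tdf_image F l ek x) [b]
    \<ge> tdf_inv_prob F l \<kappa> (tdf_image F l ek x) x"
proof -
  interpret measurement "n + 1 + m" "q + e" "A + (1 + m) + (1 + n)" "dec_gates n m q e CI CE" "A + m" "A + (1 + m) + n"
    by (rule measurement_dec[OF wfs(1,2)])
  let ?y = "tdf_image F l ek x" and ?c = "b \<noteq> parity (band x r)"
  let ?ct = "r @ [?c] @ ?y"
  have lct: "length ?ct = n + 1 + m" using r length_tdf_image[OF eff lek x] by simp
  have "sde_dec_prob (sde_of F) l \<kappa>' ?ct [b] = (\<Sum>j\<in>J. sqnorm (A + (1 + m) + (1 + n)) (post (\<lambda>u. u = [True, b]) ?ct (\<psi>' j)))"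
    unfolding sde_dec_prob_def sde_dec_branch_def sde_of_simps dec_circuit_def lct Let_def if_P[OF refl]
    by (rule qtrace_branch_circ[OF gr' lct]) simp
  also have "\<dots> = (\<Sum>j\<in>J. \<Sum>g | length g = wires CI \<and> [?y = tdf_image F l ek (take n g),
        ?y = tdf_image F l ek (take n g) \<and> ?c \<noteq> parity (band r (take n g))] = [True, b]. (cmod (\<beta> ?y j g))\<^sup>2)"
    by (rule sum_post[OF r length_tdf_image[OF eff lek x]])
  also have "\<dots> \<ge> (\<Sum>j\<in>J. \<Sum>g | length g = wires CI \<and> take n g = x. (cmod (\<beta> ?y j g))\<^sup>2)"
    by (intro sum_mono sum_mono2)
      (auto intro: finite_subset[OF _ finite_bitstrings[of "wires CI"]] simp: band_commute[of x r])
  finally show ?thesis unfolding tdf_inv_prob_gram[OF eff gr length_tdf_image[OF eff lek x] x] .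
qed

text \<open>For the exceptional keys, about which correctness of inversion says nothing.\<close>

lemma sde_dec_prob_nonneg:
  assumes "length ct = n + 1 + m"
  shows "0 \<le> sde_dec_prob (sde_of F) l \<kappa>' ct [b]"
proof -
  interpret measurement "n + 1 + m" "q + e" "A + (1 + m) + (1 + n)" "dec_gates n m q e CI CE" "A + m" "A + (1 + m) + n"
    by (rule measurement_dec[OF wfs(1,2)])
  have "sde_dec_prob (sde_of F) l \<kappa>' ct [b] = (\<Sum>j\<in>J. sqnorm (A + (1 + m) + (1 + n)) (post (\<lambda>u. u = [True, b]) ct (\<psi>' j)))"
    unfolding sde_dec_prob_def sde_dec_branch_def sde_of_simps dec_circuit_def assms Let_def if_P[OF refl]
    by (rule qtrace_branch_circ[OF gr' assms]) simp
  then show ?thesis by (simp add: sum_nonneg)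
qed

text \<open>For every ciphertext one outcome \<open>z0\<close> turns out to have weight at least
  \<open>1 - \<epsilon>\<close>; \<open>gentle_measurement\<close> does the rest.\<close>

lemma trace_distance_dec_key:
  assumes good: "good_key F l \<epsilon> ek \<kappa>" and \<epsilon>: "0 \<le> \<epsilon>"
  shows "trace_distance (q + e) \<kappa>' (sde_dec_key 1 (sde_of F) l \<kappa>' ct) \<le> sqrt \<epsilon> + \<epsilon>"
proof (cases "length ct = n + 1 + m")
  case True
  interpret measurement "n + 1 + m" "q + e" "A + (1 + m) + (1 + n)" "dec_gates n m q e CI CE" "A + m" "A + (1 + m) + n"
    by (rule measurement_dec[OF wfs(1,2)])
  define r c y where "r = take n ct" and "c = ct ! n" and "y = drop (n + 1) ct"
  have ct: "ct = r @ [c] @ y" unfolding r_def c_def y_def using True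
      id_take_nth_drop[of n ct] by simp
  have lr: "length r = n" and ly: "length y = m" using True by (auto simp: r_def y_def)
  have "\<exists>z0. length z0 = 2 \<and> (\<Sum>j\<in>J. sqnorm (A + (1 + m) + (1 + n)) (post (\<lambda>u. u \<noteq> z0) ct (\<psi>' j))) \<le> \<epsilon>"
  proof (cases "\<exists>x. length x = n \<and> y = tdf_image F l ek x")
    case True
    then obtain x where x: "length x = n" "y = tdf_image F l ek x" by blast
    let ?z = "[True, c \<noteq> parity (band r x)]"
    have "(\<Sum>j\<in>J. sqnorm (A + (1 + m) + (1 + n)) (post (\<lambda>u. u \<noteq> ?z) ct (\<psi>' j)))
       \<le> (\<Sum>j\<in>J. \<Sum>g | length g = wires CI \<and> take n g \<noteq> x. (cmod (\<beta> y j g))\<^sup>2)"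
      unfolding ct sum_post[OF lr ly] using x(2)
      by (intro sum_mono sum_mono2) (auto intro: finite_subset[OF _ finite_bitstrings[of "wires CI"]])
    also have "\<dots> = (\<Sum>j\<in>J. (\<Sum>g | length g = wires CI. (cmod (\<beta> y j g))\<^sup>2)
         - (\<Sum>g | length g = wires CI \<and> take n g = x. (cmod (\<beta> y j g))\<^sup>2))"
    proof (rule sum.cong[OF refl])
      fix j
      have "{g. length g = wires CI \<and> take n g \<noteq> x} = {g. length g = wires CI} - {g. length g = wires CI \<and> take n g = x}" by auto
      then show "(\<Sum>g | length g = wires CI \<and> take n g \<noteq> x. (cmod (\<beta> y j g))\<^sup>2)
        = (\<Sum>g | length g = wires CI. (cmod (\<beta> y j g))\<^sup>2) - (\<Sum>g | length g = wires CI \<and> take n g = x. (cmod (\<beta> y j g))\<^sup>2)"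
        using finite_bitstrings[of "wires CI", unfolded bitstrings_def] by (simp add: sum_diff Collect_mono)
    qed
    also have "\<dots> = 1 - tdf_inv_prob F l \<kappa> y x"
      unfolding sum_subtractf sum_\<beta>[OF ly] tdf_inv_prob_gram[OF eff gr ly x(1)] ..
    \<comment> \<open>This \<open>x\<close> depends on the ciphertext, which is why
      \<open>good_key\<close> quantifies over all preimages.\<close>
    also have "\<dots> \<le> \<epsilon>" using good x unfolding good_key_def by (simp add: algebra_simps)
    finally show ?thesis by (intro exI[of _ ?z]) simp
  next
    case False
    \<comment> \<open>No candidate evaluates to \<open>y\<close>, so rejection is certain whatever
      \<open>Inv\<close> returns.\<close>
    have "{g. length g = wires CI \<and> [y = tdf_image F l ek (take n g),
        y = tdf_image F l ek (take n g) \<and> c \<noteq> parity (band r (take n g))] \<noteq> [False, False]} = {}"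
      using False wfs(1) by (auto simp: wf_circuit_iff)
    then have "(\<Sum>j\<in>J. sqnorm (A + (1 + m) + (1 + n)) (post (\<lambda>u. u \<noteq> [False, False]) ct (\<psi>' j))) = 0"
      unfolding ct sum_post[OF lr ly] by (simp only: sum.empty sum.neutral_const)
    then show ?thesis using \<epsilon> by (intro exI[of _ "[False, False]"]) simp
  qed
  then obtain z0 where z0: "length z0 = 2"
    "(\<Sum>j\<in>J. sqnorm (A + (1 + m) + (1 + n)) (post (\<lambda>u. u \<noteq> z0) ct (\<psi>' j))) \<le> \<epsilon>" by blast
  have "sde_dec_key 1 (sde_of F) l \<kappa>' ct
      = (\<lambda>s t. \<Sum>z\<in>bitstrings 2. branch circ (n + 1 + m + (q + e)) (q + e) (with_classical ct \<kappa>') z s t)"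
    unfolding sde_dec_key_def sde_dec_branch_def sde_of_simps dec_circuit_def True Let_def if_P[OF refl]
    by (simp add: fun_eq_iff numeral_2_eq_2)
  then show ?thesis using gentle_measurement[OF J gr' tr' True z0] by (simp only:)
next
  case False
  define L where "L = length ct"
  interpret measurement L "q + e" "L + (q + e) + 2" "[]" "L + (q + e)" "L + (q + e) + 1"
    by unfold_locales auto
  \<comment> \<open>The program is empty, so the two output wires still hold their initial
    zeros.\<close>
  have "computed ct \<phi> s = 0" if "length s = L + (q + e) + 2" "outbits s \<noteq> [False, False]" for \<phi> s
  proof (rule ccontr)
    assume "computed ct \<phi> s \<noteq> 0"
    then obtain t where t: "length t = q + e" "s = ct @ t @ zeros 2"
      unfolding computed_def start_def superpos_def run_gates_Nil
      by (auto simp: ket_def elim!: sum.not_neutral_contains_not_neutral split: if_splits)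
    then have "outbits s = [False, False]"
      unfolding outbits_def by (simp add: L_def nth_append numeral_2_eq_2)
    with that(2) show False by simp
  qed
  then have "sqnorm (L + (q + e) + 2) (post (\<lambda>u. u \<noteq> [False, False]) ct \<phi>) = 0" for \<phi>
    unfolding sqnorm_post by (intro sum.neutral) auto
  then have "(\<Sum>j\<in>J. sqnorm (L + (q + e) + 2) (post (\<lambda>u. u \<noteq> [False, False]) ct (\<psi>' j))) \<le> \<epsilon>" using \<epsilon> by simp
  from gentle_measurement[OF J gr' tr' L_def[symmetric] _ this]
  have "trace_distance (q + e) \<kappa>' (\<lambda>s t. \<Sum>z\<in>bitstrings 2. branch circ (L + (q + e)) (q + e) (with_classical ct \<kappa>') z s t)
     \<le> sqrt \<epsilon> + \<epsilon>" by simp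
  moreover have "sde_dec_key 1 (sde_of F) l \<kappa>' ct
      = (\<lambda>s t. \<Sum>z\<in>bitstrings 2. branch circ (L + (q + e)) (q + e) (with_classical ct \<kappa>') z s t)"
    unfolding sde_dec_key_def sde_dec_branch_def sde_of_simps dec_circuit_def if_not_P[OF False] L_def
    by (simp add: fun_eq_iff numeral_2_eq_2)
  ultimately show ?thesis by (simp only:)
qed

end

section \<open>The quantum Goldreich-Levin extractor\<close>

text \<open>\<open>diff_op B ct\<close> is \<open>E\<^sub>0 - E\<^sub>1\<close> for the measurement operators of \<open>B\<close> on challenge \<open>ct\<close>.\<close>

definition diff_op :: "circuit \<Rightarrow> bits \<Rightarrow> bits \<Rightarrow> bits \<Rightarrow> complex" where
  "diff_op B ct t s = (\<Sum>b\<in>UNIV. sign b * effect B [b] (ct @ t) (ct @ s))"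

text \<open>The Fourier coefficient at \<open>x @ [True]\<close> of the difference operator as a
  function of the ciphertext prefix \<open>a\<close>, that is \<open>r\<close> followed by the
  masked bit. The appended \<open>True\<close> lets the masked bit contribute to the sign.\<close>

definition gl_op :: "nat \<Rightarrow> circuit \<Rightarrow> bits \<Rightarrow> bits \<Rightarrow> bits \<Rightarrow> bits \<Rightarrow> complex" where
  "gl_op n B y x t s = (\<Sum>a\<in>bitstrings (n + 1). sign (parity (band (x @ [True]) a)) * diff_op B (a @ y) t s) / 2 ^ (n + 1)"

text \<open>The vector obtained by applying the tensor product of \<open>M\<close> and
  \<open>N\<close> to \<open>\<phi>\<close>.\<close>

definition apply2 ::
  "nat \<Rightarrow> nat \<Rightarrow> (bits \<Rightarrow> bits \<Rightarrow> complex) \<Rightarrow> (bits \<Rightarrow> bits \<Rightarrow> complex) \<Rightarrow> (bits \<Rightarrow> complex) \<Rightarrow> bits \<Rightarrow> bits \<Rightarrow> complex" where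
  "apply2 b c M N \<phi> t t' = (\<Sum>s\<in>bitstrings b. \<Sum>s'\<in>bitstrings c. M t s * N t' s' * \<phi> (s @ s'))"

text \<open>
  Bernstein-Vazirani with \<open>B\<close> as phase oracle: \<open>B\<close> runs on a copy of the register holding the
  superposition over \<open>(r, c)\<close>, the sign of its answer is taken by \<open>Z = T\<^sup>4\<close>, and all is uncomputed.
\<close>

definition extractor :: "nat \<Rightarrow> nat \<Rightarrow> nat \<Rightarrow> circuit \<Rightarrow> circuit" where
  "extractor n m b B = (let k = n + 1; P = k + (m + b) in
     Circuit (P + wires B)
      (swap_block 0 (P + k) (m + b) @ gate_family k (H 0) @ copy_block 0 P k
        @ shift P (gates B @ replicate 4 (T 0) @ inverse_gates (gates B))
        @ copy_block 0 P k @ gate_family k (H 0)))"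

lemma wf_extractor:
  assumes "wf_circuit (n + 1 + m + b) 1 B"
  shows "wf_circuit (m + b) n (extractor n m b B)"
proof -
  have "wf_gates (wires B) (gates B @ replicate 4 (T 0) @ inverse_gates (gates B))"
    using assms by (simp add: wf_circuit_iff wf_inverse_gates numeral_eq_Suc)
  then show ?thesis using assms unfolding wf_circuit_iff extractor_def Let_def
    by (auto intro!: wf_swap_block wf_copy_block wf_gate_family wf_gates_shift[of "wires B"] simp del: wf_gates_append
      simp: wf_gates_append[of _ "swap_block _ _ _"] wf_gates_append[of _ "gate_family _ _"] wf_gates_append[of _ "copy_block _ _ _"]
        wf_gates_append[of _ "shift _ _"])
qed

lemma run_Z: "run_gates (replicate 4 (T i)) \<psi> u = sign (u ! i) * \<psi> u"
proof -
  have "cis (pi / 4) ^ 4 = - 1" using Complex.DeMoivre[of "pi / 4" 4] by (simp add: complex_eq_iff)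
  then have "cis (pi / 4) * (cis (pi / 4) * (cis (pi / 4) * cis (pi / 4))) = - 1"
    by (simp add: power4_eq_xxxx mult.assoc)
  then show ?thesis by (simp add: numeral_eq_Suc run_gates_Cons sign_def flip: mult.assoc)
qed

text \<open>Computing, taking the sign and uncomputing is a conjugated phase. Moving the inverse to
  the other side of the inner product leaves a signed sum over the final strings, whose two signs
  collect the effects for answers 0 and 1.\<close>

lemma phase_oracle_entry:
  assumes wf: "wf_circuit (length (ct @ s)) 1 B" and len: "length t = length s"
  shows "run_gates (gates B @ replicate 4 (T 0) @ inverse_gates (gates B)) (ket (pad B (ct @ s))) (pad B (ct @ t))
    = diff_op B ct t s"
proof -
  let ?W = "wires B"
  have W: "?W = 1 + (?W - 1)" "length (ct @ s) \<le> ?W" "wf_gates ?W (gates B)" using wf by (auto simp: wf_circuit_iff)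
  define f where "f = run_gates (replicate 4 (T 0)) (amp B (ct @ s))"
  define t0 where "t0 = pad B (ct @ t)"
  have lt0: "length t0 = ?W" using W len by (simp add: t0_def pad_eq)
  have "run_gates (gates B @ replicate 4 (T 0) @ inverse_gates (gates B)) (ket (pad B (ct @ s))) t0
     = run_gates (inverse_gates (gates B)) f t0"
    unfolding f_def amp_eq by (simp only: run_gates_append)
  also have "\<dots> = inner_prod ?W (ket t0) (run_gates (inverse_gates (gates B)) f)"
    unfolding inner_prod_def by (subst sum_bitstrings_single[of t0]) (auto simp: lt0 ket_def)
  also have "\<dots> = inner_prod ?W (run_gates (gates B) (ket t0)) (run_gates (gates B) (run_gates (inverse_gates (gates B)) f))"
    using inner_prod_run_gates[OF W(3)] by simp
  also have "\<dots> = inner_prod ?W (amp B (ct @ t)) f"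
    unfolding inner_prod_def amp_eq t0_def using W(3) by (intro sum.cong refl) (auto simp: run_gates_inverse)
  also have "\<dots> = (\<Sum>u\<in>bitstrings (1 + (?W - 1)). cnj (amp B (ct @ t) u) * (sign (u ! 0) * amp B (ct @ s) u))"
    unfolding inner_prod_def f_def run_Z using W(1) by simp
  also have "\<dots> = diff_op B ct t s"
    unfolding sum_bitstrings_append diff_op_def effect_def UNIV_bool
    by (simp add: sum_bitstrings_1 sum_distrib_left mult_ac)
  finally show ?thesis unfolding t0_def .
qed

text \<open>Each Hadamard layer contributes \<open>1 / sqrt 2 ^ (n + 1)\<close>, the second one also
  the signs. Because the copy of \<open>a\<close> has been erased again, the terms for different
  \<open>a\<close> end in the same state of the work wires and add up coherently.\<close>

lemma amp_extractor:
  assumes wf: "wf_circuit (n + 1 + m + b) 1 B"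
    and lens: "length y = m" "length s = b" "length t = b" "length x = n + 1"
  shows "amp (extractor n m b B) (y @ s)
      (x @ zeros (m + b) @ (zeros (n + 1) @ y @ t @ zeros (wires B - (n + 1 + m + b))))
    = (\<Sum>a\<in>bitstrings (n + 1). sign (parity (band x a)) * diff_op B (a @ y) t s) / 2 ^ (n + 1)"
proof -
  let ?W = "wires B" and ?k = "n + 1"
  define P where "P = ?k + (m + b)"
  define G where "G = gates B @ replicate 4 (T 0) @ inverse_gates (gates B)"
  define R where "R = ?W - (n + 1 + m + b)"
  have W: "n + 1 + m + b \<le> ?W" "1 \<le> ?W" "wf_gates ?W (gates B)" using wf by (auto simp: wf_circuit_iff)
  have wR: "?W = ?k + (m + b + R)" using W by (simp add: R_def)
  have wfG: "wf_gates ?W G" using W unfolding G_def by (simp add: wf_inverse_gates numeral_eq_Suc)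
  have wfs: "wf_gates (P + ?W) (swap_block 0 (P + ?k) (m + b))" "wf_gates (P + ?W) (copy_block 0 P ?k)"
    using W by (auto intro!: wf_swap_block wf_copy_block simp: P_def)
  let ?c = "1 / complex_of_real (sqrt 2) ^ ?k"
  let ?Had = "gate_family ?k (H 0)"
  define Z where "Z = zeros (m + b)"
  have lZ: "length Z = m + b" by (simp add: Z_def)
  have padB: "pad B (a @ y @ t) = a @ y @ t @ zeros R" if "length a = ?k" "length t = b" for a t
    using that lens by (simp add: pad_eq R_def)
  have "P + ?W - length (y @ s) = ?k + (?k + (m + b + R))" using lens wR by (simp add: P_def)
  then have pad: "pad (extractor n m b B) (y @ s) = (y @ s) @ zeros ?k @ zeros ?k @ Z @ zeros R"
    unfolding pad_eq extractor_def Let_def P_def[symmetric] Z_def by (simp only: circuit.sel replicate_add append_assoc)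
  have 0: "act (swap_block 0 (P + ?k) (m + b)) (pad (extractor n m b B) (y @ s)) = zeros ?k @ Z @ zeros ?k @ y @ s @ zeros R"
  proof -
    have "act (swap_block 0 (P + ?k) (m + b)) ([] @ (y @ s) @ (zeros ?k @ zeros ?k) @ Z @ zeros R)
       = [] @ Z @ (zeros ?k @ zeros ?k) @ (y @ s) @ zeros R"
      by (rule act_swap_block) (use lens lZ in \<open>auto simp: P_def\<close>)
    moreover have "Z @ zeros ?k = zeros ?k @ Z" unfolding Z_def by (simp only: replicate_add[symmetric] add.commute)
    ultimately show ?thesis unfolding pad by (metis append_Nil append_assoc)
  qed
  define \<psi>1 where "\<psi>1 = run_gates ?Had (ket (zeros ?k @ Z @ zeros ?k @ y @ s @ zeros R))"
  have \<psi>1: "\<psi>1 u = superpos (bitstrings ?k) (\<lambda>_. ?c) (\<lambda>a. a @ Z @ zeros ?k @ y @ s @ zeros R) u" if "length u = P + ?W" for u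
  proof -
    define a u' where "a = take ?k u" and "u' = drop ?k u"
    have u: "u = a @ u'" "length a = ?k" using that by (auto simp: a_def u'_def P_def)
    let ?r = "Z @ zeros ?k @ y @ s @ zeros R"
    have "\<psi>1 u = (\<Sum>a'\<in>bitstrings ?k. sign (parity (band a a')) * ket (zeros ?k @ ?r) (a' @ u')) / complex_of_real (sqrt 2) ^ ?k"
      unfolding \<psi>1_def u(1) by (rule run_hadamard_layer[OF u(2)])
    also have "(\<Sum>a'\<in>bitstrings ?k. sign (parity (band a a')) * ket (zeros ?k @ ?r) (a' @ u'))
       = sign (parity (band a (zeros ?k))) * ket (zeros ?k @ ?r) (zeros ?k @ u')"
    proof (rule sum_bitstrings_single)
      fix a' assume "a' \<in> bitstrings ?k" "a' \<noteq> zeros ?k"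
      then have "a' @ u' \<noteq> zeros ?k @ ?r" by (metis append_eq_append_conv in_bitstrings length_replicate)
      then show "sign (parity (band a a')) * ket (zeros ?k @ ?r) (a' @ u') = 0" by (simp only: ket_def if_False mult_zero_right)
    qed simp
    also have "parity (band a (zeros ?k)) = False"
    proof -
      have "parity (band v (zeros (length v))) = False" for v by (induction v) auto
      from this[of a] u(2) show ?thesis by simp
    qed
    finally have "\<psi>1 u = (if u' = ?r then ?c else 0)" by (simp add: ket_def sign_def)
    also have "\<dots> = superpos (bitstrings ?k) (\<lambda>_. ?c) (\<lambda>a. a @ ?r) u"
      using superpos_block_at[of a ?k "[]" "[]" "\<lambda>_. ?c" ?r u'] u by simp
    finally show ?thesis .
  qed
  define \<psi>2 where "\<psi>2 = superpos (bitstrings ?k) (\<lambda>_. ?c) (\<lambda>a. (a @ Z) @ pad B (a @ y @ s))"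
  have \<psi>2: "run_gates (copy_block 0 P ?k) (superpos (bitstrings ?k) (\<lambda>_. ?c) (\<lambda>a. a @ Z @ zeros ?k @ y @ s @ zeros R)) = \<psi>2"
    unfolding run_superpos_classical[OF wfs(2) classical_copy_block] \<psi>2_def
  proof (rule superpos_cong[OF refl])
    fix a assume a: "a \<in> bitstrings ?k"
    have "act (copy_block 0 P ?k) ([] @ a @ Z @ zeros ?k @ y @ s @ zeros R) = [] @ a @ Z @ bxor a (zeros ?k) @ y @ s @ zeros R"
      by (rule act_copy_block) (use a lZ in \<open>auto simp: P_def\<close>)
    then show "act (copy_block 0 P ?k) (a @ Z @ zeros ?k @ y @ s @ zeros R) = (a @ Z) @ pad B (a @ y @ s)"
      using a lens padB by (simp del: replicate_Suc)
  qed
  define \<psi>3 where "\<psi>3 = run_gates (shift P G) \<psi>2"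
  \<comment> \<open>The first register still holds \<open>a'\<close>, so only the branch with
    \<open>a' = a\<close> reaches this basis state.\<close>
  have \<psi>3: "\<psi>3 (a @ Z @ pad B (a @ y @ t)) = ?c * diff_op B (a @ y) t s" if a: "length a = ?k" for a
  proof -
    have "run_gates (shift P G) (ket ((a' @ Z) @ pad B (a' @ y @ s))) (a @ Z @ pad B (a @ y @ t))
      = (if a' = a then diff_op B (a @ y) t s else 0)" if a': "length a' = ?k" for a'
    proof -
      have lp: "length (pad B (a' @ y @ s)) = ?W" "length (pad B (a @ y @ t)) = ?W" using a a' lens wR by (simp_all add: padB)
      have e: "run_gates (shift P G) (ket ((a' @ Z) @ pad B (a' @ y @ s)))
         = superpos (bitstrings ?W) (run_gates G (ket (pad B (a' @ y @ s)))) (\<lambda>g. (a' @ Z) @ g @ [])"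
        using ket_block[OF lp(1), of "a' @ Z" "[]"] run_superpos_block[OF wfG, of P "a' @ Z" "ket (pad B (a' @ y @ s))" "[]"] a' lZ
        by (simp add: P_def)
      have "run_gates (shift P G) (ket ((a' @ Z) @ pad B (a' @ y @ s))) (a @ Z @ pad B (a @ y @ t))
         = (if a' = a then run_gates G (ket (pad B (a' @ y @ s))) (pad B (a @ y @ t)) else 0)"
        unfolding e using superpos_block_at[OF lp(2), of "a @ Z" "a' @ Z" "run_gates G (ket (pad B (a' @ y @ s)))" "[]" "[]"] a a' by auto
      also have "\<dots> = (if a' = a then diff_op B (a @ y) t s else 0)"
        using phase_oracle_entry[of "a @ y" s B t] wf a lens unfolding G_def by (simp add: add.assoc)
      finally show ?thesis .
    qed
    then have "\<psi>3 (a @ Z @ pad B (a @ y @ t)) = (\<Sum>a'\<in>bitstrings ?k. ?c * (if a' = a then diff_op B (a @ y) t s else 0))"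
      unfolding \<psi>3_def \<psi>2_def run_superpos by (intro sum.cong refl) simp
    also have "\<dots> = ?c * diff_op B (a @ y) t s"
      by (subst sum_bitstrings_single[of a]) (use a in auto)
    finally show ?thesis .
  qed
  define \<psi>4 where "\<psi>4 = run_gates (copy_block 0 P ?k) \<psi>3"
  \<comment> \<open>Copying a second time erases the copy, as \<open>bxor a a\<close> is
    zero.\<close>
  have \<psi>4: "\<psi>4 (a @ Z @ zeros ?k @ y @ t @ zeros R) = ?c * diff_op B (a @ y) t s" if a: "length a = ?k" for a
  proof -
    have "act (copy_block 0 P ?k) ([] @ a @ Z @ a @ y @ t @ zeros R) = [] @ a @ Z @ bxor a a @ y @ t @ zeros R"
      by (rule act_copy_block) (use a lZ in \<open>auto simp: P_def\<close>)
    then have "act (copy_block 0 P ?k) (a @ Z @ pad B (a @ y @ t)) = a @ Z @ zeros ?k @ y @ t @ zeros R"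
      using a lens by (simp add: padB)
    then have "act (rev (copy_block 0 P ?k)) (a @ Z @ zeros ?k @ y @ t @ zeros R) = a @ Z @ pad B (a @ y @ t)"
      using act_rev[OF wfs(2)] by metis
    then show ?thesis unfolding \<psi>4_def run_classical_gates[OF classical_copy_block] using \<psi>3[OF a] by simp
  qed
  have cong: "run_gates gs f u = run_gates gs f' u" if "\<And>u. length u = P + ?W \<Longrightarrow> f u = f' u" "length u = P + ?W" for gs f f' u
    by (rule run_gates_cong) (use that in auto)
  have fin: "length (x @ Z @ zeros ?k @ y @ t @ zeros R) = P + ?W" using lens lZ wR by (simp add: P_def)
  have e: "amp (extractor n m b B) (y @ s) = run_gates ?Had (run_gates (copy_block 0 P ?k) (run_gates (shift P G)
      (run_gates (copy_block 0 P ?k) \<psi>1)))"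
    unfolding amp_eq \<psi>1_def 0[symmetric] run_ket_classical[OF wfs(1) classical_swap_block, symmetric]
    by (subst extractor_def) (simp only: Let_def circuit.sel run_gates_append P_def G_def)
  have "amp (extractor n m b B) (y @ s) (x @ Z @ zeros ?k @ y @ t @ zeros R)
     = run_gates ?Had \<psi>4 (x @ Z @ zeros ?k @ y @ t @ zeros R)"
    unfolding e \<psi>4_def \<psi>3_def \<psi>2[symmetric] by (intro cong fin \<psi>1)
  also have "\<dots> = (\<Sum>a\<in>bitstrings ?k. sign (parity (band x a)) * \<psi>4 (a @ Z @ zeros ?k @ y @ t @ zeros R)) / complex_of_real (sqrt 2) ^ ?k"
    by (rule run_hadamard_layer) (rule lens)
  also have "\<dots> = (\<Sum>a\<in>bitstrings ?k. sign (parity (band x a)) * (?c * diff_op B (a @ y) t s)) / complex_of_real (sqrt 2) ^ ?k"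
    by (intro arg_cong2[where f = "(/)"] sum.cong refl) (simp only: \<psi>4 in_bitstrings)
  also have "\<dots> = (\<Sum>a\<in>bitstrings ?k. sign (parity (band x a)) * diff_op B (a @ y) t s) * (?c * ?c)"
    by (simp add: sum_distrib_right sum_divide_distrib mult_ac)
  also have "?c * ?c = 1 / 2 ^ ?k"
  proof -
    have "complex_of_real (sqrt 2) * complex_of_real (sqrt 2) = 2" by (simp flip: of_real_mult)
    then have "complex_of_real (sqrt 2) ^ ?k * complex_of_real (sqrt 2) ^ ?k = 2 ^ ?k"
      by (simp only: power_mult_distrib[symmetric])
    then show ?thesis by (simp only: times_divide_times_eq mult_1)
  qed
  finally show ?thesis unfolding R_def Z_def by simp
qed

lemma sum_product3:
  fixes p :: "'a \<Rightarrow> 'd::comm_semiring_0"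
  shows "(\<Sum>v\<in>V. p v) * (\<Sum>w\<in>W. q w) * (\<Sum>k\<in>K. r k) = (\<Sum>k\<in>K. \<Sum>v\<in>V. \<Sum>w\<in>W. p v * q w * r k)"
  unfolding sum_product[of p V q W] sum_distrib_left[of _ r K] unfolding sum_distrib_right ..

text \<open>Expanding both effects over the unmeasured wires turns the trace into squared
  amplitudes, which shows nonnegativity and permits termwise lower bounds.\<close>

lemma joint_prob_gram:
  assumes gr: "gram (b + c) K \<phi> \<sigma>"
  shows "joint_prob B C b c \<sigma> x y z w = (\<Sum>k\<in>K. \<Sum>v\<in>bitstrings (wires B - length z). \<Sum>v'\<in>bitstrings (wires C - length w).
     (cmod (\<Sum>s\<in>bitstrings b. \<Sum>s'\<in>bitstrings c. amp B (x @ s) (z @ v) * amp C (y @ s') (w @ v') * \<phi> k (s @ s')))\<^sup>2)"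
proof -
  let ?I = "K \<times> bitstrings (wires B - length z) \<times> bitstrings (wires C - length w)"
  let ?S = "bitstrings b \<times> bitstrings c"
  define f where "f = (\<lambda>(k, v, v') (s, s'). amp B (x @ s) (z @ v) * amp C (y @ s') (w @ v') * \<phi> k (s @ s'))"
  have "(\<Sum>s\<in>bitstrings b. \<Sum>t\<in>bitstrings b. \<Sum>s'\<in>bitstrings c. \<Sum>t'\<in>bitstrings c.
           effect B z (x @ t) (x @ s) * effect C w (y @ t') (y @ s') * \<sigma> (s @ s') (t @ t'))
     = (\<Sum>s\<in>bitstrings b. \<Sum>s'\<in>bitstrings c. \<Sum>t\<in>bitstrings b. \<Sum>t'\<in>bitstrings c.
           effect B z (x @ t) (x @ s) * effect C w (y @ t') (y @ s') * \<sigma> (s @ s') (t @ t'))"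
    by (intro sum.cong refl sum.swap)
  also have "\<dots> = (\<Sum>s\<in>bitstrings b. \<Sum>s'\<in>bitstrings c. \<Sum>t\<in>bitstrings b. \<Sum>t'\<in>bitstrings c. \<Sum>i\<in>?I. f i (s, s') * cnj (f i (t, t')))"
  proof (intro sum.cong refl)
    fix s t s' t' assume l: "s \<in> bitstrings b" "t \<in> bitstrings b" "s' \<in> bitstrings c" "t' \<in> bitstrings c"
    have "\<sigma> (s @ s') (t @ t') = (\<Sum>k\<in>K. \<phi> k (s @ s') * cnj (\<phi> k (t @ t')))"
      using gr l unfolding gram_def by simp
    then have "effect B z (x @ t) (x @ s) * effect C w (y @ t') (y @ s') * \<sigma> (s @ s') (t @ t')
      = (\<Sum>v\<in>bitstrings (wires B - length z). cnj (amp B (x @ t) (z @ v)) * amp B (x @ s) (z @ v))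
        * (\<Sum>v'\<in>bitstrings (wires C - length w). cnj (amp C (y @ t') (w @ v')) * amp C (y @ s') (w @ v'))
        * (\<Sum>k\<in>K. \<phi> k (s @ s') * cnj (\<phi> k (t @ t')))" unfolding effect_def by simp
    also have "\<dots> = (\<Sum>k\<in>K. \<Sum>v\<in>bitstrings (wires B - length z). \<Sum>v'\<in>bitstrings (wires C - length w).
        f (k, v, v') (s, s') * cnj (f (k, v, v') (t, t')))"
      unfolding f_def sum_product3 by (simp add: mult_ac)
    also have "\<dots> = (\<Sum>i\<in>?I. f i (s, s') * cnj (f i (t, t')))"
      by (simp add: sum.cartesian_product case_prod_unfold)
    finally show "effect B z (x @ t) (x @ s) * effect C w (y @ t') (y @ s') * \<sigma> (s @ s') (t @ t')
      = (\<Sum>i\<in>?I. f i (s, s') * cnj (f i (t, t')))" .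
  qed
  also have "\<dots> = (\<Sum>p\<in>?S. \<Sum>p'\<in>?S. \<Sum>i\<in>?I. f i p * cnj (f i p'))"
    by (simp only: sum_Times_pair[symmetric])
  also have "\<dots> = (\<Sum>i\<in>?I. \<Sum>p\<in>?S. \<Sum>p'\<in>?S. f i p * cnj (f i p'))"
    by (rule trans[OF sum.cong[OF refl sum.swap] sum.swap])
  also have "\<dots> = (\<Sum>i\<in>?I. complex_of_real ((cmod (\<Sum>p\<in>?S. f i p))\<^sup>2))"
    unfolding complex_norm_square by (simp add: sum_product)
  finally have *: "(\<Sum>s\<in>bitstrings b. \<Sum>t\<in>bitstrings b. \<Sum>s'\<in>bitstrings c. \<Sum>t'\<in>bitstrings c.
           effect B z (x @ t) (x @ s) * effect C w (y @ t') (y @ s') * \<sigma> (s @ s') (t @ t'))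
     = complex_of_real (\<Sum>i\<in>?I. (cmod (\<Sum>p\<in>?S. f i p))\<^sup>2)" by (simp only: of_real_sum)
  show ?thesis unfolding joint_prob_def * Re_complex_of_real f_def
    by (simp add: sum.cartesian_product case_prod_unfold)
qed

text \<open>Among the squared amplitudes for outputs \<open>xB\<close> and \<open>xC\<close>, only
  those are kept where both circuits have restored their work wires; their amplitudes are the
  entries of \<open>gl_op\<close>.\<close>

lemma joint_prob_extractor_ge:
  assumes wfB: "wf_circuit (n + 1 + m + b) 1 B" and wfC: "wf_circuit (n + 1 + m + c) 1 C"
    and gr: "gram (b + c) K \<phi> \<sigma>"
    and lens: "length yB = m" "length yC = m" "length xB = n" "length xC = n"
  shows "joint_prob (extractor n m b B) (extractor n m c C) b c \<sigma> yB yC xB xC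
    \<ge> (\<Sum>k\<in>K. \<Sum>t\<in>bitstrings b. \<Sum>t'\<in>bitstrings c. (cmod (apply2 b c (gl_op n B yB xB) (gl_op n C yC xC) (\<phi> k) t t'))\<^sup>2)"
proof -
  \<comment> \<open>The unmeasured wires of a successful run. The leading \<open>[True]\<close> is
    the last wire of the transformed register, the one that carried the masked bit.\<close>
  define F where "F b B y t = [True] @ zeros (m + b) @ (zeros (n + 1) @ y @ t @ zeros (wires B - (n + 1 + m + b)))"
    for b :: nat and B :: circuit and y t :: bits
  have inj: "inj (F b B y)" for b B y by (auto simp: inj_def F_def)
  have len: "length (F b B y t) = wires (extractor n m b B) - n"
    if "wf_circuit (n + 1 + m + b) 1 B" "length y = m" "length t = b" for b B y t
    using that by (simp add: F_def extractor_def Let_def wf_circuit_iff)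
  have amp: "amp (extractor n m b B) (y @ s) (x @ F b B y t) = gl_op n B y x t s"
    if "wf_circuit (n + 1 + m + b) 1 B" "length y = m" "length s = b" "length t = b" "length x = n" for b B x y s t
    using amp_extractor[OF that(1-4), of "x @ [True]"] that(5) by (simp add: F_def gl_op_def)
  let ?g = "\<lambda>k v v'. (cmod (\<Sum>s\<in>bitstrings b. \<Sum>s'\<in>bitstrings c. amp (extractor n m b B) (yB @ s) (xB @ v) *
      amp (extractor n m c C) (yC @ s') (xC @ v') * \<phi> k (s @ s')))\<^sup>2"
  let ?VB = "bitstrings (wires (extractor n m b B) - length xB)" and ?VC = "bitstrings (wires (extractor n m c C) - length xC)"
  have "(\<Sum>t\<in>bitstrings b. \<Sum>t'\<in>bitstrings c. (cmod (apply2 b c (gl_op n B yB xB) (gl_op n C yC xC) (\<phi> k) t t'))\<^sup>2)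
      \<le> (\<Sum>v\<in>?VB. \<Sum>v'\<in>?VC. ?g k v v')" for k
  proof -
    have "(\<Sum>t\<in>bitstrings b. \<Sum>t'\<in>bitstrings c. (cmod (apply2 b c (gl_op n B yB xB) (gl_op n C yC xC) (\<phi> k) t t'))\<^sup>2)
      = (\<Sum>t\<in>bitstrings b. \<Sum>t'\<in>bitstrings c. ?g k (F b B yB t) (F c C yC t'))"
    proof (intro sum.cong refl)
      fix t t' assume t: "t \<in> bitstrings b" "t' \<in> bitstrings c"
      have "apply2 b c (gl_op n B yB xB) (gl_op n C yC xC) (\<phi> k) t t' = (\<Sum>s\<in>bitstrings b. \<Sum>s'\<in>bitstrings c.
          amp (extractor n m b B) (yB @ s) (xB @ F b B yB t) * amp (extractor n m c C) (yC @ s') (xC @ F c C yC t') * \<phi> k (s @ s'))"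
        unfolding apply2_def using t lens by (intro sum.cong refl) (simp add: amp[OF wfB] amp[OF wfC])
      then show "(cmod (apply2 b c (gl_op n B yB xB) (gl_op n C yC xC) (\<phi> k) t t'))\<^sup>2 = ?g k (F b B yB t) (F c C yC t')"
        by (simp only:)
    qed
    also have "\<dots> = (\<Sum>t\<in>bitstrings b. \<Sum>v'\<in>F c C yC ` bitstrings c. ?g k (F b B yB t) v')"
      by (rule sum.cong[OF refl]) (simp add: sum.reindex[OF inj_on_subset[OF inj subset_UNIV]])
    also have "\<dots> = (\<Sum>v\<in>F b B yB ` bitstrings b. \<Sum>v'\<in>F c C yC ` bitstrings c. ?g k v v')"
      by (simp add: sum.reindex[OF inj_on_subset[OF inj subset_UNIV]])
    also have "\<dots> \<le> (\<Sum>v\<in>F b B yB ` bitstrings b. \<Sum>v'\<in>?VC. ?g k v v')"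
      by (intro sum_mono sum_mono2) (use len[OF wfC] lens in auto)
    also have "\<dots> \<le> (\<Sum>v\<in>?VB. \<Sum>v'\<in>?VC. ?g k v v')"
      by (intro sum_mono2) (use len[OF wfB] lens in \<open>auto intro!: sum_nonneg\<close>)
    finally show ?thesis .
  qed
  then show ?thesis unfolding joint_prob_gram[OF gr] by (intro sum_mono) auto
qed

section \<open>Anti-piracy security\<close>

subsection \<open>The first-stage adversary\<close>

text \<open>Copies \<open>ek\<close> in place of the second component of the key, and discards the messages.\<close>

definition discard_messages :: "nat \<Rightarrow> nat \<Rightarrow> nat \<Rightarrow> circuit \<Rightarrow> circuit" where
  "discard_messages e q b A = Circuit (wires A + (4 + b))
     (copy_block 0 (e + q) e @ gates A @ swap_block 0 (wires A) (4 + b) @ swap_block 0 (wires A + 4) b)"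

lemma wf_discard_messages:
  assumes "wf_circuit (e + (q + e)) (4 + b) A"
  shows "wf_circuit (e + q) b (discard_messages e q b A)"
  using assms unfolding wf_circuit_iff discard_messages_def
  by (auto intro!: wf_copy_block wf_swap_block intro: wf_gates_mono)

text \<open>\<open>s\<close> is the pair of registers to hand over, \<open>z\<close> the messages
  and \<open>r\<close> the rest. The wires \<open>h\<close> and \<open>f\<close> were fresh and have
  only been swapped around, so they must be zero.\<close>

lemma evolve_discard_messages:
  assumes wf: "wf_circuit (e + (q + e)) (4 + b) A" and ek: "length ek = e"
    and lens: "length s = b" "length h = 4" "length r = wires A - (4 + b)" "length z = 4" "length f = b"
  shows "evolve_vec (discard_messages e q b A) (e + q) (classical_vec ek \<psi>) (s @ h @ r @ z @ f)
    = (if h = zeros 4 \<and> f = zeros b then evolve_vec A (e + (q + e)) (classical_vec ek (key_vec q ek \<psi>)) (z @ s @ r) else 0)"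
proof -
  let ?w = "wires A" and ?S = "swap_block 0 (wires A) (4 + b) @ swap_block 0 (wires A + 4) b"
  have len: "e + (q + e) \<le> ?w" "4 + b \<le> ?w" "wf_gates ?w (gates A)" using wf by (auto simp: wf_circuit_iff)
  define \<alpha> where "\<alpha> = evolve_vec A (e + (q + e)) (classical_vec ek (key_vec q ek \<psi>))"
  have \<alpha>: "\<alpha> = run_gates (gates A) (superpos (bitstrings q) \<psi> (\<lambda>s. pad A (ek @ s @ ek)))"
    unfolding \<alpha>_def evolve_vec_classical[of "e + (q + e)" ek "q + e", unfolded ek, OF refl] superpos_key_vec[OF ek] ..
  have wfs: "wf_gates (?w + (4 + b)) (copy_block 0 (e + q) e)" "wf_gates (?w + (4 + b)) ?S"
    using len by (auto intro!: wf_copy_block wf_swap_block)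
  have cl: "classical_gates ?S" unfolding classical_append by (intro conjI classical_swap_block)
  have "evolve_vec (discard_messages e q b A) (e + q) (classical_vec ek \<psi>)
    = run_gates ?S (run_gates (gates A) (run_gates (copy_block 0 (e + q) e)
        (superpos (bitstrings q) \<psi> (\<lambda>s. pad (discard_messages e q b A) (ek @ s)))))"
    unfolding evolve_vec_classical[of "e + q" ek q, unfolded ek, OF refl]
    by (subst discard_messages_def) (simp only: circuit.sel run_gates_append)
  also have "run_gates (copy_block 0 (e + q) e) (superpos (bitstrings q) \<psi> (\<lambda>s. pad (discard_messages e q b A) (ek @ s)))
    = superpos (bitstrings q) \<psi> (\<lambda>s. [] @ pad A (ek @ s @ ek) @ zeros (4 + b))"
    unfolding run_superpos_classical[OF wfs(1) classical_copy_block]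
  proof (rule superpos_cong[OF refl])
    fix s assume s: "s \<in> bitstrings q"
    have "?w + (4 + b) - (e + q) = e + ((?w - (e + (q + e))) + (4 + b))" using len by simp
    then have "pad (discard_messages e q b A) (ek @ s) = [] @ ek @ s @ zeros e @ zeros (?w - (e + (q + e))) @ zeros (4 + b)"
      using s ek unfolding pad_eq discard_messages_def
      by (simp only: circuit.sel length_append in_bitstrings replicate_add append_assoc append_Nil)
    moreover have "act (copy_block 0 (e + q) e) ([] @ ek @ s @ zeros e @ zeros (?w - (e + (q + e))) @ zeros (4 + b))
      = [] @ ek @ s @ bxor ek (zeros e) @ zeros (?w - (e + (q + e))) @ zeros (4 + b)"
      by (rule act_copy_block) (use s ek in auto)
    ultimately show "act (copy_block 0 (e + q) e) (pad (discard_messages e q b A) (ek @ s)) = [] @ pad A (ek @ s @ ek) @ zeros (4 + b)"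
      using s ek by (simp add: pad_eq)
  qed
  also have "\<dots> = superpos (bitstrings ?w) (superpos (bitstrings q) \<psi> (\<lambda>s. pad A (ek @ s @ ek))) (\<lambda>g. [] @ g @ zeros (4 + b))"
    by (rule superpos_image[where F = "\<lambda>s. pad A (ek @ s @ ek)"]) (use len ek in \<open>auto simp: pad_eq\<close>)
  also have "run_gates (gates A) \<dots> = superpos (bitstrings ?w) \<alpha> (\<lambda>g. [] @ g @ zeros (4 + b))"
    unfolding \<alpha> using run_superpos_block[OF len(3), of 0 "[]"] by (simp only: shift_0 list.size(3))
  finally have e: "evolve_vec (discard_messages e q b A) (e + q) (classical_vec ek \<psi>)
    = run_gates ?S (superpos (bitstrings ?w) \<alpha> (\<lambda>g. [] @ g @ zeros (4 + b)))" .
  have act: "act ?S (z @ s @ r @ f @ h) = s @ h @ r @ z @ f"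
    if "length h = 4" "length f = b" for h f
  proof -
    have "act (swap_block 0 ?w (4 + b)) ([] @ (z @ s) @ r @ (f @ h) @ []) = [] @ (f @ h) @ r @ (z @ s) @ []"
      by (rule act_swap_block) (use lens len that in auto)
    moreover have "act (swap_block 0 (?w + 4) b) ([] @ f @ (h @ r @ z) @ s @ []) = [] @ s @ (h @ r @ z) @ f @ []"
      by (rule act_swap_block) (use lens len that in auto)
    ultimately show ?thesis by simp
  qed
  have "run_gates ?S (superpos (bitstrings ?w) \<alpha> (\<lambda>g. [] @ g @ zeros (4 + b))) (s @ h @ r @ z @ f)
    = superpos (bitstrings ?w) \<alpha> (\<lambda>g. [] @ g @ zeros (4 + b)) (z @ s @ r @ f @ h)"
    unfolding run_classical_gates[OF cl] act[OF lens(2,5), symmetric] act_rev[OF wfs(2)] ..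
  also have "\<dots> = (if f @ h = zeros (4 + b) then \<alpha> (z @ s @ r) else 0)"
    using superpos_block_at[of "z @ s @ r" ?w "[]" "[]" \<alpha> "zeros (4 + b)" "f @ h"] lens len by simp
  also have "f @ h = zeros (4 + b) \<longleftrightarrow> h = zeros 4 \<and> f = zeros b"
  proof -
    have "zeros (4 + b) = zeros b @ zeros 4" unfolding replicate_add[symmetric] by (simp only: add.commute)
    then show ?thesis using lens by auto
  qed
  finally show ?thesis unfolding e \<alpha>_def[symmetric] .
qed

text \<open>The unnormalised state of the two registers when the messages are \<open>z\<close> and
  the remaining wires read \<open>r\<close>.\<close>

definition register_vec :: "nat \<Rightarrow> nat \<Rightarrow> circuit \<Rightarrow> bits \<Rightarrow> (bits \<Rightarrow> complex) \<Rightarrow> bits \<Rightarrow> bits \<Rightarrow> bits \<Rightarrow> complex" where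
  "register_vec e q A ek \<psi> z r s = evolve_vec A (e + (q + e)) (classical_vec ek (key_vec q ek \<psi>)) (z @ s @ r)"

context
  fixes e q b :: nat and A :: circuit and ek :: bits and \<kappa> \<kappa>' :: qstate and J :: "bits set" and \<psi> :: "bits \<Rightarrow> bits \<Rightarrow> complex"
  assumes wf: "wf_circuit (e + (q + e)) (4 + b) A" and ek: "length ek = e"
    and ext: "extends_key q ek \<kappa> \<kappa>'" and gr: "gram q J \<psi> \<kappa>" and tr: "(\<Sum>j\<in>J. sqnorm q (\<psi> j)) = 1"
begin

lemma gram_branch_messages:
  assumes "length z = 4"
  shows "gram b (J \<times> bitstrings (wires A - (4 + b))) (\<lambda>(j, r). register_vec e q A ek (\<psi> j) z r)
    (branch A (e + (q + e)) b (with_classical ek \<kappa>') z)"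
proof -
  have "gram (e + (q + e)) J (\<lambda>j. classical_vec ek (key_vec q ek (\<psi> j))) (with_classical ek \<kappa>')"
    by (rule gram_with_classical) (use gram_key_vec[OF ext gr] ek in auto)
  from branch_gram[OF this] show ?thesis
    unfolding gram_def register_vec_def using assms by (simp add: sum.cartesian_product case_prod_unfold)
qed

text \<open>Discarding the messages makes \<open>z\<close> one more traced-out index. The search
  adversary thus holds the sum over \<open>z\<close> of the very states that occur in the encryption
  game.\<close>

lemma gram_branch_discard_messages:
  "gram b (bitstrings 4 \<times> J \<times> bitstrings (wires A - (4 + b))) (\<lambda>(z, j, r). register_vec e q A ek (\<psi> j) z r)
    (branch (discard_messages e q b A) (e + q) b (with_classical ek \<kappa>) [])"
  unfolding gram_def
proof (intro ballI)
  fix s t assume st: "s \<in> bitstrings b" "t \<in> bitstrings b"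
  let ?D = "discard_messages e q b A" and ?k = "wires A - (4 + b)"
  let ?v = "\<lambda>j. evolve_vec ?D (e + q) (classical_vec ek (\<psi> j))"
  have w: "4 + b \<le> wires A" using wf by (simp add: wf_circuit_iff)
  have g: "gram (e + q) J (\<lambda>j. classical_vec ek (\<psi> j)) (with_classical ek \<kappa>)"
    by (rule gram_with_classical[OF gr]) (use ek in auto)
  have n: "wires ?D - (length ([] :: bits) + b) = length (zeros 4) + (?k + 4) + length (zeros b)"
    using w by (simp add: discard_messages_def)
  have inner: "(\<Sum>u\<in>bitstrings (wires ?D - (length ([] :: bits) + b)). ?v j ([] @ s @ u) * cnj (?v j ([] @ t @ u)))
    = (\<Sum>z\<in>bitstrings 4. \<Sum>r\<in>bitstrings ?k. register_vec e q A ek (\<psi> j) z r s * cnj (register_vec e q A ek (\<psi> j) z r t))" for j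
  proof -
    have ev: "?v j (s' @ h @ rz @ f) = (if h = zeros 4 \<and> f = zeros b then register_vec e q A ek (\<psi> j) (drop ?k rz) (take ?k rz) s' else 0)"
      if "length s' = b" "length h = 4" "length rz = ?k + 4" "length f = b" for s' h rz f
      using evolve_discard_messages[OF wf ek that(1,2), of "take ?k rz" "drop ?k rz" f "\<psi> j"] that
      by (simp add: register_vec_def append_take_drop)
    have "(\<Sum>u\<in>bitstrings (wires ?D - (length ([] :: bits) + b)). ?v j ([] @ s @ u) * cnj (?v j ([] @ t @ u)))
      = (\<Sum>rz\<in>bitstrings (?k + 4). ?v j ([] @ s @ (zeros 4 @ rz @ zeros b)) * cnj (?v j ([] @ t @ (zeros 4 @ rz @ zeros b))))"
      by (rule sum_bitstrings_fixed[OF n]) (use st ev in auto)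
    also have "\<dots> = (\<Sum>rz\<in>bitstrings (?k + 4). register_vec e q A ek (\<psi> j) (drop ?k rz) (take ?k rz) s
        * cnj (register_vec e q A ek (\<psi> j) (drop ?k rz) (take ?k rz) t))"
      by (intro sum.cong refl) (use st ev in simp)
    also have "\<dots> = (\<Sum>r\<in>bitstrings ?k. \<Sum>z\<in>bitstrings 4. register_vec e q A ek (\<psi> j) z r s * cnj (register_vec e q A ek (\<psi> j) z r t))"
      unfolding sum_bitstrings_append by (intro sum.cong refl) auto
    finally show ?thesis by (subst (asm) sum.swap)
  qed
  have "branch ?D (e + q) b (with_classical ek \<kappa>) [] s t
    = (\<Sum>j\<in>J. \<Sum>z\<in>bitstrings 4. \<Sum>r\<in>bitstrings ?k. register_vec e q A ek (\<psi> j) z r s * cnj (register_vec e q A ek (\<psi> j) z r t))"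
    unfolding branch_gram[OF g] by (rule sum.cong[OF refl inner])
  also have "\<dots> = (\<Sum>z\<in>bitstrings 4. \<Sum>j\<in>J. \<Sum>r\<in>bitstrings ?k. register_vec e q A ek (\<psi> j) z r s * cnj (register_vec e q A ek (\<psi> j) z r t))"
    by (rule sum.swap)
  finally show "branch ?D (e + q) b (with_classical ek \<kappa>) [] s t
    = (\<Sum>k\<in>bitstrings 4 \<times> J \<times> bitstrings ?k. (case k of (z, j, r) \<Rightarrow> register_vec e q A ek (\<psi> j) z r) s
        * cnj ((case k of (z, j, r) \<Rightarrow> register_vec e q A ek (\<psi> j) z r) t))"
    by (simp add: sum.cartesian_product case_prod_unfold)
qed

lemma sum_sqnorm_register_vec:
  "(\<Sum>z\<in>bitstrings 4. \<Sum>(j, r)\<in>J \<times> bitstrings (wires A - (4 + b)). sqnorm b (register_vec e q A ek (\<psi> j) z r)) = 1"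
proof -
  let ?k = "wires A - (4 + b)"
  have w: "wires A = 4 + (b + ?k)" "e + (q + e) \<le> wires A" "wf_gates (wires A) (gates A)" using wf by (auto simp: wf_circuit_iff)
  have "(\<Sum>z\<in>bitstrings 4. \<Sum>r\<in>bitstrings ?k. sqnorm b (register_vec e q A ek \<phi> z r)) = sqnorm q \<phi>" for \<phi>
  proof -
    have "(\<Sum>z\<in>bitstrings 4. \<Sum>r\<in>bitstrings ?k. sqnorm b (register_vec e q A ek \<phi> z r))
      = (\<Sum>z\<in>bitstrings 4. \<Sum>s\<in>bitstrings b. \<Sum>r\<in>bitstrings ?k. (cmod (register_vec e q A ek \<phi> z r s))\<^sup>2)"
      unfolding sqnorm_def by (intro sum.cong refl sum.swap)
    also have "\<dots> = sqnorm (4 + (b + ?k)) (evolve_vec A (e + (q + e)) (classical_vec ek (key_vec q ek \<phi>)))"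
      unfolding sqnorm_def register_vec_def sum_bitstrings_append ..
    also have "\<dots> = sqnorm (wires A) (evolve_vec A (e + (q + e)) (classical_vec ek (key_vec q ek \<phi>)))"
      using w(1) by simp
    also have "\<dots> = sqnorm q \<phi>"
      using w ek by (simp add: sqnorm_evolve_vec sqnorm_classical_vec[of _ ek "q + e"] sqnorm_key_vec)
    finally show ?thesis .
  qed
  then have "(\<Sum>j\<in>J. \<Sum>z\<in>bitstrings 4. \<Sum>r\<in>bitstrings ?k. sqnorm b (register_vec e q A ek (\<psi> j) z r)) = 1"
    using tr by simp
  then show ?thesis by (subst (asm) sum.swap) (simp add: sum.cartesian_product)
qed

end

subsection \<open>The bias of a pair of adversaries\<close>

text \<open>The trace of the tensor product of \<open>M\<close> and \<open>N\<close> times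
  \<open>\<sigma>\<close>.\<close>

definition expect2 ::
  "nat \<Rightarrow> nat \<Rightarrow> (bits \<Rightarrow> bits \<Rightarrow> complex) \<Rightarrow> (bits \<Rightarrow> bits \<Rightarrow> complex) \<Rightarrow> qstate \<Rightarrow> complex" where
  "expect2 b c M N \<sigma> = (\<Sum>s\<in>bitstrings b. \<Sum>t\<in>bitstrings b. \<Sum>s'\<in>bitstrings c. \<Sum>t'\<in>bitstrings c.
     M t s * N t' s' * \<sigma> (s @ s') (t @ t'))"

lemma expect2_cong:
  "(\<And>t s. length t = b \<Longrightarrow> length s = b \<Longrightarrow> M t s = M' t s) \<Longrightarrow> (\<And>t s. length t = c \<Longrightarrow> length s = c \<Longrightarrow> N t s = N' t s)
    \<Longrightarrow> expect2 b c M N \<sigma> = expect2 b c M' N' \<sigma>"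
  unfolding expect2_def by (intro sum.cong refl) simp

lemma expect2_product:
  "expect2 b c M N \<sigma> = (\<Sum>p\<in>bitstrings b \<times> bitstrings b \<times> bitstrings c \<times> bitstrings c.
     case p of (s, t, s', t') \<Rightarrow> M t s * N t' s' * \<sigma> (s @ s') (t @ t'))"
  unfolding expect2_def by (simp add: sum.cartesian_product case_prod_unfold)

lemma expect2_sum_left: "expect2 b c (\<lambda>t s. \<Sum>i\<in>I. \<alpha> i * M i t s) N \<sigma> = (\<Sum>i\<in>I. \<alpha> i * expect2 b c (M i) N \<sigma>)"
  unfolding expect2_product sum_distrib_left
  by (rule trans[OF sum.cong[OF refl] sum.swap]) (auto simp: sum_distrib_right mult.assoc)

lemma expect2_sum_right: "expect2 b c M (\<lambda>t s. \<Sum>i\<in>I. \<alpha> i * N i t s) \<sigma> = (\<Sum>i\<in>I. \<alpha> i * expect2 b c M (N i) \<sigma>)"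
  unfolding expect2_product sum_distrib_left
  by (rule trans[OF sum.cong[OF refl] sum.swap])
    (auto simp: sum_distrib_right sum_distrib_left mult.assoc mult.left_commute)

lemma joint_prob_expect2:
  "joint_prob B C b c \<sigma> x y z w = Re (expect2 b c (\<lambda>t s. effect B z (x @ t) (x @ s)) (\<lambda>t s. effect C w (y @ t) (y @ s)) \<sigma>)"
  unfolding joint_prob_def expect2_def ..

text \<open>Completeness of the measurement: summing over the answers leaves the inner product of
  two columns of a unitary.\<close>

lemma sum_effect:
  assumes wf: "wf_circuit (length ct + b) 1 B" and len: "length t = b" "length s = b"
  shows "(\<Sum>a\<in>UNIV. effect B [a] (ct @ t) (ct @ s)) = (if t = s then 1 else 0)"
proof -
  let ?W = "wires B"
  have W: "1 + (?W - 1) = ?W" "length ct + b \<le> ?W" "wf_gates ?W (gates B)" using wf by (auto simp: wf_circuit_iff)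
  have "(\<Sum>a\<in>UNIV. effect B [a] (ct @ t) (ct @ s)) = inner_prod (1 + (?W - 1)) (amp B (ct @ t)) (amp B (ct @ s))"
    unfolding inner_prod_def sum_bitstrings_append effect_def UNIV_bool by (simp add: sum_bitstrings_1)
  also have "\<dots> = inner_prod ?W (ket (pad B (ct @ t))) (ket (pad B (ct @ s)))"
    unfolding W(1) amp_eq by (rule inner_prod_run_gates[OF W(3)])
  also have "\<dots> = ket (pad B (ct @ s)) (pad B (ct @ t))"
    unfolding inner_prod_def by (subst sum_bitstrings_single[of "pad B (ct @ t)"]) (use W len in \<open>auto simp: ket_def pad_eq\<close>)
  also have "\<dots> = (if t = s then 1 else 0)" using len by (simp add: ket_def pad_eq)
  finally show ?thesis .
qed

definition rsign :: "bool \<Rightarrow> real" where "rsign v = (if v then - 1 else 1)"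

text \<open>Each effect is half the identity plus or minus half the difference operator. Over the
  two answer pairs with a given parity the terms with one difference operator cancel, leaving the
  trace and a single tensor product.\<close>

lemma joint_prob_matching:
  assumes wfB: "wf_circuit (length x + b) 1 B" and wfC: "wf_circuit (length y + c) 1 C" and gr: "gram (b + c) K \<phi> \<sigma>"
  shows "(\<Sum>(outB, outC)\<in>{(a, a'). (a \<noteq> a') = v}. joint_prob B C b c \<sigma> x y [outB] [outC])
    = ((\<Sum>k\<in>K. sqnorm (b + c) (\<phi> k)) + rsign v * Re (expect2 b c (diff_op B x) (diff_op C y) \<sigma>)) / 2"
proof -
  let ?E = "\<lambda>a t s. effect B [a] (x @ t) (x @ s)" and ?F = "\<lambda>a t s. effect C [a] (y @ t) (y @ s)"
  let ?j = "\<lambda>a a'. joint_prob B C b c \<sigma> x y [a] [a']"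
  have "expect2 b c (\<lambda>t s. \<Sum>a\<in>UNIV. 1 * ?E a t s) (\<lambda>t s. \<Sum>a\<in>UNIV. 1 * ?F a t s) \<sigma>
      = expect2 b c (\<lambda>t s. if t = s then 1 else 0) (\<lambda>t s. if t = s then 1 else 0) \<sigma>"
    by (rule expect2_cong) (simp_all add: sum_effect[OF wfB] sum_effect[OF wfC] del: UNIV_bool)
  also have "\<dots> = (\<Sum>s\<in>bitstrings b. \<Sum>s'\<in>bitstrings c. \<sigma> (s @ s') (s @ s'))"
  proof -
    have "(\<Sum>t\<in>bitstrings b. \<Sum>s'\<in>bitstrings c. \<Sum>t'\<in>bitstrings c. (if t = s then 1 else 0) * (if t' = s' then 1 else 0) * \<sigma> (s @ s') (t @ t'))
      = (\<Sum>s'\<in>bitstrings c. \<sigma> (s @ s') (s @ s'))" if "length s = b" for s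
    proof -
      have "(\<Sum>t\<in>bitstrings b. \<Sum>s'\<in>bitstrings c. \<Sum>t'\<in>bitstrings c. (if t = s then 1 else 0) * (if t' = s' then 1 else 0) * \<sigma> (s @ s') (t @ t'))
        = (\<Sum>s'\<in>bitstrings c. \<Sum>t'\<in>bitstrings c. (if s = s then 1 else 0) * (if t' = s' then 1 else 0) * \<sigma> (s @ s') (s @ t'))"
        by (rule sum_bitstrings_single) (use that in auto)
      also have "\<dots> = (\<Sum>s'\<in>bitstrings c. \<sigma> (s @ s') (s @ s'))"
      proof (rule sum.cong[OF refl])
        fix s' assume "s' \<in> bitstrings c"
        then show "(\<Sum>t'\<in>bitstrings c. (if s = s then 1 else 0) * (if t' = s' then 1 else 0) * \<sigma> (s @ s') (s @ t')) = \<sigma> (s @ s') (s @ s')"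
          by (subst sum_bitstrings_single[of s']) auto
      qed
      finally show ?thesis .
    qed
    then show ?thesis unfolding expect2_def by (rule sum.cong[OF refl]) (simp only: in_bitstrings)
  qed
  also have "\<dots> = (\<Sum>s\<in>bitstrings (b + c). \<sigma> s s)" by (rule sum_bitstrings_append[symmetric])
  also have "\<dots> = (\<Sum>s\<in>bitstrings (b + c). \<Sum>k\<in>K. complex_of_real ((cmod (\<phi> k s))\<^sup>2))"
    unfolding complex_norm_square using gr by (intro sum.cong refl) (simp add: gram_def)
  also have "\<dots> = complex_of_real (\<Sum>k\<in>K. sqnorm (b + c) (\<phi> k))"
    unfolding sqnorm_def of_real_sum by (rule sum.swap)
  finally have "(\<Sum>a\<in>UNIV. \<Sum>a'\<in>UNIV. expect2 b c (?E a) (?F a') \<sigma>) = complex_of_real (\<Sum>k\<in>K. sqnorm (b + c) (\<phi> k))"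
    unfolding expect2_sum_left expect2_sum_right by simp
  from arg_cong[OF this, of Re] have tot: "(\<Sum>k\<in>K. sqnorm (b + c) (\<phi> k)) = ?j True True + ?j True False + ?j False True + ?j False False"
    unfolding UNIV_bool by (simp add: joint_prob_expect2 algebra_simps)
  have diff: "Re (expect2 b c (diff_op B x) (diff_op C y) \<sigma>) = ?j True True - ?j True False - ?j False True + ?j False False"
    unfolding diff_op_def expect2_sum_left expect2_sum_right UNIV_bool
    by (simp add: joint_prob_expect2 sign_def algebra_simps)
  have "{(a, a'). (a \<noteq> a') = True} = {(True, False), (False, True)}" "{(a, a'). (a \<noteq> a') = False} = {(True, True), (False, False)}" by auto
  then show ?thesis unfolding tot diff by (cases v) (simp_all add: rsign_def)
qed

text \<open>
  The coin only matters through \<open>c = \<langle>r, x\<rangle> \<oplus> \<mu>\<close>, and then it equals \<open>c\<close> up to \<open>\<langle>r, x\<rangle>\<close>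
  and a constant.  If both messages agree, the contributions of the two coins cancel.
\<close>

lemma sum_coin_diff_op:
  fixes \<mu> :: "bool \<Rightarrow> bool"
  assumes x: "length x = n"
  shows "(\<Sum>coin\<in>UNIV. sign coin * (\<Sum>r\<in>bitstrings n. diff_op B (r @ [\<mu> coin \<noteq> parity (band x r)] @ y) t s))
       = (if \<mu> False = \<mu> True then 0 else sign (\<mu> False)) * (2 ^ (n + 1) * gl_op n B y x t s)"
proof -
    define a where "a = (if \<mu> False = \<mu> True then 0 else sign (\<mu> False))"
    let ?d = "\<lambda>r c. diff_op B (r @ [c] @ y) t s"
    have "2 ^ (n + 1) * gl_op n B y x t s = (\<Sum>a\<in>bitstrings (n + 1). sign (parity (band (x @ [True]) a)) * diff_op B (a @ y) t s)"
      by (simp add: gl_op_def)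
    also have "\<dots> = (\<Sum>r\<in>bitstrings n. sign (parity (band x r)) * (?d r False - ?d r True))"
      unfolding sum_bitstrings_append sum_bitstrings_1[unfolded One_nat_def[symmetric]]
      by (intro sum.cong refl) (use x in \<open>auto simp: sign_def\<close>)
    finally have gl: "2 ^ (n + 1) * gl_op n B y x t s = (\<Sum>r\<in>bitstrings n. sign (parity (band x r)) * (?d r False - ?d r True))" .
    have "(\<Sum>coin\<in>UNIV. sign coin * (\<Sum>r\<in>bitstrings n. ?d r (\<mu> coin \<noteq> parity (band x r))))
       = (\<Sum>r\<in>bitstrings n. ?d r (\<mu> False \<noteq> parity (band x r)) - ?d r (\<mu> True \<noteq> parity (band x r)))"
      unfolding UNIV_bool by (simp add: sign_def sum_subtractf)
    also have "\<dots> = (\<Sum>r\<in>bitstrings n. a * (sign (parity (band x r)) * (?d r False - ?d r True)))"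
    proof (rule sum.cong[OF refl])
      fix r
      show "?d r (\<mu> False \<noteq> parity (band x r)) - ?d r (\<mu> True \<noteq> parity (band x r))
         = a * (sign (parity (band x r)) * (?d r False - ?d r True))"
        by (cases "\<mu> False"; cases "\<mu> True"; cases "parity (band x r)") (simp_all add: a_def sign_def)
    qed
    finally show ?thesis unfolding gl sum_distrib_left a_def .
qed

lemma expect2_gram:
  assumes gr: "gram (b + c) K \<phi> \<sigma>"
  shows "expect2 b c M N \<sigma> = (\<Sum>k\<in>K. \<Sum>t\<in>bitstrings b. \<Sum>t'\<in>bitstrings c. apply2 b c M N (\<phi> k) t t' * cnj (\<phi> k (t @ t')))"
proof -
  have "expect2 b c M N \<sigma> = (\<Sum>t\<in>bitstrings b. \<Sum>t'\<in>bitstrings c. \<Sum>s\<in>bitstrings b. \<Sum>s'\<in>bitstrings c. M t s * N t' s' * \<sigma> (s @ s') (t @ t'))"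
    unfolding expect2_def
    by (rule trans[OF sum.swap], rule sum.cong[OF refl], rule trans[OF sum.cong[OF refl sum.swap] sum.swap])
  also have "\<dots> = (\<Sum>t\<in>bitstrings b. \<Sum>t'\<in>bitstrings c. \<Sum>k\<in>K. apply2 b c M N (\<phi> k) t t' * cnj (\<phi> k (t @ t')))"
  proof (intro sum.cong refl)
    fix t t' assume t: "t \<in> bitstrings b" "t' \<in> bitstrings c"
    have "(\<Sum>s\<in>bitstrings b. \<Sum>s'\<in>bitstrings c. M t s * N t' s' * \<sigma> (s @ s') (t @ t'))
      = (\<Sum>s\<in>bitstrings b. \<Sum>s'\<in>bitstrings c. \<Sum>k\<in>K. M t s * N t' s' * \<phi> k (s @ s') * cnj (\<phi> k (t @ t')))"
      using t gr by (intro sum.cong refl) (simp add: gram_def sum_distrib_left mult.assoc)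
    also have "\<dots> = (\<Sum>k\<in>K. \<Sum>s\<in>bitstrings b. \<Sum>s'\<in>bitstrings c. M t s * N t' s' * \<phi> k (s @ s') * cnj (\<phi> k (t @ t')))"
      by (rule trans[OF sum.cong[OF refl sum.swap] sum.swap])
    finally show "(\<Sum>s\<in>bitstrings b. \<Sum>s'\<in>bitstrings c. M t s * N t' s' * \<sigma> (s @ s') (t @ t'))
      = (\<Sum>k\<in>K. apply2 b c M N (\<phi> k) t t' * cnj (\<phi> k (t @ t')))"
      by (simp add: apply2_def sum_distrib_right)
  qed
  also have "\<dots> = (\<Sum>k\<in>K. \<Sum>t\<in>bitstrings b. \<Sum>t'\<in>bitstrings c. apply2 b c M N (\<phi> k) t t' * cnj (\<phi> k (t @ t')))"
    by (rule trans[OF sum.cong[OF refl sum.swap] sum.swap])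
  finally show ?thesis .
qed

lemma sum_Times3: "(\<Sum>(a, x, r)\<in>A \<times> B \<times> C. h a x r) = (\<Sum>a\<in>A. \<Sum>x\<in>B. \<Sum>r\<in>C. h a x r)"
  by (simp add: sum.cartesian_product)

lemma sum_coins_strings_flatten:
  fixes G :: "bool \<Rightarrow> bits \<Rightarrow> bits \<Rightarrow> bool \<Rightarrow> bits \<Rightarrow> bits \<Rightarrow> real"
  shows "(\<Sum>(a, a')\<in>UNIV. (\<Sum>x\<in>S. \<Sum>r\<in>S. (\<Sum>x'\<in>S. \<Sum>r'\<in>S. G a x r a' x' r') / M) / M) / 4
    = (\<Sum>(a, x, r)\<in>UNIV \<times> S \<times> S. \<Sum>(a', x', r')\<in>UNIV \<times> S \<times> S. G a x r a' x' r') / (4 * M * M)"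
proof -
  have "(\<Sum>(a, a')\<in>UNIV. (\<Sum>x\<in>S. \<Sum>r\<in>S. (\<Sum>x'\<in>S. \<Sum>r'\<in>S. G a x r a' x' r') / M) / M)
    = (\<Sum>a\<in>UNIV. \<Sum>a'\<in>UNIV. \<Sum>x\<in>S. \<Sum>r\<in>S. \<Sum>x'\<in>S. \<Sum>r'\<in>S. G a x r a' x' r') / (M * M)"
    unfolding UNIV_Times_UNIV[symmetric] sum.cartesian_product[symmetric]
    by (simp add: sum_divide_distrib)
  also have "(\<Sum>a\<in>UNIV. \<Sum>a'\<in>UNIV. \<Sum>x\<in>S. \<Sum>r\<in>S. \<Sum>x'\<in>S. \<Sum>r'\<in>S. G a x r a' x' r')
    = (\<Sum>a\<in>UNIV. \<Sum>x\<in>S. \<Sum>r\<in>S. \<Sum>a'\<in>UNIV. \<Sum>x'\<in>S. \<Sum>r'\<in>S. G a x r a' x' r')"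
    by (rule sum.cong[OF refl], rule trans[OF sum.swap], rule sum.cong[OF refl], rule sum.swap)
  finally show ?thesis unfolding sum_Times3 by (simp only: divide_divide_eq_left mult_ac)
qed

lemma sum_Re_affine:
  "(\<Sum>i\<in>I. \<Sum>j\<in>J. (t + Re (s i * (s' j * w i j))) / 2)
    = (real (card I) * (real (card J) * t) + Re (\<Sum>i\<in>I. s i * (\<Sum>j\<in>J. s' j * w i j))) / 2"
  by (simp add: sum_divide_distrib[symmetric] sum.distrib sum_distrib_left del: times_complex.sel)

text \<open>One fixed key; \<open>y\<close> is evaluation under it, and \<open>\<phi> z\<close> is the state after outputting messages \<open>z\<close>.\<close>

lemma cpa_game_bound:
  fixes \<mu>B \<mu>C :: "bits \<Rightarrow> bool \<Rightarrow> bool"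
  assumes wfB: "wf_circuit (n + 1 + m + b) 1 B" and wfC: "wf_circuit (n + 1 + m + c) 1 C"
    and y: "\<And>x. length x = n \<Longrightarrow> length (y x) = m"
    and K: "finite K" and Z: "finite Z"
    and gr: "\<And>z. z \<in> Z \<Longrightarrow> gram (b + c) K (\<phi> z) (\<sigma> z)"
    and tr: "(\<Sum>z\<in>Z. \<Sum>k\<in>K. sqnorm (b + c) (\<phi> z k)) = 1"
  defines "N \<equiv> 2 ^ n :: real" and "S \<equiv> bitstrings n"
    and "ct \<equiv> \<lambda>x r \<mu>. r @ [\<mu> \<noteq> parity (band x r)] @ y x"
  shows "(\<Sum>z\<in>Z. (\<Sum>(a, a')\<in>UNIV. (\<Sum>x\<in>S. \<Sum>r\<in>S. (\<Sum>x'\<in>S. \<Sum>r'\<in>S.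
        \<Sum>(outB, outC)\<in>{(o1, o2). (o1 \<noteq> o2) = (a \<noteq> a')}.
          joint_prob B C b c (\<sigma> z) (ct x r (\<mu>B z a)) (ct x' r' (\<mu>C z a')) [outB] [outC]) / N\<^sup>2) / N\<^sup>2) / 4)
    \<le> 1 / 2 + sqrt ((\<Sum>x\<in>S. \<Sum>x'\<in>S. \<Sum>z\<in>Z. \<Sum>k\<in>K. \<Sum>t\<in>bitstrings b. \<Sum>t'\<in>bitstrings c.
        (cmod (apply2 b c (gl_op n B (y x) x) (gl_op n C (y x') x') (\<phi> z k) t t'))\<^sup>2) / N\<^sup>2) / 2"
proof -
  have N: "N > 0" "real (card S) = N" "finite S" by (auto simp: N_def S_def card_bitstrings)
  let ?I = "(UNIV :: bool set) \<times> S \<times> S"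
  let ?t = "\<lambda>z. \<Sum>k\<in>K. sqnorm (b + c) (\<phi> z k)"
  let ?gB = "\<lambda>x. gl_op n B (y x) x" and ?gC = "\<lambda>x. gl_op n C (y x) x"
  let ?X = "\<lambda>z. \<Sum>x\<in>S. \<Sum>x'\<in>S. expect2 b c (?gB x) (?gC x') (\<sigma> z)"
  have cardI: "real (card ?I) = 2 * N * N" using N by (simp add: card_cartesian_product)
  \<comment> \<open>Per message string: the trace part sums to 1/2 over all \<open>z\<close>, and
    the bias is bounded by a modulus, which removes the sign that depends on the chosen
    messages.\<close>
  have game: "(\<Sum>(a, a')\<in>UNIV. (\<Sum>x\<in>S. \<Sum>r\<in>S. (\<Sum>x'\<in>S. \<Sum>r'\<in>S.
        \<Sum>(outB, outC)\<in>{(o1, o2). (o1 \<noteq> o2) = (a \<noteq> a')}.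
          joint_prob B C b c (\<sigma> z) (ct x r (\<mu>B z a)) (ct x' r' (\<mu>C z a')) [outB] [outC]) / N\<^sup>2) / N\<^sup>2) / 4
      \<le> ?t z / 2 + cmod (?X z) / N\<^sup>2 / 2" if z: "z \<in> Z" for z
  proof -
    let ?d = "\<lambda>i. case i of (a, x, r) \<Rightarrow> diff_op B (ct x r (\<mu>B z a))"
    let ?d' = "\<lambda>i. case i of (a, x, r) \<Rightarrow> diff_op C (ct x r (\<mu>C z a))"
    let ?s = "\<lambda>i. case i of (a, x, r) \<Rightarrow> sign a"
    have j: "(\<Sum>(outB, outC)\<in>{(o1, o2). (o1 \<noteq> o2) = (a \<noteq> a')}.
          joint_prob B C b c (\<sigma> z) (ct x r (\<mu>B z a)) (ct x' r' (\<mu>C z a')) [outB] [outC])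
       = (?t z + Re (?s (a, x, r) * (?s (a', x', r') * expect2 b c (?d (a, x, r)) (?d' (a', x', r')) (\<sigma> z)))) / 2"
      if "x \<in> S" "r \<in> S" "x' \<in> S" "r' \<in> S" for a x r a' x' r'
    proof -
      have "rsign (a \<noteq> a') * Re w = Re (sign a * (sign a' * w))" for w
        by (simp add: rsign_def sign_def)
      moreover have "length (ct x r (\<mu>B z a)) = n + 1 + m" "length (ct x' r' (\<mu>C z a')) = n + 1 + m"
        using that y by (auto simp: ct_def S_def)
      ultimately show ?thesis using joint_prob_matching[OF _ _ gr[OF z], of "ct x r (\<mu>B z a)" B "ct x' r' (\<mu>C z a')" C "a \<noteq> a'"] wfB wfC
        by (simp only: prod.case)
    qed
    have "(\<Sum>(a, a')\<in>UNIV. (\<Sum>x\<in>S. \<Sum>r\<in>S. (\<Sum>x'\<in>S. \<Sum>r'\<in>S.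
        \<Sum>(outB, outC)\<in>{(o1, o2). (o1 \<noteq> o2) = (a \<noteq> a')}.
          joint_prob B C b c (\<sigma> z) (ct x r (\<mu>B z a)) (ct x' r' (\<mu>C z a')) [outB] [outC]) / N\<^sup>2) / N\<^sup>2) / 4
      = (\<Sum>(a, x, r)\<in>?I. \<Sum>(a', x', r')\<in>?I. \<Sum>(outB, outC)\<in>{(o1, o2). (o1 \<noteq> o2) = (a \<noteq> a')}.
          joint_prob B C b c (\<sigma> z) (ct x r (\<mu>B z a)) (ct x' r' (\<mu>C z a')) [outB] [outC]) / (4 * N\<^sup>2 * N\<^sup>2)"
      by (rule sum_coins_strings_flatten)
    also have "\<dots> = (\<Sum>i\<in>?I. \<Sum>i'\<in>?I. (?t z + Re (?s i * (?s i' * expect2 b c (?d i) (?d' i') (\<sigma> z)))) / 2) / (4 * N\<^sup>2 * N\<^sup>2)"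
    proof (intro arg_cong2[where f = "(/)"] refl, rule sum.cong[OF refl])
      fix i assume "i \<in> ?I"
      then obtain a x r where i: "i = (a, x, r)" "x \<in> S" "r \<in> S" by auto
      show "(case i of (a, x, r) \<Rightarrow> \<Sum>(a', x', r')\<in>?I. \<Sum>(outB, outC)\<in>{(o1, o2). (o1 \<noteq> o2) = (a \<noteq> a')}.
          joint_prob B C b c (\<sigma> z) (ct x r (\<mu>B z a)) (ct x' r' (\<mu>C z a')) [outB] [outC])
        = (\<Sum>i'\<in>?I. (?t z + Re (?s i * (?s i' * expect2 b c (?d i) (?d' i') (\<sigma> z)))) / 2)"
        unfolding i(1) prod.case[of _ a "(x, r)"] prod.case[of _ x r]
      proof (rule sum.cong[OF refl])
        fix i' assume "i' \<in> ?I"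
        then obtain a' x' r' where i': "i' = (a', x', r')" "x' \<in> S" "r' \<in> S" by auto
        show "(case i' of (a', x', r') \<Rightarrow> \<Sum>(outB, outC)\<in>{(o1, o2). (o1 \<noteq> o2) = (a \<noteq> a')}.
            joint_prob B C b c (\<sigma> z) (ct x r (\<mu>B z a)) (ct x' r' (\<mu>C z a')) [outB] [outC])
          = (?t z + Re (sign a * (?s i' * expect2 b c (diff_op B (ct x r (\<mu>B z a))) (?d' i') (\<sigma> z)))) / 2"
          unfolding i'(1) using j[OF i(2,3) i'(2,3)] by (simp only: prod.case)
      qed
    qed
    also have "\<dots> = ((2 * N * N) * ((2 * N * N) * ?t z) + Re (\<Sum>i\<in>?I. ?s i * (\<Sum>i'\<in>?I. ?s i' * expect2 b c (?d i) (?d' i') (\<sigma> z)))) / 2 / (4 * N\<^sup>2 * N\<^sup>2)"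
      unfolding sum_Re_affine cardI ..
    also have "(\<Sum>i\<in>?I. ?s i * (\<Sum>i'\<in>?I. ?s i' * expect2 b c (?d i) (?d' i') (\<sigma> z)))
      = expect2 b c (\<lambda>t s. \<Sum>i\<in>?I. ?s i * ?d i t s) (\<lambda>t s. \<Sum>i\<in>?I. ?s i * ?d' i t s) (\<sigma> z)"
      unfolding expect2_sum_left expect2_sum_right ..
    finally have 1: "(\<Sum>(a, a')\<in>UNIV. (\<Sum>x\<in>S. \<Sum>r\<in>S. (\<Sum>x'\<in>S. \<Sum>r'\<in>S.
        \<Sum>(outB, outC)\<in>{(o1, o2). (o1 \<noteq> o2) = (a \<noteq> a')}.
          joint_prob B C b c (\<sigma> z) (ct x r (\<mu>B z a)) (ct x' r' (\<mu>C z a')) [outB] [outC]) / N\<^sup>2) / N\<^sup>2) / 4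
      = ((2 * N * N) * ((2 * N * N) * ?t z)
        + Re (expect2 b c (\<lambda>t s. \<Sum>i\<in>?I. ?s i * ?d i t s) (\<lambda>t s. \<Sum>i\<in>?I. ?s i * ?d' i t s) (\<sigma> z))) / 2 / (4 * N\<^sup>2 * N\<^sup>2)" .
    \<comment> \<open>The factor depends on the two messages only and not on \<open>x\<close>, so it
      comes out of the average over preimages. Its modulus is 0 or 1.\<close>
    have M: "\<exists>\<alpha>. cmod \<alpha> \<le> 1 \<and> (\<forall>t s. (\<Sum>(a, x, r)\<in>?I. sign a * diff_op D (ct x r (\<mu> a)) t s)
        = (\<Sum>x\<in>S. \<alpha> * 2 ^ (n + 1) * gl_op n D (y x) x t s))" for D and \<mu> :: "bool \<Rightarrow> bool"
    proof -
      let ?a = "if \<mu> False = \<mu> True then 0 else sign (\<mu> False)"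
      have "(\<Sum>(a, x, r)\<in>?I. sign a * diff_op D (ct x r (\<mu> a)) t s) = (\<Sum>x\<in>S. ?a * 2 ^ (n + 1) * gl_op n D (y x) x t s)" for t s
      proof -
        have "(\<Sum>(a, x, r)\<in>?I. sign a * diff_op D (ct x r (\<mu> a)) t s) = (\<Sum>a\<in>UNIV. \<Sum>x\<in>S. \<Sum>r\<in>S. sign a * diff_op D (ct x r (\<mu> a)) t s)"
          by (simp add: sum.cartesian_product)
        also have "\<dots> = (\<Sum>x\<in>S. \<Sum>a\<in>UNIV. sign a * (\<Sum>r\<in>S. diff_op D (ct x r (\<mu> a)) t s))"
          unfolding sum_distrib_left by (rule sum.swap)
        also have "\<dots> = (\<Sum>x\<in>S. ?a * 2 ^ (n + 1) * gl_op n D (y x) x t s)"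
        proof (rule sum.cong[OF refl])
          fix x assume "x \<in> S"
          then have x: "length x = n" by (simp add: S_def)
          show "(\<Sum>a\<in>UNIV. sign a * (\<Sum>r\<in>S. diff_op D (ct x r (\<mu> a)) t s)) = ?a * 2 ^ (n + 1) * gl_op n D (y x) x t s"
            unfolding S_def ct_def sum_coin_diff_op[OF x] by (simp only: mult.assoc)
        qed
        finally show ?thesis .
      qed
      moreover have "cmod ?a \<le> 1" by simp
      ultimately show ?thesis by blast
    qed
    obtain \<alpha> where \<alpha>: "cmod \<alpha> \<le> 1" "\<And>t s. (\<Sum>i\<in>?I. ?s i * ?d i t s) = (\<Sum>x\<in>S. \<alpha> * 2 ^ (n + 1) * ?gB x t s)"
      using M[of B "\<mu>B z"] by (auto simp: case_prod_unfold)
    obtain \<beta> where \<beta>: "cmod \<beta> \<le> 1" "\<And>t s. (\<Sum>i\<in>?I. ?s i * ?d' i t s) = (\<Sum>x\<in>S. \<beta> * 2 ^ (n + 1) * ?gC x t s)"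
      using M[of C "\<mu>C z"] by (auto simp: case_prod_unfold)
    have "expect2 b c (\<lambda>t s. \<Sum>i\<in>?I. ?s i * ?d i t s) (\<lambda>t s. \<Sum>i\<in>?I. ?s i * ?d' i t s) (\<sigma> z)
       = (\<Sum>x\<in>S. \<alpha> * 2 ^ (n + 1) * (\<Sum>x'\<in>S. \<beta> * 2 ^ (n + 1) * expect2 b c (?gB x) (?gC x') (\<sigma> z)))"
      unfolding \<alpha>(2) \<beta>(2) expect2_sum_left expect2_sum_right ..
    also have "\<dots> = (\<alpha> * \<beta> * complex_of_real (4 * N\<^sup>2)) * ?X z"
      by (simp add: N_def sum_distrib_left power2_eq_square mult_ac)
    finally have 2: "expect2 b c (\<lambda>t s. \<Sum>i\<in>?I. ?s i * ?d i t s) (\<lambda>t s. \<Sum>i\<in>?I. ?s i * ?d' i t s) (\<sigma> z)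
       = (\<alpha> * \<beta> * complex_of_real (4 * N\<^sup>2)) * ?X z" .
    have "Re ((\<alpha> * \<beta> * complex_of_real (4 * N\<^sup>2)) * ?X z) \<le> cmod ((\<alpha> * \<beta> * complex_of_real (4 * N\<^sup>2)) * ?X z)"
      by (rule complex_Re_le_cmod)
    also have "\<dots> = (cmod \<alpha> * cmod \<beta>) * (4 * N\<^sup>2 * cmod (?X z))" by (simp only: norm_mult norm_of_real) simp
    also have "\<dots> \<le> 1 * (4 * N\<^sup>2 * cmod (?X z))"
      using \<alpha>(1) \<beta>(1) by (intro mult_right_mono mult_le_one) auto
    finally have 3: "Re ((\<alpha> * \<beta> * complex_of_real (4 * N\<^sup>2)) * ?X z) \<le> 4 * N\<^sup>2 * cmod (?X z)" by simp
    have "((2 * N * N) * ((2 * N * N) * ?t z) + Re ((\<alpha> * \<beta> * complex_of_real (4 * N\<^sup>2)) * ?X z)) / 2 / (4 * N\<^sup>2 * N\<^sup>2)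
       \<le> ((2 * N * N) * ((2 * N * N) * ?t z) + 4 * N\<^sup>2 * cmod (?X z)) / 2 / (4 * N\<^sup>2 * N\<^sup>2)"
      using 3 N by (intro divide_right_mono add_left_mono) auto
    also have "\<dots> = ?t z / 2 + cmod (?X z) / N\<^sup>2 / 2"
      using N(1) by (simp add: field_simps power2_eq_square)
    finally show ?thesis unfolding 1 2 .
  qed
  let ?app = "\<lambda>x x' z k t t'. cmod (apply2 b c (?gB x) (?gC x') (\<phi> z k) t t')"
  let ?P = "S \<times> S \<times> Z \<times> K \<times> bitstrings b \<times> bitstrings c"
  \<comment> \<open>Cauchy-Schwarz runs over preimages, messages, state indices and basis strings at
    once. The weight \<open>1 / N\<^sup>2\<close> is shared equally, so that \<open>g\<close>
    becomes a unit vector and the square of \<open>f\<close> is the averaged extraction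
    weight.\<close>
  define f where "f = (\<lambda>(x, x', z, k, t, t'). ?app x x' z k t t' / N)"
  define g where "g = (\<lambda>(x :: bits, x' :: bits, z, k, t, t'). cmod (\<phi> z k (t @ t')) / N)"
  have "(\<Sum>z\<in>Z. cmod (?X z) / N\<^sup>2) \<le> (\<Sum>z\<in>Z. (\<Sum>x\<in>S. \<Sum>x'\<in>S. \<Sum>k\<in>K. \<Sum>t\<in>bitstrings b. \<Sum>t'\<in>bitstrings c.
       ?app x x' z k t t' * cmod (\<phi> z k (t @ t'))) / N\<^sup>2)"
  proof (intro sum_mono divide_right_mono)
    fix z assume z: "z \<in> Z"
    show "cmod (?X z) \<le> (\<Sum>x\<in>S. \<Sum>x'\<in>S. \<Sum>k\<in>K. \<Sum>t\<in>bitstrings b. \<Sum>t'\<in>bitstrings c. ?app x x' z k t t' * cmod (\<phi> z k (t @ t')))"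
      unfolding expect2_gram[OF gr[OF z]]
      by (intro order_trans[OF norm_sum] sum_mono) (simp add: norm_mult)
  qed simp
  also have "\<dots> = (\<Sum>p\<in>?P. \<bar>f p\<bar> * \<bar>g p\<bar>)"
  proof -
    have "(\<Sum>z\<in>Z. (\<Sum>x\<in>S. \<Sum>x'\<in>S. h z x x') / N\<^sup>2) = (\<Sum>x\<in>S. \<Sum>x'\<in>S. \<Sum>z\<in>Z. h z x x' / N\<^sup>2)" for h :: "bits \<Rightarrow> bits \<Rightarrow> bits \<Rightarrow> real"
      unfolding sum_divide_distrib by (rule trans[OF sum.swap sum.cong[OF refl sum.swap]])
    note this[of "\<lambda>z x x'. \<Sum>k\<in>K. \<Sum>t\<in>bitstrings b. \<Sum>t'\<in>bitstrings c. ?app x x' z k t t' * cmod (\<phi> z k (t @ t'))"]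
    also have "(\<Sum>x\<in>S. \<Sum>x'\<in>S. \<Sum>z\<in>Z. (\<Sum>k\<in>K. \<Sum>t\<in>bitstrings b. \<Sum>t'\<in>bitstrings c. ?app x x' z k t t' * cmod (\<phi> z k (t @ t'))) / N\<^sup>2)
      = (\<Sum>p\<in>?P. \<bar>f p\<bar> * \<bar>g p\<bar>)"
      using N(1) by (simp add: f_def g_def sum.cartesian_product case_prod_unfold sum_divide_distrib power2_eq_square)
    finally show ?thesis .
  qed
  also have "\<dots> \<le> L2_set f ?P * L2_set g ?P" by (rule L2_set_mult_ineq)
  \<comment> \<open>For each pair of preimages the states over all messages have total squared norm
    1.\<close>
  also have "L2_set g ?P = 1"
  proof -
    have "(\<Sum>p\<in>?P. (g p)\<^sup>2) = (\<Sum>x\<in>S. \<Sum>x'\<in>S. (\<Sum>z\<in>Z. \<Sum>k\<in>K. \<Sum>t\<in>bitstrings b. \<Sum>t'\<in>bitstrings c. (cmod (\<phi> z k (t @ t')))\<^sup>2) / N\<^sup>2)"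
      by (simp add: g_def sum.cartesian_product case_prod_unfold sum_divide_distrib power_divide del: sum_constant)
    also have "\<dots> = (\<Sum>x\<in>S. \<Sum>x'\<in>S. 1 / N\<^sup>2)"
      using tr by (simp add: sqnorm_def sum_bitstrings_append)
    also have "\<dots> = 1" using N by (simp add: power2_eq_square)
    finally show ?thesis by (simp add: L2_set_def)
  qed
  also have "L2_set f ?P = sqrt ((\<Sum>x\<in>S. \<Sum>x'\<in>S. \<Sum>z\<in>Z. \<Sum>k\<in>K. \<Sum>t\<in>bitstrings b. \<Sum>t'\<in>bitstrings c. (?app x x' z k t t')\<^sup>2) / N\<^sup>2)"
    by (simp add: L2_set_def f_def sum.cartesian_product case_prod_unfold sum_divide_distrib power_divide)
  finally have "(\<Sum>z\<in>Z. cmod (?X z) / N\<^sup>2)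
     \<le> sqrt ((\<Sum>x\<in>S. \<Sum>x'\<in>S. \<Sum>z\<in>Z. \<Sum>k\<in>K. \<Sum>t\<in>bitstrings b. \<Sum>t'\<in>bitstrings c. (?app x x' z k t t')\<^sup>2) / N\<^sup>2)" by simp
  moreover have "(\<Sum>z\<in>Z. ?t z / 2 + cmod (?X z) / N\<^sup>2 / 2) = 1 / 2 + (\<Sum>z\<in>Z. cmod (?X z) / N\<^sup>2) / 2"
    using tr by (simp add: sum.distrib sum_divide_distrib[symmetric])
  ultimately have le: "(\<Sum>z\<in>Z. ?t z / 2 + cmod (?X z) / N\<^sup>2 / 2)
     \<le> 1 / 2 + sqrt ((\<Sum>x\<in>S. \<Sum>x'\<in>S. \<Sum>z\<in>Z. \<Sum>k\<in>K. \<Sum>t\<in>bitstrings b. \<Sum>t'\<in>bitstrings c. (?app x x' z k t t')\<^sup>2) / N\<^sup>2) / 2"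
    by linarith
  show ?thesis by (rule order_trans[OF sum_mono[OF game] le])
qed

section \<open>Averaging over the keys\<close>

lemma sde_encrypt_sde_of:
  assumes eff: "tdf_efficient F" and ek: "length ek = ek_len F l"
  shows "sde_encrypt (sde_of F) l ek [\<mu>] = map_pmf (\<lambda>u. drop (tdf_n F l) u
      @ [\<mu> \<noteq> parity (band (take (tdf_n F l) u) (drop (tdf_n F l) u))] @ tdf_image F l ek (take (tdf_n F l) u))
      (uniform_bits (tdf_n F l + tdf_n F l))"
  unfolding sde_encrypt_def run_random_def sde_of_simps
proof (rule map_pmf_cong[OF refl])
  fix u assume "u \<in> set_pmf (uniform_bits (tdf_n F l + tdf_n F l))"
  then have u: "length u = tdf_n F l + tdf_n F l" by (simp add: uniform_bits_def)
  have wf: "wf_circuit (ek_len F l + tdf_n F l) (tdf_m F l) (tdf_eval F l)" using eff by (simp add: tdf_efficient_def)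
  show "run_classical (enc_gates_circuit (ek_len F l) (tdf_n F l) (tdf_m F l) (tdf_eval F l)) (tdf_n F l + 1 + tdf_m F l) ((ek @ [\<mu>]) @ u)
    = drop (tdf_n F l) u @ [\<mu> \<noteq> parity (band (take (tdf_n F l) u) (drop (tdf_n F l) u))] @ tdf_image F l ek (take (tdf_n F l) u)"
    using run_enc_gates_circuit[OF wf ek, of "take (tdf_n F l) u" "drop (tdf_n F l) u" \<mu>] u unfolding tdf_image_def by simp
qed

lemma expectation_sde_encrypt:
  fixes f :: "bits \<Rightarrow> real"
  assumes eff: "tdf_efficient F" and ek: "length ek = ek_len F l"
  shows "measure_pmf.expectation (sde_encrypt (sde_of F) l ek [\<mu>]) f
    = (\<Sum>x\<in>bitstrings (tdf_n F l). \<Sum>r\<in>bitstrings (tdf_n F l).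
        f (r @ [\<mu> \<noteq> parity (band x r)] @ tdf_image F l ek x)) / (2 ^ tdf_n F l)\<^sup>2"
proof -
  have "(2::real) ^ (tdf_n F l + tdf_n F l) = (2 ^ tdf_n F l)\<^sup>2" by (simp add: power_add power2_eq_square)
  then show ?thesis
    unfolding sde_encrypt_sde_of[OF eff ek] integral_map_pmf expectation_uniform_bits sum_bitstrings_append
    by (intro arg_cong2[where f = "(/)"] sum.cong refl) simp_all
qed

lemma expectation_sde_keys:
  fixes f :: "_ \<Rightarrow> real"
  assumes "tdf_efficient F"
  shows "measure_pmf.expectation (sde_keys (sde_of F) l) f = measure_pmf.expectation (key_pairs F l) (\<lambda>p. f (snd p))"
  unfolding snd_key_pairs[OF assms, symmetric] integral_map_pmf ..

lemma expectation_tdf_keys: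
  fixes f :: "_ \<Rightarrow> real"
  assumes "tdf_efficient F"
  shows "measure_pmf.expectation (tdf_keys F l) f = measure_pmf.expectation (key_pairs F l) (\<lambda>p. f (fst p))"
  unfolding fst_key_pairs[OF assms, symmetric] integral_map_pmf ..

lemma prob_tdf_keys:
  assumes "tdf_efficient F"
  shows "measure_pmf.prob (tdf_keys F l) G = measure_pmf.expectation (key_pairs F l) (\<lambda>p. indicator G (fst p))"
  using expectation_tdf_keys[OF assms, of l "indicator G :: _ \<Rightarrow> real"] by simp

lemma expectation_mono_key_pairs:
  assumes "tdf_efficient F" "\<And>p. p \<in> set_pmf (key_pairs F l) \<Longrightarrow> f p \<le> (g p :: real)"
  shows "measure_pmf.expectation (key_pairs F l) f \<le> measure_pmf.expectation (key_pairs F l) g"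
  by (rule integral_mono_AE)
    (use assms finite_key_pairs in \<open>auto intro!: integrable_measure_pmf_finite simp: AE_measure_pmf_iff\<close>)

text \<open>Passing to the absolute value of \<open>\<epsilon>\<close> can only add good keys, and
  the later bounds, which contain its root, ask for a nonnegative error.\<close>

lemma almost_all_keys_correct_good_key:
  assumes "tdf_almost_all_keys_correct F"
  obtains \<delta> \<epsilon> where "negligible \<delta>" "negligible \<epsilon>" "\<And>l. 0 \<le> \<epsilon> l"
    "\<And>l. measure_pmf.prob (tdf_keys F l) {(ek, td, \<kappa>). good_key F l (\<epsilon> l) ek \<kappa>} \<ge> 1 - \<delta> l"
proof -
  from assms obtain \<delta> \<epsilon> where *: "negligible \<delta>" "negligible \<epsilon>"
    "\<And>l. measure_pmf.prob (tdf_keys F l) {(ek, td, \<kappa>). good_key F l (\<epsilon> l) ek \<kappa>} \<ge> 1 - \<delta> l"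
    unfolding tdf_almost_all_keys_correct_def good_key_def by blast
  have "{(ek, td, \<kappa>). good_key F l (\<epsilon> l) ek \<kappa>} \<subseteq> {(ek, td :: bits, \<kappa>). good_key F l \<bar>\<epsilon> l\<bar> ek \<kappa>}" for l
    unfolding good_key_def by force
  then have "1 - \<delta> l \<le> measure_pmf.prob (tdf_keys F l) {(ek, td, \<kappa>). good_key F l \<bar>\<epsilon> l\<bar> ek \<kappa>}" for l
    by (intro order_trans[OF *(3) measure_pmf.finite_measure_mono]) simp_all
  moreover have "negligible (\<lambda>l. \<bar>\<epsilon> l\<bar>)" by (rule negligible_mono[OF *(2)]) simp
  ultimately show ?thesis using that[of \<delta> "\<lambda>l. \<bar>\<epsilon> l\<bar>"] *(1) by simp
qed

lemma sde_correct_sde_of: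
  assumes eff: "tdf_efficient F" and corr: "tdf_almost_all_keys_correct F"
  shows "sde_correct 1 (sde_of F)"
  unfolding sde_correct_def
proof
  fix \<mu> assume "\<mu> \<in> bitstrings 1"
  then obtain b where \<mu>: "\<mu> = [b]" by (auto simp: length_Suc_conv)
  obtain \<delta> \<epsilon> where neg: "negligible \<delta>" "negligible \<epsilon>" and \<epsilon>: "\<And>l. 0 \<le> \<epsilon> l"
    and good: "\<And>l. measure_pmf.prob (tdf_keys F l) {(ek, td, \<kappa>). good_key F l (\<epsilon> l) ek \<kappa>} \<ge> 1 - \<delta> l"
    using almost_all_keys_correct_good_key[OF corr] by blast
  let ?G = "\<lambda>l. {(ek, td :: bits, \<kappa>). good_key F l (\<epsilon> l) ek \<kappa>}"
  have "measure_pmf.expectation (sde_keys (sde_of F) l) (\<lambda>(pk, sk, \<kappa>).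
      measure_pmf.expectation (sde_encrypt (sde_of F) l pk \<mu>) (\<lambda>ct. sde_dec_prob (sde_of F) l \<kappa> ct \<mu>)) \<ge> 1 - (\<delta> l + \<epsilon> l)"
    (is "measure_pmf.expectation _ ?f \<ge> _") for l
  proof -
    let ?N = "2 ^ tdf_n F l :: real"
    \<comment> \<open>A lower bound that holds for every key: \<open>1 - \<epsilon> l\<close> on
      good keys, and something not above 0 on the others.\<close>
    have "measure_pmf.expectation (key_pairs F l) (\<lambda>p. indicator (?G l) (fst p) - \<epsilon> l)
        \<le> measure_pmf.expectation (key_pairs F l) (\<lambda>p. ?f (snd p))"
    proof (rule expectation_mono_key_pairs[OF eff])
      fix p assume p: "p \<in> set_pmf (key_pairs F l)"
      obtain ek td \<kappa> pk sk \<kappa>' where p_eq: "p = ((ek, td, \<kappa>), (pk, sk, \<kappa>'))" by (cases p) auto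
      note sp = set_key_pairs[OF eff p[unfolded p_eq]]
      then have pk: "pk = ek" and lek: "length ek = ek_len F l" and ext: "extends_key (qtd_len F l) ek \<kappa> \<kappa>'" by auto
      from sp obtain J :: "bits set" and \<psi> where J: "finite J" and gr: "gram (qtd_len F l) J \<psi> \<kappa>"
        and tr: "(\<Sum>j\<in>J. sqnorm (qtd_len F l) (\<psi> j)) = 1" unfolding density_def by blast
      note lim = length_tdf_image[OF eff lek]
      have "(\<Sum>x\<in>bitstrings (tdf_n F l). \<Sum>r\<in>bitstrings (tdf_n F l). indicator (?G l) (fst p) - \<epsilon> l)
        \<le> (\<Sum>x\<in>bitstrings (tdf_n F l). \<Sum>r\<in>bitstrings (tdf_n F l).
            sde_dec_prob (sde_of F) l \<kappa>' (r @ [b \<noteq> parity (band x r)] @ tdf_image F l ek x) [b])"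
      proof (intro sum_mono)
        fix x r assume xr: "x \<in> bitstrings (tdf_n F l)" "r \<in> bitstrings (tdf_n F l)"
        let ?p = "sde_dec_prob (sde_of F) l \<kappa>' (r @ [b \<noteq> parity (band x r)] @ tdf_image F l ek x) [b]"
        show "indicator (?G l) (fst p) - \<epsilon> l \<le> ?p"
        proof (cases "good_key F l (\<epsilon> l) ek \<kappa>")
          case True
          then have "1 - \<epsilon> l \<le> tdf_inv_prob F l \<kappa> (tdf_image F l ek x) x" using xr unfolding good_key_def by blast
          also have "\<dots> \<le> ?p" using sde_dec_prob_ge[OF eff lek ext J gr tr, of x r b] xr by simp
          finally show ?thesis using True by (simp add: p_eq)
        next
          case False
          have "0 \<le> ?p" using xr lim by (intro sde_dec_prob_nonneg[OF eff lek ext J gr tr]) auto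
          then show ?thesis using False \<epsilon>[of l] by (simp add: p_eq)
        qed
      qed
      then have "?N\<^sup>2 * (indicator (?G l) (fst p) - \<epsilon> l) \<le> (\<Sum>x\<in>bitstrings (tdf_n F l). \<Sum>r\<in>bitstrings (tdf_n F l).
            sde_dec_prob (sde_of F) l \<kappa>' (r @ [b \<noteq> parity (band x r)] @ tdf_image F l ek x) [b])"
        by (simp add: card_bitstrings power2_eq_square mult.assoc)
      then have "indicator (?G l) (fst p) - \<epsilon> l \<le> (\<Sum>x\<in>bitstrings (tdf_n F l). \<Sum>r\<in>bitstrings (tdf_n F l).
            sde_dec_prob (sde_of F) l \<kappa>' (r @ [b \<noteq> parity (band x r)] @ tdf_image F l ek x) [b]) / ?N\<^sup>2"
        by (subst pos_le_divide_eq) (simp_all add: mult.commute)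
      then show "indicator (?G l) (fst p) - \<epsilon> l \<le> ?f (snd p)"
        by (simp only: p_eq snd_conv prod.case pk \<mu> expectation_sde_encrypt[OF eff lek])
    qed
    moreover have "measure_pmf.expectation (key_pairs F l) (\<lambda>p. indicator (?G l) (fst p) - \<epsilon> l)
       = measure_pmf.prob (tdf_keys F l) (?G l) - \<epsilon> l"
      unfolding prob_tdf_keys[OF eff]
      by (subst Bochner_Integration.integral_diff) (auto intro!: integrable_measure_pmf_finite finite_key_pairs[OF eff])
    ultimately show ?thesis using good[of l] unfolding expectation_sde_keys[OF eff] by linarith
  qed
  then show "\<exists>\<epsilon>. negligible \<epsilon> \<and> (\<forall>l. measure_pmf.expectation (sde_keys (sde_of F) l) (\<lambda>(pk, sk, \<kappa>).
      measure_pmf.expectation (sde_encrypt (sde_of F) l pk \<mu>) (\<lambda>ct. sde_dec_prob (sde_of F) l \<kappa> ct \<mu>)) \<ge> 1 - \<epsilon> l)"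
    using negligible_add[OF neg] by blast
qed

lemma sde_robust_sde_of:
  assumes eff: "tdf_efficient F" and corr: "tdf_almost_all_keys_correct F"
  shows "sde_robust 1 (sde_of F)"
proof -
  obtain \<delta> \<epsilon> where neg: "negligible \<delta>" "negligible \<epsilon>" and \<epsilon>: "\<And>l. 0 \<le> \<epsilon> l"
    and good: "\<And>l. measure_pmf.prob (tdf_keys F l) {(ek, td, \<kappa>). good_key F l (\<epsilon> l) ek \<kappa>} \<ge> 1 - \<delta> l"
    using almost_all_keys_correct_good_key[OF corr] by blast
  let ?G = "\<lambda>l. {(ek, td :: bits, \<kappa>). good_key F l (\<epsilon> l) ek \<kappa>}"
  let ?R = "\<lambda>l. {(pk :: bits, sk :: bits, \<kappa>). \<forall>ct. trace_distance (qsk_len (sde_of F) l) \<kappa> (sde_dec_key 1 (sde_of F) l \<kappa> ct) \<le> sqrt \<bar>\<epsilon> l\<bar> + \<epsilon> l}"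
  have "measure_pmf.prob (tdf_keys F l) (?G l) \<le> measure_pmf.prob (sde_keys (sde_of F) l) (?R l)" for l
  proof -
    have "measure_pmf.expectation (key_pairs F l) (\<lambda>p. indicator (?G l) (fst p))
      \<le> measure_pmf.expectation (key_pairs F l) (\<lambda>p. indicator (?R l) (snd p) :: real)"
    proof (rule expectation_mono_key_pairs[OF eff])
      fix p assume p: "p \<in> set_pmf (key_pairs F l)"
      obtain ek td \<kappa> pk sk \<kappa>' where p_eq: "p = ((ek, td, \<kappa>), (pk, sk, \<kappa>'))" by (cases p) auto
      note sp = set_key_pairs[OF eff p[unfolded p_eq]]
      then have lek: "length ek = ek_len F l" and ext: "extends_key (qtd_len F l) ek \<kappa> \<kappa>'" by auto
      from sp obtain J :: "bits set" and \<psi> where J: "finite J" and gr: "gram (qtd_len F l) J \<psi> \<kappa>"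
        and tr: "(\<Sum>j\<in>J. sqnorm (qtd_len F l) (\<psi> j)) = 1" unfolding density_def by blast
      have "(pk, sk, \<kappa>') \<in> ?R l" if "good_key F l (\<epsilon> l) ek \<kappa>"
        using trace_distance_dec_key[OF eff lek ext J gr tr that \<epsilon>] \<epsilon>[of l] by simp
      then show "indicator (?G l) (fst p) \<le> (indicator (?R l) (snd p) :: real)"
        unfolding p_eq fst_conv snd_conv by (auto simp: indicator_def)
    qed
    then show ?thesis
      unfolding prob_tdf_keys[OF eff] expectation_sde_keys[OF eff, of l "indicator (?R l) :: _ \<Rightarrow> real", symmetric] by simp
  qed
  then have "measure_pmf.prob (sde_keys (sde_of F) l) (?R l) \<ge> 1 - \<delta> l" for l using good[of l] order_trans by blast
  moreover have "negligible (\<lambda>l. sqrt \<bar>\<epsilon> l\<bar> + \<epsilon> l)" by (intro negligible_add negligible_sqrt neg)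
  ultimately show ?thesis unfolding sde_robust_def using neg(1)
    by (intro exI[of _ \<delta>] exI[of _ "\<lambda>l. sqrt \<bar>\<epsilon> l\<bar> + \<epsilon> l"]) blast
qed

text \<open>In the search game the second stage receives only an image, so the extractors prepare
  the rest of the ciphertext themselves, in superposition.\<close>

definition tdf_adversary :: "tdf \<Rightarrow> adversary \<Rightarrow> adversary" where
  "tdf_adversary F \<A> = \<lparr>
     adv_A = (\<lambda>l. discard_messages (ek_len F l) (qtd_len F l) (reg_B \<A> l + reg_C \<A> l) (adv_A \<A> l)),
     adv_B = (\<lambda>l. extractor (tdf_n F l) (tdf_m F l) (reg_B \<A> l) (adv_B \<A> l)),
     adv_C = (\<lambda>l. extractor (tdf_n F l) (tdf_m F l) (reg_C \<A> l) (adv_C \<A> l)),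
     reg_B = reg_B \<A>, reg_C = reg_C \<A>\<rparr>"

text \<open>The constant is a generous common one: the extractor has eight gates per gate of
  \<open>B\<close>, seven of them for the inverse, and a bounded number more per wire.\<close>

lemma poly_bounded_scaled:
  assumes "poly_bounded g" "poly_bounded h" "\<And>l. f l \<le> 12 * (g l + h l)"
  shows "poly_bounded f"
  by (rule poly_bounded_mono[OF poly_bounded_mult[OF poly_bounded_const[of 12] poly_bounded_add[OF assms(1,2)]] assms(3)])

lemma poly_size_discard_messages:
  assumes "poly_size_family C" "\<And>l. wf_circuit (e l + (q l + e l)) (4 + b l) (C l)"
  shows "poly_size_family (\<lambda>l. discard_messages (e l) (q l) (b l) (C l))"
proof -
  have w: "e l + (q l + e l) \<le> wires (C l)" "4 + b l \<le> wires (C l)" for l using assms(2) by (auto simp: wf_circuit_iff)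
  have p: "poly_bounded (\<lambda>l. wires (C l))" "poly_bounded (\<lambda>l. length (gates (C l)))"
    using assms(1) by (auto simp: poly_size_family_iff)
  show ?thesis unfolding poly_size_family_iff discard_messages_def circuit.sel
  proof (intro conjI; rule poly_bounded_scaled[OF p])
    fix l
    show "wires (C l) + (4 + b l) \<le> 12 * (wires (C l) + length (gates (C l)))" using w[of l] by simp
    show "length (copy_block 0 (e l + q l) (e l) @ gates (C l) @ swap_block 0 (wires (C l)) (4 + b l) @ swap_block 0 (wires (C l) + 4) (b l))
      \<le> 12 * (wires (C l) + length (gates (C l)))" using w[of l] by simp
  qed
qed

lemma poly_size_extractor:
  assumes "poly_size_family C" "\<And>l. wf_circuit (n l + 1 + m l + b l) 1 (C l)"
  shows "poly_size_family (\<lambda>l. extractor (n l) (m l) (b l) (C l))"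
proof -
  have w: "n l + 1 + m l + b l \<le> wires (C l)" for l using assms(2) by (auto simp: wf_circuit_iff)
  have p: "poly_bounded (\<lambda>l. wires (C l))" "poly_bounded (\<lambda>l. length (gates (C l)))"
    using assms(1) by (auto simp: poly_size_family_iff)
  have "wires (extractor (n l) (m l) (b l) (C l)) \<le> 12 * (wires (C l) + length (gates (C l)))" for l
    using w[of l] unfolding extractor_def Let_def by simp
  moreover have "length (gates (extractor (n l) (m l) (b l) (C l))) \<le> 12 * (wires (C l) + length (gates (C l)))" for l
    using w[of l] unfolding extractor_def Let_def by simp
  ultimately show ?thesis unfolding poly_size_family_iff by (blast intro: poly_bounded_scaled[OF p])
qed

lemma qpt_tdf_adversary:
  assumes "qpt_adversary (\<lambda>l. pk_len (sde_of F) l + qsk_len (sde_of F) l) (\<lambda>l. 4) (ct_len (sde_of F)) (\<lambda>l. 1) \<A>"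
  shows "qpt_adversary (\<lambda>l. ek_len F l + qtd_len F l) (\<lambda>l. 0) (tdf_m F) (tdf_n F) (tdf_adversary F \<A>)"
proof -
  have ps: "poly_size_family (adv_A \<A>)" "poly_size_family (adv_B \<A>)" "poly_size_family (adv_C \<A>)"
    and wf: "wf_circuit (ek_len F l + (qtd_len F l + ek_len F l)) (4 + (reg_B \<A> l + reg_C \<A> l)) (adv_A \<A> l)"
     "wf_circuit (tdf_n F l + 1 + tdf_m F l + reg_B \<A> l) 1 (adv_B \<A> l)"
     "wf_circuit (tdf_n F l + 1 + tdf_m F l + reg_C \<A> l) 1 (adv_C \<A> l)" for l
    using assms unfolding qpt_adversary_def sde_of_simps by (auto simp: add.assoc)
  show ?thesis
    unfolding qpt_adversary_def tdf_adversary_def adversary.simps add_0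
    by (intro conjI allI poly_size_discard_messages poly_size_extractor ps wf wf_extractor wf_discard_messages)
qed

lemma message_1: "length z = 4 \<Longrightarrow> i < 4 \<Longrightarrow> message 1 z i = [z ! i]"
  unfolding message_def by (simp add: take_Suc_conv_app_nth Cons_nth_drop_Suc[symmetric])

lemma expectation_coins:
  fixes f :: "bool \<times> bool \<Rightarrow> real"
  shows "measure_pmf.expectation (pmf_of_set UNIV) f = (\<Sum>p\<in>UNIV. f p) / 4"
  by (subst integral_pmf_of_set) (simp_all add: card_UNIV_bool flip: UNIV_Times_UNIV)

text \<open>The expression under the root in \<open>cpa_game_bound\<close> is, for each pair of
  preimages, at most the probability that both extractors succeed on the state \<open>D\<close> with
  discarded messages.\<close>

lemma cpa_win_le_search_win_given_key:
  assumes eff: "tdf_efficient F"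
    and qpt: "qpt_adversary (\<lambda>l. pk_len (sde_of F) l + qsk_len (sde_of F) l) (\<lambda>l. 4) (ct_len (sde_of F)) (\<lambda>l. 1) \<A>"
    and lek: "length ek = ek_len F l" and ext: "extends_key (qtd_len F l) ek \<kappa> \<kappa>'" and dens: "density (qtd_len F l) \<kappa>"
  shows "(\<Sum>z\<in>bitstrings 4.
         let \<sigma> = branch (adv_A \<A> l) (ek_len F l + (qtd_len F l + ek_len F l)) (reg_B \<A> l + reg_C \<A> l)
                   (with_classical ek \<kappa>') z
         in measure_pmf.expectation (pmf_of_set UNIV) (\<lambda>(coinB :: bool, coinC :: bool).
            measure_pmf.expectation (sde_encrypt (sde_of F) l ek (message 1 z (of_bool coinB))) (\<lambda>ctB.
            measure_pmf.expectation (sde_encrypt (sde_of F) l ek (message 1 z (2 + of_bool coinC))) (\<lambda>ctC.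
              \<Sum>(outB, outC) \<in> {(b, c). (b \<noteq> c) = (coinB \<noteq> coinC)}.
                joint_prob (adv_B \<A> l) (adv_C \<A> l) (reg_B \<A> l) (reg_C \<A> l) \<sigma>
                  ctB ctC [outB] [outC]))))
    \<le> 1 / 2 + sqrt (let \<sigma> = branch (adv_A (tdf_adversary F \<A>) l) (ek_len F l + qtd_len F l) (reg_B (tdf_adversary F \<A>) l + reg_C (tdf_adversary F \<A>) l)
                 (with_classical ek \<kappa>) []
       in measure_pmf.expectation (uniform_bits (tdf_n F l)) (\<lambda>xB.
          measure_pmf.expectation (uniform_bits (tdf_n F l)) (\<lambda>xC.
            joint_prob (adv_B (tdf_adversary F \<A>) l) (adv_C (tdf_adversary F \<A>) l) (reg_B (tdf_adversary F \<A>) l) (reg_C (tdf_adversary F \<A>) l) \<sigma>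
              (tdf_image F l ek xB) (tdf_image F l ek xC) xB xC))) / 2"
proof -
  let ?e = "ek_len F l" and ?q = "qtd_len F l" and ?n = "tdf_n F l" and ?m = "tdf_m F l"
  let ?b = "reg_B \<A> l" and ?c = "reg_C \<A> l" and ?A = "adv_A \<A> l" and ?B = "adv_B \<A> l" and ?C = "adv_C \<A> l"
  let ?y = "tdf_image F l ek" and ?S = "bitstrings (tdf_n F l)" and ?N = "2 ^ tdf_n F l :: real"
  have wf: "wf_circuit (?e + (?q + ?e)) (4 + (?b + ?c)) ?A" "wf_circuit (?n + 1 + ?m + ?b) 1 ?B" "wf_circuit (?n + 1 + ?m + ?c) 1 ?C"
    using qpt unfolding qpt_adversary_def sde_of_simps by (auto simp: add.assoc)
  from dens obtain J :: "bits set" and \<psi> where J: "finite J" and gr: "gram ?q J \<psi> \<kappa>"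
    and tr: "(\<Sum>j\<in>J. sqnorm ?q (\<psi> j)) = 1" unfolding density_def by blast
  define K where "K = J \<times> bitstrings (wires ?A - (4 + (?b + ?c)))"
  define \<phi> where "\<phi> z = (\<lambda>(j, r). register_vec ?e ?q ?A ek (\<psi> j) z r)" for z
  define \<sigma> where "\<sigma> z = branch ?A (?e + (?q + ?e)) (?b + ?c) (with_classical ek \<kappa>') z" for z
  define D where "D = branch (discard_messages ?e ?q (?b + ?c) ?A) (?e + ?q) (?b + ?c) (with_classical ek \<kappa>) []"
  have K: "finite K" using J by (simp add: K_def)
  have g: "gram (?b + ?c) K (\<phi> z) (\<sigma> z)" if "z \<in> bitstrings 4" for z
    using gram_branch_messages[OF wf(1) lek ext gr tr, of z] that by (simp add: K_def \<phi>_def \<sigma>_def)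
  have gD: "gram (?b + ?c) (bitstrings 4 \<times> K) (\<lambda>(z, k). \<phi> z k) D"
    using gram_branch_discard_messages[OF wf(1) lek ext gr tr] by (simp add: K_def \<phi>_def D_def case_prod_unfold)
  have t1: "(\<Sum>z\<in>bitstrings 4. \<Sum>k\<in>K. sqnorm (?b + ?c) (\<phi> z k)) = 1"
    using sum_sqnorm_register_vec[OF wf(1) lek ext gr tr] by (simp add: K_def \<phi>_def case_prod_unfold)
  note ly = length_tdf_image[OF eff lek]
  let ?gl = "\<lambda>x x' z k. \<Sum>t\<in>bitstrings ?b. \<Sum>t'\<in>bitstrings ?c. (cmod (apply2 ?b ?c (gl_op ?n ?B (?y x) x) (gl_op ?n ?C (?y x') x') (\<phi> z k) t t'))\<^sup>2"
  let ?win = "\<lambda>x x'. joint_prob (extractor ?n ?m ?b ?B) (extractor ?n ?m ?c ?C) ?b ?c D (?y x) (?y x') x x'"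
  have "(\<Sum>x\<in>?S. \<Sum>x'\<in>?S. \<Sum>z\<in>bitstrings 4. \<Sum>k\<in>K. ?gl x x' z k) \<le> (\<Sum>x\<in>?S. \<Sum>x'\<in>?S. ?win x x')"
  proof (intro sum_mono)
    fix x x' assume "x \<in> ?S" "x' \<in> ?S"
    then have "(\<Sum>p\<in>bitstrings 4 \<times> K. \<Sum>t\<in>bitstrings ?b. \<Sum>t'\<in>bitstrings ?c. (cmod (apply2 ?b ?c (gl_op ?n ?B (?y x) x) (gl_op ?n ?C (?y x') x') ((\<lambda>(z, k). \<phi> z k) p) t t'))\<^sup>2) \<le> ?win x x'"
      by (intro joint_prob_extractor_ge wf(2,3) gD ly) auto
    then show "(\<Sum>z\<in>bitstrings 4. \<Sum>k\<in>K. ?gl x x' z k) \<le> ?win x x'"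
      by (simp only: case_prod_unfold sum_Times_fst_snd[of "?gl x x'"])
  qed
  then have le: "(\<Sum>x\<in>?S. \<Sum>x'\<in>?S. \<Sum>z\<in>bitstrings 4. \<Sum>k\<in>K. ?gl x x' z k) / ?N\<^sup>2
    \<le> (\<Sum>x\<in>?S. (\<Sum>x'\<in>?S. ?win x x') / ?N) / ?N"
    by (simp add: divide_right_mono power2_eq_square flip: sum_divide_distrib)
  have "(\<Sum>z\<in>bitstrings 4. (\<Sum>(a, a')\<in>UNIV. (\<Sum>x\<in>?S. \<Sum>r\<in>?S. (\<Sum>x'\<in>?S. \<Sum>r'\<in>?S.
        \<Sum>(outB, outC)\<in>{(o1, o2). (o1 \<noteq> o2) = (a \<noteq> a')}.
          joint_prob ?B ?C ?b ?c (\<sigma> z) (r @ [z ! of_bool a \<noteq> parity (band x r)] @ ?y x)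
            (r' @ [z ! (2 + of_bool a') \<noteq> parity (band x' r')] @ ?y x') [outB] [outC]) / ?N\<^sup>2) / ?N\<^sup>2) / 4)
    \<le> 1 / 2 + sqrt ((\<Sum>x\<in>?S. \<Sum>x'\<in>?S. \<Sum>z\<in>bitstrings 4. \<Sum>k\<in>K. ?gl x x' z k) / ?N\<^sup>2) / 2"
    by (rule cpa_game_bound[OF wf(2,3) ly K _ g t1, where \<mu>B = "\<lambda>z a. z ! of_bool a" and \<mu>C = "\<lambda>z a. z ! (2 + of_bool a)"]) auto
  also have "\<dots> \<le> 1 / 2 + sqrt ((\<Sum>x\<in>?S. (\<Sum>x'\<in>?S. ?win x x') / ?N) / ?N) / 2"
    using le by simp
  finally have main: "(\<Sum>z\<in>bitstrings 4. (\<Sum>(a, a')\<in>UNIV. (\<Sum>x\<in>?S. \<Sum>r\<in>?S. (\<Sum>x'\<in>?S. \<Sum>r'\<in>?S.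
        \<Sum>(outB, outC)\<in>{(o1, o2). (o1 \<noteq> o2) = (a \<noteq> a')}.
          joint_prob ?B ?C ?b ?c (\<sigma> z) (r @ [z ! of_bool a \<noteq> parity (band x r)] @ ?y x)
            (r' @ [z ! (2 + of_bool a') \<noteq> parity (band x' r')] @ ?y x') [outB] [outC]) / ?N\<^sup>2) / ?N\<^sup>2) / 4)
    \<le> 1 / 2 + sqrt ((\<Sum>x\<in>?S. (\<Sum>x'\<in>?S. ?win x x') / ?N) / ?N) / 2" .
  have tdf: "(let \<sigma> = branch (adv_A (tdf_adversary F \<A>) l) (ek_len F l + qtd_len F l) (reg_B (tdf_adversary F \<A>) l + reg_C (tdf_adversary F \<A>) l)
                 (with_classical ek \<kappa>) []
       in measure_pmf.expectation (uniform_bits (tdf_n F l)) (\<lambda>xB.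
          measure_pmf.expectation (uniform_bits (tdf_n F l)) (\<lambda>xC.
            joint_prob (adv_B (tdf_adversary F \<A>) l) (adv_C (tdf_adversary F \<A>) l) (reg_B (tdf_adversary F \<A>) l) (reg_C (tdf_adversary F \<A>) l) \<sigma>
              (tdf_image F l ek xB) (tdf_image F l ek xC) xB xC)))
     = (\<Sum>x\<in>?S. (\<Sum>x'\<in>?S. ?win x x') / ?N) / ?N"
    by (simp only: Let_def tdf_adversary_def adversary.simps expectation_uniform_bits D_def)
  show ?thesis unfolding tdf
  proof (rule order_trans[OF eq_refl main], rule sum.cong[OF refl])
    fix z :: bits assume "z \<in> bitstrings 4"
    then have msg: "message 1 z (of_bool a) = [z ! of_bool a]" "message 1 z (2 + of_bool a) = [z ! (2 + of_bool a)]" for a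
      by (cases a; simp add: message_1[unfolded One_nat_def])+
    show "(let \<sigma> = branch (adv_A \<A> l) (ek_len F l + (qtd_len F l + ek_len F l)) (reg_B \<A> l + reg_C \<A> l)
                   (with_classical ek \<kappa>') z
         in measure_pmf.expectation (pmf_of_set UNIV) (\<lambda>(coinB :: bool, coinC :: bool).
            measure_pmf.expectation (sde_encrypt (sde_of F) l ek (message 1 z (of_bool coinB))) (\<lambda>ctB.
            measure_pmf.expectation (sde_encrypt (sde_of F) l ek (message 1 z (2 + of_bool coinC))) (\<lambda>ctC.
              \<Sum>(outB, outC) \<in> {(b, c). (b \<noteq> c) = (coinB \<noteq> coinC)}.
                joint_prob (adv_B \<A> l) (adv_C \<A> l) (reg_B \<A> l) (reg_C \<A> l) \<sigma>
                  ctB ctC [outB] [outC]))))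
      = (\<Sum>(a, a')\<in>UNIV. (\<Sum>x\<in>?S. \<Sum>r\<in>?S. (\<Sum>x'\<in>?S. \<Sum>r'\<in>?S.
        \<Sum>(outB, outC)\<in>{(o1, o2). (o1 \<noteq> o2) = (a \<noteq> a')}.
          joint_prob ?B ?C ?b ?c (\<sigma> z) (r @ [z ! of_bool a \<noteq> parity (band x r)] @ ?y x)
            (r' @ [z ! (2 + of_bool a') \<noteq> parity (band x' r')] @ ?y x') [outB] [outC]) / ?N\<^sup>2) / ?N\<^sup>2) / 4"
      by (simp only: Let_def expectation_coins msg expectation_sde_encrypt[OF eff lek] \<sigma>_def)
  qed
qed

text \<open>Jensen's inequality for the root, read off from the nonnegativity of the
  variance.\<close>

lemma expectation_sqrt_le:
  assumes "finite (set_pmf p)" "\<And>x. x \<in> set_pmf p \<Longrightarrow> 0 \<le> f x"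
  shows "measure_pmf.expectation p (\<lambda>x. sqrt (f x)) \<le> sqrt (measure_pmf.expectation p f)"
proof (rule real_le_rsqrt)
  note i = integrable_measure_pmf_finite[OF assms(1)]
  have "measure_pmf.expectation p (\<lambda>x. (sqrt (f x))\<^sup>2) = measure_pmf.expectation p f"
    by (rule integral_cong_AE) (use assms(2) in \<open>auto simp: AE_measure_pmf_iff\<close>)
  moreover have "0 \<le> measure_pmf.variance p (\<lambda>x. sqrt (f x))" by (rule measure_pmf.variance_positive)
  ultimately show "(measure_pmf.expectation p (\<lambda>x. sqrt (f x)))\<^sup>2 \<le> measure_pmf.expectation p f"
    using measure_pmf.variance_eq[where X = "\<lambda>x. sqrt (f x)", OF i i] by simp
qed

lemma joint_prob_gram_nonneg: "gram (b + c) K \<phi> \<sigma> \<Longrightarrow> 0 \<le> joint_prob B C b c \<sigma> x y z w"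
  unfolding joint_prob_gram by (intro sum_nonneg) simp

text \<open>The bound for one key contains a root, and concavity moves the average over the coupled
  keys under it.\<close>

lemma cpa_win_le_search_win:
  assumes eff: "tdf_efficient F"
    and qpt: "qpt_adversary (\<lambda>l. pk_len (sde_of F) l + qsk_len (sde_of F) l) (\<lambda>l. 4) (ct_len (sde_of F)) (\<lambda>l. 1) \<A>"
  shows "sde_cpa_win_prob 1 (sde_of F) \<A> l \<le> 1 / 2 + sqrt (tdf_win_prob F (tdf_adversary F \<A>) l) / 2"
proof -
  let ?P = "measure_pmf.expectation (key_pairs F l)"
  define f where "f = (\<lambda>(ek, td :: bits, \<kappa>). let \<sigma> = branch (adv_A (tdf_adversary F \<A>) l) (ek_len F l + qtd_len F l) (reg_B (tdf_adversary F \<A>) l + reg_C (tdf_adversary F \<A>) l)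
                 (with_classical ek \<kappa>) []
       in measure_pmf.expectation (uniform_bits (tdf_n F l)) (\<lambda>xB.
          measure_pmf.expectation (uniform_bits (tdf_n F l)) (\<lambda>xC.
            joint_prob (adv_B (tdf_adversary F \<A>) l) (adv_C (tdf_adversary F \<A>) l) (reg_B (tdf_adversary F \<A>) l) (reg_C (tdf_adversary F \<A>) l) \<sigma>
              (tdf_image F l ek xB) (tdf_image F l ek xC) xB xC)))"
  have tdf: "tdf_win_prob F (tdf_adversary F \<A>) l = ?P (\<lambda>p. f (fst p))"
    unfolding tdf_win_prob_def f_def[symmetric] expectation_tdf_keys[OF eff] ..
  have nonneg: "0 \<le> f (fst p)" if p: "p \<in> set_pmf (key_pairs F l)" for p
  proof -
    obtain ek td \<kappa> pk sk \<kappa>' where p_eq: "p = ((ek, td, \<kappa>), (pk, sk, \<kappa>'))" by (cases p) auto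
    note sp = set_key_pairs[OF eff p[unfolded p_eq]]
    then have lek: "length ek = ek_len F l" and ext: "extends_key (qtd_len F l) ek \<kappa> \<kappa>'" by auto
    from sp obtain J :: "bits set" and \<psi> where gr: "gram (qtd_len F l) J \<psi> \<kappa>"
      and tr: "(\<Sum>j\<in>J. sqnorm (qtd_len F l) (\<psi> j)) = 1" unfolding density_def by blast
    have wf: "wf_circuit (ek_len F l + (qtd_len F l + ek_len F l)) (4 + (reg_B \<A> l + reg_C \<A> l)) (adv_A \<A> l)"
      using qpt unfolding qpt_adversary_def sde_of_simps by (auto simp: add.assoc)
    show ?thesis
      unfolding p_eq fst_conv f_def prod.case Let_def expectation_uniform_bits tdf_adversary_def adversary.simps
      by (intro divide_nonneg_nonneg sum_nonneg joint_prob_gram_nonneg[OF gram_branch_discard_messages[OF wf lek ext gr tr]]) simp_all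
  qed
  have "sde_cpa_win_prob 1 (sde_of F) \<A> l \<le> ?P (\<lambda>p. 1 / 2 + sqrt (f (fst p)) / 2)"
    unfolding sde_cpa_win_prob_def expectation_sde_keys[OF eff]
  proof (rule expectation_mono_key_pairs[OF eff])
    fix p assume p: "p \<in> set_pmf (key_pairs F l)"
    obtain ek td \<kappa> pk sk \<kappa>' where p_eq: "p = ((ek, td, \<kappa>), (pk, sk, \<kappa>'))" by (cases p) auto
    note sp = set_key_pairs[OF eff p[unfolded p_eq]]
    then have pk: "pk = ek" and *: "length ek = ek_len F l" "extends_key (qtd_len F l) ek \<kappa> \<kappa>'" "density (qtd_len F l) \<kappa>"
      by auto
    show "(case snd p of (pk, sk, \<kappa>) \<Rightarrow> \<Sum>z \<in> bitstrings (4 * 1).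
         let \<sigma> = branch (adv_A \<A> l) (pk_len (sde_of F) l + qsk_len (sde_of F) l) (reg_B \<A> l + reg_C \<A> l)
                   (with_classical pk \<kappa>) z
         in measure_pmf.expectation (pmf_of_set UNIV) (\<lambda>(coinB :: bool, coinC :: bool).
            measure_pmf.expectation (sde_encrypt (sde_of F) l pk (message 1 z (of_bool coinB))) (\<lambda>ctB.
            measure_pmf.expectation (sde_encrypt (sde_of F) l pk (message 1 z (2 + of_bool coinC))) (\<lambda>ctC.
              \<Sum>(outB, outC) \<in> {(b, c). (b \<noteq> c) = (coinB \<noteq> coinC)}.
                joint_prob (adv_B \<A> l) (adv_C \<A> l) (reg_B \<A> l) (reg_C \<A> l) \<sigma>
                  ctB ctC [outB] [outC])))) \<le> 1 / 2 + sqrt (f (fst p)) / 2"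
      unfolding p_eq fst_conv snd_conv prod.case[of _ ek "(sk, \<kappa>')"] prod.case[of _ sk \<kappa>'] f_def pk sde_of_simps mult_1_right
        prod.case[of _ ek "(td, \<kappa>)"] prod.case[of _ td \<kappa>]
      by (rule cpa_win_le_search_win_given_key[OF eff qpt *])
  qed
  also have "\<dots> = 1 / 2 + ?P (\<lambda>p. sqrt (f (fst p))) / 2"
    by (subst Bochner_Integration.integral_add) (auto intro!: integrable_measure_pmf_finite finite_key_pairs[OF eff])
  also have "\<dots> \<le> 1 / 2 + sqrt (?P (\<lambda>p. f (fst p))) / 2"
    using expectation_sqrt_le[OF finite_key_pairs[OF eff] nonneg] by simp
  finally show ?thesis unfolding tdf .
qed

lemma sde_cpa_plus_anti_piracy_sde_of:
  assumes eff: "tdf_efficient F" and sec: "tdf_search_anti_piracy F"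
  shows "sde_cpa_plus_anti_piracy 1 (sde_of F)"
  unfolding sde_cpa_plus_anti_piracy_def mult_1_right
proof (intro allI impI)
  fix \<A> assume qpt: "qpt_adversary (\<lambda>l. pk_len (sde_of F) l + qsk_len (sde_of F) l) (\<lambda>l. 4) (ct_len (sde_of F)) (\<lambda>l. 1) \<A>"
  then obtain \<epsilon> where \<epsilon>: "negligible \<epsilon>" "\<And>l. tdf_win_prob F (tdf_adversary F \<A>) l \<le> \<epsilon> l"
    using sec qpt_tdf_adversary unfolding tdf_search_anti_piracy_def by blast
  have "sde_cpa_win_prob 1 (sde_of F) \<A> l \<le> 1 / 2 + sqrt \<bar>\<epsilon> l\<bar>" for l
  proof -
    have "sqrt (tdf_win_prob F (tdf_adversary F \<A>) l) \<le> sqrt \<bar>\<epsilon> l\<bar>" using \<epsilon>(2)[of l] by simp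
    moreover have "0 \<le> sqrt \<bar>\<epsilon> l\<bar>" by simp
    ultimately show ?thesis using cpa_win_le_search_win[OF eff qpt, of l] by linarith
  qed
  then show "\<exists>\<epsilon>. negligible \<epsilon> \<and> (\<forall>l. sde_cpa_win_prob 1 (sde_of F) \<A> l \<le> 1 / 2 + \<epsilon> l)"
    using negligible_sqrt[OF \<epsilon>(1)] by blast
qed

theorem mainTheorem7:
  assumes "\<exists>F. TDF_CP F"
  shows "\<exists>S. SDE 1 S \<and> sde_robust 1 S \<and> sde_cpa_plus_anti_piracy 1 S"
proof -
  from assms obtain F where F: "tdf_efficient F" "tdf_almost_all_keys_correct F" "tdf_search_anti_piracy F"
    unfolding TDF_CP_def by blast
  then show ?thesis
    unfolding SDE_def
    by (blast intro: sde_efficient_sde_of sde_correct_sde_of sde_robust_sde_of sde_cpa_plus_anti_piracy_sde_of)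
qed

end
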